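(* Let $0<\beta<1$ and let $\Omega\subset\mathbb{C}$ be a bounded doubly-connected domain whose outermost boundary component $\mathcal{C}$ is $C^{3,\alpha}$. If $\Omega$ is biholomorphic to $B_1-\overline{B}_\beta=\{z:\beta<|z|<1\}$, then $$\lambda(\Omega,v)\ge\frac{2\pi^2}{3}\Bigl[\Bigl(\frac{\pi}{\ln\beta}\Bigr)^2+1\Bigr].$$
   Context: For a bounded domain $\Omega\subset\mathbb{C}$, let $u$ be the solution of $\Delta u=e^{2u}$ in $\Omega$ with $u\to+\infty$ at $\partial\Omega$ (the conformal factor of the complete hyperbolic metric $e^{2u}g_E$), and set $v=e^{-u}$, so $v\Delta v=|\nabla v|^2-1$ in $\Omega$ and $v=0$ on $\partial\Omega$. Near the $C^{3,\alpha}$ boundary component $\mathcal{C}$, $v(z)=d(z)-\tfrac12\kappa(y)d(z)^2+c_3(y)d(z)^3+O(d(z)^{3+\alpha})$, where $d(z)$ is the Euclidean distance to $\partial\Omega$, $y\in\partial\Omega$ is the point with $d(z)=|z-y|$ and $\kappa(y)$ is the curvature of the boundary at $y$; this defines $c_3$ on $\mathcal{C}$. Then $\lambda(\Omega,v)=-\int_{\mathcal{C}}dl\cdot\int_{\mathcal{C}}c_3\,dl$, with Euclidean arc length. *)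

theory Defs
  imports "HOL-Complex_Analysis.Complex_Analysis"
begin

text \<open>A bounded doubly-connected domain: open, connected, bounded, and its complement in the
  plane has exactly two connected components (one unbounded, one bounded), i.e. its complement
  in the Riemann sphere has exactly two components.\<close>
definition doubly_connected_domain :: "complex set \<Rightarrow> bool" where
  "doubly_connected_domain \<Omega> \<longleftrightarrow>
     open \<Omega> \<and> connected \<Omega> \<and> \<Omega> \<noteq> {} \<and> card (components (- \<Omega>)) = 2"

definition outer_boundary :: "complex set \<Rightarrow> complex set" where
  "outer_boundary \<Omega> = frontier (THE W. W \<in> components (- \<Omega>) \<and> \<not> bounded W)"

definition biholomorphic :: "complex set \<Rightarrow> complex set \<Rightarrow> bool" where
  "biholomorphic A B \<longleftrightarrow>
     (\<exists>f g. f holomorphic_on A \<and> g holomorphic_on B \<and> f ` A = B \<and> g ` B = A \<and>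
            (\<forall>z\<in>A. g (f z) = z) \<and> (\<forall>w\<in>B. f (g w) = w))"

definition annulus :: "real \<Rightarrow> complex set" where
  "annulus \<beta> = {z. \<beta> < cmod z \<and> cmod z < 1}"

definition C2_on :: "complex set \<Rightarrow> (complex \<Rightarrow> real) \<Rightarrow> bool" where
  "C2_on S f \<longleftrightarrow>
     (\<exists>(Df :: complex \<Rightarrow> complex \<Rightarrow>\<^sub>L real) (D2f :: complex \<Rightarrow> complex \<Rightarrow>\<^sub>L (complex \<Rightarrow>\<^sub>L real)).
        (\<forall>z\<in>S. (f has_derivative blinfun_apply (Df z)) (at z) \<and>
                (Df has_derivative blinfun_apply (D2f z)) (at z)) \<and>
        continuous_on S D2f)"

definition dir_deriv :: "(complex \<Rightarrow> real) \<Rightarrow> complex \<Rightarrow> complex \<Rightarrow> real" where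
  "dir_deriv f h z = deriv (\<lambda>t::real. f (z + of_real t * h)) 0"

definition laplacian :: "(complex \<Rightarrow> real) \<Rightarrow> complex \<Rightarrow> real" where
  "laplacian f z = dir_deriv (dir_deriv f 1) 1 z + dir_deriv (dir_deriv f \<i>) \<i> z"

text \<open>u solves the Liouville equation Delta u = e^(2u) in Omega and blows up at the boundary,
  i.e. e^(2u) g_E is the complete hyperbolic metric of Omega.\<close>
definition hyperbolic_conformal_factor :: "complex set \<Rightarrow> (complex \<Rightarrow> real) \<Rightarrow> bool" where
  "hyperbolic_conformal_factor \<Omega> u \<longleftrightarrow>
     C2_on \<Omega> u \<and> (\<forall>z\<in>\<Omega>. laplacian u z = exp (2 * u z)) \<and>
     (\<forall>\<zeta>\<in>frontier \<Omega>. filterlim u at_top (at \<zeta> within \<Omega>))"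

definition C3a_arclength_param :: "(real \<Rightarrow> complex) \<Rightarrow> real \<Rightarrow> real \<Rightarrow> bool" where
  "C3a_arclength_param \<gamma> L \<alpha> \<longleftrightarrow>
     L > 0 \<and> 0 < \<alpha> \<and> \<alpha> < 1 \<and>
     (\<forall>s. \<gamma> (s + L) = \<gamma> s) \<and> inj_on \<gamma> {0..<L} \<and>
     (\<exists>\<gamma>1 \<gamma>2 \<gamma>3 M.
        (\<forall>s. (\<gamma> has_vector_derivative \<gamma>1 s) (at s)) \<and>
        (\<forall>s. (\<gamma>1 has_vector_derivative \<gamma>2 s) (at s)) \<and>
        (\<forall>s. (\<gamma>2 has_vector_derivative \<gamma>3 s) (at s)) \<and>
        (\<forall>s t. cmod (\<gamma>3 s - \<gamma>3 t) \<le> M * \<bar>s - t\<bar> powr \<alpha>) \<and>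
        (\<forall>s. cmod (\<gamma>1 s) = 1))"

definition tangent :: "(real \<Rightarrow> complex) \<Rightarrow> real \<Rightarrow> complex" where
  "tangent \<gamma> s = vector_derivative \<gamma> (at s)"

definition inward_normal :: "complex set \<Rightarrow> (real \<Rightarrow> complex) \<Rightarrow> real \<Rightarrow> complex" where
  "inward_normal \<Omega> \<gamma> s =
     (if (\<forall>\<^sub>F t in at_right 0. \<gamma> s + of_real t * (\<i> * tangent \<gamma> s) \<in> \<Omega>)
      then \<i> * tangent \<gamma> s else - \<i> * tangent \<gamma> s)"

text \<open>Curvature of the boundary at gamma(s), positive when the boundary bends towards Omega
  (e.g. 1/R for the boundary of a disc of radius R).\<close>
definition bdry_curvature :: "complex set \<Rightarrow> (real \<Rightarrow> complex) \<Rightarrow> real \<Rightarrow> real" where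
  "bdry_curvature \<Omega> \<gamma> s =
     Re (vector_derivative (tangent \<gamma>) (at s) * cnj (inward_normal \<Omega> \<gamma> s))"

text \<open>The coefficient c_3 in v = d - kappa d^2/2 + c_3 d^3 + O(d^(3+alpha)) at y = gamma(s);
  along the inward normal at y the distance d to the boundary equals t for small t.\<close>
definition c3_coeff :: "complex set \<Rightarrow> (complex \<Rightarrow> real) \<Rightarrow> (real \<Rightarrow> complex) \<Rightarrow> real \<Rightarrow> real" where
  "c3_coeff \<Omega> v \<gamma> s =
     Lim (at_right 0)
       (\<lambda>t::real. (v (\<gamma> s + of_real t * inward_normal \<Omega> \<gamma> s) - t
                     + bdry_curvature \<Omega> \<gamma> s * t^2 / 2) / t^3)"

definition lambda_inv :: "complex set \<Rightarrow> (complex \<Rightarrow> real) \<Rightarrow> (real \<Rightarrow> complex) \<Rightarrow> real \<Rightarrow> real" where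
  "lambda_inv \<Omega> v \<gamma> L = - L * integral {0..L} (\<lambda>s. c3_coeff \<Omega> v \<gamma> s)"

end

theory Submission
  imports Defs "HOL-Real_Asymp.Real_Asymp"
begin

text \<open>Let \<open>g\<close> map \<open>\<Omega>\<close> onto the annulus, \<open>|g| = 1\<close> on the outer curve (else pass to \<open>\<beta> / g\<close>). By
  uniqueness for the Liouville equation, \<open>exp (-u) = sin (a X) / (a |g' / g|)\<close> with \<open>X = - ln |g|\<close> and
  \<open>a = \<pi> / (- ln \<beta>)\<close>. Uniqueness needs the lower bound \<open>u \<ge> (1 - \<epsilon>) ln (1/d) - C\<close>, obtained by comparison
  with averaged logarithmic poles placed in the complement.

  On the outer curve \<open>g\<close> has three continuous derivatives: composing \<open>g\<close> with a cubic Taylor polynomial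
  of the curve, lifted slightly into \<open>\<Omega>\<close>, gives a function on a half disc with
  \<open>|G x| = 1 - O(|x| powr (3 + \<alpha>))\<close> on the real axis, and reflection with Cauchy's formula approximates
  it by holomorphic functions on full discs, so that the fourth derivative of \<open>g\<close> is integrable along normals.

  If \<open>\<psi>\<close> denotes the derivative of \<open>arg g\<close> along the curve, the expansion of \<open>exp (-u)\<close> gives
  \<open>c\<^sub>3 = \<psi>'' / (3 \<psi>) - \<kappa>\<^sup>2 / 6 - (\<psi>' / \<psi>)\<^sup>2 / 2 - a\<^sup>2 \<psi>\<^sup>2 / 6\<close>. Integrating by parts,
  \<open>- \<integral> c\<^sub>3 \<ge> \<integral> \<kappa>\<^sup>2 / 6 + a\<^sup>2 \<integral> \<psi>\<^sup>2 / 6\<close>, and the Cauchy-Schwarz inequality finishes, since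
  \<open>\<integral> |\<kappa>| \<ge> 2 \<pi>\<close> (Fenchel) and \<open>\<integral> \<psi>\<close> is a positive multiple of \<open>2 \<pi>\<close>.\<close>

section \<open>Laplacians and the maximum principle\<close>

text \<open>The rate at which \<open>u\<close> blows up is unknown, so two solutions cannot simply
  be subtracted at the boundary. A barrier with a single pole at a boundary point has the same
  defect. Spreading the pole over many points of the complement keeps the barrier bounded on a
  sublevel set of \<open>u\<close>; there is room for this because no component of the complement is
  a single point. The resulting bound with factor 1 - \<epsilon> suffices, since one solution may be
  multiplied by 1 - e before the subtraction.

  A curve of limited smoothness has no holomorphic straightening. Its Taylor polynomial at
  \<open>\<gamma> s\<close> misses the curve by order |x|^(3 + \<alpha>), possibly on the side where
  \<open>g\<close> is undefined. A lift of the same order costs nothing in the error and brings the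
  half disc into \<Omega>. The constants do not depend on the base point, so boundary derivatives
  are uniform limits along parallel curves and can be differentiated along the curve.

  For the round annulus \<kappa> and \<psi> are constant, and all inequalities between integrals are
  equalities.\<close>

definition has_d2 :: "(complex \<Rightarrow> real) \<Rightarrow> complex \<Rightarrow> complex \<Rightarrow> real \<Rightarrow> real \<Rightarrow> bool" where
  "has_d2 f h z b a \<longleftrightarrow>
     (\<exists>d. (\<forall>\<^sub>F t in nhds 0. ((\<lambda>t. f (z + of_real t * h)) has_real_derivative d t) (at t)) \<and>
          d 0 = b \<and> (d has_real_derivative a) (at 0))"

text \<open>A relational Laplacian: each axis direction has its own second derivative, taken along
  one line. The maximum principle uses no more than this, and sums, multiples and compositions are
  handled without second Frechet derivatives.\<close>

definition has_lap :: "(complex \<Rightarrow> real) \<Rightarrow> complex \<Rightarrow> real \<Rightarrow> bool" where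
  "has_lap f z l \<longleftrightarrow>
     (\<exists>b a b' a'. has_d2 f 1 z b a \<and> has_d2 f \<i> z b' a' \<and> l = a + a')"

lemma has_d2I:
  assumes "\<forall>\<^sub>F t in nhds 0. ((\<lambda>t. f (z + of_real t * h)) has_real_derivative d t) (at t)"
    "d 0 = b" "(d has_real_derivative a) (at 0)"
  shows "has_d2 f h z b a"
  using assms unfolding has_d2_def by blast

lemma has_d2_add:
  assumes "has_d2 f h z b a" "has_d2 g h z b' a'"
  shows "has_d2 (\<lambda>z. f z + g z) h z (b + b') (a + a')"
proof -
  obtain d where d: "\<forall>\<^sub>F t in nhds 0. ((\<lambda>t. f (z + of_real t * h)) has_real_derivative d t) (at t)"
     "d 0 = b" "(d has_real_derivative a) (at 0)" using assms(1) unfolding has_d2_def by blast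
  obtain e where e: "\<forall>\<^sub>F t in nhds 0. ((\<lambda>t. g (z + of_real t * h)) has_real_derivative e t) (at t)"
     "e 0 = b'" "(e has_real_derivative a') (at 0)" using assms(2) unfolding has_d2_def by blast
  show ?thesis
  proof (rule has_d2I[where d="\<lambda>t. d t + e t"])
    show "\<forall>\<^sub>F t in nhds 0. ((\<lambda>t. f (z + of_real t * h) + g (z + of_real t * h)) has_real_derivative d t + e t) (at t)"
      using d(1) e(1) by eventually_elim (rule DERIV_add)
    show "((\<lambda>t. d t + e t) has_real_derivative a + a') (at 0)"
      using d(3) e(3) by (rule DERIV_add)
  qed (simp add: d e)
qed

lemma has_d2_cmult:
  assumes "has_d2 f h z b a"
  shows "has_d2 (\<lambda>z. c * f z) h z (c * b) (c * a)"
proof -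
  obtain d where d: "\<forall>\<^sub>F t in nhds 0. ((\<lambda>t. f (z + of_real t * h)) has_real_derivative d t) (at t)"
     "d 0 = b" "(d has_real_derivative a) (at 0)" using assms(1) unfolding has_d2_def by blast
  show ?thesis
  proof (rule has_d2I[where d="\<lambda>t. c * d t"])
    show "\<forall>\<^sub>F t in nhds 0. ((\<lambda>t. c * f (z + of_real t * h)) has_real_derivative c * d t) (at t)"
      using d(1) by eventually_elim (rule DERIV_cmult)
    show "((\<lambda>t. c * d t) has_real_derivative c * a) (at 0)"
      using d(3) by (rule DERIV_cmult)
  qed (simp add: d)
qed

lemma has_d2_const: "has_d2 (\<lambda>z. c) h z 0 0"
  by (rule has_d2I[where d="\<lambda>t. 0"]) auto

lemma has_lap_const: "has_lap (\<lambda>z. c) z 0"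
  unfolding has_lap_def using has_d2_const[of c 1 z] has_d2_const[of c \<i> z] by (metis add_0)

lemma has_lap_add:
  assumes "has_lap f z l" "has_lap g z m"
  shows "has_lap (\<lambda>z. f z + g z) z (l + m)"
proof -
  obtain b a b' a' where 1: "has_d2 f 1 z b a" "has_d2 f \<i> z b' a'" "l = a + a'"
    using assms(1) unfolding has_lap_def by blast
  obtain c d c' d' where 2: "has_d2 g 1 z c d" "has_d2 g \<i> z c' d'" "m = d + d'"
    using assms(2) unfolding has_lap_def by blast
  have "l + m = (a + d) + (a' + d')" using 1(3) 2(3) by simp
  then show ?thesis unfolding has_lap_def
    using has_d2_add[OF 1(1) 2(1)] has_d2_add[OF 1(2) 2(2)] by blast
qed

lemma has_lap_cmult:
  assumes "has_lap f z l"
  shows "has_lap (\<lambda>z. c * f z) z (c * l)"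
proof -
  obtain b a b' a' where 1: "has_d2 f 1 z b a" "has_d2 f \<i> z b' a'" "l = a + a'"
    using assms(1) unfolding has_lap_def by blast
  show ?thesis unfolding has_lap_def
    using has_d2_cmult[OF 1(1), of c] has_d2_cmult[OF 1(2), of c] 1(3) distrib_left[of c a a'] by blast
qed

lemma has_lap_diff:
  assumes "has_lap f z l" "has_lap g z m"
  shows "has_lap (\<lambda>z. f z - g z) z (l - m)"
  using has_lap_add[OF assms(1) has_lap_cmult[OF assms(2), of "-1"]] by simp

lemma has_lap_sum:
  assumes "finite I" "\<And>i. i \<in> I \<Longrightarrow> has_lap (f i) z (l i)"
  shows "has_lap (\<lambda>z. \<Sum>i\<in>I. f i z) z (\<Sum>i\<in>I. l i)"
  using assms by (induction I rule: finite_induct) (simp_all add: has_lap_const has_lap_add)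

lemma eventually_nhds_line:
  fixes z h :: complex
  assumes "\<forall>\<^sub>F y in nhds z. P y"
  shows "\<forall>\<^sub>F t in nhds (0::real). P (z + of_real t * h)"
proof -
  have "isCont (\<lambda>t. z + of_real t * h) (0::real)" by (intro continuous_intros)
  then have "((\<lambda>t. z + of_real t * h) \<longlongrightarrow> z) (nhds (0::real))"
    by (simp add: continuous_at tendsto_nhds_iff)
  then show ?thesis using assms by (auto simp: filterlim_iff)
qed

text \<open>At a maximum the first derivative along the line vanishes. If the second were positive,
  the first would be positive just to the right, and the mean value theorem would produce a larger
  value there.\<close>

lemma has_d2_local_max:
  assumes "has_d2 f h z b a" "\<forall>\<^sub>F y in nhds z. f y \<le> f z"
  shows "a \<le> 0"
proof (rule ccontr)
  assume "\<not> a \<le> 0"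
  then have a: "a > 0" by simp
  obtain d where d: "\<forall>\<^sub>F t in nhds 0. ((\<lambda>t. f (z + of_real t * h)) has_real_derivative d t) (at t)"
     "d 0 = b" "(d has_real_derivative a) (at 0)" using assms(1) unfolding has_d2_def by blast
  have "\<forall>\<^sub>F t in nhds (0::real). f (z + of_real t * h) \<le> f z"
    using eventually_nhds_line[OF assms(2)] by simp
  with d(1) have "\<forall>\<^sub>F t in nhds 0. ((\<lambda>t. f (z + of_real t * h)) has_real_derivative d t) (at t) \<and>
      f (z + of_real t * h) \<le> f z" by eventually_elim simp
  then obtain e where e: "e > 0" "\<And>t. \<bar>t\<bar> < e \<Longrightarrow> ((\<lambda>t. f (z + of_real t * h)) has_real_derivative d t) (at t)"
    "\<And>t. \<bar>t\<bar> < e \<Longrightarrow> f (z + of_real t * h) \<le> f z"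
    unfolding eventually_nhds_metric dist_real_def by auto
  have d0: "d 0 = 0"
    by (rule DERIV_local_max[OF e(2), of 0 e]) (use e in auto)
  obtain k where k: "k > 0" "\<And>t. 0 < t \<Longrightarrow> t < k \<Longrightarrow> d 0 < d (0 + t)"
    using DERIV_pos_inc_right[OF d(3) a] by blast
  define t where "t = min e k / 2"
  have t: "0 < t" "t < e" "t < k" using e(1) k(1) by (auto simp: t_def)
  have "\<exists>c. 0 < c \<and> c < t \<and> f (z + of_real t * h) - f (z + of_real 0 * h) = (t - 0) * d c"
    by (rule MVT2) (use t e in auto)
  then obtain c where c: "0 < c" "c < t" "f (z + of_real t * h) - f (z + of_real 0 * h) = (t - 0) * d c" by blast
  have "d c > 0" using k(2)[of c] c t d0 by simp
  then have "f (z + of_real t * h) > f z" using c(3) mult_pos_pos[OF t(1) \<open>d c > 0\<close>] by simp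
  then show False using e(3)[of t] t by simp
qed

lemma has_lap_local_max:
  assumes "has_lap f z l" "\<forall>\<^sub>F y in nhds z. f y \<le> f z"
  shows "l \<le> 0"
proof -
  obtain b a b' a' where "has_d2 f 1 z b a" "has_d2 f \<i> z b' a'" "l = a + a'"
    using assms(1) unfolding has_lap_def by blast
  then show ?thesis using has_d2_local_max[OF _ assms(2), of 1] has_d2_local_max[OF _ assms(2), of \<i>]
    by (simp add: add_nonpos_nonpos)
qed

section \<open>Maximum principles with boundary behaviour given by upper limits\<close>

lemma compact_superlevel:
  fixes U :: "complex set" and f :: "complex \<Rightarrow> real"
  assumes "open U" "bounded U" "continuous_on U f"
    and bd: "\<And>\<xi>. \<xi> \<in> frontier U \<Longrightarrow> \<forall>\<^sub>F z in at \<xi> within U. f z < c"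
  shows "compact {y\<in>U. f y \<ge> c}"
proof -
  define T where "T = {y\<in>U. f y \<ge> c}"
  have "closed T"
    unfolding closed_sequential_limits
  proof safe
    fix x l assume x: "\<forall>n. x n \<in> T" and lim: "x \<longlonglongrightarrow> l"
    have lcl: "l \<in> closure U" using x lim unfolding closure_sequential T_def by blast
    have "l \<in> U"
    proof (rule ccontr)
      assume nU: "l \<notin> U"
      then have "l \<in> frontier U" using lcl \<open>open U\<close> by (simp add: frontier_def interior_open)
      from bd[OF this] have ev: "\<forall>\<^sub>F y in at l within U. f y < c" .
      \<comment> \<open>A limit outside \<open>U\<close> lies on the frontier, where
        \<open>f\<close> is eventually below \<open>c\<close>.\<close>
      have "filterlim x (at l within U) sequentially"
        unfolding filterlim_at using lim x nU by (auto simp: T_def intro!: always_eventually)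
      with ev have "\<forall>\<^sub>F n in sequentially. f (x n) < c" by (auto simp: filterlim_iff)
      then obtain n where "f (x n) < c" by (auto simp: eventually_sequentially)
      then show False using x by (auto simp: T_def not_less[symmetric])
    qed
    moreover have "f l \<ge> c"
    proof (rule LIMSEQ_le_const)
      have "isCont f l" using \<open>l \<in> U\<close> assms(1,3) by (simp add: continuous_on_eq_continuous_at)
      then show "(\<lambda>n. f (x n)) \<longlonglongrightarrow> f l" using lim by (rule isCont_tendsto_compose)
    qed (use x in \<open>auto simp: T_def\<close>)
    ultimately show "l \<in> T" by (simp add: T_def)
  qed
  moreover have "bounded T" using \<open>bounded U\<close> by (rule bounded_subset) (auto simp: T_def)
  ultimately show ?thesis by (simp add: compact_eq_bounded_closed T_def)
qed

text \<open>Strict positivity of the Laplacian wherever \<open>f\<close> is positive excludes a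
  positive interior maximum by the second derivative test. The boundary condition makes the
  superlevel set compact, so a positive value would force such a maximum.\<close>

lemma max_principle:
  assumes "open U" "bounded U" "continuous_on U f"
    and bd: "\<And>\<xi> \<epsilon>. \<xi> \<in> frontier U \<Longrightarrow> \<epsilon> > 0 \<Longrightarrow> \<forall>\<^sub>F z in at \<xi> within U. f z < \<epsilon>"
    and lap: "\<And>z. z \<in> U \<Longrightarrow> f z > 0 \<Longrightarrow> \<exists>l>0. has_lap f z l"
    and z: "z \<in> U"
  shows "f z \<le> 0"
proof (rule ccontr)
  assume "\<not> f z \<le> 0"
  then have pos: "f z > 0" by simp
  define T where "T = {y\<in>U. f y \<ge> f z}"
  have "compact T" unfolding T_def by (rule compact_superlevel[OF assms(1-3)]) (rule bd[OF _ pos])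
  moreover have "T \<noteq> {}" using z by (auto simp: T_def)
  moreover have "continuous_on T f" using assms(3) by (rule continuous_on_subset) (auto simp: T_def)
  ultimately obtain y where y: "y \<in> T" "\<And>x. x \<in> T \<Longrightarrow> f x \<le> f y"
    using continuous_attains_sup[of T f] by auto
  have yU: "y \<in> U" "f y \<ge> f z" using y by (auto simp: T_def)
  have max: "f x \<le> f y" if "x \<in> U" for x
    using y(2)[of x] that yU by (cases "x \<in> T") (auto simp: T_def)
  obtain l where l: "l > 0" "has_lap f y l" using lap[of y] yU pos by auto
  have "\<forall>\<^sub>F x in nhds y. f x \<le> f y"
    using eventually_nhds_in_open[OF \<open>open U\<close> yU(1)] by eventually_elim (rule max)
  from has_lap_local_max[OF l(2) this] l(1) show False by simp
qed

text \<open>The functions it serves have no known continuous extension to the frontier. The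
  classical principle is therefore applied on the compact set where |f| is at least a level
  \<open>c\<close> strictly between 1 and the supposed large value; on the frontier of that set |f|
  equals \<open>c\<close>.\<close>

lemma maximum_modulus_limsup:
  assumes U: "open U" "bounded U" and f: "f holomorphic_on U"
    and bd: "\<And>\<xi> \<epsilon>. \<xi> \<in> frontier U \<Longrightarrow> \<epsilon> > 0 \<Longrightarrow> \<forall>\<^sub>F z in at \<xi> within U. norm (f z) < 1 + \<epsilon>"
    and z: "z \<in> U"
  shows "norm (f z) \<le> 1"
proof (rule ccontr)
  assume "\<not> norm (f z) \<le> 1"
  define c where "c = (1 + norm (f z)) / 2"
  have c: "c > 1" "c < norm (f z)" using \<open>\<not> norm (f z) \<le> 1\<close> by (auto simp: c_def)
  define T where "T = {y\<in>U. norm (f y) \<ge> c}"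
  have fc: "continuous_on U f" using f by (rule holomorphic_on_imp_continuous_on)
  have nc: "continuous_on U (\<lambda>y. norm (f y))" by (intro continuous_intros fc)
  have T: "compact T" unfolding T_def
    by (rule compact_superlevel[OF U nc]) (use bd[of _ "c - 1"] c in auto)
  have TU: "T \<subseteq> U" by (auto simp: T_def)
  have op: "open {y\<in>U. norm (f y) > c}"
    using continuous_open_preimage[OF nc U(1), of "{c<..}"] by (simp add: vimage_def Int_def)
  have "norm (f z) \<le> c"
  proof (rule maximum_modulus_frontier[where f=f and S=T])
    show "f holomorphic_on interior T" by (rule holomorphic_on_subset[OF f]) (use TU interior_subset in blast)
    show "continuous_on (closure T) f"
      using T TU by (intro continuous_on_subset[OF fc]) (simp add: compact_imp_closed)
    show "norm (f y) \<le> c" if "y \<in> frontier T" for y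
    proof (rule ccontr)
      assume "\<not> norm (f y) \<le> c"
      moreover have "y \<in> T" using that T by (simp add: frontier_def compact_imp_closed)
      ultimately have "y \<in> {y\<in>U. norm (f y) > c}" using TU by auto
      moreover have "{y\<in>U. norm (f y) > c} \<subseteq> interior T" by (rule interior_maximal[OF _ op]) (auto simp: T_def)
      ultimately show False using that by (auto simp: frontier_def)
    qed
  qed (use T z c in \<open>auto simp: T_def compact_imp_bounded\<close>)
  then show False using c by simp
qed

text \<open>Translates iterated \<open>deriv\<close> into the relational Laplacian. At every nearby
  point the first derivative along the line is \<open>Df\<close> applied to the direction, which
  allows it to be differentiated once more.\<close>

lemma C2_on_has_lap:
  assumes "open S" "C2_on S u" "z \<in> S"
  shows "has_lap u z (laplacian u z)"
proof -
  obtain Df :: "complex \<Rightarrow> complex \<Rightarrow>\<^sub>L real" and D2f :: "complex \<Rightarrow> complex \<Rightarrow>\<^sub>L (complex \<Rightarrow>\<^sub>L real)"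
    where D: "\<And>z. z \<in> S \<Longrightarrow> (u has_derivative blinfun_apply (Df z)) (at z)"
      "\<And>z. z \<in> S \<Longrightarrow> (Df has_derivative blinfun_apply (D2f z)) (at z)"
    using assms(2) unfolding C2_on_def by blast
  have line: "((\<lambda>t. z + of_real t * h) has_derivative (\<lambda>t. of_real t * h)) (at s)" for h and s :: real
    by (auto intro!: derivative_eq_intros)
  have d1: "((\<lambda>t. u (y + of_real t * h)) has_real_derivative blinfun_apply (Df (y + of_real s * h)) h) (at s)"
    if "y + of_real s * h \<in> S" for y h s
  proof -
    have "((\<lambda>t. y + of_real t * h) has_derivative (\<lambda>t. of_real t * h)) (at s)"
      by (auto intro!: derivative_eq_intros)
    from has_derivative_compose[OF this D(1)[OF that]]
    have "((\<lambda>t. u (y + of_real t * h)) has_derivative (\<lambda>t. blinfun_apply (Df (y + of_real s * h)) (of_real t * h))) (at s)" .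
    moreover have "blinfun_apply (Df (y + of_real s * h)) (of_real t * h) = t * blinfun_apply (Df (y + of_real s * h)) h" for t
      using blinfun.scaleR_right[of "Df (y + of_real s * h)" t h] by (simp add: scaleR_conv_of_real)
    ultimately show ?thesis unfolding has_field_derivative_def by (simp add: mult.commute[of _ "blinfun_apply _ _"] mult_commute_abs)
  qed
  have dd: "dir_deriv u h y = blinfun_apply (Df y) h" if "y \<in> S" for y h
    unfolding dir_deriv_def using DERIV_imp_deriv[OF d1[of y 0 h]] that by simp
  have d2: "((\<lambda>t. blinfun_apply (Df (z + of_real t * h)) h) has_real_derivative blinfun_apply (blinfun_apply (D2f z) h) h) (at 0)" for h
  proof -
    have "((\<lambda>t. Df (z + of_real t * h)) has_derivative (\<lambda>t. blinfun_apply (D2f z) (of_real t * h))) (at (0::real))"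
      using has_derivative_compose[OF line[of h 0], of Df "blinfun_apply (D2f z)"] D(2)[OF assms(3)] by simp
    then have "((\<lambda>t. blinfun_apply (Df (z + of_real t * h)) h) has_derivative (\<lambda>t. blinfun_apply (blinfun_apply (D2f z) (of_real t * h)) h)) (at (0::real))"
      by (rule bounded_linear.has_derivative[OF blinfun.bounded_linear_left])
    moreover have "blinfun_apply (blinfun_apply (D2f z) (of_real t * h)) h = t * blinfun_apply (blinfun_apply (D2f z) h) h" for t
      using blinfun.scaleR_right[of "D2f z" t h] by (simp add: scaleR_conv_of_real[symmetric] blinfun.scaleR_left)
    ultimately show ?thesis unfolding has_field_derivative_def by (simp add: mult_commute_abs)
  qed
  have ev: "\<forall>\<^sub>F t in nhds (0::real). z + of_real t * h \<in> S" for h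
    by (rule eventually_nhds_line[OF eventually_nhds_in_open[OF assms(1,3)]])
  have H: "has_d2 u h z (blinfun_apply (Df z) h) (dir_deriv (dir_deriv u h) h z)" for h
  proof (rule has_d2I[where d="\<lambda>t. blinfun_apply (Df (z + of_real t * h)) h"])
    show "\<forall>\<^sub>F t in nhds 0. ((\<lambda>t. u (z + of_real t * h)) has_real_derivative blinfun_apply (Df (z + of_real t * h)) h) (at t)"
      using ev[of h] by eventually_elim (rule d1)
    have "((\<lambda>t. dir_deriv u h (z + of_real t * h)) has_real_derivative blinfun_apply (blinfun_apply (D2f z) h) h) (at 0)"
      using d2[of h] by (subst DERIV_cong_ev[OF refl _ refl]) (use ev[of h] in \<open>auto elim!: eventually_mono simp: dd\<close>)
    then have "dir_deriv (dir_deriv u h) h z = blinfun_apply (blinfun_apply (D2f z) h) h"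
      unfolding dir_deriv_def[of "dir_deriv u h"] by (rule DERIV_imp_deriv)
    with d2[of h] show "((\<lambda>t. blinfun_apply (Df (z + of_real t * h)) h) has_real_derivative dir_deriv (dir_deriv u h) h z) (at 0)" by simp
  qed simp
  show ?thesis unfolding has_lap_def laplacian_def using H[of 1] H[of \<i>] by blast
qed

lemma C2_on_continuous:
  assumes "C2_on S u"
  shows "continuous_on S u"
  using assms unfolding C2_on_def
  by (meson continuous_at_imp_continuous_on has_derivative_continuous)

section \<open>The Laplacian of a function of \<open>ln |g|\<close>\<close>

lemma has_vector_derivative_line:
  assumes "(g has_field_derivative g') (at (z + of_real s * h))"
  shows "((\<lambda>t. g (z + of_real t * h)) has_vector_derivative h * g') (at s)"
proof -
  have "((\<lambda>t. z + of_real t * h) has_vector_derivative h) (at s)"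
    by (auto intro!: derivative_eq_intros simp: has_vector_derivative_def scaleR_conv_of_real)
  from field_vector_diff_chain_at[OF this assms] show ?thesis by (simp add: o_def)
qed

lemma ln_norm_has_derivative:
  fixes f :: "real \<Rightarrow> complex"
  assumes f: "(f has_vector_derivative f') (at s)" and nz: "f s \<noteq> 0"
  shows "((\<lambda>t. ln (norm (f t))) has_real_derivative Re (f' / f s)) (at s)"
proof -
  have fd: "(f has_derivative (\<lambda>t. t *\<^sub>R f')) (at s)"
    using f by (simp add: has_vector_derivative_def)
  have "((\<lambda>t. norm (f t)) has_derivative (\<lambda>t. (t *\<^sub>R f') \<bullet> sgn (f s))) (at s)"
    using has_derivative_compose[OF fd has_derivative_norm[OF nz]] by (simp add: inner_commute)
  then have "((\<lambda>t. norm (f t)) has_real_derivative (f' \<bullet> sgn (f s))) (at s)"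
    by (simp add: has_field_derivative_def mult.commute mult_commute_abs)
  then have "((\<lambda>t. ln (norm (f t))) has_real_derivative (f' \<bullet> sgn (f s)) / norm (f s)) (at s)"
    using nz by (auto intro!: derivative_eq_intros)
  moreover have "(f' \<bullet> sgn (f s)) / norm (f s) = Re (f' / f s)"
  proof -
    have "f' \<bullet> sgn (f s) = Re (f' * cnj (sgn (f s)))" by (simp add: inner_complex_def)
    also have "\<dots> / norm (f s) = Re (f' * (cnj (f s) / of_real ((norm (f s))\<^sup>2)))"
      by (simp add: sgn_eq field_simps power2_eq_square flip: Re_divide_of_real)
    also have "cnj (f s) / of_real ((norm (f s))\<^sup>2) = 1 / f s"
      using nz complex_norm_square[of "f s"] by (simp add: field_simps)
    finally show ?thesis by simp
  qed
  ultimately show ?thesis by simp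
qed

text \<open>With q = g'/g, the second derivative in direction h is F'' (Re (h q))^2 + F' Re (h^2
  q'). For h = 1 and h = i the squares add up to |q|^2, and the terms with q' cancel because 1 + i^2
  = 0, which is the harmonicity of ln |g|.\<close>

lemma has_lap_comp_ln_norm:
  assumes S: "open S" "z \<in> S" and g: "g holomorphic_on S" "\<And>y. y \<in> S \<Longrightarrow> g y \<noteq> 0"
    and F1: "\<forall>\<^sub>F x in nhds (ln (norm (g z))). (F has_real_derivative F' x) (at x)"
    and F2: "(F' has_real_derivative F'') (at (ln (norm (g z))))"
  shows "has_lap (\<lambda>z. F (ln (norm (g z)))) z (F'' * (norm (deriv g z / g z))\<^sup>2)"
proof -
  define q where "q = (\<lambda>z. deriv g z / g z)"
  have qh: "q holomorphic_on S" unfolding q_def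
    by (intro holomorphic_intros holomorphic_deriv g S) (use g in auto)
  define X where "X = (\<lambda>z. ln (norm (g z)))"
  have X1: "((\<lambda>t. X (z + of_real t * h)) has_real_derivative Re (h * q (z + of_real s * h))) (at s)"
    if "z + of_real s * h \<in> S" for s h
  proof -
    let ?y = "z + of_real s * h"
    have gd: "(g has_field_derivative deriv g ?y) (at ?y)"
      using g(1) S(1) that holomorphic_derivI by blast
    have "g ?y \<noteq> 0" using g(2) that by auto
    from ln_norm_has_derivative[OF has_vector_derivative_line[OF gd] this]
    show ?thesis by (simp add: X_def q_def)
  qed
  have X2: "((\<lambda>t. Re (h * q (z + of_real t * h))) has_real_derivative Re (h * h * deriv q z)) (at 0)" for h
  proof -
    have qd: "(q has_field_derivative deriv q z) (at z)"
      using qh S holomorphic_derivI by blast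
    have "((\<lambda>t. q (z + of_real t * h)) has_vector_derivative (h * deriv q z)) (at 0)"
      by (rule has_vector_derivative_line) (simp add: qd)
    then have "((\<lambda>t. h * q (z + of_real t * h)) has_vector_derivative h * (h * deriv q z)) (at 0)"
      by (intro has_vector_derivative_mult_right) auto
    then have "((\<lambda>t. Re (h * q (z + of_real t * h))) has_vector_derivative Re (h * (h * deriv q z))) (at 0)"
      by (rule bounded_linear.has_vector_derivative[OF bounded_linear_Re])
    then show ?thesis by (simp add: has_real_derivative_iff_has_vector_derivative mult.assoc)
  qed
  have ev: "\<forall>\<^sub>F t in nhds (0::real). z + of_real t * h \<in> S" for h
    by (rule eventually_nhds_line[OF eventually_nhds_in_open[OF S]])
  have H: "has_d2 (\<lambda>z. F (X z)) h z (F' (X z) * Re (h * q z))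
      (F'' * (Re (h * q z))\<^sup>2 + F' (X z) * Re (h * h * deriv q z))" for h
  proof (rule has_d2I[where d="\<lambda>t. F' (X (z + of_real t * h)) * Re (h * q (z + of_real t * h))"])
    have "isCont (\<lambda>t. X (z + of_real t * h)) 0" using X1[of 0 h] S DERIV_isCont by auto
    then have "((\<lambda>t. X (z + of_real t * h)) \<longlongrightarrow> X z) (nhds (0::real))"
      by (simp add: continuous_at tendsto_nhds_iff)
    then have "\<forall>\<^sub>F t in nhds (0::real). (F has_real_derivative F' (X (z + of_real t * h))) (at (X (z + of_real t * h)))"
      using F1 by (auto simp: filterlim_iff X_def)
    with ev[of h] show "\<forall>\<^sub>F t in nhds 0. ((\<lambda>t. F (X (z + of_real t * h))) has_real_derivative
        F' (X (z + of_real t * h)) * Re (h * q (z + of_real t * h))) (at t)"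
    proof eventually_elim
      case (elim t)
      from DERIV_chain2[OF elim(2) X1[OF elim(1)]] show ?case .
    qed
    have "((\<lambda>t. F' (X (z + of_real t * h))) has_real_derivative F'' * Re (h * q (z + of_real 0 * h))) (at 0)"
      by (rule DERIV_chain2[OF _ X1]) (use F2 S in \<open>auto simp: X_def\<close>)
    from DERIV_mult[OF this X2[of h]]
    show "((\<lambda>t. F' (X (z + of_real t * h)) * Re (h * q (z + of_real t * h))) has_real_derivative
      F'' * (Re (h * q z))\<^sup>2 + F' (X z) * Re (h * h * deriv q z)) (at 0)"
      by (simp add: power2_eq_square algebra_simps)
  qed simp
  have "F'' * (Re (1 * q z))\<^sup>2 + F' (X z) * Re (1 * 1 * deriv q z) + (F'' * (Re (\<i> * q z))\<^sup>2 + F' (X z) * Re (\<i> * \<i> * deriv q z))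
     = F'' * (norm (deriv g z / g z))\<^sup>2"
    by (simp add: cmod_power2 q_def[symmetric] distrib_left) (simp add: q_def cmod_power2 flip: norm_divide)
  then show ?thesis unfolding has_lap_def using H[of 1] H[of \<i>] unfolding X_def by metis
qed

lemma has_lap_ln_norm:
  assumes S: "open S" "z \<in> S" and g: "g holomorphic_on S" "\<And>y. y \<in> S \<Longrightarrow> g y \<noteq> 0"
  shows "has_lap (\<lambda>z. ln (norm (g z))) z 0"
  using has_lap_comp_ln_norm[where F="\<lambda>x. x" and F'="\<lambda>x. 1" and F''=0, OF assms] by simp

section \<open>The Liouville equation\<close>

lemma sum_ln_ge: "(\<Sum>k=1..n. ln (real k)) \<ge> real n * ln (real n) - real n"
proof (induction n)
  case (Suc n)
  show ?case
  proof (cases "n = 0")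
    case False
    then have n: "real n > 0" by simp
    have "ln (real (Suc n) / real n) \<le> real (Suc n) / real n - 1"
      by (rule ln_le_minus_one) (use n in simp)
    also have "\<dots> = 1 / real n" using n by (simp add: field_simps)
    finally have "real n * (ln (real (Suc n)) - ln (real n)) \<le> 1"
      using n by (simp add: ln_div field_simps)
    then show ?thesis using Suc.IH by (simp add: algebra_simps)
  qed simp
qed simp

text \<open>A uniform logarithmic potential of many small masses at the distances \<open>\<tau>i/n\<close> is bounded
  below independently of their number, the nearest mass contributing only \<open>(ln \<delta>)/n\<close>.\<close>
lemma mean_ln_ge:
  fixes x \<tau> \<delta> :: real and y :: "nat \<Rightarrow> real"
  assumes n: "n \<ge> 1" and \<tau>: "\<tau> > 0" and x: "x \<ge> 0" and \<delta>: "\<delta> > 0"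
    and y: "\<And>i. i \<in> {1..n} \<Longrightarrow> y i \<ge> \<bar>x - \<tau> * real i / real n\<bar>" "\<And>i. i \<in> {1..n} \<Longrightarrow> y i \<ge> \<delta>"
    and nb: "real n \<ge> ln (\<tau> / \<delta>)"
  shows "(\<Sum>i=1..n. ln (y i)) / real n \<ge> ln \<tau> - 5"
proof -
  \<comment> \<open>All masses lie in [0, \<tau>], so moving \<open>x\<close> down to \<tau> only
    shortens distances; the truncated point has a nearest index \<open>j\<close> of at most
    \<open>n\<close>.\<close>
  define x' where "x' = min x \<tau>"
  have x': "0 \<le> x'" "x' \<le> \<tau>" using x \<tau> by (auto simp: x'_def)
  have rn: "real n > 0" using n by simp
  have y': "y i \<ge> \<bar>x' - \<tau> * real i / real n\<bar>" if "i \<in> {1..n}" for i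
  proof -
    have "real i \<le> real n" using that by simp
    then have "\<tau> * real i / real n \<le> \<tau>" using \<tau> rn by (simp add: field_simps)
    then have "\<bar>x' - \<tau> * real i / real n\<bar> \<le> \<bar>x - \<tau> * real i / real n\<bar>" by (auto simp: x'_def)
    with y(1)[OF that] show ?thesis by linarith
  qed
  define X where "X = x' * real n / \<tau>"
  define j where "j = nat (round X)"
  have X: "0 \<le> X" "X \<le> real n" using x' \<tau> rn by (auto simp: X_def field_simps)
  have "round X \<ge> 0" using X(1) round_mono[of 0 X] by simp
  then have jX: "real j = of_int (round X)" by (simp add: j_def)
  then have j: "\<bar>real j - X\<bar> \<le> 1/2" using of_int_round_abs_le[of X] by simp
  have "real j \<le> real n + 1/2" using j X by linarith
  then have jn: "j \<le> n" by linarith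
  \<comment> \<open>Rounding errs by at most 1/2 while |i - j| is at least 1, so in units of
    \<tau>/n the distance is still at least |i - j|/2.\<close>
  have yb: "y i \<ge> \<tau> * (\<bar>real i - real j\<bar> / (2 * real n))" if "i \<in> {1..n}" "i \<noteq> j" for i
  proof -
    have 1: "\<bar>real i - real j\<bar> \<ge> 1" using that(2) by linarith
    have "\<bar>X - real i\<bar> \<ge> \<bar>real i - real j\<bar> - 1/2" using j by linarith
    moreover have "a / 2 \<le> b" if "1 \<le> a" "a - 1/2 \<le> b" for a b :: real using that by linarith
    ultimately have 2: "\<bar>X - real i\<bar> \<ge> \<bar>real i - real j\<bar> / 2" using 1 by blast
    have "x' - \<tau> * real i / real n = \<tau> / real n * (X - real i)"
      using \<tau> rn by (simp add: X_def field_simps)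
    then have "\<bar>x' - \<tau> * real i / real n\<bar> = \<tau> / real n * \<bar>X - real i\<bar>"
      using \<tau> rn by (simp add: abs_mult)
    also have "\<dots> \<ge> \<tau> / real n * (\<bar>real i - real j\<bar> / 2)"
      using 2 \<tau> rn by (intro mult_left_mono) auto
    finally show ?thesis using y'[OF that(1)] by (simp add: field_simps)
  qed
  define L where "L = (\<lambda>k::nat. ln (real k / (2 * real n)))"
  have Lneg: "L k \<le> 0" if "k \<in> {1..n}" for k
    unfolding L_def using that rn by (intro iffD2[OF ln_le_zero_iff]) auto
  define A where "A = (\<Sum>k=1..n. L k)"
  have A: "A \<ge> - real n - real n * ln 2"
  proof -
    have "A = (\<Sum>k=1..n. ln (real k) - ln (2 * real n))"
      unfolding A_def L_def by (rule sum.cong) (use rn in \<open>auto simp: ln_div\<close>)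
    also have "\<dots> = (\<Sum>k=1..n. ln (real k)) - real n * ln (2 * real n)"
      by (simp add: sum_subtractf)
    also have "real n * ln (2 * real n) = real n * ln 2 + real n * ln (real n)"
      using rn by (simp add: ln_mult algebra_simps)
    finally show ?thesis using sum_ln_ge[of n] by simp
  qed
  \<comment> \<open>The index \<open>j\<close> may be 0; then no mass is singled out and the third
    part is empty.\<close>
  have split: "{1..n} = ({1..<j} \<union> {j<..n}) \<union> ({j} \<inter> {1..n})" using jn by auto
  have t: "ln (y i) \<ge> ln \<tau> + L (nat \<bar>int i - int j\<bar>)" if "i \<in> {1..n}" "i \<noteq> j" for i
  proof -
    have e: "real (nat \<bar>int i - int j\<bar>) = \<bar>real i - real j\<bar>" by simp
    have pos: "\<bar>real i - real j\<bar> / (2 * real n) > 0" using that(2) rn by simp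
    have "ln \<tau> + L (nat \<bar>int i - int j\<bar>) = ln (\<tau> * (\<bar>real i - real j\<bar> / (2 * real n)))"
      unfolding L_def e using pos \<tau> by (subst ln_mult) auto
    also have "\<dots> \<le> ln (y i)"
      using yb[OF that] mult_pos_pos[OF \<tau> pos] by (intro iffD2[OF ln_le_cancel_iff]) linarith+
    finally show ?thesis .
  qed
  have s1: "(\<Sum>i\<in>{1..<j}. ln (y i)) \<ge> (\<Sum>i\<in>{1..<j}. ln \<tau>) + A"
  proof -
    have "(\<Sum>i\<in>{1..<j}. ln (y i)) \<ge> (\<Sum>i\<in>{1..<j}. ln \<tau> + L (nat \<bar>int i - int j\<bar>))"
      by (rule sum_mono, rule t) (use jn in auto)
    moreover have "(\<Sum>i\<in>{1..<j}. L (nat \<bar>int i - int j\<bar>)) = (\<Sum>k\<in>{1..<j}. L k)"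
      by (rule sum.reindex_bij_witness[of _ "\<lambda>k. j - k" "\<lambda>i. j - i"]) (auto simp: nat_diff_distrib of_nat_diff)
    moreover have "(\<Sum>k\<in>{1..<j}. L k) \<ge> A" unfolding A_def
      by (rule sum_mono2[where f="\<lambda>k. - L k", simplified sum_negf neg_le_iff_le]) (use jn Lneg in \<open>auto\<close>)
    ultimately show ?thesis by (simp add: sum.distrib)
  qed
  have s2: "(\<Sum>i\<in>{j<..n}. ln (y i)) \<ge> (\<Sum>i\<in>{j<..n}. ln \<tau>) + A"
  proof -
    have "(\<Sum>i\<in>{j<..n}. ln (y i)) \<ge> (\<Sum>i\<in>{j<..n}. ln \<tau> + L (nat \<bar>int i - int j\<bar>))"
      by (rule sum_mono, rule t) auto
    moreover have "(\<Sum>i\<in>{j<..n}. L (nat \<bar>int i - int j\<bar>)) = (\<Sum>k\<in>{1..n-j}. L k)"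
      by (rule sum.reindex_bij_witness[of _ "\<lambda>k. j + k" "\<lambda>i. i - j"]) (auto simp: nat_diff_distrib of_nat_diff)
    moreover have "(\<Sum>k\<in>{1..n-j}. L k) \<ge> A" unfolding A_def
      by (rule sum_mono2[where f="\<lambda>k. - L k", simplified sum_negf neg_le_iff_le]) (use jn Lneg in \<open>auto\<close>)
    ultimately show ?thesis by (simp add: sum.distrib)
  qed
  have s3: "(\<Sum>i\<in>{j} \<inter> {1..n}. ln (y i)) \<ge> (\<Sum>i\<in>{j} \<inter> {1..n}. ln \<tau>) - real n"
  proof (cases "j \<in> {1..n}")
    case True
    have "ln (y j) \<ge> ln \<delta>" using y(2)[OF True] \<delta> by simp
    moreover have "ln \<delta> \<ge> ln \<tau> - real n" using nb \<delta> \<tau> by (simp add: ln_div)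
    ultimately show ?thesis using True by simp
  qed simp
  have "(\<Sum>i=1..n. ln (y i)) = (\<Sum>i\<in>{1..<j}. ln (y i)) + (\<Sum>i\<in>{j<..n}. ln (y i)) + (\<Sum>i\<in>{j} \<inter> {1..n}. ln (y i))"
    by (subst split, subst sum.union_disjoint, simp, simp, fastforce, subst sum.union_disjoint) auto
  moreover have "(\<Sum>i=1..n. ln \<tau>) = (\<Sum>i\<in>{1..<j}. ln \<tau>) + (\<Sum>i\<in>{j<..n}. ln \<tau>) + (\<Sum>i\<in>{j} \<inter> {1..n}. ln \<tau>)"
    by (subst split, subst sum.union_disjoint, simp, simp, fastforce, subst sum.union_disjoint) auto
  ultimately have "(\<Sum>i=1..n. ln (y i)) \<ge> (\<Sum>i=1..n. ln \<tau>) + 2 * A - real n"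
    using s1 s2 s3 by linarith
  also have "(\<Sum>i=1..n. ln \<tau>) = real n * ln \<tau>" by simp
  \<comment> \<open>Each side of \<open>j\<close> costs n + n ln 2 and the nearest mass costs n,
    together at most 5 n.\<close>
  finally have "(\<Sum>i=1..n. ln (y i)) \<ge> real n * ln \<tau> - 3 * real n - 2 * real n * ln 2" using A by linarith
  moreover have "real n * ln 2 \<le> real n * 1" using ln_2_less_1 by (intro mult_left_mono) auto
  ultimately have "(\<Sum>i=1..n. ln (y i)) \<ge> real n * (ln \<tau> - 5)" by (simp add: algebra_simps)
  then show ?thesis using rn by (simp add: field_simps)
qed

text \<open>Continuity is demanded separately because derivatives along two lines through a point do
  not imply it.\<close>

definition liouville :: "complex set \<Rightarrow> (complex \<Rightarrow> real) \<Rightarrow> bool" where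
  "liouville S u \<longleftrightarrow> continuous_on S u \<and> (\<forall>z\<in>S. has_lap u z (exp (2 * u z)))"

text \<open>Where u > w, the difference has Laplacian e^(2u) - e^(2w) > 0, which is the form the
  maximum principle asks for.\<close>

lemma liouville_compare:
  assumes U: "open U" "bounded U" and u: "liouville U u" and w: "liouville U w"
    and bd: "\<And>\<xi> \<epsilon>. \<xi> \<in> frontier U \<Longrightarrow> \<epsilon> > 0 \<Longrightarrow> \<forall>\<^sub>F z in at \<xi> within U. u z - w z < \<epsilon>"
    and z: "z \<in> U"
  shows "u z \<le> w z"
proof -
  have "u z - w z \<le> 0"
  proof (rule max_principle[OF U _ bd _ z])
    show "continuous_on U (\<lambda>z. u z - w z)"
      using u w by (intro continuous_intros) (auto simp: liouville_def)
    fix y assume y: "y \<in> U" "u y - w y > 0"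
    have "has_lap (\<lambda>z. u z - w z) y (exp (2 * u y) - exp (2 * w y))"
      using u w y by (intro has_lap_diff) (auto simp: liouville_def)
    then show "\<exists>l>0. has_lap (\<lambda>z. u z - w z) y l" using y by (intro exI[of _ "exp (2 * u y) - exp (2 * w y)"]) auto
  qed
  then show ?thesis by simp
qed

lemma liouville_subset: "liouville S u \<Longrightarrow> T \<subseteq> S \<Longrightarrow> liouville T u"
  unfolding liouville_def by (auto intro: continuous_on_subset)

text \<open>The logarithm of the Poincare density 2R / (R^2 - |z - c|^2), normalised to curvature
  -1.\<close>

lemma liouville_disc:
  assumes R: "R > 0"
  shows "liouville (ball c R) (\<lambda>z. (ln (2 * R) - ln (R\<^sup>2 - (norm (z - c))\<^sup>2)))"
proof -
  have pos: "R\<^sup>2 - (norm (z - c))\<^sup>2 > 0" if "z \<in> ball c R" for z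
    using that R power_strict_mono[of "norm (z - c)" R 2] by (simp add: dist_norm norm_minus_commute)
  have lap: "has_lap (\<lambda>z. (ln (2 * R) - ln (R\<^sup>2 - (norm (z - c))\<^sup>2))) z (exp (2 * (ln (2 * R) - ln (R\<^sup>2 - (norm (z - c))\<^sup>2))))"
    if z: "z \<in> ball c R" for z
  proof -
    define x y where "x = Re (z - c)" and "y = Im (z - c)"
    define N where "N = R\<^sup>2 - (x\<^sup>2 + y\<^sup>2)"
    have Nz: "N = R\<^sup>2 - (norm (z - c))\<^sup>2" by (simp add: N_def x_def y_def cmod_power2)
    have Npos: "N > 0" using pos[OF z] Nz by simp
    have ev: "\<forall>\<^sub>F t in nhds (0::real). R\<^sup>2 - ((x' + t)\<^sup>2 + y'\<^sup>2) > 0" if "R\<^sup>2 - (x'\<^sup>2 + y'\<^sup>2) > 0" for x' y' :: real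
    proof -
      have "isCont (\<lambda>t. R\<^sup>2 - ((x' + t)\<^sup>2 + y'\<^sup>2)) 0" by (intro continuous_intros)
      then have "((\<lambda>t. R\<^sup>2 - ((x' + t)\<^sup>2 + y'\<^sup>2)) \<longlongrightarrow> R\<^sup>2 - (x'\<^sup>2 + y'\<^sup>2)) (nhds 0)"
        by (simp add: continuous_at tendsto_nhds_iff)
      then show ?thesis using that by (rule order_tendstoD)
    qed
    \<comment> \<open>On a coordinate line through \<open>z\<close> the squared norm is a quadratic
      in one variable: \<open>x'\<close> is the coordinate that moves, \<open>y'\<close> the one
      that stays.\<close>
    have key: "\<exists>b. has_d2 (\<lambda>z. (ln (2 * R) - ln (R\<^sup>2 - (norm (z - c))\<^sup>2))) h z b ((2 * N + 4 * x'\<^sup>2) / N\<^sup>2)"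
      if e: "\<And>t. R\<^sup>2 - (norm (z + of_real t * h - c))\<^sup>2 = R\<^sup>2 - ((x' + t)\<^sup>2 + y'\<^sup>2)" for h x' y'
    proof -
      have N': "N = R\<^sup>2 - (x'\<^sup>2 + y'\<^sup>2)" using e[of 0] Nz by simp
      have "has_d2 (\<lambda>z. (ln (2 * R) - ln (R\<^sup>2 - (norm (z - c))\<^sup>2))) h z (2 * x' / N) ((2 * N + 4 * x'\<^sup>2) / N\<^sup>2)"
      proof (rule has_d2I[where d="\<lambda>t. 2 * (x' + t) / (R\<^sup>2 - ((x' + t)\<^sup>2 + y'\<^sup>2))"])
        show "\<forall>\<^sub>F t in nhds 0. ((\<lambda>t. (ln (2 * R) - ln (R\<^sup>2 - (norm (z + of_real t * h - c))\<^sup>2)))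
           has_real_derivative 2 * (x' + t) / (R\<^sup>2 - ((x' + t)\<^sup>2 + y'\<^sup>2))) (at t)"
          unfolding e using ev[OF Npos[unfolded N']]
        proof eventually_elim
          case (elim t)
          then show ?case using R
            by (auto intro!: derivative_eq_intros simp: field_simps power2_eq_square)
        qed
        show "((\<lambda>t. 2 * (x' + t) / (R\<^sup>2 - ((x' + t)\<^sup>2 + y'\<^sup>2))) has_real_derivative (2 * N + 4 * x'\<^sup>2) / N\<^sup>2) (at 0)"
          using Npos unfolding N'
          by (auto intro!: derivative_eq_intros simp: power2_eq_square algebra_simps)
      qed (simp add: N')
      then show ?thesis by blast
    qed
    have "\<exists>b. has_d2 (\<lambda>z. (ln (2 * R) - ln (R\<^sup>2 - (norm (z - c))\<^sup>2))) 1 z b ((2 * N + 4 * x\<^sup>2) / N\<^sup>2)"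
      by (rule key[where y'=y]) (simp add: cmod_power2 x_def y_def algebra_simps)
    moreover have "\<exists>b. has_d2 (\<lambda>z. (ln (2 * R) - ln (R\<^sup>2 - (norm (z - c))\<^sup>2))) \<i> z b ((2 * N + 4 * y\<^sup>2) / N\<^sup>2)"
      by (rule key[where y'=x]) (simp add: cmod_power2 x_def y_def algebra_simps)
    moreover have "exp (2 * (ln (2 * R) - ln (R\<^sup>2 - (norm (z - c))\<^sup>2))) = (2 * N + 4 * x\<^sup>2) / N\<^sup>2 + (2 * N + 4 * y\<^sup>2) / N\<^sup>2"
    proof -
      have "exp (2 * (ln (2 * R) - ln (R\<^sup>2 - (norm (z - c))\<^sup>2))) = (exp (ln (2 * R / N)))\<^sup>2"
        using R Npos exp_double[of "ln (2 * R) - ln N"] by (simp add: Nz[symmetric] ln_div)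
      also have "\<dots> = (2 * R / N)\<^sup>2" using R Npos by simp
      also have "\<dots> = (4 * R\<^sup>2) / N\<^sup>2" by (simp add: power_divide power_mult_distrib)
      also have "4 * R\<^sup>2 = (2 * N + 4 * x\<^sup>2) + (2 * N + 4 * y\<^sup>2)" by (simp add: N_def)
      finally show ?thesis by (simp add: add_divide_distrib)
    qed
    ultimately show ?thesis unfolding has_lap_def by blast
  qed
  show ?thesis unfolding liouville_def using lap
    by (auto intro!: continuous_intros simp: dist_norm)
      (use pos R in \<open>fastforce simp: dist_norm\<close>)+
qed

section \<open>Growth bounds and uniqueness for solutions that blow up at the frontier\<close>

lemma blowup_sublevel:
  fixes \<Omega> :: "complex set"
  assumes \<Omega>: "open \<Omega>" "bounded \<Omega>"
    and blow: "\<And>\<xi>. \<xi> \<in> frontier \<Omega> \<Longrightarrow> filterlim u at_top (at \<xi> within \<Omega>)"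
  shows "closure {z\<in>\<Omega>. u z < (N::real)} \<subseteq> \<Omega>" "compact (closure {z\<in>\<Omega>. u z < N})"
proof -
  show "closure {z\<in>\<Omega>. u z < N} \<subseteq> \<Omega>"
  proof
    fix \<xi> assume \<xi>: "\<xi> \<in> closure {z\<in>\<Omega>. u z < N}"
    show "\<xi> \<in> \<Omega>"
    proof (rule ccontr)
      assume n: "\<xi> \<notin> \<Omega>"
      have "\<xi> \<in> closure \<Omega>" using \<xi> closure_mono[of "{z\<in>\<Omega>. u z < N}" \<Omega>] by auto
      then have "\<xi> \<in> frontier \<Omega>" using n \<Omega> by (simp add: frontier_def interior_open)
      from blow[OF this] have ev: "\<forall>\<^sub>F z in at \<xi> within \<Omega>. u z > N" by (simp add: filterlim_at_top_dense)
      obtain x where x: "\<forall>n. x n \<in> {z\<in>\<Omega>. u z < N}" "x \<longlonglongrightarrow> \<xi>" using \<xi> unfolding closure_sequential by blast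
      have "filterlim x (at \<xi> within \<Omega>) sequentially"
        unfolding filterlim_at using x n by (auto intro!: always_eventually)
      with ev have "\<forall>\<^sub>F n in sequentially. u (x n) > N" by (auto simp: filterlim_iff)
      then obtain n where "u (x n) > N" by (auto simp: eventually_sequentially)
      then show False using x(1) by (auto dest: spec[of _ n])
    qed
  qed
  show "compact (closure {z\<in>\<Omega>. u z < N})"
    using \<Omega>(2) by (auto simp: compact_closure intro: bounded_subset)
qed

text \<open>The barrier is s = - (1 - \<epsilon>) G + |z - p|^(2 \<epsilon>) - C0, where
  \<open>G\<close> is the mean of ln |z - c i| over points \<open>c i\<close> of the complement at
  distances \<tau> i/n from \<open>p\<close>. \<open>G\<close> is harmonic, and the power
  contributes the Laplacian 4 \<epsilon>^2 |z - p|^(2 \<epsilon> - 2), which dominates e^(2s):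
  \<open>s\<close> is a subsolution. Averaging keeps \<open>s\<close> below a level \<open>N\<close>
  that depends on \<tau> but not on \<open>n\<close>, so \<open>s\<close> can be compared with
  \<open>u\<close> on the set where u < N.\<close>

lemma liouville_lower_bound:
  assumes \<Omega>: "open \<Omega>" "bounded \<Omega>" and u: "liouville \<Omega> u"
    and blow: "\<And>\<xi>. \<xi> \<in> frontier \<Omega> \<Longrightarrow> filterlim u at_top (at \<xi> within \<Omega>)"
    and nd: "\<And>p t. p \<in> frontier \<Omega> \<Longrightarrow> 0 \<le> t \<Longrightarrow> t \<le> r0 \<Longrightarrow> \<exists>x. x \<notin> \<Omega> \<and> dist p x = t"
    and \<epsilon>: "0 < \<epsilon>" "\<epsilon> < 1"
  shows "\<exists>C. \<forall>z\<in>\<Omega>. \<forall>p\<in>frontier \<Omega>. dist z p \<le> r0 \<longrightarrow> u z \<ge> (1 - \<epsilon>) * ln (1 / dist z p) - C"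
proof -
  define a where "a = 1 - \<epsilon>"
  have a: "0 < a" "a < 1" using \<epsilon> by (auto simp: a_def)
  have "bounded (closure \<Omega>)" using \<Omega> by (intro bounded_closure)
  then obtain R where R: "\<And>x y. x \<in> closure \<Omega> \<Longrightarrow> y \<in> closure \<Omega> \<Longrightarrow> dist x y \<le> R"
    unfolding bounded_two_points by auto
  define B where "B = (max R 1) powr (2 * \<epsilon>)"
  have B: "B \<ge> 0" by (simp add: B_def)
  \<comment> \<open>6 is the loss in G \<ge> ln |z - p| - 6, \<open>B\<close> bounds |z - p|^(2
    \<epsilon>), and ln (2 \<epsilon>) produces in e^(2s) the factor 4 \<epsilon>^2 of the
    Laplacian.\<close>
  define C0 where "C0 = 6 + B - ln (2 * \<epsilon>)"
  have "u z0 \<ge> (1 - \<epsilon>) * ln (1 / dist z0 p) - (\<bar>C0\<bar> + 1)"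
    if z0: "z0 \<in> \<Omega>" and p: "p \<in> frontier \<Omega>" and d0: "dist z0 p \<le> r0" for z0 p
  proof -
    define \<tau> where "\<tau> = dist z0 p"
    have pn: "p \<notin> \<Omega>" using p \<Omega>(1) by (simp add: frontier_def interior_open)
    have pcl: "p \<in> closure \<Omega>" using p by (simp add: frontier_def)
    have \<tau>: "\<tau> > 0" using z0 pn by (auto simp: \<tau>_def)
    \<comment> \<open>The upper bound for \<open>s\<close> that results from G \<ge> ln \<tau> -
      5.\<close>
    define N where "N = - a * (ln \<tau> - 5) + B - C0"
    define U where "U = {z\<in>\<Omega>. u z < N}"
    have Ucl: "closure U \<subseteq> \<Omega>" "compact (closure U)"
      using blowup_sublevel[OF \<Omega> blow] by (auto simp: U_def)
    have uc: "continuous_on \<Omega> u" using u by (simp add: liouville_def)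
    have Uo: "open U" unfolding U_def
      using continuous_open_preimage[OF uc \<Omega>(1), of "{..<N}"] by (simp add: vimage_def Int_def)
    have Ub: "bounded U" using \<Omega>(2) by (rule bounded_subset) (auto simp: U_def)
    have "closed (- \<Omega>)" using \<Omega>(1) by (simp add: closed_Compl)
    obtain \<delta> where \<delta>: "\<delta> > 0" "\<And>x y. x \<in> closure U \<Longrightarrow> y \<in> - \<Omega> \<Longrightarrow> \<delta> \<le> dist x y"
      using separate_compact_closed[OF Ucl(2) \<open>closed (- \<Omega>)\<close>] Ucl(1) by (metis ComplD disjoint_iff subsetD)
    \<comment> \<open>\<open>n\<close> is chosen after \<delta>: a single pole may come as close as
      \<delta> to \<open>U\<close>, and its share of the mean has to stay bounded.\<close>
    obtain n where n: "real n \<ge> max 1 (ln (\<tau> / \<delta>))" using real_arch_simple by blast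
    then have n1: "n \<ge> 1" by simp
    then have rn: "real n > 0" by simp
    have "\<exists>x. x \<notin> \<Omega> \<and> dist p x = \<tau> * real i / real n" if "i \<in> {1..n}" for i
    proof (rule nd[OF p])
      have "real i \<le> real n" using that by simp
      then have "\<tau> * real i / real n \<le> \<tau>" using \<tau> rn by (simp add: field_simps)
      then show "\<tau> * real i / real n \<le> r0" using d0 by (simp add: \<tau>_def)
    qed (use \<tau> in auto)
    then obtain c where c: "\<And>i. i \<in> {1..n} \<Longrightarrow> c i \<notin> \<Omega>" "\<And>i. i \<in> {1..n} \<Longrightarrow> dist p (c i) = \<tau> * real i / real n"
      by metis
    have c\<tau>: "dist p (c i) \<le> \<tau>" if "i \<in> {1..n}" for i
    proof -
      have "real i \<le> real n" using that by simp
      then have "\<tau> * real i / real n \<le> \<tau>" using \<tau> rn by (simp add: field_simps)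
      then show ?thesis using c(2)[OF that] by simp
    qed
    define G where "G = (\<lambda>z. (\<Sum>i=1..n. ln (norm (z - c i))) / real n)"
    define s where "s = (\<lambda>z. - a * G z + exp (2 * \<epsilon> * ln (norm (z - p))) + (- C0))"
    have tri: "norm (z - c i) \<ge> \<bar>norm (z - p) - dist p (c i)\<bar>" for z i
      by norm
    have G1: "G z \<ge> ln \<tau> - 5" if z: "z \<in> closure U" for z
      unfolding G_def
    proof (rule mean_ln_ge[OF n1 \<tau>, where x="norm (z - p)" and \<delta>=\<delta>])
      show "\<bar>norm (z - p) - \<tau> * real i / real n\<bar> \<le> norm (z - c i)" if "i \<in> {1..n}" for i
        using tri[of z i] c(2)[OF that] by simp
      show "\<delta> \<le> norm (z - c i)" if "i \<in> {1..n}" for i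
        using \<delta>(2)[OF z, of "c i"] c(1)[OF that] by (simp add: dist_norm)
    qed (use \<delta> n in auto)
    have zp: "norm (z - p) > 0" if "z \<in> closure U" for z using that Ucl pn by auto
    \<comment> \<open>Far from \<open>p\<close> every pole is at least |z - p|/2 away; within 2
      \<tau> the bound by ln \<tau> is as good up to ln 2.\<close>
    have G2: "G z \<ge> ln (norm (z - p)) - 6" if z: "z \<in> closure U" for z
    proof (cases "norm (z - p) \<ge> 2 * \<tau>")
      case True
      have "ln (norm (z - c i)) \<ge> ln (norm (z - p)) - 6" if "i \<in> {1..n}" for i
      proof -
        have "norm (z - c i) \<ge> norm (z - p) / 2" using tri[of z i] c\<tau>[OF that] True by linarith
        then have "ln (norm (z - c i)) \<ge> ln (norm (z - p) / 2)" using zp[OF z] by (intro iffD2[OF ln_le_cancel_iff]) auto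
        also have "ln (norm (z - p) / 2) = ln (norm (z - p)) - ln 2" using zp[OF z] by (simp add: ln_div)
        finally show ?thesis using ln_2_less_1 by linarith
      qed
      then have "(\<Sum>i=1..n. ln (norm (z - c i))) \<ge> (\<Sum>i=1..n. ln (norm (z - p)) - 6)" by (intro sum_mono)
      then show ?thesis unfolding G_def using rn by (simp add: field_simps)
    next
      case False
      then have "ln (norm (z - p)) \<le> ln (2 * \<tau>)" using zp[OF z] \<tau> by (intro iffD2[OF ln_le_cancel_iff]) auto
      also have "\<dots> = ln 2 + ln \<tau>" using \<tau> by (simp add: ln_mult)
      finally show ?thesis using G1[OF z] ln_2_less_1 by linarith
    qed
    have expB: "exp (2 * \<epsilon> * ln (norm (z - p))) \<le> B" if z: "z \<in> closure U" for z
    proof -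
      have "z \<in> closure \<Omega>" using z Ucl(1) closure_subset[of \<Omega>] by auto
      then have "norm (z - p) \<le> max R 1" using R[of z p] pcl by (simp add: dist_norm le_max_iff_disj)
      then have "norm (z - p) powr (2 * \<epsilon>) \<le> B" unfolding B_def using zp[OF z] \<epsilon> by (intro powr_mono2) auto
      then show ?thesis using zp[OF z] by (simp add: powr_def)
    qed
    have sN: "s z \<le> N" if z: "z \<in> closure U" for z
    proof -
      have "a * (ln \<tau> - 5) \<le> a * G z" using G1[OF z] a by (intro mult_left_mono) auto
      then show ?thesis unfolding s_def N_def using expB[OF z] by simp
    qed
    have sc: "continuous_on \<Omega> s"
      unfolding s_def G_def using c(1) pn rn by (intro continuous_intros) auto
    have lap: "has_lap s z (4 * \<epsilon>\<^sup>2 * exp (2 * \<epsilon> * ln (norm (z - p))) * (norm (1 / (z - p)))\<^sup>2)" if "z \<in> \<Omega>" for z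
    proof -
      have "has_lap (\<lambda>z. ln (norm (z - c i))) z 0" if i: "i \<in> {1..n}" for i
        by (rule has_lap_ln_norm[where S=\<Omega>]) (use \<Omega> \<open>z \<in> \<Omega>\<close> c(1)[OF i] in \<open>auto intro!: holomorphic_intros\<close>)
      then have "has_lap (\<lambda>z. \<Sum>i=1..n. ln (norm (z - c i))) z (\<Sum>i=1..n. 0)"
        by (intro has_lap_sum) auto
      then have 1: "has_lap (\<lambda>z. (- a / real n) * (\<Sum>i=1..n. ln (norm (z - c i)))) z ((- a / real n) * (\<Sum>i=1..n. 0))"
        by (rule has_lap_cmult)
      have 2: "has_lap (\<lambda>z. exp (2 * \<epsilon> * ln (norm (z - p)))) z
         (4 * \<epsilon>\<^sup>2 * exp (2 * \<epsilon> * ln (norm (z - p))) * (norm (deriv (\<lambda>z. z - p) z / (z - p)))\<^sup>2)"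
        by (rule has_lap_comp_ln_norm[where S=\<Omega> and F'="\<lambda>x. 2 * \<epsilon> * exp (2 * \<epsilon> * x)"])
          (use \<Omega> \<open>z \<in> \<Omega>\<close> pn in \<open>auto intro!: always_eventually holomorphic_intros derivative_eq_intros simp: power2_eq_square\<close>)
      have d: "deriv (\<lambda>z. z - p) z = 1" by (rule DERIV_imp_deriv) (auto intro!: derivative_eq_intros)
      have e: "(\<lambda>z. (- a / real n) * (\<Sum>i=1..n. ln (norm (z - c i))) + exp (2 * \<epsilon> * ln (norm (z - p))) + (- C0)) = s"
        unfolding s_def G_def by (auto simp: fun_eq_iff)
      show ?thesis
        using has_lap_add[OF has_lap_add[OF 1 2] has_lap_const[of "- C0"]] unfolding e d by simp
    qed
    \<comment> \<open>The subsolution inequality. It rests on 2 a = 2 - 2 \<epsilon>, which turns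
      e^(- 2 a l) into |z - p|^(2 \<epsilon> - 2).\<close>
    have sexp: "exp (2 * s z) \<le> 4 * \<epsilon>\<^sup>2 * exp (2 * \<epsilon> * ln (norm (z - p))) * (norm (1 / (z - p)))\<^sup>2"
      if z: "z \<in> U" for z
    proof -
      have zc: "z \<in> closure U" using z closure_subset by auto
      define l where "l = ln (norm (z - p))"
      have "a * (l - 6) \<le> a * G z" using G2[OF zc] a by (intro mult_left_mono) (auto simp: l_def)
      then have "s z \<le> - a * l + 6 * a + B - C0" unfolding s_def using expB[OF zc] by (simp add: algebra_simps)
      also have "\<dots> \<le> - a * l + ln (2 * \<epsilon>)" using a by (simp add: C0_def)
      finally have "exp (2 * s z) \<le> exp (2 * (- a * l + ln (2 * \<epsilon>)))" by simp
      also have "\<dots> = exp (- 2 * a * l + 2 * ln (2 * \<epsilon>))" by (simp add: algebra_simps)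
      also have "\<dots> = exp (- 2 * a * l) * (exp (ln (2 * \<epsilon>)))\<^sup>2"
        by (simp only: exp_add exp_double)
      also have "\<dots> = exp (2 * \<epsilon> * l + - 2 * l) * (4 * \<epsilon>\<^sup>2)" using \<epsilon> by (simp add: a_def algebra_simps power2_eq_square)
      also have "\<dots> = exp (2 * \<epsilon> * l) * (exp (- l))\<^sup>2 * (4 * \<epsilon>\<^sup>2)" using exp_double[of "- l"] by (subst exp_add) simp
      also have "exp (- l) = norm (1 / (z - p))" using zp[OF zc] by (simp add: l_def exp_minus norm_divide inverse_eq_divide)
      finally show ?thesis by (simp add: l_def mult_ac)
    qed
    \<comment> \<open>On the frontier of \<open>U\<close> the solution is at least \<open>N\<close>,
      hence at least \<open>s\<close>; inside, s > u would give the difference a positive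
      Laplacian.\<close>
    have main: "s z - u z \<le> 0" if z: "z \<in> U" for z
    proof (rule max_principle[OF Uo Ub _ _ _ z])
      show "continuous_on U (\<lambda>z. s z - u z)"
        by (intro continuous_intros continuous_on_subset[OF sc] continuous_on_subset[OF uc]) (auto simp: U_def)
      fix \<xi> e :: "_" assume \<xi>: "\<xi> \<in> frontier U" and e: "e > (0::real)"
      have \<xi>c: "\<xi> \<in> closure U" using \<xi> by (simp add: frontier_def)
      then have \<xi>\<Omega>: "\<xi> \<in> \<Omega>" using Ucl by auto
      have "\<xi> \<notin> U" using \<xi> Uo by (simp add: frontier_def interior_open)
      then have "u \<xi> \<ge> N" using \<xi>\<Omega> by (auto simp: U_def)
      then have "s \<xi> - u \<xi> < e" using sN[OF \<xi>c] e by linarith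
      moreover have "isCont (\<lambda>z. s z - u z) \<xi>"
        using sc uc \<xi>\<Omega> \<Omega>(1) by (auto intro!: continuous_intros simp: continuous_on_eq_continuous_at)
      then have "((\<lambda>z. s z - u z) \<longlongrightarrow> s \<xi> - u \<xi>) (at \<xi> within U)"
        by (auto simp: continuous_at intro: tendsto_within_subset)
      ultimately show "\<forall>\<^sub>F z in at \<xi> within U. s z - u z < e" by (rule order_tendstoD(2)[rotated])
    next
      fix y assume y: "y \<in> U" "s y - u y > 0"
      then have y\<Omega>: "y \<in> \<Omega>" by (simp add: U_def)
      let ?l = "4 * \<epsilon>\<^sup>2 * exp (2 * \<epsilon> * ln (norm (y - p))) * (norm (1 / (y - p)))\<^sup>2"
      have "has_lap (\<lambda>z. s z - u z) y (?l - exp (2 * u y))"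
        using lap[OF y\<Omega>] u y\<Omega> by (intro has_lap_diff) (auto simp: liouville_def)
      moreover have "exp (2 * u y) < exp (2 * s y)" using y by simp
      then have "?l - exp (2 * u y) > 0" using sexp[OF y(1)] by linarith
      ultimately show "\<exists>l>0. has_lap (\<lambda>z. s z - u z) y l" by blast
    qed
    have goal: "- a * ln \<tau> - C0 - 1 \<le> u z0"
    proof (cases "z0 \<in> U")
      case True
      then have "s z0 \<le> u z0" using main by fastforce
      \<comment> \<open>All poles are within 2 \<tau> of \<open>z0\<close>, which turns the barrier
        at \<open>z0\<close> into the claimed bound.\<close>
      moreover have "G z0 \<le> ln \<tau> + 1"
      proof -
        have "ln (norm (z0 - c i)) \<le> ln \<tau> + 1" if i: "i \<in> {1..n}" for i
        proof -
          have "norm (z0 - c i) \<le> dist z0 p + dist p (c i)" by norm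
          then have "norm (z0 - c i) \<le> 2 * \<tau>" using c\<tau>[OF i] by (simp add: \<tau>_def)
          moreover have "norm (z0 - c i) > 0" using c(1)[OF i] z0 by auto
          ultimately have "ln (norm (z0 - c i)) \<le> ln (2 * \<tau>)" using \<tau> by (intro iffD2[OF ln_le_cancel_iff]) auto
          also have "\<dots> = ln 2 + ln \<tau>" using \<tau> by (simp add: ln_mult)
          finally show ?thesis using ln_2_less_1 by linarith
        qed
        then have "(\<Sum>i=1..n. ln (norm (z0 - c i))) \<le> (\<Sum>i=1..n. ln \<tau> + 1)" by (intro sum_mono)
        then show ?thesis unfolding G_def using rn by (simp add: field_simps)
      qed
      then have "a * G z0 \<le> a * (ln \<tau> + 1)" using a by (intro mult_left_mono) auto
      moreover have "a * (ln \<tau> + 1) = a * ln \<tau> + a" by (simp add: distrib_left)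
      moreover have "exp (2 * \<epsilon> * ln (norm (z0 - p))) \<ge> 0" by simp
      ultimately show ?thesis unfolding s_def using a by linarith
    next
      case False
      then have "u z0 \<ge> N" using z0 by (auto simp: U_def)
      then show ?thesis using B a unfolding N_def by (simp add: algebra_simps)
    qed
    have "(1 - \<epsilon>) * ln (1 / dist z0 p) = - a * ln \<tau>" using \<tau> by (simp add: \<tau>_def[symmetric] a_def ln_div algebra_simps)
    then show ?thesis using goal by linarith
  qed
  then show ?thesis by blast
qed

text \<open>Ahlfors' comparison: a solution on a disc lies below the Poincare metric of the disc.
  The radius is halved so that \<open>w\<close> is bounded on the closed disc while the Poincare
  density blows up at its frontier; at the centre the density is 2/R = 4/d.\<close>

lemma liouville_upper_bound:
  assumes w: "liouville \<Omega> w" and sub: "ball z d \<subseteq> \<Omega>" and d: "d > 0"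
  shows "w z \<le> ln (4 / d)"
proof -
  define R where "R = d / 2"
  have R: "R > 0" using d by (simp add: R_def)
  have cb: "cball z R \<subseteq> \<Omega>" using sub d by (auto simp: R_def)
  have wc: "continuous_on (cball z R) w" using w cb by (auto simp: liouville_def intro: continuous_on_subset)
  obtain M where M: "\<And>y. y \<in> cball z R \<Longrightarrow> w y \<le> M"
    using continuous_attains_sup[OF compact_cball _ wc] R by fastforce
  have "w z \<le> ln (2 * R) - ln (R\<^sup>2 - (norm (z - z))\<^sup>2)"
  proof (rule liouville_compare[OF open_ball bounded_ball _ liouville_disc[OF R]])
    show "liouville (ball z R) w" by (rule liouville_subset[OF w]) (use cb in auto)
    fix \<xi> e assume \<xi>: "\<xi> \<in> frontier (ball z R)" and e: "e > (0::real)"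
    have \<xi>R: "norm (\<xi> - z) = R" using \<xi> R by (simp add: frontier_ball dist_norm norm_minus_commute)
    have "((\<lambda>y. R\<^sup>2 - (norm (y - z))\<^sup>2) \<longlongrightarrow> R\<^sup>2 - (norm (\<xi> - z))\<^sup>2) (at \<xi> within ball z R)"
      by (intro tendsto_intros)
    then have "\<forall>\<^sub>F y in at \<xi> within ball z R. R\<^sup>2 - (norm (y - z))\<^sup>2 < 2 * R * exp (- M)"
      using R \<xi>R by (intro order_tendstoD(2)) auto
    moreover have "\<forall>\<^sub>F y in at \<xi> within ball z R. y \<in> ball z R" by (simp add: eventually_at_filter)
    ultimately show "\<forall>\<^sub>F y in at \<xi> within ball z R. w y - (ln (2 * R) - ln (R\<^sup>2 - (norm (y - z))\<^sup>2)) < e"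
    proof eventually_elim
      case (elim y)
      have pos: "R\<^sup>2 - (norm (y - z))\<^sup>2 > 0"
        using elim(2) R power_strict_mono[of "norm (y - z)" R 2] by (simp add: dist_norm norm_minus_commute)
      then have "ln (R\<^sup>2 - (norm (y - z))\<^sup>2) < ln (2 * R * exp (- M))"
        using elim(1) by (subst ln_less_cancel_iff) auto
      also have "\<dots> = ln (2 * R) - M" using R by (simp add: ln_mult)
      finally show ?case using M[of y] elim(2) e by simp
    qed
  qed (use R in auto)
  also have "\<dots> = ln (2 * R / R\<^sup>2)" using R by (simp add: ln_div)
  also have "2 * R / R\<^sup>2 = 4 / d" using d by (simp add: R_def power2_eq_square)
  finally show ?thesis .
qed

text \<open>Near the boundary, w is at most ln (1/d) + const and u is at least (1 - \<epsilon>) ln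
  (1/d) - const, so (1 - e) w - u tends to minus infinity there if \<epsilon> is small against e. In
  the interior the shift \<eta> = - ln (1 - e) / 2 compensates the factor: u < w - \<eta> gives
  e^(2u) < (1 - e) e^(2w), and the right side is the Laplacian of (1 - e) w. Finally e tends to
  0.\<close>

theorem liouville_unique:
  assumes \<Omega>: "open \<Omega>" "bounded \<Omega>" and u: "liouville \<Omega> u" and w: "liouville \<Omega> w"
    and blow: "\<And>\<xi>. \<xi> \<in> frontier \<Omega> \<Longrightarrow> filterlim u at_top (at \<xi> within \<Omega>)"
    and r0: "r0 > 0"
    and nd: "\<And>p t. p \<in> frontier \<Omega> \<Longrightarrow> 0 \<le> t \<Longrightarrow> t \<le> r0 \<Longrightarrow> \<exists>x. x \<notin> \<Omega> \<and> dist p x = t"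
    and uw: "\<And>z. z \<in> \<Omega> \<Longrightarrow> u z \<le> w z" and z: "z \<in> \<Omega>"
  shows "w z = u z"
proof -
  have uc: "continuous_on \<Omega> u" and wc: "continuous_on \<Omega> w" using u w by (auto simp: liouville_def)
  \<comment> \<open>\<open>u\<close> is bounded below because it blows up at the frontier; the bound
    controls the term e w where \<open>w\<close> is negative.\<close>
  have "\<exists>m\<ge>0. \<forall>y\<in>\<Omega>. u y \<ge> - m"
  proof -
    let ?K = "closure {z\<in>\<Omega>. u z < 0}"
    have K: "?K \<subseteq> \<Omega>" "compact ?K" using blowup_sublevel[OF \<Omega> blow] by auto
    have "bounded (u ` ?K)"
      using compact_continuous_image[OF continuous_on_subset[OF uc K(1)] K(2)] compact_imp_bounded by blast
    then obtain b where b: "\<And>y. y \<in> ?K \<Longrightarrow> \<bar>u y\<bar> \<le> b" unfolding bounded_iff by auto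
    have "u y \<ge> - \<bar>b\<bar>" if "y \<in> \<Omega>" for y
    proof (cases "u y < 0")
      case True
      then have "y \<in> ?K" using that closure_subset[of "{z\<in>\<Omega>. u z < 0}"] by blast
      then show ?thesis using b[of y] by linarith
    qed simp
    then show ?thesis by (intro exI[of _ "\<bar>b\<bar>"]) auto
  qed
  then obtain m where m: "m \<ge> 0" "\<And>y. y \<in> \<Omega> \<Longrightarrow> u y \<ge> - m" by blast
  have main: "w z - u z \<le> e * w z + (- ln (1 - e) / 2) + e * m" if e: "0 < e" "e < 1" for e
  proof -
    \<comment> \<open>The gap \<epsilon> ln (1/d) between the two growth bounds costs 2 \<epsilon> w
      up to constants. Of the e w = 4 \<epsilon> w that is subtracted, 2 \<epsilon> w remains and
      diverges.\<close>
    define \<epsilon> where "\<epsilon> = e / 4"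
    define \<eta> where "\<eta> = - ln (1 - e) / 2"
    have \<epsilon>: "0 < \<epsilon>" "\<epsilon> < 1/4" using e by (auto simp: \<epsilon>_def)
    obtain C where C: "\<And>z p. z \<in> \<Omega> \<Longrightarrow> p \<in> frontier \<Omega> \<Longrightarrow> dist z p \<le> r0 \<Longrightarrow> u z \<ge> (1 - \<epsilon>) * ln (1 / dist z p) - C"
      using liouville_lower_bound[OF \<Omega> u blow nd] \<epsilon> by force
    have near: "(1 - e) * w y - u y \<le> - 2 * \<epsilon> * w y + (C + ln 4 + 2 * \<epsilon> * C)"
      if y: "y \<in> \<Omega>" and \<xi>: "\<xi> \<in> frontier \<Omega>" "dist y \<xi> < min r0 1" for y \<xi>
    proof -
      \<comment> \<open>A nearest frontier point: then the ball of radius \<open>d\<close> about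
        \<open>y\<close> lies in \<Omega>, and the upper and the lower bound refer to the same
        distance.\<close>
      obtain p where p: "p \<in> frontier \<Omega>" "\<And>x. x \<in> frontier \<Omega> \<Longrightarrow> dist y p \<le> dist y x"
        using distance_attains_inf[OF frontier_closed, of \<Omega> y] \<xi> by auto
      define d where "d = dist y p"
      have yn: "y \<notin> frontier \<Omega>" using y \<Omega>(1) by (simp add: frontier_def interior_open)
      have d: "d > 0" "d \<le> r0" "d \<le> 1" using p yn p(2)[OF \<xi>(1)] \<xi>(2) by (auto simp: d_def)
      have bs: "ball y d \<subseteq> \<Omega>"
      proof (rule ccontr)
        assume "\<not> ball y d \<subseteq> \<Omega>"
        moreover have "ball y d \<inter> \<Omega> \<noteq> {}" using y d by (metis IntI centre_in_ball empty_iff)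
        ultimately obtain x where "x \<in> ball y d" "x \<in> frontier \<Omega>"
          using connected_Int_frontier[OF connected_ball, of y d \<Omega>] by auto
        then show False using p(2)[of x] by (simp add: d_def)
      qed
      have w1: "w y \<le> ln (4 / d)" by (rule liouville_upper_bound[OF w bs d(1)])
      define l where "l = ln (1 / d)"
      have l: "l \<ge> 0" using d by (simp add: l_def)
      have w2: "w y \<le> ln 4 + l" using w1 d by (simp add: l_def ln_div)
      have u1: "u y \<ge> (1 - \<epsilon>) * l - C" using C[OF y p(1)] d by (simp add: d_def l_def)
      have "(1/2) * l \<le> (1 - \<epsilon>) * l" using \<epsilon> l by (intro mult_right_mono) auto
      also have "\<dots> \<le> w y + C" using u1 uw[OF y] by simp
      finally have "l \<le> 2 * (w y + C)" by simp
      then have "\<epsilon> * l \<le> \<epsilon> * (2 * (w y + C))" using \<epsilon> by (intro mult_left_mono) auto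
      moreover have "w y - u y \<le> ln 4 + \<epsilon> * l + C" using w2 u1 by (simp add: algebra_simps)
      moreover have "e = 4 * \<epsilon>" by (simp add: \<epsilon>_def)
      ultimately show ?thesis by (simp add: algebra_simps)
    qed
    have "((1 - e) * w z - u z) - (\<eta> + e * m) \<le> 0"
    proof (rule max_principle[OF \<Omega> _ _ _ z])
      show "continuous_on \<Omega> (\<lambda>z. (1 - e) * w z - u z - (\<eta> + e * m))" by (intro continuous_intros uc wc)
      fix \<xi> e' assume \<xi>: "\<xi> \<in> frontier \<Omega>" and e': "e' > (0::real)"
      let ?B = "(C + ln 4 + 2 * \<epsilon> * C + \<bar>\<eta> + e * m\<bar>) / (2 * \<epsilon>)"
      have "\<forall>\<^sub>F y in at \<xi> within \<Omega>. u y > ?B"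
        using blow[OF \<xi>] by (simp add: filterlim_at_top_dense)
      moreover have "\<forall>\<^sub>F y in at \<xi> within \<Omega>. y \<in> \<Omega>" by (simp add: eventually_at_filter)
      moreover have "\<forall>\<^sub>F y in at \<xi> within \<Omega>. dist y \<xi> < min r0 1"
        using r0 unfolding eventually_at by (intro exI[of _ "min r0 1"]) auto
      ultimately show "\<forall>\<^sub>F y in at \<xi> within \<Omega>. (1 - e) * w y - u y - (\<eta> + e * m) < e'"
      proof eventually_elim
        case (elim y)
        have "?B \<le> w y" using elim uw[of y] by linarith
        then have "2 * \<epsilon> * ?B \<le> 2 * \<epsilon> * w y" using \<epsilon> by (intro mult_left_mono) auto
        then have "C + ln 4 + 2 * \<epsilon> * C + \<bar>\<eta> + e * m\<bar> \<le> 2 * \<epsilon> * w y" using \<epsilon> by simp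
        then show ?case using near[OF elim(2) \<xi> elim(3)] e' by linarith
      qed
    next
      fix y assume y: "y \<in> \<Omega>" "(1 - e) * w y - u y - (\<eta> + e * m) > 0"
      have "has_lap (\<lambda>z. (1 - e) * w z - u z - (\<eta> + e * m)) y ((1 - e) * exp (2 * w y) - exp (2 * u y) - 0)"
        using u w y by (intro has_lap_diff has_lap_cmult has_lap_const) (auto simp: liouville_def)
      moreover have "exp (2 * u y) < (1 - e) * exp (2 * w y)"
      proof -
        have "w y \<ge> - m" using m(2)[OF y(1)] uw[OF y(1)] by linarith
        then have "e * w y \<ge> e * (- m)" using e by (intro mult_left_mono) auto
        then have "u y < w y - \<eta>" using y(2) by (simp add: algebra_simps)
        then have "exp (2 * u y) < exp (2 * (w y - \<eta>))" by simp
        also have "2 * (w y - \<eta>) = 2 * w y + ln (1 - e)" by (simp add: \<eta>_def)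
        also have "exp (2 * w y + ln (1 - e)) = (1 - e) * exp (2 * w y)" using e by (simp add: exp_add)
        finally show ?thesis .
      qed
      ultimately show "\<exists>l>0. has_lap (\<lambda>z. (1 - e) * w z - u z - (\<eta> + e * m)) y l"
        by (intro exI[of _ "(1 - e) * exp (2 * w y) - exp (2 * u y) - 0"]) auto
    qed
    then show ?thesis by (simp add: \<eta>_def algebra_simps)
  qed
  have "w z - u z \<le> 0"
  proof (rule tendsto_lowerbound)
    show "((\<lambda>e. e * w z + (- ln (1 - e) / 2) + e * m) \<longlongrightarrow> 0) (at_right 0)"
      by (auto intro!: tendsto_eq_intros)
    show "\<forall>\<^sub>F e in at_right 0. w z - u z \<le> e * w z + (- ln (1 - e) / 2) + e * m"
      unfolding eventually_at_right_field by (intro exI[of _ 1]) (use main in auto)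
  qed simp
  then show ?thesis using uw[OF z] by simp
qed

section \<open>Cauchy integrals on half discs\<close>

text \<open>A Cauchy integral is holomorphic off its path for any continuous density. Stated for
  arcs because the two half circles will carry different densities.\<close>

lemma arc_cauchy_integral:
  assumes r: "r > 0" and f: "continuous_on (path_image (part_circlepath 0 r a b)) f"
  shows "(\<lambda>\<zeta>. contour_integral (part_circlepath 0 r a b) (\<lambda>w. f w / (w - \<zeta>))) holomorphic_on ball 0 r"
    and "\<zeta> \<in> ball 0 r \<Longrightarrow> (\<lambda>w. f w / (w - \<zeta>)) contour_integrable_on part_circlepath 0 r a b"
proof -
  let ?\<gamma> = "part_circlepath 0 r a b"
  have sp: "path_image ?\<gamma> \<subseteq> sphere 0 r" using r by (intro path_image_part_circlepath_subset') auto
  show int: "(\<lambda>w. f w / (w - \<zeta>)) contour_integrable_on ?\<gamma>" if "\<zeta> \<in> ball 0 r" for \<zeta>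
    by (rule contour_integrable_continuous_part_circlepath) (use sp that in \<open>auto intro!: continuous_intros f\<close>)
  have "((\<lambda>\<zeta>. contour_integral ?\<gamma> (\<lambda>w. f w / (w - \<zeta>))) has_field_derivative
      (of_nat 1 * contour_integral ?\<gamma> (\<lambda>u. f u / (u - \<zeta>) ^ Suc 1))) (at \<zeta>)" if z: "\<zeta> \<in> ball 0 r" for \<zeta>
  proof (rule Cauchy_next_derivative(2)[where S="ball 0 r" and B="r * \<bar>b - a\<bar>"])
    show "norm (vector_derivative ?\<gamma> (at t)) \<le> r * \<bar>b - a\<bar>" for t
      using r by (simp add: vector_derivative_part_circlepath norm_mult)
         (simp add: abs_mult of_real_diff[symmetric] del: of_real_diff)?
    show "((\<lambda>u. f u / (u - w) ^ 1) has_contour_integral contour_integral ?\<gamma> (\<lambda>u. f u / (u - w))) ?\<gamma>"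
      if "w \<in> ball 0 r - path_image ?\<gamma>" for w
      using int[of w] that by (simp add: has_contour_integral_integral)
    show "\<zeta> \<in> ball 0 r - path_image ?\<gamma>" using z sp by auto
  qed (use f in auto)
  then show "(\<lambda>\<zeta>. contour_integral ?\<gamma> (\<lambda>w. f w / (w - \<zeta>))) holomorphic_on ball 0 r"
    by (subst holomorphic_on_open[OF open_ball]) blast
qed

text \<open>The diameter may be replaced by the lower half circle, since 1/(w - \<zeta>) is
  holomorphic on the closed lower half plane; what results is the integral over the full
  circle.\<close>

lemma winding_half_disc:
  assumes r: "r > 0" and z: "norm \<zeta> < r" "Im \<zeta> > 0"
  shows "winding_number (part_circlepath 0 r 0 pi +++ linepath (- of_real r) (of_real r)) \<zeta> = 1"
proof -
  let ?U = "part_circlepath 0 r 0 pi" and ?L = "part_circlepath 0 r pi (2 * pi)"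
  let ?f = "\<lambda>w. 1 / (w - \<zeta>)"
  have spU: "path_image ?U \<subseteq> sphere 0 r" and spL: "path_image ?L \<subseteq> sphere 0 r"
    using r by (auto intro!: path_image_part_circlepath_subset')
  have seg: "closed_segment (- of_real r) (of_real r) \<subseteq> {w. Im w = 0}"
    by (auto simp: closed_segment_def)
  have iU: "?f contour_integrable_on ?U" and iL: "?f contour_integrable_on ?L"
    using arc_cauchy_integral(2)[OF r, of _ _ "\<lambda>_. 1" \<zeta>] z by (auto)
  have il: "?f contour_integrable_on linepath (- of_real r) (of_real r)"
    by (rule contour_integrable_continuous_linepath) (use seg z in \<open>auto intro!: continuous_intros\<close>)
  have il': "?f contour_integrable_on linepath (of_real r) (- of_real r)"
    by (rule contour_integrable_continuous_linepath)
      (use seg z in \<open>auto intro!: continuous_intros simp: closed_segment_commute\<close>)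
  have sU: "pathfinish ?U = - of_real r" by (simp add: exp_pi_i exp_pi_i' mult.commute)
  have sL: "pathstart ?L = - of_real r" "pathfinish ?L = of_real r"
    using exp_two_pi_i by (simp_all add: exp_pi_i exp_pi_i' mult.commute mult.left_commute)
  let ?H = "{w. Im w \<le> 0}"
  have Limg: "path_image ?L \<subseteq> ?H"
  proof
    fix w assume "w \<in> path_image ?L"
    then obtain \<theta> where "\<theta> \<in> {pi..2*pi}" "w = of_real r * exp (\<i> * of_real \<theta>)"
      using path_image_part_circlepath[of pi "2*pi" 0 r] by auto
    moreover have "sin \<theta> \<le> 0" using calculation(1) sin_le_zero[of \<theta>] by (cases "\<theta> = 2 * pi") auto
    ultimately show "w \<in> ?H" using r by (simp add: Im_exp mult_nonneg_nonpos)
  qed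
  have "(?f has_contour_integral 0) (?L +++ linepath (of_real r) (- of_real r))"
  proof (rule Cauchy_theorem_convex_simple[where S="?H"])
    show "?f holomorphic_on ?H" using z by (auto intro!: holomorphic_intros)
    show "convex ?H" by (rule convex_halfspace_Im_le)
    show "valid_path (?L +++ linepath (of_real r) (- of_real r))" using sL by (intro valid_path_join) auto
    show "path_image (?L +++ linepath (of_real r) (- of_real r)) \<subseteq> ?H"
      using Limg seg sL by (subst path_image_join) (auto simp: closed_segment_commute)
  qed (use sL in auto)
  then have "contour_integral ?L ?f + contour_integral (linepath (of_real r) (- of_real r)) ?f = 0"
    using contour_integral_join[OF iL il'] by (auto dest!: contour_integral_unique)
  moreover have "contour_integral (linepath (of_real r) (- of_real r)) ?f = - contour_integral (linepath (- of_real r) (of_real r)) ?f"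
    by (rule contour_integral_reverse_linepath)
      (use seg z in \<open>auto intro!: continuous_intros simp: closed_segment_commute\<close>)
  ultimately have l: "contour_integral (linepath (- of_real r) (of_real r)) ?f = contour_integral ?L ?f" by simp
  let ?h = "\<lambda>t. ?f (0 + of_real r * cis t) * of_real r * \<i> * cis t"
  have c: "contour_integral (circlepath 0 r) ?f = 2 * pi * \<i>"
    using contour_integral_unique[OF Cauchy_integral_circlepath_simple[of "\<lambda>_. 1" 0 r \<zeta>]] z by simp
  have ne: "of_real r * cis t \<noteq> \<zeta>" for t using z(1) r by (metis abs_of_pos mult.right_neutral norm_cis norm_mult norm_of_real order_less_irrefl)
  have hint: "?h integrable_on {a..b}" for a b
    by (rule integrable_continuous_real) (use ne in \<open>auto intro!: continuous_intros\<close>)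
  have "contour_integral ?U ?f + contour_integral ?L ?f = integral {0..pi} ?h + integral {pi..2*pi} ?h"
    by (simp add: contour_integral_part_circlepath_eq)
  also have "\<dots> = integral {0..2*pi} ?h"
    by (rule Henstock_Kurzweil_Integration.integral_combine[OF _ _ hint]) auto
  also have "\<dots> = contour_integral (circlepath 0 r) ?f"
    by (simp add: circlepath_def contour_integral_part_circlepath_eq)
  finally have tot: "contour_integral ?U ?f + contour_integral ?L ?f = 2 * pi * \<i>" using c by simp
  have "winding_number (?U +++ linepath (- of_real r) (of_real r)) \<zeta>
     = 1/(2*pi*\<i>) * contour_integral (?U +++ linepath (- of_real r) (of_real r)) ?f"
  proof (rule winding_number_valid_path)
    show "valid_path (?U +++ linepath (- of_real r) (of_real r))" using sU by (intro valid_path_join) auto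
    show "\<zeta> \<notin> path_image (?U +++ linepath (- of_real r) (of_real r))"
      using sU spU seg z by (subst path_image_join) auto
  qed
  also have "contour_integral (?U +++ linepath (- of_real r) (of_real r)) ?f = 2 * pi * \<i>"
    using contour_integral_join[OF iU il] l tot by simp
  finally show ?thesis by simp
qed

text \<open>Reflection in the circle turns the defect of \<open>|G| = 1\<close> on the real axis into the density of a
  Cauchy integral. Cauchy's formula is applied to \<open>\<zeta> G \<zeta>\<close>, since \<open>G\<close> need not be continuous at 0.\<close>
lemma half_disc_repr:
  fixes G :: "complex \<Rightarrow> complex" and r \<beta> C \<alpha> :: real
  assumes r: "0 < r" and \<beta>: "0 < \<beta>" and C: "C \<ge> 0" and \<alpha>: "0 < \<alpha>"
    and S: "open S" "G holomorphic_on S" "{\<zeta>. Im \<zeta> \<ge> 0 \<and> \<zeta> \<noteq> 0 \<and> norm \<zeta> \<le> r} \<subseteq> S"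
    and bd: "\<And>\<zeta>. Im \<zeta> \<ge> 0 \<Longrightarrow> \<zeta> \<noteq> 0 \<Longrightarrow> norm \<zeta> \<le> r \<Longrightarrow> \<beta> \<le> norm (G \<zeta>) \<and> norm (G \<zeta>) \<le> 1"
    and ax: "\<And>x::real. x \<noteq> 0 \<Longrightarrow> \<bar>x\<bar> \<le> r \<Longrightarrow> 1 - norm (G x) \<le> C * \<bar>x\<bar> powr (3 + \<alpha>)"
  obtains A :: "complex \<Rightarrow> complex" and J :: "real \<Rightarrow> complex" where "A holomorphic_on ball 0 r"
    "\<And>\<zeta>. \<zeta> \<in> ball 0 (r/2) \<Longrightarrow> norm (A \<zeta>) \<le> 4 * (1 + 1 / \<beta>)"
    "continuous_on {-r..r} J" "\<And>x. \<bar>x\<bar> \<le> r \<Longrightarrow> norm (J x) \<le> (2 * C / \<beta>) * \<bar>x\<bar> powr (3 + \<alpha>)"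
    "\<And>\<zeta>. norm \<zeta> < r \<Longrightarrow> Im \<zeta> > 0 \<Longrightarrow>
       G \<zeta> = A \<zeta> + 1 / (2 * pi * \<i>) * integral {-r..r} (\<lambda>x. J x / (of_real x - \<zeta>))"
proof -
  \<comment> \<open>The jump on the real axis between \<open>G\<close> and its reflection 1 / cnj (G
    (cnj w)), which measures the failure of |G| = 1. The value 0 at the origin, where
    \<open>G\<close> is unknown, is the continuous one by the decay of the defect.\<close>
  define J :: "real \<Rightarrow> complex" where "J = (\<lambda>x. if x = 0 then 0 else G x - 1 / cnj (G x))"
  \<comment> \<open>The factor \<open>w\<close> makes \<open>G\<close> and its reflection continuous
    at 0, since |G| stays between \<beta> and 1.\<close>
  define E1 where "E1 = (\<lambda>w. w * G w)"
  define E2 where "E2 = (\<lambda>w. w / cnj (G (cnj w)))"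
  define C2 where "C2 = 2 * C / \<beta>"
  have C2: "C2 \<ge> 0" using C \<beta> by (simp add: C2_def)
  let ?Hp = "{w. norm w \<le> r \<and> Im w \<ge> 0}" and ?Hm = "{w. norm w \<le> r \<and> Im w \<le> 0}"
  have Gne: "G w \<noteq> 0" if "w \<in> ?Hp" "w \<noteq> 0" for w using bd[of w] that \<beta> by auto
  have GC: "isCont G w" "G field_differentiable at w" if "w \<in> ?Hp" "w \<noteq> 0" for w
    using S that holomorphic_on_imp_differentiable_at[OF S(2,1), of w] field_differentiable_imp_continuous_at[of G w] by auto
  have J0: "norm (J x) \<le> C2 * \<bar>x\<bar> powr (3 + \<alpha>)" if x: "\<bar>x\<bar> \<le> r" for x
  proof (cases "x = 0")
    case False
    have b: "\<beta> \<le> norm (G x)" "norm (G x) \<le> 1" using bd[of "of_real x"] x False by auto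
    then have ne: "G x \<noteq> 0" using \<beta> by auto
    have "J x = (G x * cnj (G x) - 1) / cnj (G x)" using False ne by (simp add: J_def field_simps)
    also have "G x * cnj (G x) = of_real ((norm (G x))\<^sup>2)" using complex_norm_square[of "G x"] by simp
    finally have "norm (J x) = norm (of_real ((norm (G x))\<^sup>2) - 1 :: complex) / norm (G x)" by (simp add: norm_divide)
    also have "of_real ((norm (G x))\<^sup>2) - 1 = (of_real ((norm (G x))\<^sup>2 - 1) :: complex)" by simp
    also have "norm (of_real ((norm (G x))\<^sup>2 - 1) :: complex) = 1 - (norm (G x))\<^sup>2"
      using b by (simp only: norm_of_real) (simp add: abs_square_le_1)
    also have "\<dots> = (1 - norm (G x)) * (1 + norm (G x))" by (simp add: power2_eq_square algebra_simps)
    also have "\<dots> / norm (G x) \<le> ((1 - norm (G x)) * 2) / \<beta>"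
      using b \<beta> by (intro frac_le mult_left_mono) auto
    also have "\<dots> \<le> ((C * \<bar>x\<bar> powr (3 + \<alpha>)) * 2) / \<beta>"
      using ax[OF False x] \<beta> by (intro divide_right_mono mult_right_mono) auto
    finally show ?thesis by (simp add: C2_def mult_ac)
  qed (simp add: J_def)
  have Jc: "continuous_on {-r..r} J"
    unfolding continuous_on_eq_continuous_within
  proof
    fix x assume x: "x \<in> {-r..r}"
    show "continuous (at x within {-r..r}) J"
    proof (cases "x = 0")
      case True
      have "((\<lambda>x. C2 * \<bar>x\<bar> powr (3 + \<alpha>)) \<longlongrightarrow> C2 * \<bar>0\<bar> powr (3 + \<alpha>)) (at 0 within {-r..r})"
        by (intro tendsto_intros) (use \<alpha> in auto)
      then have "((\<lambda>x. C2 * \<bar>x\<bar> powr (3 + \<alpha>)) \<longlongrightarrow> 0) (at 0 within {-r..r})" by simp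
      then have "(J \<longlongrightarrow> 0) (at 0 within {-r..r})"
        by (rule Lim_null_comparison[rotated]) (auto simp: eventually_at_filter abs_le_iff intro!: always_eventually J0)
      then show ?thesis unfolding True continuous_within by (simp add: J_def)
    next
      case False
      have xs: "complex_of_real x \<in> ?Hp" "complex_of_real x \<noteq> 0" using x False by auto
      have "isCont (\<lambda>y::real. G y - 1 / cnj (G y)) x"
        using GC(1)[OF xs] Gne[OF xs] by (intro continuous_intros isCont_o2[of x of_real G]) auto
      then have "isCont J x"
        by (rule iffD2[OF isCont_cong, rotated])
          (use False in \<open>auto simp: J_def eventually_nhds intro!: exI[of _ "-{0}"]\<close>)
      then show ?thesis by (rule continuous_at_imp_continuous_at_within)
    qed
  qed
  have E1c: "continuous_on ?Hp E1"
    unfolding continuous_on_eq_continuous_within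
  proof
    fix w assume w: "w \<in> ?Hp"
    show "continuous (at w within ?Hp) E1"
    proof (cases "w = 0")
      case True
      have "(E1 \<longlongrightarrow> 0) (at 0 within ?Hp)"
      proof (rule Lim_null_comparison)
        show "\<forall>\<^sub>F x in at 0 within ?Hp. norm (E1 x) \<le> norm x"
          unfolding eventually_at_filter using bd
          by (auto simp: E1_def norm_mult intro!: always_eventually mult_left_le)
        show "(norm \<longlongrightarrow> 0) (at (0::complex) within ?Hp)" by (intro tendsto_norm_zero tendsto_ident_at)
      qed
      then show ?thesis unfolding True continuous_within by (simp add: E1_def)
    next
      case False
      have "isCont E1 w" unfolding E1_def
        by (rule continuous_mult[OF continuous_ident GC(1)[OF w False]])
      then show ?thesis by (rule continuous_at_imp_continuous_at_within)
    qed
  qed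
  have E2c: "continuous_on ?Hm E2"
    unfolding continuous_on_eq_continuous_within
  proof
    fix w assume w: "w \<in> ?Hm"
    show "continuous (at w within ?Hm) E2"
    proof (cases "w = 0")
      case True
      have "(E2 \<longlongrightarrow> 0) (at 0 within ?Hm)"
      proof (rule Lim_null_comparison)
        have "norm (E2 x) \<le> norm x / \<beta>" if "x \<in> ?Hm" "x \<noteq> 0" for x
          using bd[of "cnj x"] that \<beta> by (auto simp: E2_def norm_divide intro!: divide_left_mono mult_pos_pos)
        then show "\<forall>\<^sub>F x in at 0 within ?Hm. norm (E2 x) \<le> norm x / \<beta>"
          unfolding eventually_at_filter by (auto intro!: always_eventually)
        have "((\<lambda>x. norm x / \<beta>) \<longlongrightarrow> norm (0::complex) / \<beta>) (at (0::complex) within ?Hm)" using \<beta> by (intro tendsto_intros) auto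
        then show "((\<lambda>x. norm x / \<beta>) \<longlongrightarrow> 0) (at (0::complex) within ?Hm)" by simp
      qed
      then show ?thesis unfolding True continuous_within by (simp add: E2_def)
    next
      case False
      then have c: "cnj w \<in> ?Hp" "cnj w \<noteq> 0" using w by auto
      have "isCont (\<lambda>w. G (cnj w)) w"
        by (rule isCont_o2[of w cnj G, OF _ GC(1)[OF c]]) (intro continuous_intros)
      then have "isCont E2 w" unfolding E2_def using Gne[OF c] by (intro continuous_intros) auto
      then show ?thesis by (rule continuous_at_imp_continuous_at_within)
    qed
  qed
  have E2d: "E2 field_differentiable at w" if w: "w \<in> ?Hm" "w \<noteq> 0" for w
  proof -
    have c: "cnj w \<in> ?Hp" "cnj w \<noteq> 0" using w by auto
    have "(cnj \<circ> G \<circ> cnj) field_differentiable at w" by (rule field_differentiable_cnj_cnj[OF GC(2)[OF c]])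
    then have "(\<lambda>w. cnj (G (cnj w))) field_differentiable at w" by (simp add: o_def)
    then show ?thesis unfolding E2_def
      using Gne[OF c] by (intro derivative_intros) auto
  qed
  let ?U = "part_circlepath 0 r 0 pi" and ?L = "part_circlepath 0 r pi (2 * pi)"
  let ?l = "linepath (- of_real r) (of_real r) :: real \<Rightarrow> complex"
  let ?l' = "linepath (of_real r) (- of_real r) :: real \<Rightarrow> complex"
  have spU: "path_image ?U \<subseteq> sphere 0 r" and spL: "path_image ?L \<subseteq> sphere 0 r"
    using r by (auto intro!: path_image_part_circlepath_subset')
  have Uimg: "path_image ?U \<subseteq> ?Hp"
  proof
    fix w assume ww: "w \<in> path_image ?U"
    then obtain \<theta> where t: "\<theta> \<in> {0..pi}" "w = of_real r * exp (\<i> * of_real \<theta>)"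
      using path_image_part_circlepath[of 0 pi 0 r] by auto
    have "sin \<theta> \<ge> 0" using t sin_ge_zero[of \<theta>] by auto
    then show "w \<in> ?Hp" using r t spU ww by (auto simp: Im_exp)
  qed
  have Limg: "path_image ?L \<subseteq> ?Hm"
  proof
    fix w assume ww: "w \<in> path_image ?L"
    then obtain \<theta> where t: "\<theta> \<in> {pi..2*pi}" "w = of_real r * exp (\<i> * of_real \<theta>)"
      using path_image_part_circlepath[of pi "2*pi" 0 r] by auto
    moreover have "sin \<theta> \<le> 0" using t(1) sin_le_zero[of \<theta>] by (cases "\<theta> = 2 * pi") auto
    ultimately show "w \<in> ?Hm" using r spL ww by (auto simp: Im_exp mult_nonneg_nonpos)
  qed
  have seg: "closed_segment (- of_real r) (of_real r) \<subseteq> ?Hp \<inter> ?Hm"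
  proof -
    have "convex (?Hp \<inter> ?Hm)"
    proof -
      have "?Hp \<inter> ?Hm = cball 0 r \<inter> {w. Im w \<ge> 0} \<inter> {w. Im w \<le> 0}" by auto
      then show ?thesis by (simp add: convex_Int convex_halfspace_Im_ge convex_halfspace_Im_le)
    qed
    then show ?thesis using r by (intro closed_segment_subset) auto
  qed
  have segc: "closed_segment (of_real r) (- of_real r) = closed_segment (- of_real r :: complex) (of_real r)"
    by (rule closed_segment_commute)
  have fU: "pathfinish ?U = - of_real r" by (simp add: exp_pi_i exp_pi_i' mult.commute)
  have fL: "pathstart ?L = - of_real r" "pathfinish ?L = of_real r"
    using exp_two_pi_i by (simp_all add: exp_pi_i exp_pi_i' mult.commute mult.left_commute)
  have cvp: "convex ?Hp"
  proof -
    have "?Hp = cball 0 r \<inter> {w. Im w \<ge> 0}" by auto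
    then show ?thesis by (simp add: convex_Int convex_halfspace_Im_ge)
  qed
  have cvm: "convex ?Hm"
  proof -
    have "?Hm = cball 0 r \<inter> {w. Im w \<le> 0}" by auto
    then show ?thesis by (simp add: convex_Int convex_halfspace_Im_le)
  qed
  have E1U: "continuous_on (path_image ?U) E1" by (rule continuous_on_subset[OF E1c Uimg])
  have E2L: "continuous_on (path_image ?L) E2" by (rule continuous_on_subset[OF E2c Limg])
  \<comment> \<open>Cauchy's formula on the upper half disc is added to Cauchy's theorem on the
    lower one. This leaves the two arcs and the integral of x J x / (x - \<zeta>) over the diameter,
    which splits by x / (x - \<zeta>) = 1 + \<zeta> / (x - \<zeta>).\<close>
  have key: "2 * pi * \<i> * (\<zeta> * G \<zeta>) = contour_integral ?U (\<lambda>w. E1 w / (w - \<zeta>)) + contour_integral ?L (\<lambda>w. E2 w / (w - \<zeta>))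
      + integral {-r..r} J + \<zeta> * integral {-r..r} (\<lambda>x. J x / (of_real x - \<zeta>))"
    if z: "norm \<zeta> < r" "Im \<zeta> > 0" for \<zeta>
  proof -
    have zne: "\<zeta> \<noteq> 0" "\<zeta> \<in> ball 0 r" using z by auto
    have iU: "(\<lambda>w. E1 w / (w - \<zeta>)) contour_integrable_on ?U"
      and iL: "(\<lambda>w. E2 w / (w - \<zeta>)) contour_integrable_on ?L"
      using arc_cauchy_integral(2)[OF r E1U zne(2)] arc_cauchy_integral(2)[OF r E2L zne(2)] by auto
    have cs1: "continuous_on (closed_segment (- of_real r) (of_real r)) (\<lambda>w. E1 w / (w - \<zeta>))"
      using seg z by (auto intro!: continuous_intros continuous_on_subset[OF E1c])
    have cs2: "continuous_on (closed_segment (- of_real r) (of_real r)) (\<lambda>w. E2 w / (w - \<zeta>))"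
      using seg z by (auto intro!: continuous_intros continuous_on_subset[OF E2c])
    have il: "(\<lambda>w. E1 w / (w - \<zeta>)) contour_integrable_on ?l"
      by (rule contour_integrable_continuous_linepath[OF cs1])
    have il2: "(\<lambda>w. E2 w / (w - \<zeta>)) contour_integrable_on ?l"
      by (rule contour_integrable_continuous_linepath[OF cs2])
    have il': "(\<lambda>w. E2 w / (w - \<zeta>)) contour_integrable_on ?l'"
      by (rule contour_integrable_continuous_linepath) (simp add: segc cs2)
    have zint: "\<zeta> \<in> interior ?Hp"
    proof -
      have "ball 0 r \<inter> {w. Im w > 0} \<subseteq> interior ?Hp"
        by (rule interior_maximal) (auto intro!: open_Int open_halfspace_Im_gt)
      then show ?thesis using z by auto
    qed
    have "((\<lambda>w. E1 w / (w - \<zeta>)) has_contour_integral (2 * pi * \<i> * winding_number (?U +++ ?l) \<zeta> * E1 \<zeta>)) (?U +++ ?l)"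
    proof (rule Cauchy_integral_formula_weak[where S="?Hp" and k="{0}"])
      show "E1 field_differentiable at x" if "x \<in> interior ?Hp - {0}" for x
      proof -
        have "x \<in> ?Hp" "x \<noteq> 0" using that interior_subset[of ?Hp] by auto
        then show ?thesis unfolding E1_def using GC(2)[of x] by (intro derivative_intros) auto
      qed
      show "path_image (?U +++ ?l) \<subseteq> ?Hp - {\<zeta>}"
        using Uimg seg spU z fU by (subst path_image_join) auto
      show "valid_path (?U +++ ?l)" using fU by (intro valid_path_join) auto
    qed (use zint zne cvp E1c in auto)
    then have 1: "contour_integral ?U (\<lambda>w. E1 w / (w - \<zeta>)) + contour_integral ?l (\<lambda>w. E1 w / (w - \<zeta>)) = 2 * pi * \<i> * E1 \<zeta>"
      using contour_integral_join[OF iU il] winding_half_disc[OF r z] by (auto dest!: contour_integral_unique)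
    have "((\<lambda>w. E2 w / (w - \<zeta>)) has_contour_integral 0) (?L +++ ?l')"
    proof (rule Cauchy_theorem_convex[where S="?Hm" and K="{0}"])
      show "continuous_on ?Hm (\<lambda>w. E2 w / (w - \<zeta>))" using z by (auto intro!: continuous_intros E2c)
      show "(\<lambda>w. E2 w / (w - \<zeta>)) field_differentiable at x" if "x \<in> interior ?Hm - {0}" for x
      proof -
        have "x \<in> ?Hm" "x \<noteq> 0" using that interior_subset[of ?Hm] by auto
        then show ?thesis using E2d[of x] z by (intro derivative_intros) auto
      qed
      show "path_image (?L +++ ?l') \<subseteq> ?Hm"
        using Limg seg fL by (subst path_image_join) (auto simp: segc)
      show "valid_path (?L +++ ?l')" using fL by (intro valid_path_join) auto
    qed (use cvm fL in auto)
    then have "contour_integral ?L (\<lambda>w. E2 w / (w - \<zeta>)) + contour_integral ?l' (\<lambda>w. E2 w / (w - \<zeta>)) = 0"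
      using contour_integral_join[OF iL il'] by (auto dest!: contour_integral_unique)
    moreover have "contour_integral ?l' (\<lambda>w. E2 w / (w - \<zeta>)) = - contour_integral ?l (\<lambda>w. E2 w / (w - \<zeta>))"
      by (rule contour_integral_reverse_linepath) (simp add: segc cs2)
    ultimately have 2: "contour_integral ?L (\<lambda>w. E2 w / (w - \<zeta>)) = contour_integral ?l (\<lambda>w. E2 w / (w - \<zeta>))" by simp
    have "contour_integral ?l (\<lambda>w. E1 w / (w - \<zeta>)) - contour_integral ?l (\<lambda>w. E2 w / (w - \<zeta>))
        = contour_integral ?l (\<lambda>w. E1 w / (w - \<zeta>) - E2 w / (w - \<zeta>))"
      by (rule contour_integral_diff[OF il il2, symmetric])
    also have "\<dots> = integral {-r..r} (\<lambda>x. E1 (of_real x) / (of_real x - \<zeta>) - E2 (of_real x) / (of_real x - \<zeta>))"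
      using r by (subst contour_integral_linepath_Reals_eq) auto
    also have "\<dots> = integral {-r..r} (\<lambda>x. J x + \<zeta> * (J x / (of_real x - \<zeta>)))"
    proof (rule integral_cong)
      fix x assume "x \<in> {-r..r}"
      have ne: "of_real x - \<zeta> \<noteq> 0" using z by auto
      show "E1 (of_real x) / (of_real x - \<zeta>) - E2 (of_real x) / (of_real x - \<zeta>) = J x + \<zeta> * (J x / (of_real x - \<zeta>))"
      proof (cases "x = 0")
        case False
        have "E1 (of_real x) / (of_real x - \<zeta>) - E2 (of_real x) / (of_real x - \<zeta>) = of_real x * J x / (of_real x - \<zeta>)"
        proof -
          have "E1 (of_real x) - E2 (of_real x) = of_real x * J x"
            using False by (simp add: E1_def E2_def J_def right_diff_distrib)
          then show ?thesis by (simp add: diff_divide_distrib[symmetric])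
        qed
        also have "\<dots> = J x + \<zeta> * (J x / (of_real x - \<zeta>))" using ne by (simp add: field_simps)
        finally show ?thesis .
      qed (simp add: E1_def E2_def J_def)
    qed
    also have "\<dots> = integral {-r..r} J + integral {-r..r} (\<lambda>x. \<zeta> * (J x / (of_real x - \<zeta>)))"
      by (rule Henstock_Kurzweil_Integration.integral_add)
        (use z in \<open>auto intro!: integrable_continuous_real continuous_intros Jc\<close>)
    also have "integral {-r..r} (\<lambda>x. \<zeta> * (J x / (of_real x - \<zeta>))) = \<zeta> * integral {-r..r} (\<lambda>x. J x / (of_real x - \<zeta>))"
      by (rule integral_mult_right)
    finally show ?thesis using 1 2 by (simp add: E1_def algebra_simps)
  qed
  define B where "B = (\<lambda>\<zeta>. 1 / (2 * pi * \<i>) * (contour_integral ?U (\<lambda>w. E1 w / (w - \<zeta>)) + contour_integral ?L (\<lambda>w. E2 w / (w - \<zeta>)) + integral {-r..r} J))"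
  define c where "c = (\<lambda>\<zeta>. 1 / (2 * pi * \<i>) * integral {-r..r} (\<lambda>x. J x / (of_real x - \<zeta>)))"
  have Bc: "\<zeta> * G \<zeta> = B \<zeta> + \<zeta> * c \<zeta>" if "norm \<zeta> < r" "Im \<zeta> > 0" for \<zeta>
  proof -
    have "2 * pi * \<i> * (\<zeta> * G \<zeta>) = 2 * pi * \<i> * (B \<zeta> + \<zeta> * c \<zeta>)"
      unfolding key[OF that] B_def c_def by (simp add: field_simps)
    then show ?thesis by simp
  qed
  have Bh: "B holomorphic_on ball 0 r" unfolding B_def
    by (intro holomorphic_intros arc_cauchy_integral(1)[OF r E1U] arc_cauchy_integral(1)[OF r E2L])
  \<comment> \<open>Along the imaginary axis \<open>G\<close> and the Cauchy integral
    \<open>c\<close> stay bounded, so B = \<zeta> (G - c) tends to 0. Hence the division of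
    \<open>B\<close> by \<zeta> creates no pole at 0.\<close>
  have B0: "B 0 = 0"
  proof -
    define M where "M = 1 + C2 * r powr (2 + \<alpha>) * (2 * r)"
    have cb: "norm (c (\<i> * of_real t)) \<le> C2 * r powr (2 + \<alpha>) * (2 * r)" if t: "0 < t" for t
    proof -
      have "norm (integral {-r..r} (\<lambda>x. J x / (of_real x - \<i> * of_real t))) \<le> integral {-r..r} (\<lambda>x. C2 * r powr (2 + \<alpha>))"
      proof (rule Henstock_Kurzweil_Integration.integral_norm_bound_integral)
        have "of_real x - \<i> * of_real t \<noteq> 0" for x :: real using t by (auto simp: complex_eq_iff)
        then show "(\<lambda>x. J x / (of_real x - \<i> * of_real t)) integrable_on {-r..r}"
          by (auto intro!: integrable_continuous_real continuous_intros Jc)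
        fix x assume x: "x \<in> {-r..r}"
        show "norm (J x / (of_real x - \<i> * of_real t)) \<le> C2 * r powr (2 + \<alpha>)"
        proof (cases "x = 0")
          case False
          have "\<bar>x\<bar> \<le> norm (of_real x - \<i> * of_real t)" using abs_Re_le_cmod[of "of_real x - \<i> * of_real t"] by simp
          then have "norm (J x / (of_real x - \<i> * of_real t)) \<le> norm (J x) / \<bar>x\<bar>"
            using False by (auto simp: norm_divide intro!: divide_left_mono mult_pos_pos)
          also have "\<dots> \<le> C2 * \<bar>x\<bar> powr (3 + \<alpha>) / \<bar>x\<bar>" using x by (intro divide_right_mono J0) auto
          also have "\<dots> = C2 * \<bar>x\<bar> powr (2 + \<alpha>)" using False powr_diff[of "\<bar>x\<bar>" "3 + \<alpha>" 1] by simp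
          also have "\<dots> \<le> C2 * r powr (2 + \<alpha>)" using x \<alpha> C2 by (intro mult_left_mono powr_mono2) auto
          finally show ?thesis .
        qed (use C2 in \<open>simp add: J_def\<close>)
      qed auto
      also have "\<dots> = C2 * r powr (2 + \<alpha>) * (2 * r)" using r by simp
      finally have *: "norm (integral {-r..r} (\<lambda>x. J x / (of_real x - \<i> * of_real t))) \<le> C2 * r powr (2 + \<alpha>) * (2 * r)" .
      have "norm (c (\<i> * of_real t)) = norm (integral {-r..r} (\<lambda>x. J x / (of_real x - \<i> * of_real t))) / (2 * pi)"
        by (simp add: c_def norm_mult norm_divide)
      also have "\<dots> \<le> norm (integral {-r..r} (\<lambda>x. J x / (of_real x - \<i> * of_real t))) / 1"
        using pi_gt3 by (intro divide_left_mono) auto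
      finally show ?thesis using * by simp
    qed
    have "((\<lambda>t. B (\<i> * of_real t)) \<longlongrightarrow> 0) (at_right 0)"
    proof (rule Lim_null_comparison)
      show "\<forall>\<^sub>F t in at_right 0. norm (B (\<i> * of_real t)) \<le> t * M"
        unfolding eventually_at_right_field
      proof (intro exI[of _ r] conjI allI impI)
        fix t assume t: "0 < t" "t < r"
        have "B (\<i> * of_real t) = \<i> * of_real t * (G (\<i> * of_real t) - c (\<i> * of_real t))"
          using Bc[of "\<i> * of_real t"] t by (simp add: norm_mult algebra_simps)
        then have "norm (B (\<i> * of_real t)) = t * norm (G (\<i> * of_real t) - c (\<i> * of_real t))"
          using t by (simp add: norm_mult)
        also have "\<dots> \<le> t * (norm (G (\<i> * of_real t)) + norm (c (\<i> * of_real t)))"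
          using t by (intro mult_left_mono norm_triangle_ineq4) auto
        also have "\<dots> \<le> t * M" unfolding M_def
          using t cb[OF t(1)] bd[of "\<i> * of_real t"] by (intro mult_left_mono add_mono) (auto simp: norm_mult)
        finally show "norm (B (\<i> * of_real t)) \<le> t * M" .
      qed (use r in auto)
      have "((\<lambda>t. t * M) \<longlongrightarrow> 0 * M) (at_right 0)" by (intro tendsto_intros)
      then show "((\<lambda>t. t * M) \<longlongrightarrow> 0) (at_right 0)" by simp
    qed
    moreover have "((\<lambda>t. B (\<i> * of_real t)) \<longlongrightarrow> B 0) (at_right 0)"
    proof -
      have "isCont B 0" using Bh r holomorphic_on_imp_continuous_on[OF Bh]
        by (simp add: continuous_on_eq_continuous_at)
      moreover have "((\<lambda>t. \<i> * of_real t) \<longlongrightarrow> \<i> * of_real 0) (at_right (0::real))" by (intro tendsto_intros)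
      ultimately show ?thesis using isCont_tendsto_compose[of 0 B] by simp
    qed
    ultimately show ?thesis using tendsto_unique trivial_limit_at_right_real by blast
  qed
  define A where "A = (\<lambda>z. if z = 0 then deriv B 0 else (B z - B 0) / (z - 0))"
  have Ah: "A holomorphic_on ball 0 r" unfolding A_def by (rule pole_lemma_open[OF Bh open_ball])
  have GA: "G \<zeta> = A \<zeta> + c \<zeta>" if "norm \<zeta> < r" "Im \<zeta> > 0" for \<zeta>
  proof -
    have "\<zeta> \<noteq> 0" using that by auto
    then have "A \<zeta> = B \<zeta> / \<zeta>" by (simp add: A_def B0)
    then have "\<zeta> * G \<zeta> = \<zeta> * (A \<zeta> + c \<zeta>)" using Bc[OF that] \<open>\<zeta> \<noteq> 0\<close> by (simp add: distrib_left)
    then show ?thesis using \<open>\<zeta> \<noteq> 0\<close> by simp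
  qed
  have Bb: "norm (B \<zeta>) \<le> 2 * r * (1 + 1 / \<beta>)" if z: "norm \<zeta> = r/2" for \<zeta>
  proof -
    have zb: "\<zeta> \<in> ball 0 r" using z r by auto
    have d: "norm (w - \<zeta>) \<ge> r / 2" if "norm w = r" for w using norm_triangle_ineq2[of w \<zeta>] that z by simp
    have "norm (contour_integral ?U (\<lambda>w. E1 w / (w - \<zeta>))) \<le> 2 * r * \<bar>pi - 0\<bar>"
    proof (rule contour_integral_bound_part_circlepath[OF arc_cauchy_integral(2)[OF r E1U zb]])
      fix w assume w: "w \<in> path_image ?U"
      then have wr: "norm w = r" "w \<in> ?Hp" using spU Uimg by auto
      have "norm (E1 w) \<le> r" using bd[of w] wr r by (auto simp: E1_def norm_mult intro!: mult_left_le)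
      then show "norm (E1 w / (w - \<zeta>)) \<le> 2"
        using d[OF wr(1)] r frac_le[of r "norm (E1 w)" "r/2" "norm (w - \<zeta>)"] by (simp add: norm_divide)
    qed (use r in auto)
    moreover have "norm (contour_integral ?L (\<lambda>w. E2 w / (w - \<zeta>))) \<le> (2 / \<beta>) * r * \<bar>2 * pi - pi\<bar>"
    proof (rule contour_integral_bound_part_circlepath[OF arc_cauchy_integral(2)[OF r E2L zb]])
      fix w assume w: "w \<in> path_image ?L"
      then have wr: "norm w = r" "w \<in> ?Hm" using spL Limg by auto
      have "norm (E2 w) \<le> r / \<beta>" using bd[of "cnj w"] wr r \<beta> by (auto simp: E2_def norm_divide intro!: divide_left_mono mult_pos_pos)
      then show "norm (E2 w / (w - \<zeta>)) \<le> 2 / \<beta>"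
        using d[OF wr(1)] r \<beta> frac_le[of "r / \<beta>" "norm (E2 w)" "r/2" "norm (w - \<zeta>)"] by (simp add: norm_divide)
    qed (use r \<beta> in auto)
    moreover have "norm (integral {-r..r} J) \<le> integral {-r..r} (\<lambda>x. 1 + 1 / \<beta>)"
    proof (rule Henstock_Kurzweil_Integration.integral_norm_bound_integral)
      fix x assume x: "x \<in> {-r..r}"
      show "norm (J x) \<le> 1 + 1 / \<beta>"
      proof (cases "x = 0")
        case False
        then have b: "\<beta> \<le> norm (G x)" "norm (G x) \<le> 1" using bd[of "of_real x"] x by auto
        have "norm (J x) \<le> norm (G x) + norm (1 / cnj (G x))" using False by (simp add: J_def norm_triangle_ineq4)
        also have "norm (1 / cnj (G x)) \<le> 1 / \<beta>" using b \<beta> by (auto simp: norm_divide intro!: divide_left_mono mult_pos_pos)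
        finally show ?thesis using b by simp
      qed (use \<beta> in \<open>simp add: J_def\<close>)
    qed (auto intro: integrable_continuous_real Jc)
    moreover have "integral {-r..r} (\<lambda>x. 1 + 1 / \<beta>) = (1 + 1 / \<beta>) * (2 * r)" using r by simp
    moreover have "norm (B \<zeta>) \<le> (norm (contour_integral ?U (\<lambda>w. E1 w / (w - \<zeta>))) + norm (contour_integral ?L (\<lambda>w. E2 w / (w - \<zeta>))) + norm (integral {-r..r} J)) / (2 * pi)"
      unfolding B_def norm_mult
      by (simp add: norm_divide norm_mult) (intro divide_right_mono norm_triangle_le add_mono norm_triangle_ineq order_refl, simp)
    ultimately have "norm (B \<zeta>) \<le> (2 * r * pi + (2 / \<beta>) * r * pi + (1 + 1 / \<beta>) * (2 * r)) / (2 * pi)"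
      by (elim order_trans) (intro divide_right_mono add_mono, auto simp: mult_ac)
    also have "\<dots> = r * (1 + 1 / \<beta>) + (1 + 1 / \<beta>) * r / pi" by (simp add: field_simps)
    also have "(1 + 1 / \<beta>) * r / pi \<le> (1 + 1 / \<beta>) * r / 1" using pi_gt3 \<beta> r by (intro divide_left_mono) auto
    finally show ?thesis by (simp add: algebra_simps)
  qed
  \<comment> \<open>The bound for \<open>B\<close> on the circle of radius r/2 is divided by r/2 and
    carried inwards by the maximum principle, since near 0 the quotient has no direct
    estimate.\<close>
  have Ab: "norm (A \<zeta>) \<le> 4 * (1 + 1 / \<beta>)" if z: "\<zeta> \<in> ball 0 (r/2)" for \<zeta>
  proof (rule maximum_modulus_frontier[where f=A and S="cball 0 (r/2)"])
    show "A holomorphic_on interior (cball 0 (r/2))" by (rule holomorphic_on_subset[OF Ah]) (use r in auto)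
    show "continuous_on (closure (cball 0 (r/2))) A"
      by (rule continuous_on_subset[OF holomorphic_on_imp_continuous_on[OF Ah]]) (use r in auto)
    fix w assume "w \<in> frontier (cball (0::complex) (r/2))"
    then have w: "norm w = r/2" by (simp add: frontier_cball)
    then have wne: "w \<noteq> 0" using r by auto
    have "norm (A w) = norm (B w) / norm w" using wne by (simp add: A_def B0 norm_divide)
    also have "\<dots> = norm (B w) / (r/2)" by (simp only: w)
    also have "\<dots> \<le> (2 * r * (1 + 1 / \<beta>)) / (r/2)" using r by (intro divide_right_mono Bb w) simp
    also have "\<dots> = 4 * (1 + 1 / \<beta>)" using r by (simp add: field_simps)
    finally show "norm (A w) \<le> 4 * (1 + 1 / \<beta>)" .
  qed (use z in auto)
  show thesis
    by (rule that[of A J]) (use Ah Ab Jc J0 GA in \<open>auto simp: c_def C2_def\<close>)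
qed

section \<open>Approximation by holomorphic functions on full discs\<close>

lemma integrable_abs_powr:
  assumes "e > -1" "r \<ge> 0"
  shows "(\<lambda>x::real. \<bar>x\<bar> powr e) integrable_on {-r..r}"
proof -
  have "(\<lambda>x::real. x powr e) integrable_on {0..r}" by (rule integrable_on_powr_from_0[OF assms])
  then have 1: "(\<lambda>x::real. \<bar>x\<bar> powr e) integrable_on {0..r}" by (rule integrable_eq) auto
  then have 2: "(\<lambda>x::real. \<bar>x\<bar> powr e) integrable_on {-r..0}"
    using Henstock_Kurzweil_Integration.integrable_reflect_real[where f="\<lambda>x. \<bar>x\<bar> powr e" and a=0 and b=r] by simp
  show ?thesis by (rule Henstock_Kurzweil_Integration.integrable_combine[OF _ _ 2 1]) (use assms in auto)
qed

text \<open>Four terms are taken because a density of order |x|^(3 + \<alpha>) still gives four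
  finite coefficients, the last with |x|^(\<alpha> - 1); the remainder then fixes the order of
  approximation.\<close>

lemma geometric_remainder:
  fixes a h :: complex
  assumes "a \<noteq> 0" "a \<noteq> h"
  shows "1 / (a - h) = (\<Sum>k<4. h ^ k / a ^ Suc k) + h ^ 4 / (a ^ 4 * (a - h))"
proof -
  have "(a - h) \<noteq> 0" using assms by simp
  have "(\<Sum>k<4. h ^ k / a ^ Suc k) = 1 / a + h / a^2 + h^2 / a^3 + h^3 / a^4"
    by (simp add: eval_nat_numeral)
  also have "\<dots> = (a^3 + h * a^2 + h^2 * a + h^3) / a^4"
    using assms by (simp add: field_simps eval_nat_numeral)
  finally have 1: "(\<Sum>k<4. h ^ k / a ^ Suc k) = (a^3 + h * a^2 + h^2 * a + h^3) / a^4" .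
  have "(a^3 + h * a^2 + h^2 * a + h^3) * (a - h) = a^4 - h^4"
    by (simp add: algebra_simps eval_nat_numeral)
  moreover have "(a^3 + h * a^2 + h^2 * a + h^3) / a^4 = (a^3 + h * a^2 + h^2 * a + h^3) * (a - h) / (a^4 * (a - h))"
    using \<open>a - h \<noteq> 0\<close> by simp
  ultimately have "(a^3 + h * a^2 + h^2 * a + h^3) / a^4 = (a^4 - h^4) / (a^4 * (a - h))" by simp
  then show ?thesis unfolding 1 using \<open>a - h \<noteq> 0\<close> assms(1) by (simp add: diff_divide_distrib)
qed

text \<open>The Cauchy kernel of the jump is expanded about the point i t. The four Taylor terms
  form a polynomial with bounded coefficients and join \<open>A\<close>; the remainder has order
  t^(3 + \<alpha>/2). The polynomial depends on \<open>t\<close>, its bound does not.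
  \<open>K\<close> is quantified before \<open>G\<close> because one constant has to serve all
  points of the curve.\<close>

lemma half_disc_approx:
  fixes r \<beta> C \<alpha> :: real
  assumes r: "0 < r" "r \<le> 1" and \<beta>: "0 < \<beta>" and C: "C \<ge> 0" and \<alpha>: "0 < \<alpha>" "\<alpha> < 1"
  shows "\<exists>K\<ge>0. \<forall>G S. open S \<longrightarrow> G holomorphic_on S \<longrightarrow> {\<zeta>. Im \<zeta> \<ge> 0 \<and> \<zeta> \<noteq> 0 \<and> norm \<zeta> \<le> r} \<subseteq> S \<longrightarrow>
    (\<forall>\<zeta>. Im \<zeta> \<ge> 0 \<longrightarrow> \<zeta> \<noteq> 0 \<longrightarrow> norm \<zeta> \<le> r \<longrightarrow> \<beta> \<le> norm (G \<zeta>) \<and> norm (G \<zeta>) \<le> 1) \<longrightarrow>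
    (\<forall>x::real. x \<noteq> 0 \<longrightarrow> \<bar>x\<bar> \<le> r \<longrightarrow> 1 - norm (G x) \<le> C * \<bar>x\<bar> powr (3 + \<alpha>)) \<longrightarrow>
    (\<forall>t. 0 < t \<longrightarrow> t \<le> r / 4 \<longrightarrow> (\<exists>T. T holomorphic_on ball 0 (r/2) \<and> (\<forall>\<zeta>\<in>ball 0 (r/2). norm (T \<zeta>) \<le> K) \<and>
       (\<forall>\<zeta>\<in>cball (\<i> * of_real t) (t/2). norm (G \<zeta> - T \<zeta>) \<le> K * t powr (3 + \<alpha>/2))))"
proof -
  define C2 where "C2 = 2 * C / \<beta>"
  have C2: "C2 \<ge> 0" using C \<beta> by (simp add: C2_def)
  \<comment> \<open>The exponent \<alpha>/2 - 1 is integrable at 0 and leaves the other half of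
    \<alpha> for the power of \<open>t\<close>.\<close>
  define I0 where "I0 = integral {-r..r} (\<lambda>x. \<bar>x\<bar> powr (\<alpha>/2 - 1))"
  have int0: "(\<lambda>x. \<bar>x\<bar> powr (\<alpha>/2 - 1)) integrable_on {-r..r}" using \<alpha> r by (intro integrable_abs_powr) auto
  have I0: "I0 \<ge> 0" unfolding I0_def using int0 by (intro Henstock_Kurzweil_Integration.integral_nonneg) auto
  define K where "K = 4 * (1 + 1 / \<beta>) + 4 * (C2 * I0)"
  have K: "K \<ge> 0" "4 * (C2 * I0) \<le> K" using \<beta> C2 I0 by (auto simp: K_def)
  have main: "\<exists>T. T holomorphic_on ball 0 (r/2) \<and> (\<forall>\<zeta>\<in>ball 0 (r/2). norm (T \<zeta>) \<le> K) \<and>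
       (\<forall>\<zeta>\<in>cball (\<i> * of_real t) (t/2). norm (G \<zeta> - T \<zeta>) \<le> K * t powr (3 + \<alpha>/2))"
    if S: "open S" "G holomorphic_on S" "{\<zeta>. Im \<zeta> \<ge> 0 \<and> \<zeta> \<noteq> 0 \<and> norm \<zeta> \<le> r} \<subseteq> S"
    and bd: "\<And>\<zeta>. Im \<zeta> \<ge> 0 \<Longrightarrow> \<zeta> \<noteq> 0 \<Longrightarrow> norm \<zeta> \<le> r \<Longrightarrow> \<beta> \<le> norm (G \<zeta>) \<and> norm (G \<zeta>) \<le> 1"
    and ax: "\<And>x::real. x \<noteq> 0 \<Longrightarrow> \<bar>x\<bar> \<le> r \<Longrightarrow> 1 - norm (G x) \<le> C * \<bar>x\<bar> powr (3 + \<alpha>)"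
    and t: "0 < t" "t \<le> r / 4" for G S t
  proof -
    obtain A J where A: "A holomorphic_on ball 0 r"
      "\<And>\<zeta>. \<zeta> \<in> ball 0 (r/2) \<Longrightarrow> norm (A \<zeta>) \<le> 4 * (1 + 1 / \<beta>)"
      and J: "continuous_on {-r..r} J" "\<And>x. \<bar>x\<bar> \<le> r \<Longrightarrow> norm (J x) \<le> C2 * \<bar>x\<bar> powr (3 + \<alpha>)"
      and GA: "\<And>\<zeta>. norm \<zeta> < r \<Longrightarrow> Im \<zeta> > 0 \<Longrightarrow>
       G \<zeta> = A \<zeta> + 1 / (2 * pi * \<i>) * integral {-r..r} (\<lambda>x. J x / (of_real x - \<zeta>))"
      using half_disc_repr[OF r(1) \<beta> C \<alpha>(1) S bd ax] unfolding C2_def by blast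
    define z where "z = \<i> * complex_of_real t"
    have xz: "\<bar>x\<bar> \<le> norm (of_real x - z)" "t \<le> norm (of_real x - z)" for x :: real
      using abs_Re_le_cmod[of "of_real x - z"] abs_Im_le_cmod[of "of_real x - z"] t by (auto simp: z_def)
    have xzn: "of_real x - z \<noteq> 0" for x :: real using xz(2)[of x] t by auto
    \<comment> \<open>As |x - i t| \<ge> |x|, even the fourth denominator leaves |x|^(\<alpha> - 1),
      which is at most |x|^(\<alpha>/2 - 1) for |x| \<le> 1.\<close>
    have b1: "norm (J x / (of_real x - z) ^ Suc k) \<le> C2 * \<bar>x\<bar> powr (\<alpha>/2 - 1)" if x: "x \<in> {-r..r}" and k: "k < 4" for x k
    proof (cases "x = 0")
      case True
      then show ?thesis using J(2)[of 0] r by simp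
    next
      case False
      have xr: "\<bar>x\<bar> \<le> r" using x by auto
      have "norm (J x / (of_real x - z) ^ Suc k) = norm (J x) / norm (of_real x - z) ^ Suc k"
        by (simp only: norm_divide norm_power)
      also have "\<dots> \<le> (C2 * \<bar>x\<bar> powr (3 + \<alpha>)) / \<bar>x\<bar> ^ Suc k"
        using J(2)[OF xr] xz(1)[of x] False C2 by (intro frac_le power_mono) auto
      also have "\<dots> = C2 * \<bar>x\<bar> powr (3 + \<alpha> - real (Suc k))"
        using False powr_realpow[of "\<bar>x\<bar>" "Suc k"] by (simp add: powr_diff del: of_nat_Suc power_Suc)
      also have "\<dots> \<le> C2 * \<bar>x\<bar> powr (\<alpha>/2 - 1)"
        using xr r k \<alpha> C2 False by (intro mult_left_mono powr_mono') auto
      finally show ?thesis .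
    qed
    have b2: "norm (J x / ((of_real x - z) ^ 4 * (of_real x - \<zeta>))) \<le> (2 * C2 * t powr (\<alpha>/2 - 1)) * \<bar>x\<bar> powr (\<alpha>/2 - 1)"
      if x: "x \<in> {-r..r}" and \<zeta>: "\<zeta> \<in> cball z (t/2)" for x \<zeta>
    proof (cases "x = 0")
      case True
      then show ?thesis using J(2)[of 0] r by simp
    next
      case False
      have xr: "\<bar>x\<bar> \<le> r" using x by auto
      define D where "D = norm (of_real x - z)"
      have D: "D \<ge> \<bar>x\<bar>" "D \<ge> t" "D > 0" using xz[of x] t by (auto simp: D_def)
      have "norm (of_real x - z) \<le> norm (of_real x - \<zeta>) + norm (\<zeta> - z)" by norm
      moreover have "norm (\<zeta> - z) \<le> t / 2" using \<zeta> by (simp add: dist_norm norm_minus_commute)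
      ultimately have xl: "norm (of_real x - \<zeta>) \<ge> D / 2" using D(2) by (simp add: D_def)
      \<comment> \<open>Five powers of \<open>D\<close> are shared out between |x| and
        \<open>t\<close>, both at most \<open>D\<close>: 4 + \<alpha>/2 go to |x| and 1 - \<alpha>/2
        to \<open>t\<close>.\<close>
      have "\<bar>x\<bar> powr (4 + \<alpha>/2) * t powr (1 - \<alpha>/2) \<le> D powr (4 + \<alpha>/2) * D powr (1 - \<alpha>/2)"
        using D t \<alpha> by (intro mult_mono powr_mono2) auto
      also have "\<dots> = D powr 5" using D(3) by (simp add: powr_add[symmetric])
      also have "\<dots> = D ^ 4 * D" using D(3) powr_realpow[of D 5] by (simp add: eval_nat_numeral)
      finally have p: "\<bar>x\<bar> powr (4 + \<alpha>/2) * t powr (1 - \<alpha>/2) \<le> D ^ 4 * D" .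
      have pp: "0 < \<bar>x\<bar> powr (4 + \<alpha>/2) * t powr (1 - \<alpha>/2)" using False t by simp
      have "D ^ 4 * D / 2 \<le> D ^ 4 * norm (of_real x - \<zeta>)" using xl D(3) mult_left_mono[OF xl, of "D^4"] by simp
      then have den: "\<bar>x\<bar> powr (4 + \<alpha>/2) * t powr (1 - \<alpha>/2) / 2 \<le> D ^ 4 * norm (of_real x - \<zeta>)" using p by linarith
      have "norm (J x / ((of_real x - z) ^ 4 * (of_real x - \<zeta>))) = norm (J x) / (D ^ 4 * norm (of_real x - \<zeta>))"
        by (simp add: norm_divide norm_mult norm_power D_def)
      also have "\<dots> \<le> (C2 * \<bar>x\<bar> powr (3 + \<alpha>)) / (\<bar>x\<bar> powr (4 + \<alpha>/2) * t powr (1 - \<alpha>/2) / 2)"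
        using J(2)[OF xr] den pp C2 by (intro frac_le) auto
      also have "\<dots> = 2 * C2 * (\<bar>x\<bar> powr (3 + \<alpha>) / \<bar>x\<bar> powr (4 + \<alpha>/2)) * (1 / t powr (1 - \<alpha>/2))" by simp
      also have "\<bar>x\<bar> powr (3 + \<alpha>) / \<bar>x\<bar> powr (4 + \<alpha>/2) = \<bar>x\<bar> powr (\<alpha>/2 - 1)"
        using powr_diff[of "\<bar>x\<bar>" "3 + \<alpha>" "4 + \<alpha>/2"] by (simp add: field_simps)
      also have "1 / t powr (1 - \<alpha>/2) = t powr (\<alpha>/2 - 1)" using powr_minus_divide[of t "1 - \<alpha>/2"] by simp
      finally show ?thesis by (simp add: mult_ac)
    qed
    define ck where "ck = (\<lambda>k. integral {-r..r} (\<lambda>x. J x / (of_real x - z) ^ Suc k))"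
    have ckint: "(\<lambda>x. J x / (of_real x - z) ^ Suc k) integrable_on {-r..r}" for k
      using xzn by (intro integrable_continuous_real continuous_intros J) auto
    have ckb: "norm (ck k) \<le> C2 * I0" if "k < 4" for k
    proof -
      have "norm (ck k) \<le> integral {-r..r} (\<lambda>x. C2 * \<bar>x\<bar> powr (\<alpha>/2 - 1))"
        unfolding ck_def by (rule Henstock_Kurzweil_Integration.integral_norm_bound_integral[OF ckint])
          (use int0 b1 that in \<open>auto intro: integrable_on_mult_right\<close>)
      then show ?thesis by (simp add: I0_def)
    qed
    define T where "T = (\<lambda>\<zeta>. A \<zeta> + 1 / (2 * pi * \<i>) * (\<Sum>k<4. (\<zeta> - z) ^ k * ck k))"
    have n2pi: "norm (1 / (2 * pi * \<i>)) \<le> 1" using pi_gt3 by (simp add: norm_divide norm_mult)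
    have "T holomorphic_on ball 0 (r/2)" unfolding T_def
      using r by (intro holomorphic_intros holomorphic_on_subset[OF A(1)]) auto
    moreover have "norm (T \<zeta>) \<le> K" if \<zeta>: "\<zeta> \<in> ball 0 (r/2)" for \<zeta>
    proof -
      have "norm (\<zeta> - z) \<le> norm \<zeta> + norm z" by (rule norm_triangle_ineq4)
      also have "\<dots> \<le> r/2 + r/4" using \<zeta> t by (intro add_mono) (auto simp: z_def norm_mult)
      finally have 1: "norm (\<zeta> - z) \<le> 1" using r by simp
      have "norm (\<Sum>k<4. (\<zeta> - z) ^ k * ck k) \<le> (\<Sum>k<(4::nat). C2 * I0)"
      proof (rule sum_norm_le)
        fix k :: nat assume k: "k \<in> {..<4}"
        have "norm ((\<zeta> - z) ^ k * ck k) \<le> 1 * (C2 * I0)" unfolding norm_mult norm_power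
          using 1 ckb[of k] k by (intro mult_mono power_le_one) auto
        then show "norm ((\<zeta> - z) ^ k * ck k) \<le> C2 * I0" by simp
      qed
      also have "\<dots> = 4 * (C2 * I0)" by simp
      finally have "norm (1 / (2 * pi * \<i>) * (\<Sum>k<4. (\<zeta> - z) ^ k * ck k)) \<le> 1 * (4 * (C2 * I0))"
        unfolding norm_mult using n2pi by (intro mult_mono) (auto simp: norm_mult)
      moreover have "norm (T \<zeta>) \<le> norm (A \<zeta>) + norm (1 / (2 * pi * \<i>) * (\<Sum>k<4. (\<zeta> - z) ^ k * ck k))"
        unfolding T_def by (rule norm_triangle_ineq)
      ultimately show ?thesis using A(2)[OF \<zeta>] by (simp add: K_def)
    qed
    moreover have "norm (G \<zeta> - T \<zeta>) \<le> K * t powr (3 + \<alpha>/2)" if \<zeta>: "\<zeta> \<in> cball z (t/2)" for \<zeta>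
    proof -
      have d: "norm (\<zeta> - z) \<le> t/2" using \<zeta> by (simp add: dist_norm norm_minus_commute)
      have "\<bar>Im (\<zeta> - z)\<bar> \<le> t / 2" using d abs_Im_le_cmod[of "\<zeta> - z"] by linarith
      then have "\<bar>Im \<zeta> - t\<bar> \<le> t / 2" by (simp add: z_def)
      then have im: "Im \<zeta> > 0" using t by linarith
      have "norm \<zeta> \<le> norm (\<zeta> - z) + norm z" by norm
      then have nr: "norm \<zeta> < r" using d t r by (simp add: z_def norm_mult)
      have ne: "of_real x - \<zeta> \<noteq> 0" for x :: real using im by auto
      define R where "R = (\<lambda>x::real. J x / ((of_real x - z) ^ 4 * (of_real x - \<zeta>)))"
      have Rint: "R integrable_on {-r..r}" unfolding R_def
        using xzn ne by (intro integrable_continuous_real continuous_intros J) auto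
      have "integral {-r..r} (\<lambda>x. J x / (of_real x - \<zeta>))
          = integral {-r..r} (\<lambda>x. (\<Sum>k<4. (\<zeta> - z) ^ k * (J x / (of_real x - z) ^ Suc k)) + (\<zeta> - z) ^ 4 * R x)"
      proof (rule integral_cong)
        fix x
        have g: "1 / ((of_real x - z) - (\<zeta> - z)) = (\<Sum>k<4. (\<zeta> - z) ^ k / (of_real x - z) ^ Suc k)
            + (\<zeta> - z) ^ 4 / ((of_real x - z) ^ 4 * ((of_real x - z) - (\<zeta> - z)))"
          by (rule geometric_remainder) (use xzn[of x] ne[of x] in auto)
        have "J x / (of_real x - \<zeta>) = J x * (1 / ((of_real x - z) - (\<zeta> - z)))" by simp
        also have "\<dots> = J x * (\<Sum>k<4. (\<zeta> - z) ^ k / (of_real x - z) ^ Suc k) + (\<zeta> - z) ^ 4 * R x"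
          unfolding g by (simp add: R_def distrib_left mult_ac del: power_Suc)
        also have "J x * (\<Sum>k<4. (\<zeta> - z) ^ k / (of_real x - z) ^ Suc k) = (\<Sum>k<4. (\<zeta> - z) ^ k * (J x / (of_real x - z) ^ Suc k))"
          by (simp add: sum_distrib_left mult_ac del: power_Suc)
        finally show "J x / (of_real x - \<zeta>) = (\<Sum>k<4. (\<zeta> - z) ^ k * (J x / (of_real x - z) ^ Suc k)) + (\<zeta> - z) ^ 4 * R x" .
      qed
      also have "\<dots> = integral {-r..r} (\<lambda>x. (\<Sum>k<4. (\<zeta> - z) ^ k * (J x / (of_real x - z) ^ Suc k))) + integral {-r..r} (\<lambda>x. (\<zeta> - z) ^ 4 * R x)"
        by (rule Henstock_Kurzweil_Integration.integral_add) (use ckint Rint in \<open>auto intro!: integrable_sum integrable_on_mult_right simp del: power_Suc times_divide_eq_right\<close>)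
      also have "integral {-r..r} (\<lambda>x. (\<Sum>k<4. (\<zeta> - z) ^ k * (J x / (of_real x - z) ^ Suc k))) = (\<Sum>k<4. (\<zeta> - z) ^ k * ck k)"
        unfolding ck_def by (subst Henstock_Kurzweil_Integration.integral_sum) (use ckint in \<open>auto intro!: integrable_on_mult_right simp del: power_Suc times_divide_eq_right\<close>)
      finally have I: "integral {-r..r} (\<lambda>x. J x / (of_real x - \<zeta>)) = (\<Sum>k<4. (\<zeta> - z) ^ k * ck k) + (\<zeta> - z) ^ 4 * integral {-r..r} R"
        by simp
      have "G \<zeta> - T \<zeta> = 1 / (2 * pi * \<i>) * ((\<zeta> - z) ^ 4 * integral {-r..r} R)"
        unfolding GA[OF nr im] T_def I by (simp add: distrib_left)
      then have "norm (G \<zeta> - T \<zeta>) = norm (1 / (2 * pi * \<i>)) * (norm (\<zeta> - z) ^ 4 * norm (integral {-r..r} R))"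
        by (simp only: norm_mult norm_power)
      also have "\<dots> \<le> 1 * (t ^ 4 * norm (integral {-r..r} R))"
        using d t by (intro mult_mono n2pi power_mono) auto
      also have "norm (integral {-r..r} R) \<le> integral {-r..r} (\<lambda>x. (2 * C2 * t powr (\<alpha>/2 - 1)) * \<bar>x\<bar> powr (\<alpha>/2 - 1))"
        by (rule Henstock_Kurzweil_Integration.integral_norm_bound_integral[OF Rint])
          (use int0 b2[OF _ \<zeta>] in \<open>auto simp: R_def intro!: integrable_on_mult_right\<close>)
      also have "\<dots> = (2 * C2 * t powr (\<alpha>/2 - 1)) * I0" by (simp add: I0_def)
      finally have "norm (G \<zeta> - T \<zeta>) \<le> t ^ 4 * ((2 * C2 * t powr (\<alpha>/2 - 1)) * I0)" using t by (simp add: mult_left_mono)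
      also have "\<dots> = 2 * (C2 * I0) * (t powr 4 * t powr (\<alpha>/2 - 1))" using t powr_realpow[of t 4] by simp
      also have "t powr 4 * t powr (\<alpha>/2 - 1) = t powr (3 + \<alpha>/2)" by (simp add: powr_add[symmetric] add.commute)
      also have "2 * (C2 * I0) * t powr (3 + \<alpha>/2) \<le> K * t powr (3 + \<alpha>/2)"
        using K mult_nonneg_nonneg[OF C2 I0] by (intro mult_right_mono) auto
      finally show ?thesis .
    qed
    ultimately show ?thesis unfolding z_def by blast
  qed
  show ?thesis
    by (intro exI[of _ K] conjI K(1) allI impI) (rule main, auto)
qed

section \<open>Closed curves of class \<open>C\<^sup>3\<^sup>,\<^sup>\<alpha>\<close>\<close>

lemma norm_diff_le_vector_derivative:
  fixes f :: "real \<Rightarrow> 'a::real_normed_vector"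
  assumes "\<And>y. (f has_vector_derivative f' y) (at y)" "\<And>y. \<bar>y\<bar> \<le> \<bar>x\<bar> \<Longrightarrow> norm (f' y) \<le> B"
  shows "norm (f x - f 0) \<le> B * \<bar>x\<bar>"
proof -
  have "norm (f x - f 0) \<le> B * norm (x - 0)"
  proof (rule differentiable_bound[where S="closed_segment 0 x" and f'="\<lambda>y h. h *\<^sub>R f' y"])
    fix y assume y: "y \<in> closed_segment 0 x"
    show "(f has_derivative (\<lambda>h. h *\<^sub>R f' y)) (at y within closed_segment 0 x)"
      using assms(1)[of y] by (simp add: has_vector_derivative_def has_derivative_at_withinI)
    have "\<bar>y\<bar> \<le> \<bar>x\<bar>" using y by (auto simp: closed_segment_eq_real_ivl split: if_splits)
    then show "onorm (\<lambda>h. h *\<^sub>R f' y) \<le> B"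
      using assms(2)[of y] by (intro onorm_le) (simp add: mult_right_mono mult.commute[of "\<bar>_\<bar>"])
  qed auto
  then show ?thesis by simp
qed

lemma periodic_of_int:
  fixes f :: "real \<Rightarrow> 'a"
  assumes "\<And>s. f (s + L) = f s"
  shows "f (s + of_int k * L) = f s"
proof -
  have n: "f (s + real n * L) = f s" for n s
    by (induction n arbitrary: s) (use assms in \<open>auto simp: algebra_simps, metis add.assoc\<close>)
  show ?thesis
  proof (cases "k \<ge> 0")
    case True
    then show ?thesis using n[of s "nat k"] by simp
  next
    case False
    then show ?thesis using n[of "s + of_int k * L" "nat (- k)"] by (simp add: algebra_simps)
  qed
qed

lemma reduce_period:
  fixes s L :: real
  assumes "L > 0"
  shows "s - of_int \<lfloor>s / L\<rfloor> * L \<in> {0..<L}"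
  using floor_divide_lower[OF assms, of s] floor_divide_upper[OF assms, of s] by (simp add: algebra_simps)

lemma has_vector_derivative_shift:
  fixes f :: "real \<Rightarrow> 'a::real_normed_vector"
  assumes "(f has_vector_derivative f') (at (s + x))"
  shows "((\<lambda>x. f (s + x)) has_vector_derivative f') (at x)"
proof -
  have "((\<lambda>x. s + x) has_vector_derivative 1) (at x)"
    unfolding has_vector_derivative_def by (auto intro!: derivative_eq_intros)
  from vector_diff_chain_at[OF this assms] show ?thesis by (simp add: o_def)
qed

lemma periodic_bounded:
  fixes f :: "real \<Rightarrow> complex"
  assumes L: "L > 0" and per: "\<And>s. f (s + L) = f s" and c: "continuous_on UNIV f"
  obtains B where "B > 0" "\<And>s. norm (f s) \<le> B"
proof -
  have "compact (f ` {0..L})" by (rule compact_continuous_image) (auto intro: continuous_on_subset[OF c])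
  then obtain B where B: "\<And>x. x \<in> f ` {0..L} \<Longrightarrow> norm x \<le> B" using compact_imp_bounded bounded_iff by metis
  have "norm (f s) \<le> \<bar>B\<bar> + 1" for s
  proof -
    define k where "k = - \<lfloor>s / L\<rfloor>"
    have "s + of_int k * L \<in> {0..L}" using reduce_period[OF L, of s] by (simp add: k_def)
    then have "norm (f (s + of_int k * L)) \<le> B" using B by blast
    then have "norm (f s) \<le> B" using periodic_of_int[of f L s k, OF per] by simp
    then show ?thesis by linarith
  qed
  then show thesis using that[of "\<bar>B\<bar> + 1"] by auto
qed

text \<open>The witnesses of \<open>C3a_arclength_param\<close> become parameters, so that several
  lemmas can share them and the reversed curve can supply its own.\<close>

locale C3a_curve =
  fixes \<gamma> \<gamma>1 \<gamma>2 \<gamma>3 :: "real \<Rightarrow> complex" and L \<alpha> M :: real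
  assumes L: "L > 0" and \<alpha>: "0 < \<alpha>" "\<alpha> < 1"
    and per: "\<And>s. \<gamma> (s + L) = \<gamma> s" and inj: "inj_on \<gamma> {0..<L}"
    and d1: "\<And>s. (\<gamma> has_vector_derivative \<gamma>1 s) (at s)"
    and d2: "\<And>s. (\<gamma>1 has_vector_derivative \<gamma>2 s) (at s)"
    and d3: "\<And>s. (\<gamma>2 has_vector_derivative \<gamma>3 s) (at s)"
    and hoelder: "\<And>s t. norm (\<gamma>3 s - \<gamma>3 t) \<le> M * \<bar>s - t\<bar> powr \<alpha>"
    and unit: "\<And>s. norm (\<gamma>1 s) = 1"
begin

lemma M_nonneg: "M \<ge> 0"
proof -
  have "0 \<le> M * \<bar>1 - 0\<bar> powr \<alpha>" using hoelder[of 1 0] norm_ge_zero order_trans by blast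
  then show ?thesis by simp
qed

lemma per1: "\<gamma>1 (s + L) = \<gamma>1 s"
proof -
  have "((\<lambda>s. \<gamma> (s + L)) has_vector_derivative \<gamma>1 (s + L)) (at s)"
    using has_vector_derivative_shift[of \<gamma> "\<gamma>1 (s + L)" L s] d1[of "s + L"] by (simp add: add.commute)
  then show ?thesis using d1[of s] by (simp add: per vector_derivative_unique_at)
qed

lemma per2: "\<gamma>2 (s + L) = \<gamma>2 s"
proof -
  have "((\<lambda>s. \<gamma>1 (s + L)) has_vector_derivative \<gamma>2 (s + L)) (at s)"
    using has_vector_derivative_shift[of \<gamma>1 "\<gamma>2 (s + L)" L s] d2[of "s + L"] by (simp add: add.commute)
  then show ?thesis using d2[of s] by (simp add: per1 vector_derivative_unique_at)
qed

lemma per3: "\<gamma>3 (s + L) = \<gamma>3 s"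
proof -
  have "((\<lambda>s. \<gamma>2 (s + L)) has_vector_derivative \<gamma>3 (s + L)) (at s)"
    using has_vector_derivative_shift[of \<gamma>2 "\<gamma>3 (s + L)" L s] d3[of "s + L"] by (simp add: add.commute)
  then show ?thesis using d3[of s] by (simp add: per2 vector_derivative_unique_at)
qed

lemma cont0: "continuous_on A \<gamma>" and cont1: "continuous_on A \<gamma>1" and cont2: "continuous_on A \<gamma>2"
  using d1 d2 d3 by (auto intro!: continuous_at_imp_continuous_on has_vector_derivative_continuous)

lemma cont3: "continuous_on A \<gamma>3"
proof (rule continuous_on_subset[of UNIV])
  show "continuous_on UNIV \<gamma>3"
    unfolding continuous_on_eq_continuous_within
  proof
    fix s
    have "((\<lambda>t. M * \<bar>t - s\<bar> powr \<alpha>) \<longlongrightarrow> M * \<bar>s - s\<bar> powr \<alpha>) (at s)"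
      by (intro tendsto_intros) (use \<alpha> in auto)
    then have "((\<lambda>t. M * \<bar>t - s\<bar> powr \<alpha>) \<longlongrightarrow> 0) (at s)" by simp
    then have "((\<lambda>t. \<gamma>3 t - \<gamma>3 s) \<longlongrightarrow> 0) (at s)"
      by (rule Lim_null_comparison[rotated]) (auto intro!: always_eventually hoelder)
    then show "continuous (at s) \<gamma>3" unfolding continuous_within by (rule LIM_zero_cancel)
  qed
qed simp

lemma range_eq: "range \<gamma> = \<gamma> ` {0..L}"
proof
  show "range \<gamma> \<subseteq> \<gamma> ` {0..L}"
  proof safe
    fix s
    define k where "k = - \<lfloor>s / L\<rfloor>"
    have "s + of_int k * L \<in> {0..L}" using reduce_period[OF L, of s] by (simp add: k_def)
    moreover have "\<gamma> s = \<gamma> (s + of_int k * L)" using periodic_of_int[of \<gamma> L s k, OF per] by simp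
    ultimately show "\<gamma> s \<in> \<gamma> ` {0..L}" by blast
  qed
qed auto

lemma compact_range: "compact (range \<gamma>)"
  unfolding range_eq by (rule compact_continuous_image[OF cont0]) simp

lemma closed_range: "closed (range \<gamma>)"
  using compact_range compact_imp_closed by blast

lemma inj_mod:
  assumes "\<gamma> a = \<gamma> b"
  obtains k :: int where "a = b + of_int k * L"
proof -
  note red = reduce_period[OF L]
  have g: "\<gamma> (s - of_int \<lfloor>s / L\<rfloor> * L) = \<gamma> s" for s
    using periodic_of_int[of \<gamma> L s "- \<lfloor>s / L\<rfloor>", OF per] by simp
  have "a - of_int \<lfloor>a / L\<rfloor> * L = b - of_int \<lfloor>b / L\<rfloor> * L"
    using inj_onD[OF inj _ red red] g assms by metis
  then have "a = b + of_int (\<lfloor>a / L\<rfloor> - \<lfloor>b / L\<rfloor>) * L" by (simp add: algebra_simps)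
  then show thesis by (rule that)
qed

text \<open>The argument is complex: the polynomial is holomorphic near the base point and follows
  the curve for small real arguments up to the Taylor error.\<close>

definition taylor :: "real \<Rightarrow> complex \<Rightarrow> complex" where
  "taylor s \<zeta> = \<gamma> s + \<gamma>1 s * \<zeta> + \<gamma>2 s / 2 * \<zeta>\<^sup>2 + \<gamma>3 s / 6 * \<zeta> ^ 3"

lemma shift_derivs:
  "((\<lambda>x. \<gamma> (s + x)) has_vector_derivative \<gamma>1 (s + x)) (at x)"
  "((\<lambda>x. \<gamma>1 (s + x)) has_vector_derivative \<gamma>2 (s + x)) (at x)"
  "((\<lambda>x. \<gamma>2 (s + x)) has_vector_derivative \<gamma>3 (s + x)) (at x)"
  by (intro has_vector_derivative_shift d1 d2 d3)+

text \<open>The Hoelder bound for \<gamma>3 is integrated three times by the mean value inequality;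
  each integration raises the exponent by one and keeps the constant \<open>M\<close>.\<close>

lemma taylor_bound: "norm (\<gamma> (s + x) - taylor s (of_real x)) \<le> M * \<bar>x\<bar> powr (3 + \<alpha>)"
proof -
  have pw: "M * \<bar>y\<bar> powr p * \<bar>y\<bar> = M * \<bar>y\<bar> powr (1 + p)" for y p
    by (cases "y = 0") (simp_all add: powr_add mult_ac)
  have mono: "M * \<bar>y\<bar> powr p \<le> M * \<bar>x\<bar> powr p" if "\<bar>y\<bar> \<le> \<bar>x\<bar>" "p \<ge> 0" for x y p :: real
    using that M_nonneg by (intro mult_left_mono powr_mono2) auto
  define f2 where "f2 = (\<lambda>x. \<gamma>2 (s + x) - of_real x * \<gamma>3 s)"
  define f1 where "f1 = (\<lambda>x. \<gamma>1 (s + x) - of_real x * \<gamma>2 s - of_real (x\<^sup>2 / 2) * \<gamma>3 s)"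
  define f0 where "f0 = (\<lambda>x. \<gamma> (s + x) - of_real x * \<gamma>1 s - of_real (x\<^sup>2 / 2) * \<gamma>2 s - of_real (x ^ 3 / 6) * \<gamma>3 s)"
  have D: "((\<lambda>x. complex_of_real x * c) has_vector_derivative c) (at x)"
    "((\<lambda>x. complex_of_real (x\<^sup>2 / 2) * c) has_vector_derivative of_real x * c) (at x)"
    "((\<lambda>x. complex_of_real (x ^ 3 / 6) * c) has_vector_derivative of_real (x\<^sup>2 / 2) * c) (at x)" for x c
  proof -
    have "((\<lambda>x. g x *\<^sub>R c) has_vector_derivative g' *\<^sub>R c) (at x)" if "(g has_real_derivative g') (at x)" for g g'
      using has_derivative_scaleR_left[OF that[unfolded has_field_derivative_def], of c]
      by (simp add: has_vector_derivative_def mult.commute)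
    note * = this[unfolded scaleR_conv_of_real]
    show "((\<lambda>x. complex_of_real x * c) has_vector_derivative c) (at x)"
      using *[of "\<lambda>x. x" 1] by (auto)
    show "((\<lambda>x. complex_of_real (x\<^sup>2 / 2) * c) has_vector_derivative of_real x * c) (at x)"
      by (rule *) (auto intro!: derivative_eq_intros)
    show "((\<lambda>x. complex_of_real (x ^ 3 / 6) * c) has_vector_derivative of_real (x\<^sup>2 / 2) * c) (at x)"
      by (rule *) (auto intro!: derivative_eq_intros)
  qed
  have e2: "norm (f2 x - f2 0) \<le> M * \<bar>x\<bar> powr (1 + \<alpha>)" for x
  proof -
    have "norm (f2 x - f2 0) \<le> (M * \<bar>x\<bar> powr \<alpha>) * \<bar>x\<bar>"
    proof (rule norm_diff_le_vector_derivative)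
      show "(f2 has_vector_derivative \<gamma>3 (s + y) - \<gamma>3 s) (at y)" for y
        unfolding f2_def by (intro has_vector_derivative_diff shift_derivs D)
      show "norm (\<gamma>3 (s + y) - \<gamma>3 s) \<le> M * \<bar>x\<bar> powr \<alpha>" if "\<bar>y\<bar> \<le> \<bar>x\<bar>" for y
        using hoelder[of "s + y" s] mono[OF that, of \<alpha>] \<alpha> by simp
    qed
    then show ?thesis using pw by simp
  qed
  have e1: "norm (f1 x - f1 0) \<le> M * \<bar>x\<bar> powr (1 + (1 + \<alpha>))" for x
  proof -
    have "norm (f1 x - f1 0) \<le> (M * \<bar>x\<bar> powr (1 + \<alpha>)) * \<bar>x\<bar>"
    proof (rule norm_diff_le_vector_derivative)
      show "(f1 has_vector_derivative \<gamma>2 (s + y) - \<gamma>2 s - of_real y * \<gamma>3 s) (at y)" for y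
        unfolding f1_def by (intro has_vector_derivative_diff shift_derivs D)
      show "norm (\<gamma>2 (s + y) - \<gamma>2 s - of_real y * \<gamma>3 s) \<le> M * \<bar>x\<bar> powr (1 + \<alpha>)" if "\<bar>y\<bar> \<le> \<bar>x\<bar>" for y
        using e2[of y] mono[OF that, of "1 + \<alpha>"] \<alpha> by (simp add: f2_def algebra_simps)
    qed
    then show ?thesis using pw by simp
  qed
  have "norm (f0 x - f0 0) \<le> (M * \<bar>x\<bar> powr (1 + (1 + \<alpha>))) * \<bar>x\<bar>"
  proof (rule norm_diff_le_vector_derivative)
    show "(f0 has_vector_derivative \<gamma>1 (s + y) - \<gamma>1 s - of_real y * \<gamma>2 s - of_real (y\<^sup>2 / 2) * \<gamma>3 s) (at y)" for y
      unfolding f0_def by (intro has_vector_derivative_diff shift_derivs D)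
    show "norm (\<gamma>1 (s + y) - \<gamma>1 s - of_real y * \<gamma>2 s - of_real (y\<^sup>2 / 2) * \<gamma>3 s) \<le> M * \<bar>x\<bar> powr (1 + (1 + \<alpha>))"
      if "\<bar>y\<bar> \<le> \<bar>x\<bar>" for y
      using e1[of y] mono[OF that, of "1 + (1 + \<alpha>)"] \<alpha> by (simp add: f1_def algebra_simps)
  qed
  moreover have "f0 x - f0 0 = \<gamma> (s + x) - taylor s (of_real x)"
    by (simp add: f0_def taylor_def algebra_simps)
  ultimately show ?thesis using pw by (simp add: add.assoc)
qed

lemma taylor1_bound:
  assumes "\<And>s. norm (\<gamma>2 s) \<le> B"
  shows "norm (\<gamma> (s + x) - \<gamma> s - of_real x * \<gamma>1 s) \<le> B * \<bar>x\<bar>\<^sup>2"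
proof -
  have B: "B \<ge> 0" using assms[of 0] norm_ge_zero order_trans by blast
  have D: "((\<lambda>x. complex_of_real x * c) has_vector_derivative c) (at x)" for x c
    by (auto intro!: derivative_eq_intros simp: has_vector_derivative_def scaleR_conv_of_real)
  have e1: "norm (\<gamma>1 (s + y) - \<gamma>1 (s + 0)) \<le> B * \<bar>y\<bar>" for y
    by (rule norm_diff_le_vector_derivative[OF shift_derivs(2)]) (rule assms)
  define f where "f = (\<lambda>x. \<gamma> (s + x) - of_real x * \<gamma>1 s)"
  have "norm (f x - f 0) \<le> (B * \<bar>x\<bar>) * \<bar>x\<bar>"
  proof (rule norm_diff_le_vector_derivative)
    show "(f has_vector_derivative \<gamma>1 (s + y) - \<gamma>1 s) (at y)" for y
      unfolding f_def by (intro has_vector_derivative_diff shift_derivs D)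
    show "norm (\<gamma>1 (s + y) - \<gamma>1 s) \<le> B * \<bar>x\<bar>" if "\<bar>y\<bar> \<le> \<bar>x\<bar>" for y
      using e1[of y] mult_left_mono[OF that B] by simp
  qed
  then show ?thesis by (simp add: f_def power2_eq_square algebra_simps)
qed

text \<open>Compactness: on pairs (s, x) with s in one period and \<epsilon> \<le> |x| \<le> L/2,
  the distance between \<gamma> s and \<gamma> (s + x) is positive, hence bounded below. Subtracting
  a multiple of the period brings any parameter difference to |x| \<le> L/2.\<close>

lemma injectivity_modulus:
  assumes "\<epsilon> > 0"
  obtains \<delta> where "\<delta> > 0" "\<And>s s'. dist (\<gamma> s) (\<gamma> s') < \<delta> \<Longrightarrow> \<exists>x. \<gamma> s' = \<gamma> (s + x) \<and> \<bar>x\<bar> < \<epsilon>"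
proof -
  define Q where "Q = {0..L} \<times> ({-L/2..L/2} \<inter> {x. \<epsilon> \<le> \<bar>x\<bar>})"
  have "closed {x::real. \<epsilon> \<le> \<bar>x\<bar>}" by (intro closed_Collect_le continuous_intros)
  then have Qc: "compact Q" unfolding Q_def by (intro compact_Times compact_Int_closed) auto
  define D where "D = (\<lambda>p::real\<times>real. dist (\<gamma> (fst p)) (\<gamma> (fst p + snd p)))"
  have Dc: "continuous_on Q D" unfolding D_def
    by (intro continuous_intros continuous_on_compose2[OF cont0[of UNIV]]) auto
  have Dpos: "D p > 0" if "p \<in> Q" for p
  proof (rule ccontr)
    assume "\<not> D p > 0"
    then have "\<gamma> (fst p + snd p) = \<gamma> (fst p)" by (simp add: D_def)
    then obtain k :: int where k: "fst p + snd p = fst p + of_int k * L" using inj_mod by blast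
    have "\<bar>of_int k * L\<bar> \<le> L / 2" "\<bar>of_int k * L\<bar> \<ge> \<epsilon>" using that k by (auto simp: Q_def)
    then have "\<bar>of_int k :: real\<bar> * L \<le> L / 2" "k \<noteq> 0" using L assms by (auto simp: abs_mult)
    then have "\<bar>of_int k :: real\<bar> \<le> 1/2" using L by (simp add: field_simps)
    then show False using \<open>k \<noteq> 0\<close> by linarith
  qed
  obtain \<delta> where \<delta>: "\<delta> > 0" "\<And>p. p \<in> Q \<Longrightarrow> D p \<ge> \<delta>"
  proof (cases "Q = {}")
    case False
    then obtain p where "p \<in> Q" "\<And>q. q \<in> Q \<Longrightarrow> D p \<le> D q" using continuous_attains_inf[OF Qc _ Dc] by auto
    then show thesis using that[of "D p"] Dpos by auto
  qed (use that[of 1] in auto)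
  have "\<exists>x. \<gamma> s' = \<gamma> (s + x) \<and> \<bar>x\<bar> < \<epsilon>" if d: "dist (\<gamma> s) (\<gamma> s') < \<delta>" for s s'
  proof -
    define k where "k = round ((s' - s) / L)"
    define x where "x = s' - s - of_int k * L"
    have "\<bar>(s' - s) / L - of_int k\<bar> \<le> 1/2" unfolding k_def using of_int_round_abs_le[of "(s' - s) / L"] by (simp add: abs_minus_commute)
    moreover have "x = L * ((s' - s) / L - of_int k)" using L by (simp add: x_def field_simps)
    ultimately have xb: "\<bar>x\<bar> \<le> L / 2" using L by (simp add: abs_mult)
    have gx: "\<gamma> s' = \<gamma> (s + x)" using periodic_of_int[of \<gamma> L s' "- k", OF per] by (simp add: x_def)
    have "\<gamma> s \<in> \<gamma> ` {0..L}" using range_eq by blast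
    define j where "j = - \<lfloor>s / L\<rfloor>"
    have s0: "s + of_int j * L \<in> {0..L}" using reduce_period[OF L, of s] by (simp add: j_def)
    have "\<bar>x\<bar> < \<epsilon>"
    proof (rule ccontr)
      assume "\<not> \<bar>x\<bar> < \<epsilon>"
      then have "(s + of_int j * L, x) \<in> Q" using s0 xb by (auto simp: Q_def abs_le_iff)
      from \<delta>(2)[OF this] have "\<delta> \<le> dist (\<gamma> (s + of_int j * L)) (\<gamma> (s + of_int j * L + x))" by (simp add: D_def)
      also have "\<gamma> (s + of_int j * L) = \<gamma> s" by (rule periodic_of_int[of \<gamma> L s j, OF per])
      also have "\<gamma> (s + of_int j * L + x) = \<gamma> s'" using periodic_of_int[of \<gamma> L "s + x" j, OF per] gx by (simp add: algebra_simps)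
      finally show False using d by simp
    qed
    then show ?thesis using gx by blast
  qed
  then show thesis using that \<delta>(1) by blast
qed

end

section \<open>Tangent discs and the two sides of the curve\<close>

context C3a_curve begin

text \<open>For a = \<gamma> (s + x) - \<gamma> s the normal component a . n is at most 4 B |a|^2,
  since the curve leaves its tangent only quadratically. So |a - \<rho> n|^2 = |a|^2 - 2 \<rho> a .
  n + \<rho>^2 does not fall below \<rho>^2 while 8 B \<rho> \<le> 1.\<close>

lemma near_curve_disc_bound:
  assumes B: "B > 0" "\<And>s. norm (\<gamma>2 s) \<le> B" and x: "\<bar>x\<bar> * B \<le> 1/2"
    and \<rho>: "0 \<le> \<rho>" "8 * B * \<rho> \<le> 1" and n: "n = \<i> * \<gamma>1 s \<or> n = - (\<i> * \<gamma>1 s)"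
  shows "\<rho> \<le> norm (\<gamma> (s + x) - (\<gamma> s + of_real \<rho> * n))"
proof -
  define a where "a = \<gamma> (s + x) - \<gamma> s"
  define R where "R = a - of_real x * \<gamma>1 s"
  have R: "norm R \<le> B * \<bar>x\<bar>\<^sup>2" using taylor1_bound[OF B(2), of s x] by (simp add: R_def a_def)
  have nn: "norm n = 1" using n unit[of s] by (auto simp: norm_mult)
  have "B * \<bar>x\<bar>\<^sup>2 \<le> \<bar>x\<bar> / 2" using mult_left_mono[OF x, of "\<bar>x\<bar>"] by (simp add: power2_eq_square mult_ac)
  moreover have "\<bar>x\<bar> \<le> norm a + norm R"
  proof -
    have "\<bar>x\<bar> = norm (a - R)" by (simp add: R_def norm_mult unit)
    also have "\<dots> \<le> norm a + norm R" by (rule norm_triangle_ineq4)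
    finally show ?thesis .
  qed
  ultimately have xa: "\<bar>x\<bar> \<le> 2 * norm a" using R by linarith
  have "(of_real x * \<gamma>1 s) \<bullet> n = 0"
    using n by (auto simp: inner_complex_def algebra_simps)
  then have "a \<bullet> n = R \<bullet> n" by (simp add: R_def inner_diff_left)
  then have "a \<bullet> n \<le> norm R" using norm_cauchy_schwarz[of R n] nn by simp
  also have "\<dots> \<le> B * (2 * norm a)\<^sup>2"
    by (rule order_trans[OF R]) (use power_mono[OF xa, of 2] B in \<open>intro mult_left_mono; simp\<close>)
  finally have an: "a \<bullet> n \<le> 4 * B * (norm a)\<^sup>2" by (simp add: power2_eq_square)
  have "(norm (a - of_real \<rho> * n))\<^sup>2 = (norm a)\<^sup>2 - 2 * \<rho> * (a \<bullet> n) + \<rho>\<^sup>2"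
  proof -
    have "of_real \<rho> * n = \<rho> *\<^sub>R n" by (simp add: scaleR_conv_of_real)
    then show ?thesis using nn
      by (simp add: power2_norm_eq_inner inner_diff_left inner_diff_right inner_commute)
        (simp add: power2_norm_eq_inner[symmetric] power2_eq_square inner_commute)
  qed
  moreover have "2 * \<rho> * (a \<bullet> n) \<le> 2 * \<rho> * (4 * B * (norm a)\<^sup>2)" using an \<rho> by (intro mult_left_mono) auto
  moreover have "2 * \<rho> * (4 * B * (norm a)\<^sup>2) \<le> (norm a)\<^sup>2"
    using mult_right_mono[OF \<rho>(2), of "(norm a)\<^sup>2"] by (simp add: mult_ac)
  ultimately have "\<rho>\<^sup>2 \<le> (norm (a - of_real \<rho> * n))\<^sup>2" by linarith
  then have "\<rho> \<le> norm (a - of_real \<rho> * n)" by (rule power2_le_imp_le) simp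
  then show ?thesis by (simp add: a_def algebra_simps)
qed

text \<open>Curve points with nearby parameters are excluded by the curvature bound. The others are
  excluded because the disc stays within 2 \<rho> of \<gamma> s, which is below the injectivity
  modulus.\<close>

lemma tangent_discs:
  obtains \<rho>0 where "\<rho>0 > 0"
    "\<And>\<rho> s n. 0 \<le> \<rho> \<Longrightarrow> \<rho> \<le> \<rho>0 \<Longrightarrow> n = \<i> * \<gamma>1 s \<or> n = - (\<i> * \<gamma>1 s) \<Longrightarrow> ball (\<gamma> s + of_real \<rho> * n) \<rho> \<inter> range \<gamma> = {}"
proof -
  obtain B where B: "B > 0" "\<And>s. norm (\<gamma>2 s) \<le> B"
    using periodic_bounded[OF L per2 cont2] by blast
  obtain \<delta> where \<delta>: "\<delta> > 0" "\<And>s s'. dist (\<gamma> s) (\<gamma> s') < \<delta> \<Longrightarrow> \<exists>x. \<gamma> s' = \<gamma> (s + x) \<and> \<bar>x\<bar> < 1 / (2 * B)"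
    using injectivity_modulus[of "1 / (2 * B)"] B by auto
  define \<rho>0 where "\<rho>0 = min (1 / (8 * B)) (\<delta> / 2)"
  have "\<rho>0 > 0" using B \<delta> by (simp add: \<rho>0_def)
  moreover have "ball (\<gamma> s + of_real \<rho> * n) \<rho> \<inter> range \<gamma> = {}"
    if \<rho>: "0 \<le> \<rho>" "\<rho> \<le> \<rho>0" and n: "n = \<i> * \<gamma>1 s \<or> n = - (\<i> * \<gamma>1 s)" for \<rho> s n
  proof (rule ccontr)
    assume "ball (\<gamma> s + of_real \<rho> * n) \<rho> \<inter> range \<gamma> \<noteq> {}"
    then obtain s' where s': "dist (\<gamma> s + of_real \<rho> * n) (\<gamma> s') < \<rho>" by auto
    have nn: "norm n = 1" using n unit[of s] by (auto simp: norm_mult)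
    have "dist (\<gamma> s) (\<gamma> s') \<le> dist (\<gamma> s) (\<gamma> s + of_real \<rho> * n) + dist (\<gamma> s + of_real \<rho> * n) (\<gamma> s')"
      by (rule dist_triangle)
    also have "dist (\<gamma> s) (\<gamma> s + of_real \<rho> * n) = \<rho>" using \<rho> nn by (simp add: dist_norm norm_mult)
    finally have "dist (\<gamma> s) (\<gamma> s') < \<delta>" using s' \<rho> by (simp add: \<rho>0_def)
    then obtain x where x: "\<gamma> s' = \<gamma> (s + x)" "\<bar>x\<bar> < 1 / (2 * B)" using \<delta>(2) by blast
    have "\<rho> \<le> norm (\<gamma> (s + x) - (\<gamma> s + of_real \<rho> * n))"
    proof (rule near_curve_disc_bound[OF B _ \<rho>(1) _ n])
      show "\<bar>x\<bar> * B \<le> 1/2" using x(2) B by (simp add: field_simps)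
      have "\<rho> \<le> 1 / (8 * B)" using \<rho> by (simp add: \<rho>0_def)
      then show "8 * B * \<rho> \<le> 1" using B by (simp add: field_simps)
    qed
    then show False using s' x(1) by (simp add: dist_norm norm_minus_commute)
  qed
  ultimately show thesis by (rule that)
qed

text \<open>At a nearest point the squared distance is stationary, so the connecting vector is
  orthogonal to \<gamma>1 and therefore a real multiple of i \<gamma>1. The sign of \<tau> tells the
  side.\<close>

lemma nearest_on_normal:
  obtains s \<tau> where "z = \<gamma> s + of_real \<tau> * (\<i> * \<gamma>1 s)" "\<bar>\<tau>\<bar> = infdist z (range \<gamma>)"
proof -
  obtain y where y: "y \<in> range \<gamma>" "infdist z (range \<gamma>) = dist z y"
    using infdist_attains_inf[OF closed_range, of z] by auto
  then obtain s where s: "y = \<gamma> s" by blast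
  have min: "dist z (\<gamma> s) \<le> dist z (\<gamma> t)" for t
    using infdist_le[of "\<gamma> t" "range \<gamma>" z] y(2) s by simp
  define f where "f = (\<lambda>t. (z - \<gamma> t) \<bullet> (z - \<gamma> t))"
  have fd: "(f has_real_derivative (- 2 * ((z - \<gamma> s) \<bullet> \<gamma>1 s))) (at s)"
  proof -
    have "((\<lambda>t. z - \<gamma> t) has_vector_derivative (0 - \<gamma>1 s)) (at s)"
      by (intro has_vector_derivative_diff has_vector_derivative_const d1)
    then have g: "((\<lambda>t. z - \<gamma> t) has_derivative (\<lambda>h. h *\<^sub>R (- \<gamma>1 s))) (at s)" by (simp add: has_vector_derivative_def)
    have "(f has_derivative (\<lambda>h. (z - \<gamma> s) \<bullet> (h *\<^sub>R (- \<gamma>1 s)) + (h *\<^sub>R (- \<gamma>1 s)) \<bullet> (z - \<gamma> s))) (at s)"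
      unfolding f_def by (rule has_derivative_inner[OF g g])
    moreover have "(\<lambda>h. (z - \<gamma> s) \<bullet> (h *\<^sub>R (- \<gamma>1 s)) + (h *\<^sub>R (- \<gamma>1 s)) \<bullet> (z - \<gamma> s)) = (*) (- 2 * ((z - \<gamma> s) \<bullet> \<gamma>1 s))"
      by (auto simp: fun_eq_iff inner_commute[of "\<gamma>1 s"])
    ultimately show ?thesis by (simp add: has_field_derivative_def)
  qed
  have "f s \<le> f t" for t
    using min[of t] power_mono[OF min[of t], of 2] by (simp add: f_def power2_norm_eq_inner[symmetric] dist_norm)
  then have "- 2 * ((z - \<gamma> s) \<bullet> \<gamma>1 s) = 0" by (intro DERIV_local_min[OF fd, of 1]) auto
  then have 0: "(z - \<gamma> s) \<bullet> \<gamma>1 s = 0" by simp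
  define w where "w = (z - \<gamma> s) * cnj (\<gamma>1 s)"
  have uu: "\<gamma>1 s * cnj (\<gamma>1 s) = 1" using unit[of s] complex_norm_square[of "\<gamma>1 s"] by simp
  have "Re w = 0" using 0 by (simp add: w_def inner_complex_def)
  then have w: "w = \<i> * of_real (Im w)" by (simp add: complex_eq_iff)
  have "w * \<gamma>1 s = z - \<gamma> s" using uu by (simp add: w_def mult.assoc mult.commute[of "cnj _"])
  then have "z = \<gamma> s + of_real (Im w) * (\<i> * \<gamma>1 s)" using w by (metis add.commute diff_add_cancel mult.assoc mult.commute)
  moreover have "\<bar>Im w\<bar> = infdist z (range \<gamma>)"
  proof -
    have "\<bar>Im w\<bar> = norm w" by (subst w) (simp add: norm_mult)
    also have "\<dots> = dist z y" by (simp add: w_def norm_mult unit s dist_norm)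
    finally show ?thesis using y by simp
  qed
  ultimately show thesis by (rule that)
qed

lemma jordan:
  "open (inside (range \<gamma>))" "connected (inside (range \<gamma>))" "open (outside (range \<gamma>))" "connected (outside (range \<gamma>))"
  "bounded (inside (range \<gamma>))" "\<not> bounded (outside (range \<gamma>))"
  "inside (range \<gamma>) \<inter> outside (range \<gamma>) = {}" "inside (range \<gamma>) \<union> outside (range \<gamma>) = - range \<gamma>"
  "frontier (inside (range \<gamma>)) = range \<gamma>" "frontier (outside (range \<gamma>)) = range \<gamma>"
proof -
  define p where "p = (\<lambda>t. \<gamma> (L * t))"
  have img: "path_image p = range \<gamma>"
  proof -
    have "(\<lambda>t. L * t) ` {0..1} = {0..L}" using L image_mult_atLeastAtMost[of L 0 1] by simp
    then show ?thesis unfolding path_image_def p_def range_eq by (metis image_image)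
  qed
  have "simple_path p"
  proof (rule simple_pathI)
    show "path p" unfolding path_def p_def
      by (intro continuous_on_compose2[OF cont0[of UNIV]] continuous_intros) auto
    fix x y :: real assume xy: "0 \<le> x" "x < y" "y \<le> 1" "p x = p y"
    then obtain k :: int where k: "L * x = L * y + of_int k * L" using inj_mod unfolding p_def by blast
    then have "L * x = L * (y + of_int k)" by (simp add: algebra_simps)
    then have "x = y + of_int k" using L by simp
    then have "of_int k < (0::real)" "of_int k \<ge> (-1::real)" using xy by linarith+
    then have "k = -1" by linarith
    then show "x = 0 \<and> y = 1" using \<open>x = y + of_int k\<close> xy by simp
  qed
  moreover have "pathfinish p = pathstart p" using per[of 0] by (simp add: p_def pathfinish_def pathstart_def)
  ultimately have J: "inside(path_image p) \<noteq> {} \<and> open(inside(path_image p)) \<and> connected(inside(path_image p)) \<and>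
          outside(path_image p) \<noteq> {} \<and> open(outside(path_image p)) \<and> connected(outside(path_image p)) \<and>
          bounded(inside(path_image p)) \<and> \<not> bounded(outside(path_image p)) \<and>
          inside(path_image p) \<inter> outside(path_image p) = {} \<and>
          inside(path_image p) \<union> outside(path_image p) = - path_image p \<and>
          frontier(inside(path_image p)) = path_image p \<and> frontier(outside(path_image p)) = path_image p"
    by (rule Jordan_inside_outside)
  show "open (inside (range \<gamma>))" "connected (inside (range \<gamma>))" "open (outside (range \<gamma>))" "connected (outside (range \<gamma>))"
  "bounded (inside (range \<gamma>))" "\<not> bounded (outside (range \<gamma>))"
  "inside (range \<gamma>) \<inter> outside (range \<gamma>) = {}" "inside (range \<gamma>) \<union> outside (range \<gamma>) = - range \<gamma>"
  "frontier (inside (range \<gamma>)) = range \<gamma>" "frontier (outside (range \<gamma>)) = range \<gamma>"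
    using J unfolding img by blast+
qed

text \<open>As i \<gamma>1 is the left normal, this says that the curve runs counterclockwise, and
  at the same time provides one radius for the interior and exterior tangent discs at all
  points.\<close>

definition left_inside :: "real \<Rightarrow> bool" where
  "left_inside \<rho> \<longleftrightarrow> \<rho> > 0 \<and> (\<forall>s r. 0 < r \<longrightarrow> r \<le> \<rho> \<longrightarrow>
     ball (\<gamma> s + of_real r * (\<i> * \<gamma>1 s)) r \<subseteq> inside (range \<gamma>) \<and>
     ball (\<gamma> s - of_real r * (\<i> * \<gamma>1 s)) r \<subseteq> outside (range \<gamma>))"

definition right_inside :: "real \<Rightarrow> bool" where
  "right_inside \<rho> \<longleftrightarrow> \<rho> > 0 \<and> (\<forall>s r. 0 < r \<longrightarrow> r \<le> \<rho> \<longrightarrow>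
     ball (\<gamma> s - of_real r * (\<i> * \<gamma>1 s)) r \<subseteq> inside (range \<gamma>) \<and>
     ball (\<gamma> s + of_real r * (\<i> * \<gamma>1 s)) r \<subseteq> outside (range \<gamma>))"

lemma connected_avoids:
  assumes "connected A" "A \<inter> range \<gamma> = {}" "A \<inter> inside (range \<gamma>) \<noteq> {}"
  shows "A \<subseteq> inside (range \<gamma>)"
proof (rule ccontr)
  assume "\<not> A \<subseteq> inside (range \<gamma>)"
  then have "A \<inter> frontier (inside (range \<gamma>)) \<noteq> {}"
    using connected_Int_frontier[OF assms(1,3)] by blast
  then show False using assms(2) jordan(9) by simp
qed

lemma connected_avoids':
  assumes "connected A" "A \<inter> range \<gamma> = {}" "A \<inter> outside (range \<gamma>) \<noteq> {}"
  shows "A \<subseteq> outside (range \<gamma>)"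
proof (rule ccontr)
  assume "\<not> A \<subseteq> outside (range \<gamma>)"
  then have "A \<inter> frontier (outside (range \<gamma>)) \<noteq> {}"
    using connected_Int_frontier[OF assms(1,3)] by blast
  then show False using assms(2) jordan(10) by simp
qed

text \<open>The two one-sided collars are connected and miss the curve, so each lies in one Jordan
  component. Every point near the curve is in a collar and both components have the curve as
  frontier, so each component contains a collar; a nonempty collar cannot be in both.\<close>

lemma sides:
  obtains \<rho> where "left_inside \<rho> \<or> right_inside \<rho>"
proof -
  obtain \<rho> where \<rho>: "\<rho> > 0" "\<And>r s n. 0 \<le> r \<Longrightarrow> r \<le> \<rho> \<Longrightarrow> n = \<i> * \<gamma>1 s \<or> n = - (\<i> * \<gamma>1 s) \<Longrightarrow> ball (\<gamma> s + of_real r * n) r \<inter> range \<gamma> = {}"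
    using tangent_discs by blast
  \<comment> \<open>e = 1 gives the left collar, e = -1 the right one.\<close>
  define N where "N = (\<lambda>e::complex. (\<lambda>p::real\<times>real. \<gamma> (fst p) + of_real (snd p) * (e * (\<i> * \<gamma>1 (fst p)))) ` (UNIV \<times> {0<..\<rho>}))"
  have Ncon: "connected (N e)" for e unfolding N_def
    by (intro connected_continuous_image connected_Times continuous_intros
        continuous_on_compose2[OF cont0[of UNIV]] continuous_on_compose2[OF cont1[of UNIV]]) auto
  have Ndis: "N e \<inter> range \<gamma> = {}" if e: "e = 1 \<or> e = -1" for e
  proof -
    have "\<gamma> s + of_real r * (e * (\<i> * \<gamma>1 s)) \<notin> range \<gamma>" if "0 < r" "r \<le> \<rho>" for s r
    proof -
      have "ball (\<gamma> s + of_real r * (e * (\<i> * \<gamma>1 s))) r \<inter> range \<gamma> = {}"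
        by (rule \<rho>(2)) (use that e in auto)
      moreover have "\<gamma> s + of_real r * (e * (\<i> * \<gamma>1 s)) \<in> ball (\<gamma> s + of_real r * (e * (\<i> * \<gamma>1 s))) r" using that by simp
      ultimately show ?thesis by blast
    qed
    then show ?thesis unfolding N_def by (auto simp: disjoint_iff) (metis rangeI)
  qed
  have Nmem: "z \<in> N 1 \<union> N (-1)" if z: "z \<notin> range \<gamma>" "infdist z (range \<gamma>) \<le> \<rho>" for z
  proof -
    obtain s \<tau> where st: "z = \<gamma> s + of_real \<tau> * (\<i> * \<gamma>1 s)" "\<bar>\<tau>\<bar> = infdist z (range \<gamma>)" by (rule nearest_on_normal)
    have ne: "\<tau> \<noteq> 0" using st(1) z(1) by auto
    show ?thesis
    proof (cases "\<tau> > 0")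
      case True
      then have "z = \<gamma> (fst (s, \<tau>)) + of_real (snd (s, \<tau>)) * (1 * (\<i> * \<gamma>1 (fst (s, \<tau>))))" "(s, \<tau>) \<in> UNIV \<times> {0<..\<rho>}"
        using st z by auto
      then show ?thesis unfolding N_def by blast
    next
      case False
      have "0 < - \<tau>" "- \<tau> \<le> \<rho>" using st(2) z(2) ne False by linarith+
      moreover have "z = \<gamma> (fst (s, -\<tau>)) + of_real (snd (s, -\<tau>)) * ((-1) * (\<i> * \<gamma>1 (fst (s, -\<tau>))))"
        using st(1) by simp
      ultimately have "z = \<gamma> (fst (s, -\<tau>)) + of_real (snd (s, -\<tau>)) * ((-1) * (\<i> * \<gamma>1 (fst (s, -\<tau>))))" "(s, -\<tau>) \<in> UNIV \<times> {0<..\<rho>}"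
        by auto
      then show ?thesis unfolding N_def by blast
    qed
  qed
  have meet: "\<exists>z. z \<in> S \<and> z \<notin> range \<gamma> \<and> infdist z (range \<gamma>) \<le> \<rho>" if S: "frontier S = range \<gamma>" "S \<inter> range \<gamma> = {}" for S
  proof -
    have "\<gamma> 0 \<in> closure S" using S(1) by (auto simp: frontier_def)
    then obtain z where z: "z \<in> S" "dist z (\<gamma> 0) < \<rho>" using \<rho>(1) closure_approachable by blast
    have "infdist z (range \<gamma>) \<le> dist z (\<gamma> 0)" by (rule infdist_le) simp
    then show ?thesis using z S(2) by (intro exI[of _ z]) auto
  qed
  have i0: "inside (range \<gamma>) \<inter> range \<gamma> = {}" "outside (range \<gamma>) \<inter> range \<gamma> = {}" using jordan(8) by auto
  have in_or: "N 1 \<subseteq> inside (range \<gamma>) \<or> N (-1) \<subseteq> inside (range \<gamma>)"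
  proof -
    obtain z where z: "z \<in> inside (range \<gamma>)" "z \<in> N 1 \<union> N (-1)" using meet[OF jordan(9) i0(1)] Nmem by blast
    then show ?thesis using connected_avoids[OF Ncon Ndis, of 1] connected_avoids[OF Ncon Ndis, of "-1"] by blast
  qed
  have out_or: "N 1 \<subseteq> outside (range \<gamma>) \<or> N (-1) \<subseteq> outside (range \<gamma>)"
  proof -
    obtain z where z: "z \<in> outside (range \<gamma>)" "z \<in> N 1 \<union> N (-1)" using meet[OF jordan(10) i0(2)] Nmem by blast
    then show ?thesis using connected_avoids'[OF Ncon Ndis, of 1] connected_avoids'[OF Ncon Ndis, of "-1"] by blast
  qed
  have Nin: "\<gamma> s + of_real r * (e * (\<i> * \<gamma>1 s)) \<in> N e" if "0 < r" "r \<le> \<rho>" for e s r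
  proof -
    have "(s, r) \<in> UNIV \<times> {0<..\<rho>}" using that by auto
    then show ?thesis unfolding N_def by (metis (no_types, lifting) fst_conv image_eqI snd_conv)
  qed
  have ballin: "ball (\<gamma> s + of_real r * (e * (\<i> * \<gamma>1 s))) r \<subseteq> inside (range \<gamma>)"
    if "N e \<subseteq> inside (range \<gamma>)" "e = 1 \<or> e = -1" "0 < r" "r \<le> \<rho>" for e s r
  proof (rule connected_avoids)
    show "ball (\<gamma> s + of_real r * (e * (\<i> * \<gamma>1 s))) r \<inter> range \<gamma> = {}" by (rule \<rho>(2)) (use that in auto)
    have "\<gamma> s + of_real r * (e * (\<i> * \<gamma>1 s)) \<in> inside (range \<gamma>)" using Nin[OF that(3,4)] that(1) by blast
    moreover have "\<gamma> s + of_real r * (e * (\<i> * \<gamma>1 s)) \<in> ball (\<gamma> s + of_real r * (e * (\<i> * \<gamma>1 s))) r" using that by simp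
    ultimately show "ball (\<gamma> s + of_real r * (e * (\<i> * \<gamma>1 s))) r \<inter> inside (range \<gamma>) \<noteq> {}" by blast
  qed simp
  have ballout: "ball (\<gamma> s + of_real r * (e * (\<i> * \<gamma>1 s))) r \<subseteq> outside (range \<gamma>)"
    if "N e \<subseteq> outside (range \<gamma>)" "e = 1 \<or> e = -1" "0 < r" "r \<le> \<rho>" for e s r
  proof (rule connected_avoids')
    show "ball (\<gamma> s + of_real r * (e * (\<i> * \<gamma>1 s))) r \<inter> range \<gamma> = {}" by (rule \<rho>(2)) (use that in auto)
    have "\<gamma> s + of_real r * (e * (\<i> * \<gamma>1 s)) \<in> outside (range \<gamma>)" using Nin[OF that(3,4)] that(1) by blast
    moreover have "\<gamma> s + of_real r * (e * (\<i> * \<gamma>1 s)) \<in> ball (\<gamma> s + of_real r * (e * (\<i> * \<gamma>1 s))) r" using that by simp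
    ultimately show "ball (\<gamma> s + of_real r * (e * (\<i> * \<gamma>1 s))) r \<inter> outside (range \<gamma>) \<noteq> {}" by blast
  qed simp
  have Nne: "N e \<noteq> {}" for e using Nin[of \<rho> 0 e] \<rho>(1) by auto
  have excl: "\<not> (N e \<subseteq> inside (range \<gamma>) \<and> N e \<subseteq> outside (range \<gamma>))" for e using Nne[of e] jordan(7) by blast
  have "(N 1 \<subseteq> inside (range \<gamma>) \<and> N (-1) \<subseteq> outside (range \<gamma>)) \<or> (N (-1) \<subseteq> inside (range \<gamma>) \<and> N 1 \<subseteq> outside (range \<gamma>))"
    using in_or out_or excl by blast
  then have "left_inside \<rho> \<or> right_inside \<rho>"
  proof
    assume a: "N 1 \<subseteq> inside (range \<gamma>) \<and> N (-1) \<subseteq> outside (range \<gamma>)"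
    have "left_inside \<rho>" unfolding left_inside_def
      using ballin[of 1] ballout[of "-1"] a \<rho>(1) by auto
    then show ?thesis ..
  next
    assume a: "N (-1) \<subseteq> inside (range \<gamma>) \<and> N 1 \<subseteq> outside (range \<gamma>)"
    have "right_inside \<rho>" unfolding right_inside_def
      using ballin[of "-1"] ballout[of 1] a \<rho>(1) by auto
    then show ?thesis ..
  qed
  then show thesis by (rule that)
qed

end

section \<open>Boundary regularity of the map to the annulus\<close>

text \<open>Bernoulli's inequality for 1/(1 + p) = 1 - p/(1 + p). It extracts a linear estimate from
  barriers whose exponent must be an integer for them to be single-valued.\<close>

lemma bernoulli_inverse:
  fixes a p :: real
  assumes p: "p \<ge> 0" and le: "1 \<le> a * (1 + p) ^ m"
  shows "1 - real m * p \<le> a"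
proof -
  have "1 + real m * (- (p / (1 + p))) \<le> (1 + - (p / (1 + p))) ^ m"
    by (rule Bernoulli_inequality) (use p in \<open>simp add: field_simps\<close>)
  also have "1 + - (p / (1 + p)) = 1 / (1 + p)" using p by (simp add: field_simps)
  also have "(1 / (1 + p)) ^ m = 1 / (1 + p) ^ m" by (simp add: power_one_over)
  also have "\<dots> \<le> a"
  proof -
    have "(1 + p) ^ m > 0" using p by (intro zero_less_power) simp
    then show ?thesis using le by (simp add: divide_le_eq)
  qed
  finally have "1 - real m * (p / (1 + p)) \<le> a" by simp
  moreover have "p / (1 + p) \<le> p" using p mult_nonneg_nonneg[OF p p] by (simp add: field_simps)
  then have "real m * (p / (1 + p)) \<le> real m * p" by (intro mult_left_mono) auto
  ultimately show ?thesis by linarith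
qed

text \<open>Isolates the outer end of the domain: the bounded complementary component keeps the
  distance \<delta>0 from the curve, so near the curve \<Omega> is all of the inside.\<close>

locale collar_domain = C3a_curve +
  fixes \<Omega> :: "complex set" and \<rho> \<delta>0 :: real
  assumes left: "left_inside \<rho>"
    and \<Omega>o: "open \<Omega>" and \<Omega>in: "\<Omega> \<subseteq> inside (range \<gamma>)"
    and \<delta>0: "\<delta>0 > 0"
    and collar: "\<And>z. z \<in> inside (range \<gamma>) \<Longrightarrow> infdist z (range \<gamma>) < \<delta>0 \<Longrightarrow> z \<in> \<Omega>"
begin

lemma left_ball: "0 < r \<Longrightarrow> r \<le> \<rho> \<Longrightarrow> ball (\<gamma> s + of_real r * (\<i> * \<gamma>1 s)) r \<subseteq> inside (range \<gamma>)"
  and right_ball: "0 < r \<Longrightarrow> r \<le> \<rho> \<Longrightarrow> ball (\<gamma> s - of_real r * (\<i> * \<gamma>1 s)) r \<subseteq> outside (range \<gamma>)"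
  and \<rho>pos: "\<rho> > 0"
  using left by (auto simp: left_inside_def)

lemma infdist_normal: "infdist (\<gamma> s + of_real t * (\<i> * \<gamma>1 s)) (range \<gamma>) \<le> \<bar>t\<bar>"
proof -
  have "infdist (\<gamma> s + of_real t * (\<i> * \<gamma>1 s)) (range \<gamma>) \<le> dist (\<gamma> s + of_real t * (\<i> * \<gamma>1 s)) (\<gamma> s)"
    by (rule infdist_le) simp
  then show ?thesis by (simp add: dist_norm norm_mult unit)
qed

lemma normal_in: "0 < t \<Longrightarrow> t \<le> \<rho> \<Longrightarrow> t < \<delta>0 \<Longrightarrow> \<gamma> s + of_real t * (\<i> * \<gamma>1 s) \<in> \<Omega>"
  using left_ball[of t s] infdist_normal[of s t] by (intro collar) auto

text \<open>A negative offset would place the point in an exterior tangent disc.\<close>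

lemma collar_normal:
  assumes "z \<in> \<Omega>" "infdist z (range \<gamma>) \<le> \<rho>"
  obtains s where "z = \<gamma> s + of_real (infdist z (range \<gamma>)) * (\<i> * \<gamma>1 s)" "infdist z (range \<gamma>) > 0"
proof -
  obtain s \<tau> where st: "z = \<gamma> s + of_real \<tau> * (\<i> * \<gamma>1 s)" "\<bar>\<tau>\<bar> = infdist z (range \<gamma>)" by (rule nearest_on_normal)
  have zin: "z \<in> inside (range \<gamma>)" using assms \<Omega>in by blast
  then have zn: "z \<notin> range \<gamma>" "z \<notin> outside (range \<gamma>)" using jordan(7,8) by blast+
  have "\<tau> > 0"
  proof (rule ccontr)
    assume "\<not> \<tau> > 0"
    moreover have "\<tau> \<noteq> 0" using st(1) zn(1) by auto
    ultimately have n: "\<tau> < 0" by simp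
    have "z \<in> ball (\<gamma> s - of_real (- \<tau>) * (\<i> * \<gamma>1 s)) (- \<tau>)" using st(1) n by simp
    then show False using right_ball[of "- \<tau>" s] n st(2) assms(2) zn(2) by auto
  qed
  then show thesis using that[of s] st by simp
qed

end

text \<open>\<open>glim\<close> fixes which end of the annulus belongs to the curve: |g| tends to 1
  there, and uniformly.\<close>

locale annular_domain = collar_domain +
  fixes g :: "complex \<Rightarrow> complex" and \<beta> :: real
  assumes \<beta>: "0 < \<beta>" "\<beta> < 1"
    and gh: "g holomorphic_on \<Omega>"
    and gA: "\<And>z. z \<in> \<Omega> \<Longrightarrow> \<beta> < norm (g z) \<and> norm (g z) < 1"
    and glim: "\<And>m. m < 1 \<Longrightarrow> \<exists>\<delta>>0. \<forall>z\<in>\<Omega>. infdist z (range \<gamma>) < \<delta> \<longrightarrow> m < norm (g z)"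
begin

text \<open>The barrier comes from the exterior tangent disc with centre \<open>e\<close>. The
  quotient |z - e| / \<rho>1 is at least 1 on \<Omega>; it equals 2 on the outer circle, where its
  m-th power outweighs |g| > \<beta>; near the curve |g| itself is close to 1. Hence |g| (|z - e| /
  \<rho>1)^m \<ge> 1, and at distance \<open>t\<close> along the normal the second factor is (1 +
  t/\<rho>1)^m. Because \<open>F\<close> is holomorphic, the maximum modulus principle can take the
  place of a comparison of logarithms.\<close>

lemma upper_bound:
  obtains C r1 where "C > 0" "r1 > 0" "\<And>z. z \<in> \<Omega> \<Longrightarrow> infdist z (range \<gamma>) < r1 \<Longrightarrow> 1 - norm (g z) \<le> C * infdist z (range \<gamma>)"
proof -
  define \<rho>1 where "\<rho>1 = min \<rho> (\<delta>0 / 4)"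
  have \<rho>1: "\<rho>1 > 0" "\<rho>1 \<le> \<rho>" "4 * \<rho>1 \<le> \<delta>0" using \<rho>pos \<delta>0 by (auto simp: \<rho>1_def)
  obtain m :: nat where m: "(1/2) ^ m < \<beta>" using real_arch_pow_inv[of \<beta> "1/2"] \<beta> by auto
  have m2: "1 \<le> \<beta> * 2 ^ m" using m by (simp add: power_one_over field_simps)
  have main: "1 - norm (g z) \<le> (real m / \<rho>1) * infdist z (range \<gamma>)" if z: "z \<in> \<Omega>" "infdist z (range \<gamma>) < \<rho>1" for z
  proof -
    define t where "t = infdist z (range \<gamma>)"
    obtain s where s: "z = \<gamma> s + of_real t * (\<i> * \<gamma>1 s)" "t > 0"
      using collar_normal[OF z(1)] z(2) \<rho>1 unfolding t_def by fastforce
    define e where "e = \<gamma> s - of_real \<rho>1 * (\<i> * \<gamma>1 s)"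
    define U where "U = \<Omega> \<inter> ball e (2 * \<rho>1)"
    define F where "F = (\<lambda>z. 1 / (g z * ((z - e) / of_real \<rho>1) ^ m))"
    have far: "norm (y - e) \<ge> \<rho>1" if "y \<in> \<Omega>" for y
    proof (rule ccontr)
      assume "\<not> norm (y - e) \<ge> \<rho>1"
      then have "y \<in> ball e \<rho>1" by (simp add: dist_norm norm_minus_commute)
      then have "y \<in> outside (range \<gamma>)" using right_ball[of \<rho>1 s] \<rho>1 by (auto simp: e_def)
      then show False using that \<Omega>in jordan(7) by blast
    qed
    have Fh: "F holomorphic_on \<Omega>" unfolding F_def
      using far gA \<rho>1 \<beta> by (intro holomorphic_intros gh) fastforce+
    have Fn: "norm (F y) = 1 / (norm (g y) * (norm (y - e) / \<rho>1) ^ m)" for y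
      using \<rho>1 by (simp add: F_def norm_divide norm_mult norm_power)
    have "norm (F z) \<le> 1"
    proof (rule maximum_modulus_limsup[where f=F and U=U])
      show "open U" using \<Omega>o by (auto simp: U_def)
      show "bounded U" by (auto simp: U_def)
      show "F holomorphic_on U" by (rule holomorphic_on_subset[OF Fh]) (auto simp: U_def)
      have "norm (z - e) = t + \<rho>1"
      proof -
        have "z - e = of_real (t + \<rho>1) * (\<i> * \<gamma>1 s)" using s(1) by (simp add: e_def algebra_simps)
        then show ?thesis using s(2) \<rho>1 by (simp add: norm_mult unit del: of_real_add)
      qed
      then show "z \<in> U" using z by (simp add: U_def dist_norm norm_minus_commute t_def)
      fix \<xi> and \<epsilon> :: real assume \<xi>: "\<xi> \<in> frontier U" and \<epsilon>: "\<epsilon> > 0"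
      have \<xi>c: "\<xi> \<in> closure U" using \<xi> by (simp add: frontier_def)
      have \<xi>n: "\<xi> \<notin> U" using \<xi> \<Omega>o by (simp add: frontier_def interior_open U_def)
      have "closure U \<subseteq> cball e (2 * \<rho>1)" by (rule closure_minimal) (auto simp: U_def)
      then have \<xi>b: "\<xi> \<in> cball e (2 * \<rho>1)" using \<xi>c by blast
      show "\<forall>\<^sub>F y in at \<xi> within U. norm (F y) < 1 + \<epsilon>"
      \<comment> \<open>A frontier point of \<open>U\<close> is on the circle of radius 2 \<rho>1 or
        on the curve: the disc stays within 3 \<rho>1 < \<delta>0 of \<gamma> s, so it meets no
        other boundary of \<Omega>.\<close>
      proof (cases "\<xi> \<in> \<Omega>")
        case True
        then have "norm (\<xi> - e) = 2 * \<rho>1" using \<xi>n \<xi>b by (auto simp: U_def dist_norm norm_minus_commute)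
        then have "norm (F \<xi>) = 1 / (norm (g \<xi>) * 2 ^ m)" using Fn[of \<xi>] \<rho>1 by simp
        also have "\<dots> \<le> 1 / 1"
        proof (rule divide_left_mono)
          have "\<beta> * 2 ^ m \<le> norm (g \<xi>) * 2 ^ m" using gA[OF True] by simp
          then show "1 \<le> norm (g \<xi>) * 2 ^ m" using m2 by linarith
          then show "0 < norm (g \<xi>) * 2 ^ m * 1" by linarith
        qed simp
        finally have "norm (F \<xi>) < 1 + \<epsilon>" using \<epsilon> by simp
        moreover have "isCont F \<xi>" using holomorphic_on_imp_continuous_on[OF Fh] True \<Omega>o by (simp add: continuous_on_eq_continuous_at)
        then have "((\<lambda>y. norm (F y)) \<longlongrightarrow> norm (F \<xi>)) (at \<xi> within U)"
          by (intro tendsto_norm) (auto simp: continuous_at intro: tendsto_within_subset)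
        ultimately show ?thesis by (rule order_tendstoD(2)[rotated])
      next
        case False
        have "\<xi> \<in> range \<gamma>"
        proof (rule ccontr)
          assume n: "\<xi> \<notin> range \<gamma>"
          have "\<xi> \<in> closure (inside (range \<gamma>))" using \<xi>c closure_mono[of U "inside (range \<gamma>)"] \<Omega>in by (auto simp: U_def)
          then have "\<xi> \<in> inside (range \<gamma>)" using n jordan(1,9) by (auto simp: frontier_def interior_open)
          moreover have "infdist \<xi> (range \<gamma>) < \<delta>0"
          proof -
            have "infdist \<xi> (range \<gamma>) \<le> dist \<xi> (\<gamma> s)" by (rule infdist_le) simp
            also have "\<dots> \<le> dist \<xi> e + dist e (\<gamma> s)" by (rule dist_triangle)
            also have "dist e (\<gamma> s) = \<rho>1" using \<rho>1 by (simp add: e_def dist_norm norm_mult unit)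
            finally show ?thesis using \<xi>b \<rho>1 by (simp add: dist_commute)
          qed
          ultimately show False using collar False by blast
        qed
        obtain \<delta> where \<delta>: "\<delta> > 0" "\<And>y. y \<in> \<Omega> \<Longrightarrow> infdist y (range \<gamma>) < \<delta> \<Longrightarrow> 1 / (1 + \<epsilon>) < norm (g y)"
          using glim[of "1 / (1 + \<epsilon>)"] \<epsilon> by auto
        have "norm (F y) < 1 + \<epsilon>" if y: "y \<in> U" "dist y \<xi> < \<delta>" for y
        proof -
          have "infdist y (range \<gamma>) \<le> dist y \<xi>" using \<open>\<xi> \<in> range \<gamma>\<close> by (rule infdist_le)
          then have gy: "1 / (1 + \<epsilon>) < norm (g y)" using \<delta>(2)[of y] y by (auto simp: U_def)
          have "(norm (y - e) / \<rho>1) ^ m \<ge> 1" using far[of y] y \<rho>1 by (intro one_le_power) (auto simp: U_def)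
          then have "norm (g y) * 1 \<le> norm (g y) * (norm (y - e) / \<rho>1) ^ m" by (intro mult_left_mono) auto
          then have "1 / (1 + \<epsilon>) < norm (g y) * (norm (y - e) / \<rho>1) ^ m" using gy by linarith
          moreover have "1 / D < 1 + \<epsilon>" if "1 / (1 + \<epsilon>) < D" for D
          proof -
            have "0 < 1 / (1 + \<epsilon>)" using \<epsilon> by simp
            then have "D > 0" using that by linarith
            then show ?thesis using that \<epsilon> by (simp add: field_simps)
          qed
          ultimately show ?thesis unfolding Fn by blast
        qed
        then show ?thesis unfolding eventually_at using \<delta>(1) by (intro exI[of _ \<delta>]) auto
      qed
    qed
    moreover have "norm (z - e) / \<rho>1 = 1 + t / \<rho>1"
    proof -
      have "z - e = of_real (t + \<rho>1) * (\<i> * \<gamma>1 s)" using s(1) by (simp add: e_def algebra_simps)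
      then have "norm (z - e) = t + \<rho>1" using s(2) \<rho>1 by (simp add: norm_mult unit del: of_real_add)
      then show ?thesis using \<rho>1 by (simp add: field_simps)
    qed
    ultimately have le1: "1 / (norm (g z) * (1 + t / \<rho>1) ^ m) \<le> 1" unfolding Fn by simp
    have tp: "t / \<rho>1 \<ge> 0" using s(2) \<rho>1 by simp
    have "norm (g z) * (1 + t / \<rho>1) ^ m > 0"
      using gA[OF z(1)] \<beta> tp by (intro mult_pos_pos zero_less_power) auto
    then have le: "1 \<le> norm (g z) * (1 + t / \<rho>1) ^ m" using le1 by (simp add: divide_le_eq_1_pos)
    have "1 - real m * (t / \<rho>1) \<le> norm (g z)" by (rule bernoulli_inverse[OF tp le])
    then show ?thesis by (simp add: t_def)
  qed
  show thesis
  proof (rule that[of "real m / \<rho>1 + 1" \<rho>1])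
    show "1 - norm (g z) \<le> (real m / \<rho>1 + 1) * infdist z (range \<gamma>)" if "z \<in> \<Omega>" "infdist z (range \<gamma>) < \<rho>1" for z
      using main[OF that] infdist_nonneg[of z "range \<gamma>"] by (simp add: distrib_right)
  qed (use \<rho>1 in \<open>auto intro: add_nonneg_pos\<close>)
qed

text \<open>Hopf's boundary point lemma on the interior tangent disc. On the ring between the radii
  \<rho>2/2 and \<rho>2 the function g^m \<rho>2 / (y - e) has modulus at most 1, because
  \<open>m\<close> is chosen with |g|^m < 1/2 on the inner circle. The constant may vary with
  \<open>s\<close>; it will give the positivity of a normal derivative at each single point.\<close>

lemma hopf:
  obtains c r1 where "c > 0" "r1 > 0" "\<And>t. 0 < t \<Longrightarrow> t < r1 \<Longrightarrow> 1 - norm (g (\<gamma> s + of_real t * (\<i> * \<gamma>1 s))) \<ge> c * t"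
proof -
  define \<rho>2 where "\<rho>2 = min \<rho> (\<delta>0 / 3)"
  have \<rho>2: "\<rho>2 > 0" "\<rho>2 \<le> \<rho>" "3 * \<rho>2 \<le> \<delta>0" using \<rho>pos \<delta>0 by (auto simp: \<rho>2_def)
  define e where "e = \<gamma> s + of_real \<rho>2 * (\<i> * \<gamma>1 s)"
  have sub: "ball e \<rho>2 \<subseteq> \<Omega>"
  proof
    fix y assume y: "y \<in> ball e \<rho>2"
    have "infdist y (range \<gamma>) \<le> dist y (\<gamma> s)" by (rule infdist_le) simp
    also have "\<dots> \<le> dist y e + dist e (\<gamma> s)" by (rule dist_triangle)
    also have "dist e (\<gamma> s) = \<rho>2" using \<rho>2 by (simp add: e_def dist_norm norm_mult unit)
    finally have "infdist y (range \<gamma>) < \<delta>0" using y \<rho>2 by (simp add: dist_commute)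
    then show "y \<in> \<Omega>" using y left_ball[of \<rho>2 s] \<rho>2 by (intro collar) (auto simp: e_def)
  qed
  have sph: "sphere e (\<rho>2/2) \<subseteq> \<Omega>" using sub \<rho>2 by auto
  have "continuous_on (sphere e (\<rho>2/2)) (\<lambda>y. norm (g y))"
    by (intro continuous_intros continuous_on_subset[OF holomorphic_on_imp_continuous_on[OF gh] sph])
  moreover have "sphere e (\<rho>2/2) \<noteq> {}" using \<rho>2 by simp
  ultimately obtain y0 where y0: "y0 \<in> sphere e (\<rho>2/2)" "\<And>y. y \<in> sphere e (\<rho>2/2) \<Longrightarrow> norm (g y) \<le> norm (g y0)"
    using continuous_attains_sup[OF compact_sphere, of e "\<rho>2/2" "\<lambda>y. norm (g y)"] by auto
  have "norm (g y0) < 1" using gA y0(1) sph by blast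
  then obtain m :: nat where m: "norm (g y0) ^ m < 1/2" using real_arch_pow_inv[of "1/2" "norm (g y0)"] by auto
  have m0: "m > 0" using m by (cases m) auto
  define U where "U = ball e \<rho>2 - cball e (\<rho>2/2)"
  define F where "F = (\<lambda>y. g y ^ m * (of_real \<rho>2 / (y - e)))"
  have Fn: "norm (F y) = norm (g y) ^ m * (\<rho>2 / norm (y - e))" for y
    using \<rho>2 by (simp add: F_def norm_mult norm_divide norm_power)
  have Fh: "F holomorphic_on \<Omega> - {e}" unfolding F_def
    by (intro holomorphic_intros holomorphic_on_subset[OF gh]) auto
  have "1 - norm (g (\<gamma> s + of_real t * (\<i> * \<gamma>1 s))) \<ge> 1 / (real m * \<rho>2) * t" if t: "0 < t" "t < \<rho>2 / 2" for t
  proof -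
    define z where "z = \<gamma> s + of_real t * (\<i> * \<gamma>1 s)"
    have "z - e = of_real (t - \<rho>2) * (\<i> * \<gamma>1 s)" by (simp add: z_def e_def algebra_simps)
    then have ze: "norm (z - e) = \<rho>2 - t" using t \<rho>2 by (simp add: norm_mult unit del: of_real_diff)
    have zU: "z \<in> U" using ze t by (simp add: U_def dist_norm norm_minus_commute)
    have "norm (F z) \<le> 1"
    proof (rule maximum_modulus_limsup[where f=F and U=U])
      show "open U" "bounded U" by (auto simp: U_def)
      show "F holomorphic_on U" by (rule holomorphic_on_subset[OF Fh]) (use sub \<rho>2 in \<open>auto simp: U_def\<close>)
      show "z \<in> U" by (rule zU)
      fix \<xi> and \<epsilon> :: real assume \<xi>: "\<xi> \<in> frontier U" and \<epsilon>: "\<epsilon> > 0"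
      have oU: "open U" by (auto simp: U_def)
      have \<xi>n: "\<xi> \<notin> U" using \<xi> oU by (simp add: frontier_def interior_open)
      have "closure U \<subseteq> cball e \<rho>2 \<inter> - ball e (\<rho>2/2)"
        by (rule closure_minimal) (auto simp: U_def intro!: closed_Int)
      then have \<xi>b: "dist e \<xi> \<le> \<rho>2" "dist e \<xi> \<ge> \<rho>2/2" using \<xi> by (auto simp: frontier_def)
      show "\<forall>\<^sub>F y in at \<xi> within U. norm (F y) < 1 + \<epsilon>"
      proof (cases "dist e \<xi> < \<rho>2")
        case True
        then have \<xi>s: "\<xi> \<in> sphere e (\<rho>2/2)" using \<xi>n \<xi>b by (auto simp: U_def)
        have "norm (F \<xi>) \<le> norm (g y0) ^ m * (\<rho>2 / (\<rho>2/2))"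
        proof -
          have eq: "norm (\<xi> - e) = \<rho>2/2" using \<xi>s by (simp add: dist_norm norm_minus_commute)
          show ?thesis unfolding Fn eq using y0(2)[OF \<xi>s] \<rho>2 by (intro mult_right_mono power_mono) auto
        qed
        also have "\<dots> \<le> 1" using m \<rho>2 by simp
        finally have "norm (F \<xi>) < 1 + \<epsilon>" using \<epsilon> by simp
        moreover have "isCont F \<xi>"
        proof -
          have "\<xi> \<in> \<Omega> - {e}" using \<xi>s sph \<rho>2 by auto
          moreover have "open (\<Omega> - {e})" using \<Omega>o by auto
          ultimately show ?thesis using holomorphic_on_imp_continuous_on[OF Fh] by (simp add: continuous_on_eq_continuous_at)
        qed
        then have "((\<lambda>y. norm (F y)) \<longlongrightarrow> norm (F \<xi>)) (at \<xi> within U)"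
          by (intro tendsto_norm) (auto simp: continuous_at intro: tendsto_within_subset)
        ultimately show ?thesis by (rule order_tendstoD(2)[rotated])
      next
        case False
        then have d\<xi>: "norm (\<xi> - e) = \<rho>2" using \<xi>b by (simp add: dist_norm norm_minus_commute)
        have "((\<lambda>y. \<rho>2 / norm (y - e)) \<longlongrightarrow> \<rho>2 / norm (\<xi> - e)) (at \<xi> within U)"
          using d\<xi> \<rho>2 by (intro tendsto_intros) auto
        then have ev: "\<forall>\<^sub>F y in at \<xi> within U. \<rho>2 / norm (y - e) < 1 + \<epsilon>"
          using d\<xi> \<rho>2 \<epsilon> by (intro order_tendstoD(2)) auto
        have "\<forall>\<^sub>F y in at \<xi> within U. y \<in> U" by (simp add: eventually_at_filter)
        with ev show ?thesis
        proof eventually_elim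
          case (elim y)
          have "y \<in> \<Omega>" using elim(2) sub by (auto simp: U_def)
          then have "norm (g y) ^ m \<le> 1" using gA[of y] by (intro power_le_one) auto
          then have "norm (F y) \<le> 1 * (\<rho>2 / norm (y - e))" unfolding Fn using \<rho>2 by (intro mult_right_mono) auto
          then show ?case using elim(1) by simp
        qed
      qed
    qed
    then have "norm (g z) ^ m \<le> (\<rho>2 - t) / \<rho>2" unfolding Fn ze using t \<rho>2 by (simp add: field_simps)
    moreover have "1 + real m * (norm (g z) - 1) \<le> (1 + (norm (g z) - 1)) ^ m"
      by (rule Bernoulli_inequality) simp
    ultimately have "1 + real m * (norm (g z) - 1) \<le> (\<rho>2 - t) / \<rho>2" by simp
    also have "\<dots> = 1 - t / \<rho>2" using \<rho>2 by (simp add: field_simps)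
    finally have "t / \<rho>2 \<le> real m * (1 - norm (g z))" by (simp add: algebra_simps)
    then have "t / \<rho>2 / real m \<le> real m * (1 - norm (g z)) / real m" by (intro divide_right_mono) auto
    then have "t / \<rho>2 / real m \<le> 1 - norm (g z)" using m0 by simp
    then show ?thesis by (simp add: z_def mult.commute)
  qed
  moreover have "1 / (real m * \<rho>2) > 0" using m0 \<rho>2 by simp
  moreover have "\<rho>2 / 2 > 0" using \<rho>2 by simp
  ultimately show thesis using that by blast
qed

end

text \<open>A perturbation of the identity on the upper half plane that lifts the real axis by a multiple of
  \<open>|x| powr (3 + \<alpha>)\<close>: the branch is chosen so that both half axes are lifted.\<close>
definition lift_map :: "real \<Rightarrow> real \<Rightarrow> complex \<Rightarrow> complex" where
  "lift_map \<alpha> K \<zeta> = \<zeta> + \<i> * of_real K * ((- \<i> * \<zeta>) powr of_real (3 + \<alpha>))"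

lemma norm_powr_real: "z \<noteq> 0 \<Longrightarrow> norm (z powr complex_of_real x) = norm z powr x"
  by (simp add: powr_def)

lemma lift_map_near:
  assumes "K \<ge> 0" "\<zeta> \<noteq> 0"
  shows "norm (lift_map \<alpha> K \<zeta> - \<zeta>) = K * norm \<zeta> powr (3 + \<alpha>)"
  using assms norm_powr_real[of "- \<i> * \<zeta>" "3 + \<alpha>"] by (simp add: lift_map_def norm_mult)

text \<open>Write - i \<zeta> = |\<zeta>| e^(i \<theta>) with |\<theta>| \<le> \<pi>/2. The lift
  adds K |\<zeta>|^(3 + \<alpha>) cos ((3 + \<alpha>) \<theta>) to the imaginary part. At \<theta> =
  \<pi>/2 the angle has passed three quarter turns and the cosine is sin (\<alpha> \<pi>/2) > 0, and
  likewise at - \<pi>/2. Near the axis this persists; elsewhere the cosine may be negative, but Im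
  \<zeta> is comparable to |\<zeta>| and dominates.\<close>

lemma lift_map_Im:
  assumes \<alpha>: "0 < \<alpha>" "\<alpha> < 1" and K: "K > 0" and \<zeta>: "\<zeta> \<noteq> 0" "Im \<zeta> \<ge> 0" "norm \<zeta> \<le> 1"
    and small: "2 * K * norm \<zeta> \<le> sin (\<alpha> * pi / 16)"
  shows "Im (lift_map \<alpha> K \<zeta>) \<ge> K * sin (\<alpha> * pi / 4) * norm \<zeta> powr (3 + \<alpha>)"
proof -
  define a where "a = - \<i> * \<zeta>"
  define \<theta> where "\<theta> = Im (Ln a)"
  define P where "P = norm \<zeta> powr (3 + \<alpha>)"
  have P0: "P \<ge> 0" by (simp add: P_def)
  have a0: "a \<noteq> 0" "Re a = Im \<zeta>" "norm a = norm \<zeta>" using \<zeta> by (auto simp: a_def norm_mult)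
  have ea: "exp (Ln a) = a" using a0 by simp
  have Rea: "Re a = norm \<zeta> * cos \<theta>"
    using Re_exp[of "Ln a"] a0 \<zeta>(1) by (simp add: \<theta>_def)
  have th: "\<bar>\<theta>\<bar> \<le> pi / 2" unfolding \<theta>_def using a0 \<zeta> by (intro Re_Ln_pos_le[THEN iffD2]) auto
  have p: "a powr of_real (3 + \<alpha>) = exp (of_real (3 + \<alpha>) * Ln a)" using a0 by (simp add: powr_def)
  have "Re (a powr of_real (3 + \<alpha>)) = exp ((3 + \<alpha>) * ln (norm \<zeta>)) * cos ((3 + \<alpha>) * \<theta>)"
    unfolding p using a0 by (simp add: Re_exp \<theta>_def del: of_real_add)
  also have "exp ((3 + \<alpha>) * ln (norm \<zeta>)) = P" using \<zeta> by (simp add: P_def powr_def)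
  finally have Rep: "Re (a powr of_real (3 + \<alpha>)) = P * cos ((3 + \<alpha>) * \<theta>)" .
  have Imq: "Im (lift_map \<alpha> K \<zeta>) = Im \<zeta> + K * (P * cos ((3 + \<alpha>) * \<theta>))"
    unfolding lift_map_def a_def[symmetric] using Rep by (simp add: mult.assoc)
  have api: "0 < \<alpha> * pi" "\<alpha> * pi < pi" using \<alpha> by auto
  show ?thesis
  \<comment> \<open>Multiplied by 3 + \<alpha> < 4, the margin \<alpha> \<pi>/16 becomes at most
    \<alpha> \<pi>/4, so of the excess \<alpha> \<pi>/2 over three quarter turns at least \<alpha>
    \<pi>/4 is left.\<close>
  proof (cases "\<bar>\<theta>\<bar> \<ge> pi / 2 - \<alpha> * pi / 16")
    case True
    define \<phi> where "\<phi> = (3 + \<alpha>) * \<bar>\<theta>\<bar> - 3 * pi / 2"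
    have c: "cos ((3 + \<alpha>) * \<theta>) = cos ((3 + \<alpha>) * \<bar>\<theta>\<bar>)" using cos_minus[of "(3 + \<alpha>) * \<theta>"]
      by (cases "\<theta> \<ge> 0") (auto simp: abs_if)
    also have "(3 + \<alpha>) * \<bar>\<theta>\<bar> = \<phi> + 3 * pi / 2" by (simp add: \<phi>_def)
    also have "cos (\<phi> + 3 * pi / 2) = sin \<phi>"
    proof -
      have "cos (\<phi> + 3 * pi / 2) = cos ((\<phi> + pi / 2) + pi)" by (simp add: field_simps)
      also have "\<dots> = - cos (\<phi> + pi / 2)" by (rule cos_periodic_pi)
      also have "\<dots> = sin \<phi>" using minus_sin_cos_eq[of \<phi>] by simp
      finally show ?thesis .
    qed
    finally have cs: "cos ((3 + \<alpha>) * \<theta>) = sin \<phi>" .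
    have u: "(3 + \<alpha>) * \<bar>\<theta>\<bar> \<le> (3 + \<alpha>) * (pi / 2)" using th \<alpha> by (intro mult_left_mono) auto
    have l: "(3 + \<alpha>) * \<bar>\<theta>\<bar> \<ge> (3 + \<alpha>) * (pi / 2 - \<alpha> * pi / 16)" using True \<alpha> by (intro mult_left_mono) auto
    have "(3 + \<alpha>) * (\<alpha> * pi / 16) \<le> 4 * (\<alpha> * pi / 16)" using \<alpha> by (intro mult_right_mono) auto
    moreover have e1: "(3 + \<alpha>) * (pi / 2 - \<alpha> * pi / 16) = (3 + \<alpha>) * (pi / 2) - (3 + \<alpha>) * (\<alpha> * pi / 16)"
      by (rule right_diff_distrib)
    moreover have e2: "(3 + \<alpha>) * (pi / 2) = 3 * pi / 2 + \<alpha> * pi / 2" by (simp add: distrib_right)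
    ultimately have l2: "\<phi> \<ge> \<alpha> * pi / 4" using l unfolding \<phi>_def by linarith
    have u2: "\<phi> \<le> pi / 2" using u api e2 unfolding \<phi>_def by linarith
    have "sin (\<alpha> * pi / 4) \<le> sin \<phi>"
      using l2 u2 api by (intro sin_monotone_2pi_le) auto
    then have "K * (P * sin (\<alpha> * pi / 4)) \<le> K * (P * cos ((3 + \<alpha>) * \<theta>))"
      unfolding cs using K P0 by (intro mult_left_mono) auto
    then show ?thesis unfolding Imq P_def[symmetric] using \<zeta>(2) by (simp add: mult_ac)
  next
    case False
    have "cos \<theta> = cos \<bar>\<theta>\<bar>" by (simp add: abs_if)
    also have "\<dots> \<ge> cos (pi / 2 - \<alpha> * pi / 16)" using False api by (intro cos_monotone_0_pi_le) auto
    also have "cos (pi / 2 - \<alpha> * pi / 16) = sin (\<alpha> * pi / 16)" by (simp add: cos_diff)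
    finally have "norm \<zeta> * sin (\<alpha> * pi / 16) \<le> Im \<zeta>" using Rea a0(2) \<zeta> by (metis mult_left_mono norm_ge_zero)
    moreover have "norm \<zeta> * (2 * K * norm \<zeta>) \<le> norm \<zeta> * sin (\<alpha> * pi / 16)" using small by (intro mult_left_mono) auto
    moreover have "P \<le> norm \<zeta> * norm \<zeta>"
    proof -
      have "P \<le> norm \<zeta> powr 2" unfolding P_def using \<zeta> \<alpha> by (intro powr_mono') auto
      then show ?thesis using \<zeta> by (simp add: power2_eq_square)
    qed
    then have "2 * K * P \<le> 2 * K * (norm \<zeta> * norm \<zeta>)" using K by (intro mult_left_mono) auto
    ultimately have 1: "2 * K * P \<le> Im \<zeta>" by (simp add: mult_ac)
    have "K * (P * (-1)) \<le> K * (P * cos ((3 + \<alpha>) * \<theta>))" using K P0 by (intro mult_left_mono) auto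
    moreover have "K * P * sin (\<alpha> * pi / 4) \<le> K * P * 1" using K P0 by (intro mult_left_mono) auto
    ultimately show ?thesis unfolding Imq P_def[symmetric] using 1 by (simp add: mult_ac)
  qed
qed

lemma lift_map_holomorphic: "lift_map \<alpha> K holomorphic_on {\<zeta>. - \<i> * \<zeta> \<notin> \<real>\<^sub>\<le>\<^sub>0}"
  unfolding lift_map_def by (intro holomorphic_intros) auto

lemma open_lift_domain: "open {\<zeta>. - \<i> * \<zeta> \<notin> \<real>\<^sub>\<le>\<^sub>0}"
proof -
  have "{\<zeta>. - \<i> * \<zeta> \<notin> \<real>\<^sub>\<le>\<^sub>0} = (\<lambda>\<zeta>. - \<i> * \<zeta>) -` (- \<real>\<^sub>\<le>\<^sub>0)" by auto
  also have "open \<dots>" by (intro open_vimage continuous_intros) (simp add: open_Compl)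
  finally show ?thesis .
qed

lemma upper_in_lift_domain:
  assumes "Im \<zeta> \<ge> 0" "\<zeta> \<noteq> 0"
  shows "- \<i> * \<zeta> \<notin> \<real>\<^sub>\<le>\<^sub>0"
proof
  assume "- \<i> * \<zeta> \<in> \<real>\<^sub>\<le>\<^sub>0"
  then obtain x where "- \<i> * \<zeta> = of_real x" "x \<le> 0" by (auto simp: nonpos_Reals_def)
  then have "\<zeta> = \<i> * of_real x" by (metis minus_mult_left minus_minus mult.assoc mult_minus_right i_squared mult_1 power2_eq_square)
  then show False using assms \<open>x \<le> 0\<close> by auto
qed

section \<open>Half disc charts along the curve\<close>

context C3a_curve begin

text \<open>The difference quotient is \<gamma>1 s, of norm 1, plus a remainder of norm at most
  1/2.\<close>

lemma taylor_bilipschitz: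
  assumes B: "B > 0" "\<And>s. norm (\<gamma>2 s) \<le> B" "\<And>s. norm (\<gamma>3 s) \<le> B"
    and e: "e \<le> 1" "4 * B * e \<le> 1" and ab: "norm a \<le> e" "norm b \<le> e"
  shows "norm (taylor s a - taylor s b) \<ge> norm (a - b) / 2" "norm (taylor s a - taylor s b) \<le> 2 * norm (a - b)"
proof -
  define R where "R = \<gamma>2 s / 2 * (a + b) + \<gamma>3 s / 6 * (a\<^sup>2 + a * b + b\<^sup>2)"
  have e0: "e \<ge> 0" using ab norm_ge_zero order_trans by blast
  have n2: "norm (\<gamma>2 s / 2) \<le> B / 2" "norm (\<gamma>3 s / 6) \<le> B / 6" using B(2)[of s] B(3)[of s] by (auto simp: norm_divide)
  have p1: "norm (a + b) \<le> 2 * e" using norm_triangle_ineq[of a b] ab by linarith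
  have "norm (a\<^sup>2 + a * b + b\<^sup>2) \<le> norm a * norm a + norm a * norm b + norm b * norm b"
    by (simp add: power2_eq_square norm_mult[symmetric]) (meson norm_triangle_ineq norm_triangle_le add_right_mono order_trans)
  also have "\<dots> \<le> e * e + e * e + e * e" using ab e0 by (intro add_mono mult_mono) auto
  also have "\<dots> \<le> 3 * e" using mult_left_mono[OF e(1) e0] by simp
  finally have p2: "norm (a\<^sup>2 + a * b + b\<^sup>2) \<le> 3 * e" .
  have "norm R \<le> norm (\<gamma>2 s / 2 * (a + b)) + norm (\<gamma>3 s / 6 * (a\<^sup>2 + a * b + b\<^sup>2))" unfolding R_def by (rule norm_triangle_ineq)
  also have "\<dots> \<le> B / 2 * (2 * e) + B / 6 * (3 * e)" unfolding norm_mult[of "\<gamma>2 s / 2"] norm_mult[of "\<gamma>3 s / 6"]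
    using n2 p1 p2 B(1) by (intro add_mono mult_mono) auto
  finally have R: "norm R \<le> 1/2" using e(2) B(1) by (simp add: field_simps)
  have eq: "taylor s a - taylor s b = (a - b) * (\<gamma>1 s + R)"
    by (simp add: taylor_def R_def algebra_simps power2_eq_square power3_eq_cube diff_divide_distrib)
  have "norm (\<gamma>1 s + R) \<ge> 1/2" using norm_triangle_ineq2[of "\<gamma>1 s" "- R"] unit[of s] R by simp
  then show "norm (taylor s a - taylor s b) \<ge> norm (a - b) / 2"
    unfolding eq norm_mult using mult_left_mono[of "1/2" "norm (\<gamma>1 s + R)" "norm (a - b)"] by simp
  have "norm (\<gamma>1 s + R) \<le> 2" using norm_triangle_ineq[of "\<gamma>1 s" R] unit[of s] R by simp
  then show "norm (taylor s a - taylor s b) \<le> 2 * norm (a - b)"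
    unfolding eq norm_mult using mult_left_mono[of "norm (\<gamma>1 s + R)" 2 "norm (a - b)"] by simp
qed

lemma taylor_0: "taylor s 0 = \<gamma> s"
  by (simp add: taylor_def)

end

context annular_domain begin

text \<open>If a chart value were a curve point \<gamma> (s + x), then the lifted argument would be
  within 2 M |x|^(3 + \<alpha>) of the real number x, whereas its imaginary part is at least K sin
  (\<alpha> \<pi>/4) |\<zeta>|^(3 + \<alpha>). For large \<open>K\<close> this is impossible. So the
  image avoids the curve, and by connectedness it is inside as soon as one of its points is.\<close>

lemma half_disc_map:
  assumes \<eta>: "\<eta> > 0"
  obtains r K C where "0 < r" "r \<le> 1" "0 < K" "4 * K * r \<le> 1" "0 < C"
    "\<And>s \<zeta>. Im \<zeta> \<ge> 0 \<Longrightarrow> \<zeta> \<noteq> 0 \<Longrightarrow> norm \<zeta> \<le> r \<Longrightarrow> taylor s (lift_map \<alpha> K \<zeta>) \<in> \<Omega>"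
    "\<And>s \<zeta>. Im \<zeta> \<ge> 0 \<Longrightarrow> \<zeta> \<noteq> 0 \<Longrightarrow> norm \<zeta> \<le> r \<Longrightarrow> infdist (taylor s (lift_map \<alpha> K \<zeta>)) (range \<gamma>) < \<eta>"
    "\<And>s x. x \<noteq> 0 \<Longrightarrow> \<bar>x\<bar> \<le> r \<Longrightarrow> infdist (taylor s (lift_map \<alpha> K (of_real x))) (range \<gamma>) \<le> C * \<bar>x\<bar> powr (3 + \<alpha>)"
proof -
  obtain B2 where B2: "B2 > 0" "\<And>s. norm (\<gamma>2 s) \<le> B2" using periodic_bounded[OF L per2 cont2] by blast
  obtain B3 where B3: "B3 > 0" "\<And>s. norm (\<gamma>3 s) \<le> B3" using periodic_bounded[OF L per3 cont3] by blast
  define B where "B = max B2 B3"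
  have B: "B > 0" "\<And>s. norm (\<gamma>2 s) \<le> B" "\<And>s. norm (\<gamma>3 s) \<le> B"
    using B2 B3 by (auto simp: B_def le_max_iff_disj)
  define e where "e = min 1 (1 / (4 * B))"
  have e: "0 < e" "e \<le> 1" "4 * B * e \<le> 1"
  proof -
    show "0 < e" "e \<le> 1" using B by (auto simp: e_def)
    have "e \<le> 1 / (4 * B)" by (simp add: e_def)
    then show "4 * B * e \<le> 1" using B by (simp add: field_simps)
  qed
  note bl = taylor_bilipschitz[OF B e(2,3)]
  define \<epsilon>1 where "\<epsilon>1 = min e (1 / (4 * M + 4))"
  have \<epsilon>1: "0 < \<epsilon>1" "\<epsilon>1 \<le> e" "2 * M * \<epsilon>1 \<le> 1/2"
  proof -
    show "0 < \<epsilon>1" "\<epsilon>1 \<le> e" using e M_nonneg by (auto simp: \<epsilon>1_def)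
    have "\<epsilon>1 \<le> 1 / (4 * M + 4)" by (simp add: \<epsilon>1_def)
    then have "2 * M * \<epsilon>1 \<le> 2 * M * (1 / (4 * M + 4))" using M_nonneg by (intro mult_left_mono) auto
    also have "\<dots> \<le> 1/2" using M_nonneg by (simp add: field_simps)
    finally show "2 * M * \<epsilon>1 \<le> 1/2" .
  qed
  obtain \<delta> where \<delta>: "\<delta> > 0" "\<And>s s'. dist (\<gamma> s) (\<gamma> s') < \<delta> \<Longrightarrow> \<exists>x. \<gamma> s' = \<gamma> (s + x) \<and> \<bar>x\<bar> < \<epsilon>1"
    using injectivity_modulus[OF \<epsilon>1(1)] by blast
  define \<kappa>1 where "\<kappa>1 = sin (\<alpha> * pi / 4)"
  define \<kappa>2 where "\<kappa>2 = sin (\<alpha> * pi / 16)"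
  have "\<alpha> * pi < pi" "0 < \<alpha> * pi" using \<alpha> by auto
  then have \<kappa>: "\<kappa>1 > 0" "\<kappa>2 > 0" unfolding \<kappa>1_def \<kappa>2_def by (auto intro!: sin_gt_zero)
  \<comment> \<open>512 = 2 * 4^4: the factor 2 comes from the lower bilipschitz constant, and |x|
    \<le> 4 |\<zeta>| gives 4^(3 + \<alpha>) \<le> 4^4. The added 1 makes the contradiction strict
    and keeps \<open>K\<close> positive.\<close>
  define K where "K = (512 * M + 1) / \<kappa>1"
  have K: "K > 0" "K * \<kappa>1 = 512 * M + 1" using \<kappa> M_nonneg by (auto simp: K_def)
  \<comment> \<open>One entry for each smallness condition on \<open>r\<close>: the estimate of the
    lift, the Taylor estimates, the injectivity modulus, \<eta>, the collar and the tangent disc.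
    None of them depends on the base point.\<close>
  define A where "A = {1, \<kappa>2 / (2 * K), 1 / (4 * K), e / 4, \<delta> / 8, \<eta> / 8, \<delta>0 / 8, \<rho>, 1 / (2 * (2 * K + B))}"
  define r where "r = Min A"
  have Ap: "finite A" "A \<noteq> {}" "\<And>x. x \<in> A \<Longrightarrow> x > 0"
    using \<kappa> K e \<delta> \<eta> \<delta>0 \<rho>pos B by (auto simp: A_def)
  have rA: "r \<le> x" if "x \<in> A" for x using that Ap by (simp add: r_def)
  have r0: "r > 0" unfolding r_def using Ap by (subst Min_gr_iff) auto
  have r1: "r \<le> 1" "r \<le> \<kappa>2 / (2 * K)" "r \<le> 1 / (4 * K)" "r \<le> e / 4" "r \<le> \<delta> / 8" "r \<le> \<eta> / 8" "r \<le> \<delta>0 / 8" "r \<le> \<rho>" "r \<le> 1 / (2 * (2 * K + B))"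
    by (rule rA, simp add: A_def)+
  have r2: "2 * K * r \<le> \<kappa>2" "4 * K * r \<le> 1" "2 * (2 * K + B) * r \<le> 1"
    using r1(2,3,9) K B by (auto simp: field_simps)
  define C where "C = 2 * K + M"
  have C: "C > 0" using K M_nonneg by (simp add: C_def)
  have near: "norm (lift_map \<alpha> K \<zeta> - \<zeta>) = K * norm \<zeta> powr (3 + \<alpha>)" if "\<zeta> \<noteq> 0" for \<zeta>
    using lift_map_near[of K \<zeta> \<alpha>] K that by simp
  have pw: "norm \<zeta> powr (3 + \<alpha>) \<le> (norm \<zeta>)\<^sup>2" "norm \<zeta> powr (3 + \<alpha>) \<le> norm \<zeta> * r" if "norm \<zeta> \<le> r" "\<zeta> \<noteq> 0" for \<zeta> :: complex
  proof -
    have "norm \<zeta> powr (3 + \<alpha>) \<le> norm \<zeta> powr 2" using that r1 \<alpha> by (intro powr_mono') auto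
    then show 1: "norm \<zeta> powr (3 + \<alpha>) \<le> (norm \<zeta>)\<^sup>2" using that by simp
    have "norm \<zeta> * norm \<zeta> \<le> norm \<zeta> * r" using that by (intro mult_left_mono) auto
    then show "norm \<zeta> powr (3 + \<alpha>) \<le> norm \<zeta> * r" using 1 by (simp add: power2_eq_square)
  qed
  have q2: "norm (lift_map \<alpha> K \<zeta>) \<le> 2 * norm \<zeta>" if "\<zeta> \<noteq> 0" "norm \<zeta> \<le> r" for \<zeta>
  proof -
    have "K * norm \<zeta> powr (3 + \<alpha>) \<le> K * (norm \<zeta> * r)" using pw(2)[OF that(2,1)] K by (intro mult_left_mono) auto
    also have "\<dots> = (4 * K * r) / 4 * norm \<zeta>" by simp
    also have "\<dots> \<le> 1 * norm \<zeta>" using r2 by (intro mult_right_mono) auto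
    finally show ?thesis using near[OF that(1)] norm_triangle_ineq2[of "lift_map \<alpha> K \<zeta>" \<zeta>] by linarith
  qed
  have dist4: "norm (taylor s (lift_map \<alpha> K \<zeta>) - \<gamma> s) \<le> 4 * r" if "\<zeta> \<noteq> 0" "norm \<zeta> \<le> r" for s \<zeta>
  proof -
    have "norm (lift_map \<alpha> K \<zeta>) \<le> e" using q2[OF that] that r1(4) e by linarith
    then have "norm (taylor s (lift_map \<alpha> K \<zeta>) - taylor s 0) \<le> 2 * norm (lift_map \<alpha> K \<zeta> - 0)"
      using e by (intro bl(2)) auto
    then show ?thesis using q2[OF that] that by (simp add: taylor_0)
  qed
  have inf4: "infdist (taylor s (lift_map \<alpha> K \<zeta>)) (range \<gamma>) \<le> 4 * r" if "\<zeta> \<noteq> 0" "norm \<zeta> \<le> r" for s \<zeta>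
    using dist4[OF that, of s] infdist_le[of "\<gamma> s" "range \<gamma>" "taylor s (lift_map \<alpha> K \<zeta>)"] by (simp add: dist_norm)
  have notC: "taylor s (lift_map \<alpha> K \<zeta>) \<notin> range \<gamma>" if \<zeta>: "Im \<zeta> \<ge> 0" "\<zeta> \<noteq> 0" "norm \<zeta> \<le> r" for s \<zeta>
  proof
    assume "taylor s (lift_map \<alpha> K \<zeta>) \<in> range \<gamma>"
    then obtain s' where s': "taylor s (lift_map \<alpha> K \<zeta>) = \<gamma> s'" by blast
    have "dist (\<gamma> s) (\<gamma> s') < \<delta>" using dist4[OF \<zeta>(2,3), of s] r1(5) r0 s' by (simp add: dist_norm norm_minus_commute)
    then obtain x where x: "\<gamma> s' = \<gamma> (s + x)" "\<bar>x\<bar> < \<epsilon>1" using \<delta>(2) by blast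
    define q where "q = lift_map \<alpha> K \<zeta>"
    have qe: "norm q \<le> e" using q2[OF \<zeta>(2,3)] \<zeta>(3) r1(4) e by (simp add: q_def)
    have "norm (q - of_real x) / 2 \<le> norm (taylor s q - taylor s (of_real x))"
      using qe x \<epsilon>1 by (intro bl(1)) auto
    also have "\<dots> \<le> M * \<bar>x\<bar> powr (3 + \<alpha>)" using taylor_bound[of s x] s' x by (simp add: q_def)
    finally have qx: "norm (q - of_real x) \<le> 2 * M * \<bar>x\<bar> powr (3 + \<alpha>)" by simp
    have x1: "\<bar>x\<bar> powr (3 + \<alpha>) \<le> \<bar>x\<bar> * \<epsilon>1"
    proof (cases "x = 0")
      case False
      have "\<bar>x\<bar> powr (3 + \<alpha>) \<le> \<bar>x\<bar> powr 2" using x \<epsilon>1 e \<alpha> by (intro powr_mono') auto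
      also have "\<dots> = \<bar>x\<bar> * \<bar>x\<bar>" using False by (simp add: power2_eq_square)
      also have "\<dots> \<le> \<bar>x\<bar> * \<epsilon>1" using x by (intro mult_left_mono) auto
      finally show ?thesis .
    qed simp
    have "2 * M * \<bar>x\<bar> powr (3 + \<alpha>) \<le> 2 * M * (\<bar>x\<bar> * \<epsilon>1)" using x1 M_nonneg by (intro mult_left_mono) auto
    also have "\<dots> = (2 * M * \<epsilon>1) * \<bar>x\<bar>" by simp
    also have "\<dots> \<le> 1/2 * \<bar>x\<bar>" using \<epsilon>1 by (intro mult_right_mono) auto
    finally have "norm (q - of_real x) \<le> \<bar>x\<bar> / 2" using qx by simp
    moreover have "\<bar>x\<bar> \<le> norm q + norm (q - of_real x)" using norm_triangle_ineq4[of q "q - of_real x"] by simp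
    ultimately have "\<bar>x\<bar> \<le> 2 * norm q" by linarith
    then have x4: "\<bar>x\<bar> \<le> 4 * norm \<zeta>" using q2[OF \<zeta>(2,3)] by (simp add: q_def)
    have "\<bar>x\<bar> powr (3 + \<alpha>) \<le> (4 * norm \<zeta>) powr (3 + \<alpha>)" using x4 \<alpha> by (intro powr_mono2) auto
    also have "\<dots> = 4 powr (3 + \<alpha>) * norm \<zeta> powr (3 + \<alpha>)" by (simp add: powr_mult)
    also have "4 powr (3 + \<alpha>) \<le> (4::real) powr 4" using \<alpha> by (intro powr_mono) auto
    also have "(4::real) powr 4 = 256" by simp
    finally have "\<bar>x\<bar> powr (3 + \<alpha>) \<le> 256 * norm \<zeta> powr (3 + \<alpha>)" by (simp add: mult_right_mono)
    then have "2 * M * \<bar>x\<bar> powr (3 + \<alpha>) \<le> 2 * M * (256 * norm \<zeta> powr (3 + \<alpha>))" using M_nonneg by (intro mult_left_mono) auto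
    moreover have "Im q \<le> norm (q - of_real x)" using abs_Im_le_cmod[of "q - of_real x"] by simp
    ultimately have up: "Im q \<le> 512 * M * norm \<zeta> powr (3 + \<alpha>)" using qx by linarith
    have "2 * K * norm \<zeta> \<le> 2 * K * r" using \<zeta> K by (intro mult_left_mono) auto
    then have "2 * K * norm \<zeta> \<le> sin (\<alpha> * pi / 16)" using r2(1) by (simp add: \<kappa>2_def)
    then have "K * sin (\<alpha> * pi / 4) * norm \<zeta> powr (3 + \<alpha>) \<le> Im q"
      unfolding q_def using \<alpha> K \<zeta> r1(1) by (intro lift_map_Im) auto
    then have "(512 * M + 1) * norm \<zeta> powr (3 + \<alpha>) \<le> Im q" using K(2) by (simp add: \<kappa>1_def)
    moreover have "norm \<zeta> powr (3 + \<alpha>) > 0" using \<zeta> by simp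
    ultimately show False using up by (simp add: distrib_right)
  qed
  have ins: "taylor s (lift_map \<alpha> K \<zeta>) \<in> inside (range \<gamma>)" if \<zeta>: "Im \<zeta> \<ge> 0" "\<zeta> \<noteq> 0" "norm \<zeta> \<le> r" for s \<zeta>
  proof -
    \<comment> \<open>The reference point i r: its image is within r/2 of the centre of the left
      tangent disc of radius \<open>r\<close>.\<close>
    define w where "w = \<i> * complex_of_real r"
    have w: "Im w \<ge> 0" "w \<noteq> 0" "norm w = r" using r0 by (auto simp: w_def norm_mult)
    have seg: "closed_segment \<zeta> w \<subseteq> {y. Im y \<ge> 0 \<and> y \<noteq> 0 \<and> norm y \<le> r}"
    proof
      fix y assume y: "y \<in> closed_segment \<zeta> w"
      then obtain u where u: "0 \<le> u" "u \<le> 1" "y = (1 - u) *\<^sub>R \<zeta> + u *\<^sub>R w" by (auto simp: closed_segment_def)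
      have Iy: "Im y = (1 - u) * Im \<zeta> + u * r" using u by (simp add: w_def)
      have "Im y \<ge> 0" unfolding Iy using u \<zeta> r0 by simp
      moreover have "y \<noteq> 0"
      proof (cases "u = 0")
        case False
        then have "u * r > 0" using u r0 by simp
        moreover have "(1 - u) * Im \<zeta> \<ge> 0" using u \<zeta> by simp
        ultimately have "Im y > 0" unfolding Iy by linarith
        then show ?thesis by auto
      qed (use u \<zeta> in simp)
      moreover have "norm y \<le> r"
        using y \<zeta> w closed_segment_subset[of \<zeta> "cball 0 r" w] by auto
      ultimately show "y \<in> {y. Im y \<ge> 0 \<and> y \<noteq> 0 \<and> norm y \<le> r}" by simp
    qed
    let ?P = "\<lambda>\<zeta>. taylor s (lift_map \<alpha> K \<zeta>)"
    have "continuous_on (closed_segment \<zeta> w) (lift_map \<alpha> K)"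
      by (rule continuous_on_subset[OF holomorphic_on_imp_continuous_on[OF lift_map_holomorphic]])
        (use seg upper_in_lift_domain in auto)
    then have "continuous_on (closed_segment \<zeta> w) ?P" unfolding taylor_def by (intro continuous_intros)
    then have "connected (?P ` closed_segment \<zeta> w)" by (rule connected_continuous_image) simp
    moreover have "?P ` closed_segment \<zeta> w \<inter> range \<gamma> = {}" using seg notC[of _ s] by auto
    moreover have "?P w \<in> inside (range \<gamma>)"
    proof -
      have a: "norm (?P w - taylor s w) \<le> 2 * (K * r\<^sup>2)"
      proof -
        have "norm (lift_map \<alpha> K w) \<le> e" "norm w \<le> e" using q2[of w] w r1(4) e r0 by auto
        then have "norm (?P w - taylor s w) \<le> 2 * norm (lift_map \<alpha> K w - w)" by (rule bl(2))
        also have "norm (lift_map \<alpha> K w - w) = K * norm w powr (3 + \<alpha>)" by (rule near[OF w(2)])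
        also have "\<dots> \<le> K * r\<^sup>2" using pw(1)[of w] w K by (intro mult_left_mono) auto
        finally show ?thesis by simp
      qed
      have b: "norm (taylor s w - (\<gamma> s + of_real r * (\<i> * \<gamma>1 s))) \<le> B * r\<^sup>2"
      proof -
        have "taylor s w - (\<gamma> s + of_real r * (\<i> * \<gamma>1 s)) = \<gamma>2 s / 2 * w\<^sup>2 + \<gamma>3 s / 6 * w ^ 3"
          by (simp add: taylor_def w_def algebra_simps)
        also have "norm \<dots> \<le> norm (\<gamma>2 s / 2 * w\<^sup>2) + norm (\<gamma>3 s / 6 * w ^ 3)" by (rule norm_triangle_ineq)
        also have "\<dots> = norm (\<gamma>2 s) / 2 * r\<^sup>2 + norm (\<gamma>3 s) / 6 * r ^ 3" using w by (simp add: norm_mult norm_divide norm_power)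
        also have "\<dots> \<le> B / 2 * r\<^sup>2 + B / 6 * r\<^sup>2"
        proof -
          have "r ^ 3 \<le> r\<^sup>2" using r0 r1(1) by (intro power_decreasing) auto
          then show ?thesis using B(2)[of s] B(3)[of s] B(1) r0 by (intro add_mono mult_mono) auto
        qed
        also have "\<dots> \<le> B * r\<^sup>2" using B(1) r0 by simp
        finally show ?thesis .
      qed
      have "norm (?P w - (\<gamma> s + of_real r * (\<i> * \<gamma>1 s))) \<le> norm (?P w - taylor s w) + norm (taylor s w - (\<gamma> s + of_real r * (\<i> * \<gamma>1 s)))"
        by norm
      also have "\<dots> \<le> (2 * K + B) * r * r" using a b by (simp add: power2_eq_square algebra_simps)
      also have "\<dots> \<le> 1/2 * r"
      proof -
        have "(2 * K + B) * r \<le> 1/2" using r2(3) by (simp add: algebra_simps)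
        then show ?thesis using r0 by (intro mult_right_mono) auto
      qed
      also have "\<dots> < r" using r0 by simp
      finally have "?P w \<in> ball (\<gamma> s + of_real r * (\<i> * \<gamma>1 s)) r" by (simp add: dist_norm norm_minus_commute)
      then show ?thesis using left_ball[of r s] r0 r1(8) by auto
    qed
    then have "?P ` closed_segment \<zeta> w \<inter> inside (range \<gamma>) \<noteq> {}" by auto
    ultimately have "?P ` closed_segment \<zeta> w \<subseteq> inside (range \<gamma>)" by (rule connected_avoids)
    then show ?thesis by auto
  qed
  show thesis
  proof (rule that[of r K C])
    show "taylor s (lift_map \<alpha> K \<zeta>) \<in> \<Omega>" if \<zeta>: "Im \<zeta> \<ge> 0" "\<zeta> \<noteq> 0" "norm \<zeta> \<le> r" for s \<zeta>
      using ins[OF \<zeta>] inf4[OF \<zeta>(2,3), of s] r1(7) r0 \<delta>0 by (intro collar) auto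
    show "infdist (taylor s (lift_map \<alpha> K \<zeta>)) (range \<gamma>) < \<eta>" if \<zeta>: "Im \<zeta> \<ge> 0" "\<zeta> \<noteq> 0" "norm \<zeta> \<le> r" for s \<zeta>
      using inf4[OF \<zeta>(2,3), of s] r1(6) r0 \<eta> by linarith
    show "infdist (taylor s (lift_map \<alpha> K (of_real x))) (range \<gamma>) \<le> C * \<bar>x\<bar> powr (3 + \<alpha>)" if x: "x \<noteq> 0" "\<bar>x\<bar> \<le> r" for s x
    proof -
      let ?q = "lift_map \<alpha> K (of_real x)"
      have "norm ?q \<le> e" "norm (complex_of_real x) \<le> e" using q2[of "of_real x"] x r1(4) r0 e by auto
      then have "norm (taylor s ?q - taylor s (of_real x)) \<le> 2 * norm (?q - of_real x)" by (rule bl(2))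
      also have "norm (?q - of_real x) = K * \<bar>x\<bar> powr (3 + \<alpha>)" using near[of "of_real x"] x by simp
      finally have 1: "norm (taylor s ?q - taylor s (of_real x)) \<le> 2 * (K * \<bar>x\<bar> powr (3 + \<alpha>))" by simp
      have "infdist (taylor s ?q) (range \<gamma>) \<le> dist (taylor s ?q) (\<gamma> (s + x))" by (rule infdist_le) simp
      also have "\<dots> \<le> norm (taylor s ?q - taylor s (of_real x)) + norm (\<gamma> (s + x) - taylor s (of_real x))"
        unfolding dist_norm by norm
      finally show ?thesis using 1 taylor_bound[of s x] by (simp add: C_def algebra_simps)
    qed
  qed (use r0 r1 r2 K C in auto)
qed

end

text \<open>The inverse series of \<omega> + b \<omega>^2 + c \<omega>^3 begins \<xi> - b \<xi>^2 +
  (2 b^2 - c) \<xi>^3. Substituting \<psi> = \<omega> + \<omega>^2 v with v = b + c \<omega> and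
  expanding exactly leaves \<omega>^4 times a polynomial in b, c and \<omega>.\<close>

lemma series_reversion:
  fixes b c \<omega> :: complex
  assumes B: "norm b \<le> B" "norm c \<le> B" and \<omega>: "norm \<omega> \<le> 1"
  defines "\<psi> \<equiv> \<omega> + b * \<omega>\<^sup>2 + c * \<omega> ^ 3"
  shows "norm (\<psi> - b * \<psi>\<^sup>2 + (2 * b\<^sup>2 - c) * \<psi> ^ 3 - \<omega>)
    \<le> (2 * (B * B) + B * (2 * B)\<^sup>2 + (2 * B\<^sup>2 + B) * (3 * (2 * B) + 3 * (2 * B)\<^sup>2 + (2 * B) ^ 3)) * norm \<omega> ^ 4"
proof -
  define v where "v = b + c * \<omega>"
  have B0: "B \<ge> 0" using B(1) norm_ge_zero order_trans by blast
  have v: "norm v \<le> 2 * B"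
  proof -
    have "norm v \<le> norm b + norm c * norm \<omega>" unfolding v_def norm_mult[symmetric] by (rule norm_triangle_ineq)
    also have "\<dots> \<le> B + B * 1" using B \<omega> B0 by (intro add_mono mult_mono) auto
    finally show ?thesis by simp
  qed
  have eq: "\<psi> - b * \<psi>\<^sup>2 + (2 * b\<^sup>2 - c) * \<psi> ^ 3 - \<omega>
      = (- 2 * (b * c) + (- b * v\<^sup>2 + (2 * b\<^sup>2 - c) * (3 * v + (3 * \<omega> * v\<^sup>2 + \<omega>\<^sup>2 * v ^ 3)))) * \<omega> ^ 4"
    unfolding \<psi>_def v_def by (simp add: algebra_simps power2_eq_square power3_eq_cube eval_nat_numeral)
  have n1: "norm (- 2 * (b * c)) \<le> 2 * (B * B)" using B B0 by (simp add: norm_mult mult_mono)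
  have n2: "norm (- b * v\<^sup>2) \<le> B * (2 * B)\<^sup>2" unfolding norm_mult norm_power norm_minus_cancel
    using B v B0 by (intro mult_mono power_mono) auto
  have n3: "norm (2 * b\<^sup>2 - c) \<le> 2 * B\<^sup>2 + B"
  proof -
    have "norm (2 * b\<^sup>2 - c) \<le> 2 * (norm b)\<^sup>2 + norm c" using norm_triangle_ineq4[of "2 * b\<^sup>2" c] by (simp add: norm_mult norm_power)
    also have "\<dots> \<le> 2 * B\<^sup>2 + B" using B B0 by (intro add_mono mult_left_mono power_mono) auto
    finally show ?thesis .
  qed
  have n4: "norm (3 * v + (3 * \<omega> * v\<^sup>2 + \<omega>\<^sup>2 * v ^ 3)) \<le> 3 * (2 * B) + (3 * (2 * B)\<^sup>2 + (2 * B) ^ 3)"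
  proof -
    have "norm (3 * v) \<le> 3 * (2 * B)" using v by (simp add: norm_mult)
    moreover have "norm (3 * \<omega> * v\<^sup>2) \<le> 3 * (2 * B)\<^sup>2"
    proof -
      have "norm \<omega> * norm v ^ 2 \<le> 1 * (2 * B)\<^sup>2" using v \<omega> B0 by (intro mult_mono power_mono) auto
      then show ?thesis by (simp add: norm_mult norm_power)
    qed
    moreover have "norm (\<omega>\<^sup>2 * v ^ 3) \<le> (2 * B) ^ 3"
    proof -
      have "norm \<omega> ^ 2 * norm v ^ 3 \<le> 1 * (2 * B) ^ 3" using v \<omega> B0 by (intro mult_mono power_mono power_le_one) auto
      then show ?thesis by (simp add: norm_mult norm_power)
    qed
    ultimately show ?thesis by (intro norm_triangle_le add_mono) auto
  qed
  have n5: "norm ((2 * b\<^sup>2 - c) * (3 * v + (3 * \<omega> * v\<^sup>2 + \<omega>\<^sup>2 * v ^ 3))) \<le> (2 * B\<^sup>2 + B) * (3 * (2 * B) + (3 * (2 * B)\<^sup>2 + (2 * B) ^ 3))"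
    unfolding norm_mult[of "2 * b\<^sup>2 - c"] using n3 n4 B0 by (intro mult_mono) auto
  have "norm (- 2 * (b * c) + (- b * v\<^sup>2 + (2 * b\<^sup>2 - c) * (3 * v + (3 * \<omega> * v\<^sup>2 + \<omega>\<^sup>2 * v ^ 3))))
     \<le> 2 * (B * B) + (B * (2 * B)\<^sup>2 + (2 * B\<^sup>2 + B) * (3 * (2 * B) + (3 * (2 * B)\<^sup>2 + (2 * B) ^ 3)))"
    by (intro norm_triangle_le add_mono n1 n2 n5)
  then show ?thesis unfolding eq norm_mult norm_power by (intro mult_right_mono) (auto simp: add.assoc)
qed

section \<open>The fourth derivative along normals\<close>

context annular_domain begin

text \<open>Near a point at height \<open>t\<close> on the normal, \<open>g\<close> is compared with
  \<open>h\<close>, the composition of the approximation \<open>T\<close> with the truncated inverse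
  \<open>R\<close> of the Taylor polynomial. \<open>h\<close> is holomorphic and bounded on a disc
  about \<gamma> s of fixed radius, so its fourth derivative is bounded. The difference g - h is of
  order t^(3 + \<alpha>/2) on a disc of radius t/8, and Cauchy's inequality divides by (t/8)^4. The
  resulting exponent exceeds -1, which makes the bound integrable in \<open>t\<close>.\<close>

lemma fourth_derivative_bound:
  obtains C t1 where "C > 0" "0 < t1" "t1 \<le> \<rho>" "t1 < \<delta>0" "t1 \<le> 1"
    "\<And>s t. 0 < t \<Longrightarrow> t \<le> t1 \<Longrightarrow> norm ((deriv ^^ 4) g (\<gamma> s + of_real t * (\<i> * \<gamma>1 s))) \<le> C * t powr (\<alpha>/2 - 1)"
proof -
  obtain B2 where B2: "B2 > 0" "\<And>s. norm (\<gamma>2 s) \<le> B2" using periodic_bounded[OF L per2 cont2] by blast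
  obtain B3 where B3: "B3 > 0" "\<And>s. norm (\<gamma>3 s) \<le> B3" using periodic_bounded[OF L per3 cont3] by blast
  define B where "B = max B2 B3"
  have B: "B > 0" "\<And>s. norm (\<gamma>2 s) \<le> B" "\<And>s. norm (\<gamma>3 s) \<le> B"
    using B2 B3 by (auto simp: B_def le_max_iff_disj)
  obtain C1 r1 where C1: "C1 > 0" "r1 > 0" "\<And>z. z \<in> \<Omega> \<Longrightarrow> infdist z (range \<gamma>) < r1 \<Longrightarrow> 1 - norm (g z) \<le> C1 * infdist z (range \<gamma>)"
    using upper_bound by blast
  obtain r K C2 where r: "0 < r" "r \<le> 1" and K: "0 < K" "4 * K * r \<le> 1" and C2: "0 < C2"
    and P\<Omega>: "\<And>s \<zeta>. Im \<zeta> \<ge> 0 \<Longrightarrow> \<zeta> \<noteq> 0 \<Longrightarrow> norm \<zeta> \<le> r \<Longrightarrow> taylor s (lift_map \<alpha> K \<zeta>) \<in> \<Omega>"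
    and Pr1: "\<And>s \<zeta>. Im \<zeta> \<ge> 0 \<Longrightarrow> \<zeta> \<noteq> 0 \<Longrightarrow> norm \<zeta> \<le> r \<Longrightarrow> infdist (taylor s (lift_map \<alpha> K \<zeta>)) (range \<gamma>) < r1"
    and Px: "\<And>s x. x \<noteq> 0 \<Longrightarrow> \<bar>x\<bar> \<le> r \<Longrightarrow> infdist (taylor s (lift_map \<alpha> K (of_real x))) (range \<gamma>) \<le> C2 * \<bar>x\<bar> powr (3 + \<alpha>)"
    by (rule half_disc_map[OF C1(2)]) (rule that)
  have c12: "C1 * C2 \<ge> 0" using C1(1) C2 by simp
  obtain K' where K': "K' \<ge> 0" and approx: "\<forall>G S. open S \<longrightarrow> G holomorphic_on S \<longrightarrow> {\<zeta>. Im \<zeta> \<ge> 0 \<and> \<zeta> \<noteq> 0 \<and> norm \<zeta> \<le> r} \<subseteq> S \<longrightarrow>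
    (\<forall>\<zeta>. Im \<zeta> \<ge> 0 \<longrightarrow> \<zeta> \<noteq> 0 \<longrightarrow> norm \<zeta> \<le> r \<longrightarrow> \<beta> \<le> norm (G \<zeta>) \<and> norm (G \<zeta>) \<le> 1) \<longrightarrow>
    (\<forall>x::real. x \<noteq> 0 \<longrightarrow> \<bar>x\<bar> \<le> r \<longrightarrow> 1 - norm (G x) \<le> (C1 * C2) * \<bar>x\<bar> powr (3 + \<alpha>)) \<longrightarrow>
    (\<forall>t. 0 < t \<longrightarrow> t \<le> r / 4 \<longrightarrow> (\<exists>T. T holomorphic_on ball 0 (r/2) \<and> (\<forall>\<zeta>\<in>ball 0 (r/2). norm (T \<zeta>) \<le> K') \<and>
       (\<forall>\<zeta>\<in>cball (\<i> * of_real t) (t/2). norm (G \<zeta> - T \<zeta>) \<le> K' * t powr (3 + \<alpha>/2))))"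
    using half_disc_approx[OF r \<beta>(1) c12 \<alpha>] by (elim exE conjE) (rule that)
  define C3 where "C3 = 2 * (B * B) + B * (2 * B)\<^sup>2 + (2 * B\<^sup>2 + B) * (3 * (2 * B) + 3 * (2 * B)\<^sup>2 + (2 * B) ^ 3)"
  define C4 where "C4 = 1 + 2 * B + 2 * B\<^sup>2"
  have C3: "C3 \<ge> 0" using B(1) by (simp add: C3_def)
  have C4: "C4 \<ge> 1" using B(1) by (simp add: C4_def)
  \<comment> \<open>On the unit disc \<open>R\<close> enlarges norms at most by the factor
    \<open>C4\<close>, so points within 2 \<rho>3 of \<gamma> s land in the disc of radius r/4,
    where \<open>T\<close> has a Lipschitz bound.\<close>
  define \<rho>3 where "\<rho>3 = min 1 (r / (8 * C4)) / 2"
  have \<rho>3: "\<rho>3 > 0" "2 * \<rho>3 \<le> 1" "2 * \<rho>3 * C4 \<le> r / 8"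
  proof -
    show "\<rho>3 > 0" "2 * \<rho>3 \<le> 1" using r C4 by (auto simp: \<rho>3_def)
    have "2 * \<rho>3 \<le> r / (8 * C4)" by (simp add: \<rho>3_def)
    then have "2 * \<rho>3 * C4 \<le> r / (8 * C4) * C4" using C4 by (intro mult_right_mono) auto
    then show "2 * \<rho>3 * C4 \<le> r / 8" using C4 by simp
  qed
  define t1 where "t1 = Min {\<rho>3 / 4, r / 16, 1 / (16 * (K + 8 * B)), \<rho> / 2, \<delta>0 / 4}"
  have "t1 > 0" unfolding t1_def using \<rho>3 r K B \<rho>pos \<delta>0 by (subst Min_gr_iff) auto
  have t1: "t1 > 0" "t1 \<le> \<rho>3 / 4" "t1 \<le> r / 16" "t1 \<le> 1 / (16 * (K + 8 * B))" "t1 \<le> \<rho> / 2" "t1 \<le> \<delta>0 / 4"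
    by (fact, (simp add: t1_def)+)
  have "16 * (K + 8 * B) > 0" using K B by simp
  then have "t1 * (16 * (K + 8 * B)) \<le> 1" using t1(4) by (simp add: pos_le_divide_eq)
  then have t1K: "(K + 8 * B) * t1 \<le> 1/16" by (simp add: algebra_simps)
  define E where "E = K' + (K' / (r / 4)) * (16 * K + 256 * C3)"
  have E: "E \<ge> 0" using K' r K C3 by (simp add: E_def)
  define C where "C = 24 * E * 8 ^ 4 + 24 * K' / \<rho>3 ^ 4 + 1"
  have Cp: "C > 0" using E K' \<rho>3 by (simp add: C_def add_nonneg_pos)
  have main: "norm ((deriv ^^ 4) g (\<gamma> s + of_real t * (\<i> * \<gamma>1 s))) \<le> C * t powr (\<alpha>/2 - 1)" if t: "0 < t" "t \<le> t1" for s t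
  proof -
    define z0 where "z0 = \<gamma> s + of_real t * (\<i> * \<gamma>1 s)"
    define G where "G = (\<lambda>\<zeta>. g (taylor s (lift_map \<alpha> K \<zeta>)))"
    define D where "D = {\<zeta>. - \<i> * \<zeta> \<notin> \<real>\<^sub>\<le>\<^sub>0}"
    define S where "S = D \<inter> (\<lambda>\<zeta>. taylor s (lift_map \<alpha> K \<zeta>)) -` \<Omega>"
    have th: "(\<lambda>\<zeta>. taylor s (lift_map \<alpha> K \<zeta>)) holomorphic_on D"
      unfolding taylor_def using lift_map_holomorphic[of \<alpha> K, folded D_def] by (intro holomorphic_intros)
    have So: "open S" unfolding S_def
      by (rule continuous_open_preimage[OF holomorphic_on_imp_continuous_on[OF th] _ \<Omega>o])
        (unfold D_def, rule open_lift_domain)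
    have Gh: "G holomorphic_on S"
    proof -
      have "(g \<circ> (\<lambda>\<zeta>. taylor s (lift_map \<alpha> K \<zeta>))) holomorphic_on S"
        by (rule holomorphic_on_compose_gen[OF holomorphic_on_subset[OF th] gh]) (auto simp: S_def)
      then show ?thesis by (simp add: G_def o_def)
    qed
    have HS: "{\<zeta>. Im \<zeta> \<ge> 0 \<and> \<zeta> \<noteq> 0 \<and> norm \<zeta> \<le> r} \<subseteq> S"
    proof safe
      fix \<zeta> :: complex assume \<zeta>: "0 \<le> Im \<zeta>" "\<zeta> \<noteq> 0" "norm \<zeta> \<le> r"
      have "\<zeta> \<in> D" unfolding D_def mem_Collect_eq by (rule upper_in_lift_domain[OF \<zeta>(1,2)])
      then show "\<zeta> \<in> S" using P\<Omega>[OF \<zeta>, of s] by (simp add: S_def)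
    qed
    have Gb: "\<beta> \<le> norm (G \<zeta>) \<and> norm (G \<zeta>) \<le> 1" if "Im \<zeta> \<ge> 0" "\<zeta> \<noteq> 0" "norm \<zeta> \<le> r" for \<zeta>
      using gA[OF P\<Omega>[OF that, of s]] by (simp add: G_def)
    have Gx: "1 - norm (G (of_real x)) \<le> (C1 * C2) * \<bar>x\<bar> powr (3 + \<alpha>)" if x: "x \<noteq> 0" "\<bar>x\<bar> \<le> r" for x :: real
    proof -
      have c: "Im (complex_of_real x) \<ge> 0" "complex_of_real x \<noteq> 0" "norm (complex_of_real x) \<le> r" using x by auto
      have "1 - norm (G (of_real x)) \<le> C1 * infdist (taylor s (lift_map \<alpha> K (of_real x))) (range \<gamma>)"
        unfolding G_def by (rule C1(3)[OF P\<Omega>[OF c] Pr1[OF c]])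
      also have "\<dots> \<le> C1 * (C2 * \<bar>x\<bar> powr (3 + \<alpha>))" using Px[OF x, of s] C1(1) by (intro mult_left_mono) auto
      finally show ?thesis by (simp add: mult.assoc)
    qed
    have tr: "t \<le> r / 4" using t t1 r by linarith
    have ex: "\<exists>T. T holomorphic_on ball 0 (r/2) \<and> (\<forall>\<zeta>\<in>ball 0 (r/2). norm (T \<zeta>) \<le> K') \<and>
       (\<forall>\<zeta>\<in>cball (\<i> * of_real t) (t/2). norm (G \<zeta> - T \<zeta>) \<le> K' * t powr (3 + \<alpha>/2))"
      by (rule approx[rule_format, OF So Gh HS _ _ t(1) tr]) (use Gb Gx in auto)
    then obtain T where T: "T holomorphic_on ball 0 (r/2)" "\<And>\<zeta>. \<zeta> \<in> ball 0 (r/2) \<Longrightarrow> norm (T \<zeta>) \<le> K'"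
      "\<And>\<zeta>. \<zeta> \<in> cball (\<i> * of_real t) (t/2) \<Longrightarrow> norm (G \<zeta> - T \<zeta>) \<le> K' * t powr (3 + \<alpha>/2)"
      by blast
    define b where "b = \<gamma>2 s / (2 * \<gamma>1 s)"
    define c where "c = \<gamma>3 s / (6 * \<gamma>1 s)"
    have g1: "\<gamma>1 s \<noteq> 0" using unit[of s] by auto
    have bc: "norm b \<le> B" "norm c \<le> B" using B(1) B(2)[of s] B(3)[of s] unit[of s] by (auto simp: b_def c_def norm_divide norm_mult)
    define \<psi> where "\<psi> = (\<lambda>\<omega>. \<omega> + b * \<omega>\<^sup>2 + c * \<omega> ^ 3)"
    define R where "R = (\<lambda>\<xi>. \<xi> - b * \<xi>\<^sup>2 + (2 * b\<^sup>2 - c) * \<xi> ^ 3)"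
    have tay: "taylor s \<omega> = \<gamma> s + \<gamma>1 s * \<psi> \<omega>" for \<omega>
      using g1 by (simp add: taylor_def \<psi>_def b_def c_def field_simps)
    have RC4: "norm (R \<xi>) \<le> C4 * norm \<xi>" if "norm \<xi> \<le> 1" for \<xi>
    proof -
      have n3: "norm (2 * b\<^sup>2 - c) \<le> 2 * B\<^sup>2 + B"
      proof -
        have "norm (2 * b\<^sup>2 - c) \<le> 2 * (norm b)\<^sup>2 + norm c" using norm_triangle_ineq4[of "2 * b\<^sup>2" c] by (simp add: norm_mult norm_power)
        also have "\<dots> \<le> 2 * B\<^sup>2 + B" using bc B(1) by (intro add_mono mult_left_mono power_mono) auto
        finally show ?thesis .
      qed
      have p: "norm \<xi> ^ 2 \<le> norm \<xi>" "norm \<xi> ^ 3 \<le> norm \<xi>"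
        using that power_decreasing[of 1 2 "norm \<xi>"] power_decreasing[of 1 3 "norm \<xi>"] by auto
      have "norm (b * \<xi>\<^sup>2) \<le> B * norm \<xi>" unfolding norm_mult norm_power using bc p B(1) by (intro mult_mono) auto
      moreover have "norm ((2 * b\<^sup>2 - c) * \<xi> ^ 3) \<le> (2 * B\<^sup>2 + B) * norm \<xi>"
        unfolding norm_mult[of "2 * b\<^sup>2 - c"] norm_power using n3 p B(1) by (intro mult_mono) auto
      moreover have "norm (R \<xi>) \<le> norm \<xi> + norm (b * \<xi>\<^sup>2) + norm ((2 * b\<^sup>2 - c) * \<xi> ^ 3)"
        unfolding R_def using norm_triangle_ineq[of "\<xi> - b * \<xi>\<^sup>2" "(2 * b\<^sup>2 - c) * \<xi> ^ 3"] norm_triangle_ineq4[of \<xi> "b * \<xi>\<^sup>2"] by linarith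
      ultimately show ?thesis by (simp add: C4_def algebra_simps)
    qed
    \<comment> \<open>\<open>R\<close> is a polynomial, hence available on both sides of the curve;
      an exact inverse of the lifted chart would be confined to one side.\<close>
    define h where "h = (\<lambda>z. T (R ((z - \<gamma> s) / \<gamma>1 s)))"
    have Rball: "R ((z - \<gamma> s) / \<gamma>1 s) \<in> ball 0 (r/4)" if "z \<in> ball (\<gamma> s) (2 * \<rho>3)" for z
    proof -
      have n: "norm ((z - \<gamma> s) / \<gamma>1 s) < 2 * \<rho>3" using that unit[of s] by (simp add: norm_divide dist_norm norm_minus_commute)
      then have "norm (R ((z - \<gamma> s) / \<gamma>1 s)) \<le> C4 * norm ((z - \<gamma> s) / \<gamma>1 s)" using \<rho>3 by (intro RC4) linarith
      also have "\<dots> \<le> C4 * (2 * \<rho>3)" using n C4 by (intro mult_left_mono) auto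
      finally show ?thesis using \<rho>3(3) r by (simp add: mult.commute)
    qed
    have hh: "h holomorphic_on ball (\<gamma> s) (2 * \<rho>3)"
    proof -
      have 1: "(\<lambda>z. R ((z - \<gamma> s) / \<gamma>1 s)) holomorphic_on ball (\<gamma> s) (2 * \<rho>3)"
        unfolding R_def using g1 by (intro holomorphic_intros) auto
      have "(T \<circ> (\<lambda>z. R ((z - \<gamma> s) / \<gamma>1 s))) holomorphic_on ball (\<gamma> s) (2 * \<rho>3)"
        by (rule holomorphic_on_compose_gen[OF 1 T(1)]) (use Rball r in force)
      then show ?thesis by (simp add: h_def o_def)
    qed
    have hb: "norm (h z) \<le> K'" if "z \<in> ball (\<gamma> s) (2 * \<rho>3)" for z
      unfolding h_def by (rule T(2)) (use Rball[OF that] r in auto)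
    have z0d: "dist (\<gamma> s) z0 = t" using t by (simp add: z0_def dist_norm norm_mult unit)
    have cb1: "cball z0 \<rho>3 \<subseteq> ball (\<gamma> s) (2 * \<rho>3)"
    proof
      fix y assume "y \<in> cball z0 \<rho>3"
      then show "y \<in> ball (\<gamma> s) (2 * \<rho>3)" using dist_triangle[of "\<gamma> s" y z0] z0d t t1(2) \<rho>3(1) by simp
    qed
    have h4: "norm ((deriv ^^ 4) h z0) \<le> fact 4 * K' / \<rho>3 ^ 4"
    proof (rule Cauchy_inequality)
      show "h holomorphic_on ball z0 \<rho>3" by (rule holomorphic_on_subset[OF hh]) (use cb1 ball_subset_cball in blast)
      show "continuous_on (cball z0 \<rho>3) h" by (rule continuous_on_subset[OF holomorphic_on_imp_continuous_on[OF hh] cb1])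
      show "norm (h x) \<le> K'" if "norm (z0 - x) = \<rho>3" for x using cb1 that by (intro hb) (auto simp: dist_norm)
    qed (use \<rho>3 in auto)
    have Tl: "norm (T x - T y) \<le> (K' / (r/4)) * norm (x - y)" if xy: "x \<in> ball 0 (r/4)" "y \<in> ball 0 (r/4)" for x y
    proof (rule field_differentiable_bound[where S="ball 0 (r/4)" and f'="deriv T"])
      fix w assume w: "w \<in> ball (0::complex) (r/4)"
      then have "w \<in> ball 0 (r/2)" using r by auto
      then have "(T has_field_derivative deriv T w) (at w)" using T(1) holomorphic_derivI[OF T(1) open_ball] by blast
      then show "(T has_field_derivative deriv T w) (at w within ball 0 (r/4))" by (rule has_field_derivative_at_within)
      have sub: "cball w (r/4) \<subseteq> ball 0 (r/2)"
      proof
        fix y assume "y \<in> cball w (r/4)"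
        then show "y \<in> ball 0 (r/2)" using dist_triangle[of 0 y w] w by simp
      qed
      have "norm ((deriv ^^ 1) T w) \<le> fact 1 * K' / (r/4) ^ 1"
      proof (rule Cauchy_inequality)
        show "T holomorphic_on ball w (r/4)" by (rule holomorphic_on_subset[OF T(1)]) (use sub ball_subset_cball in blast)
        show "continuous_on (cball w (r/4)) T" by (rule continuous_on_subset[OF holomorphic_on_imp_continuous_on[OF T(1)] sub])
        show "norm (T x) \<le> K'" if "norm (w - x) = r/4" for x using sub that by (intro T(2)) (auto simp: dist_norm)
      qed (use r in auto)
      then show "norm (deriv T w) \<le> K' / (r/4)" by simp
    qed (use xy in auto)
    have err: "norm (g z - h z) \<le> E * t powr (3 + \<alpha>/2)" if z: "z \<in> cball z0 (t/8)" for z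
    proof -
      define \<xi> where "\<xi> = (z - \<gamma> s) / \<gamma>1 s"
      have "\<xi> - \<i> * of_real t = (z - z0) / \<gamma>1 s" using g1 by (simp add: \<xi>_def z0_def field_simps)
      then have \<xi>t: "norm (\<xi> - \<i> * of_real t) \<le> t / 8" using z unit[of s] by (simp add: norm_divide dist_norm norm_minus_commute)
      have zb: "Im \<zeta> > 0 \<and> norm \<zeta> \<le> 3/2 * t \<and> \<zeta> \<noteq> 0" if "\<zeta> \<in> cball (\<i> * of_real t) (t/2)" for \<zeta>
      proof -
        have d: "norm (\<zeta> - \<i> * of_real t) \<le> t/2" using that by (simp add: dist_norm norm_minus_commute)
        have "\<bar>Im (\<zeta> - \<i> * of_real t)\<bar> \<le> t/2" using d abs_Im_le_cmod order_trans by blast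
        then have "\<bar>Im \<zeta> - t\<bar> \<le> t/2" by simp
        then have "Im \<zeta> > 0" using t by linarith
        moreover have "norm \<zeta> \<le> 3/2 * t" using d norm_triangle_ineq2[of \<zeta> "\<i> * of_real t"] t by (simp add: norm_mult)
        ultimately show ?thesis by auto
      qed
      have qq: "norm (lift_map \<alpha> K \<zeta> - \<zeta>) \<le> K * norm \<zeta> * norm \<zeta> \<and> norm (lift_map \<alpha> K \<zeta>) \<le> 2 * norm \<zeta> \<and> norm (\<psi> (lift_map \<alpha> K \<zeta>) - lift_map \<alpha> K \<zeta>) \<le> 2 * B * (2 * norm \<zeta>) * (2 * norm \<zeta>)"
        if \<zeta>: "\<zeta> \<in> cball (\<i> * of_real t) (t/2)" for \<zeta>
      proof -
        have zr: "norm \<zeta> \<le> r" "norm \<zeta> \<le> 1/2" using zb[OF \<zeta>] t t1(3) r by linarith+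
        have "norm (lift_map \<alpha> K \<zeta> - \<zeta>) = K * norm \<zeta> powr (3 + \<alpha>)" using K zb[OF \<zeta>] by (intro lift_map_near) auto
        also have "\<dots> \<le> K * (norm \<zeta> powr 2)" using K zr \<alpha> by (intro mult_left_mono powr_mono') auto
        also have "\<dots> = K * norm \<zeta> * norm \<zeta>" using zb[OF \<zeta>] by (simp add: power2_eq_square)
        finally have 1: "norm (lift_map \<alpha> K \<zeta> - \<zeta>) \<le> K * norm \<zeta> * norm \<zeta>" .
        have "K * norm \<zeta> * norm \<zeta> \<le> K * r * norm \<zeta>" using zr K by (intro mult_right_mono mult_left_mono) auto
        also have "\<dots> \<le> 1 * norm \<zeta>" using K by (intro mult_right_mono) auto
        finally have 2: "norm (lift_map \<alpha> K \<zeta>) \<le> 2 * norm \<zeta>" using 1 norm_triangle_ineq2[of "lift_map \<alpha> K \<zeta>" \<zeta>] by linarith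
        define q where "q = lift_map \<alpha> K \<zeta>"
        have q: "norm q \<le> 2 * norm \<zeta>" "norm q \<le> 1" using 2 zr by (auto simp: q_def)
        have "norm (\<psi> q - q) \<le> norm (b * q\<^sup>2) + norm (c * q ^ 3)" unfolding \<psi>_def using norm_triangle_ineq[of "b * q\<^sup>2" "c * q ^ 3"] by (simp add: algebra_simps)
        also have "\<dots> \<le> B * norm q ^ 2 + B * norm q ^ 2"
        proof -
          have "norm q ^ 3 \<le> norm q ^ 2" using q by (intro power_decreasing) auto
          then show ?thesis unfolding norm_mult norm_power using bc B(1) by (intro add_mono mult_mono) auto
        qed
        also have "\<dots> = 2 * B * norm q * norm q" by (simp add: power2_eq_square)
        also have "\<dots> \<le> 2 * B * (2 * norm \<zeta>) * (2 * norm \<zeta>)" using q B(1) by (intro mult_mono) auto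
        finally show ?thesis using 1 2 by (simp add: q_def)
      qed
      \<comment> \<open>A fixed point of \<open>f\<close> is a preimage of \<open>z\<close> under
        the chart. Brouwer's theorem supplies one in the disc of radius t/2, and the value of
        \<open>g\<close> at \<open>z\<close> becomes a value of \<open>G\<close> there.\<close>
      define f where "f = (\<lambda>\<zeta>. \<xi> - (\<psi> (lift_map \<alpha> K \<zeta>) - \<zeta>))"
      have fc: "continuous_on (cball (\<i> * of_real t) (t/2)) f"
      proof -
        have "continuous_on (cball (\<i> * of_real t) (t/2)) (lift_map \<alpha> K)"
          by (rule continuous_on_subset[OF holomorphic_on_imp_continuous_on[OF lift_map_holomorphic]])
            (use zb upper_in_lift_domain in \<open>force simp del: mem_cball\<close>)
        then show ?thesis unfolding f_def \<psi>_def by (intro continuous_intros)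
      qed
      \<comment> \<open>The chart displaces points by at most 3 t/8, and \<xi> is within t/8 of i t;
        together t/2.\<close>
      have fm: "f \<in> cball (\<i> * of_real t) (t/2) \<rightarrow> cball (\<i> * of_real t) (t/2)"
      proof
        fix \<zeta> assume \<zeta>: "\<zeta> \<in> cball (\<i> * of_real t) (t/2)"
        let ?q = "lift_map \<alpha> K \<zeta>"
        have n: "norm \<zeta> \<le> 3/2 * t" using zb[OF \<zeta>] by simp
        have "norm (\<psi> ?q - \<zeta>) \<le> norm (\<psi> ?q - ?q) + norm (?q - \<zeta>)" by norm
        also have "\<dots> \<le> 2 * B * (2 * norm \<zeta>) * (2 * norm \<zeta>) + K * norm \<zeta> * norm \<zeta>" using qq[OF \<zeta>] by linarith
        also have "\<dots> = (K + 8 * B) * (norm \<zeta> * norm \<zeta>)" by (simp add: algebra_simps)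
        also have "\<dots> \<le> (K + 8 * B) * ((3/2 * t) * (3/2 * t))" using n K B t by (intro mult_left_mono mult_mono) auto
        also have "\<dots> = (9/4) * t * ((K + 8 * B) * t)" by simp
        also have "\<dots> \<le> (9/4) * t * ((K + 8 * B) * t1)" using t K B by (intro mult_left_mono) auto
        also have "\<dots> \<le> (9/4) * t * (1/16)" using t1K t by (intro mult_left_mono) auto
        finally have "norm (\<psi> ?q - \<zeta>) \<le> 3/8 * t" using t by simp
        moreover have "norm (f \<zeta> - \<i> * of_real t) \<le> norm (\<xi> - \<i> * of_real t) + norm (\<psi> ?q - \<zeta>)"
          unfolding f_def using norm_triangle_ineq4[of "\<xi> - \<i> * of_real t" "\<psi> ?q - \<zeta>"] by (simp add: algebra_simps)
        ultimately have "norm (f \<zeta> - \<i> * of_real t) \<le> t/2" using \<xi>t by simp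
        then show "f \<zeta> \<in> cball (\<i> * of_real t) (t/2)" by (simp add: dist_norm norm_minus_commute)
      qed
      obtain \<zeta> where \<zeta>: "\<zeta> \<in> cball (\<i> * of_real t) (t/2)" "f \<zeta> = \<zeta>"
        using brouwer_ball[OF _ fc fm] t by auto
      define q where "q = lift_map \<alpha> K \<zeta>"
      have \<psi>q: "\<psi> q = \<xi>" using \<zeta>(2) by (simp add: f_def q_def)
      have "taylor s q = z" using tay[of q] \<psi>q g1 by (simp add: \<xi>_def)
      then have gz: "g z = G \<zeta>" by (simp add: G_def q_def)
      have n\<zeta>: "norm \<zeta> \<le> 2 * t" "\<zeta> \<noteq> 0" using zb[OF \<zeta>(1)] t by auto
      have tt: "t \<le> 1/16" "t \<le> r/16" using t t1(3) r by linarith+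
      have nq: "norm q \<le> 4 * t" "norm q \<le> 1" using qq[OF \<zeta>(1)] n\<zeta>(1) tt by (auto simp: q_def)
      \<comment> \<open>Two errors separate \<zeta> from R \<xi>: that of the lift, of order t^(3 +
        \<alpha>), and that of the series reversion, of order t^4.\<close>
      have d1: "norm (\<zeta> - q) \<le> 16 * K * t powr (3 + \<alpha>/2)"
      proof -
        have "norm (\<zeta> - q) = K * norm \<zeta> powr (3 + \<alpha>)" using lift_map_near[of K \<zeta> \<alpha>] K n\<zeta> by (simp add: q_def norm_minus_commute)
        also have "norm \<zeta> powr (3 + \<alpha>) \<le> (2 * t) powr (3 + \<alpha>)" using n\<zeta> \<alpha> by (intro powr_mono2) auto
        also have "(2 * t) powr (3 + \<alpha>) = 2 powr (3 + \<alpha>) * t powr (3 + \<alpha>)" using t by (simp add: powr_mult)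
        also have "\<dots> \<le> 2 powr 4 * t powr (3 + \<alpha>/2)" using \<alpha> t tt by (intro mult_mono powr_mono powr_mono') auto
        finally show ?thesis using K by (simp add: mult_ac)
      qed
      have d2: "norm (q - R \<xi>) \<le> 256 * C3 * t powr (3 + \<alpha>/2)"
      proof -
        have "norm (R \<xi> - q) \<le> C3 * norm q ^ 4"
          using series_reversion[OF bc nq(2)] unfolding \<psi>q[unfolded \<psi>_def] R_def C3_def .
        also have "\<dots> \<le> C3 * (4 * t) ^ 4" using nq C3 by (intro mult_left_mono power_mono) auto
        also have "\<dots> = 256 * C3 * t powr 4" using t powr_realpow[of t 4] by (simp add: power_mult_distrib)
        also have "\<dots> \<le> 256 * C3 * t powr (3 + \<alpha>/2)" using C3 \<alpha> t tt by (intro mult_left_mono powr_mono') auto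
        finally show ?thesis by (simp add: norm_minus_commute)
      qed
      have zin: "z \<in> ball (\<gamma> s) (2 * \<rho>3)" using cb1 z t t1(2) \<rho>3(1) by (auto simp: subset_iff)
      have \<zeta>in: "\<zeta> \<in> ball 0 (r/4)" using n\<zeta> tt r t by simp
      have "norm (\<zeta> - R \<xi>) \<le> norm (\<zeta> - q) + norm (q - R \<xi>)" by norm
      also have "\<dots> \<le> (16 * K + 256 * C3) * t powr (3 + \<alpha>/2)" using d1 d2 by (simp add: distrib_right)
      finally have dd: "norm (\<zeta> - R \<xi>) \<le> (16 * K + 256 * C3) * t powr (3 + \<alpha>/2)" .
      have "norm (T \<zeta> - T (R \<xi>)) \<le> (K' / (r/4)) * norm (\<zeta> - R \<xi>)"
        by (rule Tl[OF \<zeta>in]) (use Rball[OF zin] in \<open>simp add: \<xi>_def\<close>)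
      also have "\<dots> \<le> (K' / (r/4)) * ((16 * K + 256 * C3) * t powr (3 + \<alpha>/2))"
        by (rule mult_left_mono[OF dd]) (use K' r in simp)
      finally have e2: "norm (T \<zeta> - T (R \<xi>)) \<le> (K' / (r/4)) * ((16 * K + 256 * C3) * t powr (3 + \<alpha>/2))" .
      have "norm (g z - h z) \<le> norm (G \<zeta> - T \<zeta>) + norm (T \<zeta> - T (R \<xi>))"
        unfolding gz h_def \<xi>_def[symmetric] by norm
      also have "\<dots> \<le> K' * t powr (3 + \<alpha>/2) + (K' / (r/4)) * ((16 * K + 256 * C3) * t powr (3 + \<alpha>/2))"
        by (intro add_mono T(3)[OF \<zeta>(1)] e2)
      also have "\<dots> = E * t powr (3 + \<alpha>/2)" by (simp add: E_def distrib_right mult.assoc)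
      finally show ?thesis .
    qed
    have bs: "ball z0 t \<subseteq> \<Omega>"
    proof
      fix y assume y: "y \<in> ball z0 t"
      have "infdist y (range \<gamma>) \<le> dist y (\<gamma> s)" by (rule infdist_le) simp
      also have "\<dots> \<le> dist y z0 + dist z0 (\<gamma> s)" by (rule dist_triangle)
      finally have "infdist y (range \<gamma>) < \<delta>0" using y z0d t t1(6) \<delta>0 by (simp add: dist_commute)
      then show "y \<in> \<Omega>" using y left_ball[of t s] t t1(5) \<rho>pos by (intro collar) (auto simp: z0_def)
    qed
    have gho: "g holomorphic_on ball z0 t" by (rule holomorphic_on_subset[OF gh bs])
    have hho: "h holomorphic_on ball z0 t"
      by (rule holomorphic_on_subset[OF hh]) (use cb1 t t1(2) \<rho>3(1) in \<open>force simp: subset_iff\<close>)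
    have "(deriv ^^ 4) (\<lambda>w. g w - h w) z0 = (deriv ^^ 4) g z0 - (deriv ^^ 4) h z0"
      by (rule higher_deriv_diff[OF gho hho]) (use t in auto)
    moreover have "norm ((deriv ^^ 4) (\<lambda>w. g w - h w) z0) \<le> fact 4 * (E * t powr (3 + \<alpha>/2)) / (t/8) ^ 4"
    proof (rule Cauchy_inequality)
      have sub: "cball z0 (t/8) \<subseteq> ball z0 t" using t by auto
      have d: "(\<lambda>w. g w - h w) holomorphic_on ball z0 t" by (intro holomorphic_intros gho hho)
      show "(\<lambda>w. g w - h w) holomorphic_on ball z0 (t/8)" by (rule holomorphic_on_subset[OF d]) (use t in auto)
      show "continuous_on (cball z0 (t/8)) (\<lambda>w. g w - h w)" by (rule continuous_on_subset[OF holomorphic_on_imp_continuous_on[OF d] sub])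
      show "norm (g x - h x) \<le> E * t powr (3 + \<alpha>/2)" if "norm (z0 - x) = t/8" for x
        by (rule err) (use that in \<open>simp add: dist_norm\<close>)
    qed (use t in auto)
    ultimately have "norm ((deriv ^^ 4) g z0) \<le> fact 4 * (E * t powr (3 + \<alpha>/2)) / (t/8) ^ 4 + fact 4 * K' / \<rho>3 ^ 4"
      using h4 norm_triangle_ineq[of "(deriv ^^ 4) g z0 - (deriv ^^ 4) h z0" "(deriv ^^ 4) h z0"] by simp
    also have "fact 4 * (E * t powr (3 + \<alpha>/2)) / (t/8) ^ 4 = 24 * E * 8 ^ 4 * (t powr (3 + \<alpha>/2) / t ^ 4)"
      by (simp add: fact_numeral power_divide)
    also have "t powr (3 + \<alpha>/2) / t ^ 4 = t powr (\<alpha>/2 - 1)"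
    proof -
      have "t powr (3 + \<alpha>/2) / t powr 4 = t powr (3 + \<alpha>/2 - 4)" by (rule powr_diff[symmetric])
      then show ?thesis using t powr_realpow[of t 4] by simp
    qed
    also have "fact 4 * K' / \<rho>3 ^ 4 = (24 * K' / \<rho>3 ^ 4) * 1" by (simp add: fact_numeral)
    also have "\<dots> \<le> (24 * K' / \<rho>3 ^ 4) * t powr (\<alpha>/2 - 1)"
    proof -
      have "1 = t powr 0" using t by simp
      also have "\<dots> \<le> t powr (\<alpha>/2 - 1)" using t t1(3) r \<alpha> by (intro powr_mono') auto
      finally show ?thesis using K' \<rho>3 by (intro mult_left_mono) auto
    qed
    finally have "norm ((deriv ^^ 4) g z0) \<le> (24 * E * 8 ^ 4 + 24 * K' / \<rho>3 ^ 4) * t powr (\<alpha>/2 - 1)" by (simp add: distrib_right)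
    also have "\<dots> \<le> C * t powr (\<alpha>/2 - 1)" by (intro mult_right_mono) (auto simp: C_def)
    finally show ?thesis by (simp add: z0_def)
  qed
  show thesis
    by (rule that[OF Cp t1(1)]) (use t1 \<rho>pos \<delta>0 r main in auto)
qed

end

section \<open>Boundary values of \<open>g\<close> and its first three derivatives\<close>

context annular_domain begin

definition nrm :: "real \<Rightarrow> real \<Rightarrow> complex" where
  "nrm s t = \<gamma> s + of_real t * (\<i> * \<gamma>1 s)"

lemma higher_deriv_has_field_derivative:
  assumes "z \<in> \<Omega>"
  shows "((deriv ^^ k) g has_field_derivative (deriv ^^ Suc k) g z) (at z)"
proof -
  have "(deriv ^^ k) g holomorphic_on \<Omega>" by (rule holomorphic_higher_deriv[OF gh \<Omega>o])
  then show ?thesis using holomorphic_derivI[OF _ \<Omega>o assms] by simp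
qed

lemma deriv_along_normal:
  assumes "nrm s t \<in> \<Omega>"
  shows "((\<lambda>t. (deriv ^^ k) g (nrm s t)) has_vector_derivative (\<i> * \<gamma>1 s) * (deriv ^^ Suc k) g (nrm s t)) (at t)"
  unfolding nrm_def
  by (rule has_vector_derivative_line) (use higher_deriv_has_field_derivative[OF assms, of k] in \<open>simp add: nrm_def\<close>)

lemma deriv_along_curve:
  assumes "nrm s t \<in> \<Omega>"
  shows "((\<lambda>s. (deriv ^^ k) g (nrm s t)) has_vector_derivative (\<gamma>1 s + of_real t * (\<i> * \<gamma>2 s)) * (deriv ^^ Suc k) g (nrm s t)) (at s)"
proof -
  have "((\<lambda>s. nrm s t) has_vector_derivative (\<gamma>1 s + of_real t * (\<i> * \<gamma>2 s))) (at s)"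
    unfolding nrm_def by (intro has_vector_derivative_add d1 has_vector_derivative_mult_right d2)
  from field_vector_diff_chain_at[OF this higher_deriv_has_field_derivative[OF assms]]
  show ?thesis by (simp add: o_def)
qed

lemma nrm_periodic: "nrm (s + L) t = nrm s t"
  by (simp add: nrm_def per per1)

text \<open>Integrating t^(\<alpha>/2 - 1) along normals shows that the derivatives up to the third
  converge, uniformly in \<open>s\<close> and with rate t^(\<alpha>/2). On the parallel curves at
  heights \<open>T n\<close> one then has functions of \<open>s\<close> whose derivatives converge
  uniformly, so the limits may be differentiated along the curve.\<close>

lemma boundary_values:
  obtains G :: "nat \<Rightarrow> real \<Rightarrow> complex" where
    "\<And>k s. k \<le> 3 \<Longrightarrow> ((\<lambda>t. (deriv ^^ k) g (nrm s t)) \<longlongrightarrow> G k s) (at_right 0)"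
    "\<And>k s. k \<le> 2 \<Longrightarrow> (G k has_vector_derivative \<gamma>1 s * G (Suc k) s) (at s)"
    "continuous_on UNIV (G 3)" "\<And>k s. G k (s + L) = G k s"
proof -
  obtain C4 t1 where C4: "C4 > 0" and t1: "0 < t1" "t1 \<le> \<rho>" "t1 < \<delta>0" "t1 \<le> 1"
    and fourth: "\<And>s t. 0 < t \<Longrightarrow> t \<le> t1 \<Longrightarrow> norm ((deriv ^^ 4) g (nrm s t)) \<le> C4 * t powr (\<alpha>/2 - 1)"
    using fourth_derivative_bound unfolding nrm_def by metis
  define e where "e = \<alpha>/2"
  have e: "e > 0" "e < 1" using \<alpha> by (auto simp: e_def)
  have nin: "nrm s t \<in> \<Omega>" if "0 < t" "t \<le> t1" for s t
    unfolding nrm_def using normal_in[of t s] that t1 by auto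
  define F where "F = (\<lambda>k s t. (deriv ^^ k) g (nrm s t))"
  \<comment> \<open>The mean value inequality against the primitive (C/e) t^e of C t^(e -
    1).\<close>
  have step: "norm (F k s t - F k s t') \<le> C / e * (t powr e - t' powr e)"
    if C: "\<And>s t. 0 < t \<Longrightarrow> t \<le> t1 \<Longrightarrow> norm (F (Suc k) s t) \<le> C * t powr (e - 1)"
      and t: "0 < t'" "t' \<le> t" "t \<le> t1" for C k s t t'
  proof (cases "t' = t")
    case False
    then have lt: "t' < t" using t by simp
    have "norm (F k s t - F k s t') \<le> C / e * t powr e - C / e * t' powr e"
    proof (rule differentiable_bound_general[OF lt])
      have fd: "((\<lambda>t. F k s t) has_vector_derivative (\<i> * \<gamma>1 s) * F (Suc k) s x) (at x)" if "0 < x" "x \<le> t1" for x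
        unfolding F_def by (rule deriv_along_normal[OF nin[OF that]])
      show "continuous_on {t'..t} (F k s)"
        by (intro continuous_at_imp_continuous_on ballI has_vector_derivative_continuous[OF fd]) (use t in auto)
      show "continuous_on {t'..t} (\<lambda>t. C / e * t powr e)" using t by (intro continuous_intros) auto
      show "((\<lambda>t. F k s t) has_vector_derivative (\<i> * \<gamma>1 s) * F (Suc k) s x) (at x)" if "t' < x" "x < t" for x
        using fd[of x] that t by auto
      show "((\<lambda>t. C / e * t powr e) has_vector_derivative C * x powr (e - 1)) (at x)" if "t' < x" "x < t" for x
      proof -
        have "((\<lambda>t. t powr e) has_real_derivative e * x powr (e - 1)) (at x)"
          using that t by (intro has_real_derivative_powr) auto
        then have "((\<lambda>t. C / e * t powr e) has_real_derivative C / e * (e * x powr (e - 1))) (at x)" by (rule DERIV_cmult)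
        then show ?thesis using e by (simp add: has_real_derivative_iff_has_vector_derivative)
      qed
      show "norm ((\<i> * \<gamma>1 s) * F (Suc k) s x) \<le> C * x powr (e - 1)" if "t' < x" "x < t" for x
        using C[of x s] that t by (simp add: norm_mult unit)
    qed
    then show ?thesis by (simp add: right_diff_distrib)
  qed simp
  have Cnn: "C \<ge> 0" if "\<And>s t. 0 < t \<Longrightarrow> t \<le> t1 \<Longrightarrow> norm (F k s t) \<le> C * t powr (e - 1)" for C k
  proof -
    have "0 \<le> C * t1 powr (e - 1)" using that[OF t1(1) order_refl, of 0] norm_ge_zero order_trans by blast
    then show ?thesis using t1(1) by (simp add: zero_le_mult_iff)
  qed
  \<comment> \<open>The lower derivatives are even bounded, but since t^(e - 1) \<ge> 1 they also
    fit the weaker common form, and one integration step serves all orders.\<close>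
  have down: "\<exists>C. \<forall>s t. 0 < t \<longrightarrow> t \<le> t1 \<longrightarrow> norm (F k s t) \<le> C * t powr (e - 1)"
    if ex: "\<exists>C. \<forall>s t. 0 < t \<longrightarrow> t \<le> t1 \<longrightarrow> norm (F (Suc k) s t) \<le> C * t powr (e - 1)" for k
  proof -
    obtain C where C: "\<And>s t. 0 < t \<Longrightarrow> t \<le> t1 \<Longrightarrow> norm (F (Suc k) s t) \<le> C * t powr (e - 1)" using ex by blast
    have C0: "C \<ge> 0" by (rule Cnn[OF C])
    have cont: "continuous_on UNIV (\<lambda>s. F k s t1)"
      unfolding F_def
      by (intro continuous_at_imp_continuous_on ballI has_vector_derivative_continuous[OF deriv_along_curve[OF nin[OF t1(1) order_refl]]])
    have "F k (s + L) t1 = F k s t1" for s by (simp add: F_def nrm_periodic)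
    then obtain B where B: "\<And>s. norm (F k s t1) \<le> B" using periodic_bounded[OF L _ cont] by blast
    have "norm (F k s t) \<le> (B + C / e) * t powr (e - 1)" if t: "0 < t" "t \<le> t1" for s t
    proof -
      have "norm (F k s t1 - F k s t) \<le> C / e * (t1 powr e - t powr e)" by (rule step[OF C]) (use t in auto)
      also have "\<dots> \<le> C / e * 1"
      proof -
        have "t1 powr e \<le> 1" using t1 e by (intro powr_le1) auto
        then have "t1 powr e - t powr e \<le> 1" using powr_ge_zero[of t e] by linarith
        then show ?thesis using C0 e by (intro mult_left_mono) auto
      qed
      finally have "norm (F k s t) \<le> B + C / e" using B[of s] norm_triangle_ineq2[of "F k s t" "F k s t1"] by (simp add: norm_minus_commute)
      also have "\<dots> \<le> (B + C / e) * t powr (e - 1)"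
      proof -
        have "t powr 0 \<le> t powr (e - 1)" using t t1 e by (intro powr_mono') auto
        then have "1 \<le> t powr (e - 1)" using t by simp
        moreover have "B + C / e \<ge> 0" using B[of 0] C0 e norm_ge_zero[of "F k 0 t1"] by (intro add_nonneg_nonneg) (linarith, simp)
        ultimately show ?thesis using mult_left_mono[of 1 "t powr (e - 1)" "B + C / e"] by simp
      qed
      finally show ?thesis .
    qed
    then show ?thesis by blast
  qed
  have b4: "\<exists>C. \<forall>s t. 0 < t \<longrightarrow> t \<le> t1 \<longrightarrow> norm (F 4 s t) \<le> C * t powr (e - 1)"
    using fourth by (auto simp: F_def e_def)
  have b3: "\<exists>C. \<forall>s t. 0 < t \<longrightarrow> t \<le> t1 \<longrightarrow> norm (F 3 s t) \<le> C * t powr (e - 1)" by (rule down) (use b4 in simp)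
  have b2: "\<exists>C. \<forall>s t. 0 < t \<longrightarrow> t \<le> t1 \<longrightarrow> norm (F 2 s t) \<le> C * t powr (e - 1)" by (rule down) (use b3 in simp)
  have b1: "\<exists>C. \<forall>s t. 0 < t \<longrightarrow> t \<le> t1 \<longrightarrow> norm (F 1 s t) \<le> C * t powr (e - 1)" by (rule down) (use b2 in \<open>simp add: eval_nat_numeral\<close>)
  have b0: "\<exists>C. \<forall>s t. 0 < t \<longrightarrow> t \<le> t1 \<longrightarrow> norm (F 0 s t) \<le> C * t powr (e - 1)" by (rule down) (use b1 in simp)
  have bk: "\<exists>C. \<forall>s t. 0 < t \<longrightarrow> t \<le> t1 \<longrightarrow> norm (F k s t) \<le> C * t powr (e - 1)" if "k \<le> 4" for k
  proof -
    have "k = 0 \<or> k = 1 \<or> k = 2 \<or> k = 3 \<or> k = 4" using that by linarith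
    then show ?thesis using b0 b1 b2 b3 b4 by blast
  qed
  obtain Ck where Ck: "\<And>k s t. k \<le> 4 \<Longrightarrow> 0 < t \<Longrightarrow> t \<le> t1 \<Longrightarrow> norm (F k s t) \<le> Ck k * t powr (e - 1)"
    using bk by metis
  define T where "T = (\<lambda>n::nat. t1 / (real n + 1))"
  have T: "T n > 0" "T n \<le> t1" for n using t1(1) by (auto simp: T_def divide_le_eq)
  have T0: "T \<longlonglongrightarrow> 0" unfolding T_def by real_asymp
  have "(\<lambda>n. T n powr e) \<longlonglongrightarrow> 0 powr e"
    by (rule tendsto_powr'[OF T0 tendsto_const]) (use e T in \<open>auto intro!: always_eventually less_imp_le\<close>)
  then have Te: "(\<lambda>n. T n powr e) \<longlonglongrightarrow> 0" by simp
  have dif: "norm (F k s t - F k s t') \<le> Ck (Suc k) / e * t powr e" if "k \<le> 3" "0 < t'" "t' \<le> t" "t \<le> t1" for k s t t'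
  proof -
    have c0: "Ck (Suc k) \<ge> 0" using Cnn[OF Ck[of "Suc k"]] that by simp
    have "norm (F k s t - F k s t') \<le> Ck (Suc k) / e * (t powr e - t' powr e)"
      by (rule step[OF Ck]) (use that in auto)
    also have "\<dots> \<le> Ck (Suc k) / e * t powr e" using c0 e by (intro mult_left_mono) auto
    finally show ?thesis .
  qed
  have conv: "convergent (\<lambda>n. F k s (T n))" if k: "k \<le> 3" for k s
  proof -
    have "Cauchy (\<lambda>n. F k s (T n))"
    proof (rule metric_CauchyI)
      fix \<epsilon> :: real assume \<epsilon>: "\<epsilon> > 0"
      have "(\<lambda>n. Ck (Suc k) / e * T n powr e) \<longlonglongrightarrow> Ck (Suc k) / e * 0" by (intro tendsto_intros Te)
      then have "\<forall>\<^sub>F n in sequentially. Ck (Suc k) / e * T n powr e < \<epsilon> / 2" using \<epsilon> by (intro order_tendstoD(2)) auto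
      then obtain N where N: "\<And>n. n \<ge> N \<Longrightarrow> Ck (Suc k) / e * T n powr e < \<epsilon> / 2" by (auto simp: eventually_sequentially)
      have dN: "norm (F k s (T N) - F k s (T n)) < \<epsilon> / 2" if "n \<ge> N" for n
      proof -
        have "T n \<le> T N" unfolding T_def using that t1(1) by (intro divide_left_mono) auto
        from dif[OF k T(1)[of n] this T(2)[of N], of s] N[of N] show ?thesis by (rule le_less_trans) simp
      qed
      show "\<exists>M. \<forall>m\<ge>M. \<forall>n\<ge>M. dist (F k s (T m)) (F k s (T n)) < \<epsilon>"
      proof (intro exI[of _ N] allI impI)
        fix m n assume "m \<ge> N" "n \<ge> N"
        then show "dist (F k s (T m)) (F k s (T n)) < \<epsilon>"
          using dN[of m] dN[of n] dist_triangle_half_r[of "F k s (T N)" "F k s (T m)" \<epsilon> "F k s (T n)"] by (simp add: dist_norm)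
      qed
    qed
    then show ?thesis by (simp add: Cauchy_convergent_iff)
  qed
  define G where "G = (\<lambda>k s. lim (\<lambda>n. F k s (T n)))"
  have Glim: "(\<lambda>n. F k s (T n)) \<longlonglongrightarrow> G k s" if "k \<le> 3" for k s
    unfolding G_def using conv[OF that] by (simp add: convergent_LIMSEQ_iff)
  have rate: "norm (F k s t - G k s) \<le> Ck (Suc k) / e * t powr e" if k: "k \<le> 3" and t: "0 < t" "t \<le> t1" for k s t
  proof (rule tendsto_upperbound)
    show "(\<lambda>n. norm (F k s t - F k s (T n))) \<longlonglongrightarrow> norm (F k s t - G k s)" by (intro tendsto_intros Glim k)
    have "\<forall>\<^sub>F n in sequentially. T n < t" using T0 t by (intro order_tendstoD(2)) auto
    then show "\<forall>\<^sub>F n in sequentially. norm (F k s t - F k s (T n)) \<le> Ck (Suc k) / e * t powr e"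
      by eventually_elim (use dif k t T in auto)
  qed simp
  show thesis
  proof (rule that[of G])
    fix k s assume k: "k \<le> (3::nat)"
    have "((\<lambda>t. Ck (Suc k) / e * t powr e) \<longlongrightarrow> Ck (Suc k) / e * 0 powr e) (at_right 0)"
      by (intro tendsto_intros tendsto_ident_at)
        (use e in \<open>auto simp: eventually_at_right_field intro!: exI[of _ 1]\<close>)
    then have z: "((\<lambda>t. Ck (Suc k) / e * t powr e) \<longlongrightarrow> 0) (at_right 0)" by simp
    have "((\<lambda>t. F k s t - G k s) \<longlongrightarrow> 0) (at_right 0)"
      by (rule Lim_null_comparison[OF _ z]) (use rate[OF k] t1(1) in \<open>auto simp: eventually_at_right_field intro!: exI[of _ t1]\<close>)
    then show "((\<lambda>t. (deriv ^^ k) g (nrm s t)) \<longlongrightarrow> G k s) (at_right 0)" by (simp add: F_def LIM_zero_iff)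
  next
    fix k s assume k: "k \<le> (2::nat)"
    obtain B where B: "B > 0" "\<And>s. norm (\<gamma>2 s) \<le> B" using periodic_bounded[OF L per2 cont2] by blast
    define Cb where "Cb = Ck (Suc (Suc k)) / e + B * Ck (Suc k)"
    \<comment> \<open>The parallel curve has velocity \<gamma>1 + T n i \<gamma>2. The second
      summand disappears in the limit because \<open>T n\<close> times the possible growth (T n)^(e
      - 1) of the derivative still tends to 0.\<close>
    have "\<exists>h. \<forall>x\<in>UNIV. (\<lambda>n. F k x (T n)) \<longlonglongrightarrow> h x \<and> (h has_derivative (\<lambda>y. y *\<^sub>R (\<gamma>1 x * G (Suc k) x))) (at x within UNIV)"
    proof (rule has_derivative_sequence[where f'="\<lambda>n x y. y *\<^sub>R ((\<gamma>1 x + of_real (T n) * (\<i> * \<gamma>2 x)) * F (Suc k) x (T n))"])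
      show "((\<lambda>x. F k x (T n)) has_derivative (\<lambda>y. y *\<^sub>R ((\<gamma>1 x + of_real (T n) * (\<i> * \<gamma>2 x)) * F (Suc k) x (T n)))) (at x within UNIV)" for n x
        using deriv_along_curve[OF nin[OF T], of k n x] by (simp add: F_def has_vector_derivative_def)
      show "(\<lambda>n. F k 0 (T n)) \<longlonglongrightarrow> G k 0" using k by (intro Glim) auto
      fix \<epsilon> :: real assume \<epsilon>: "\<epsilon> > 0"
      have "(\<lambda>n. Cb * T n powr e) \<longlonglongrightarrow> Cb * 0" by (intro tendsto_intros Te)
      then have "\<forall>\<^sub>F n in sequentially. Cb * T n powr e < \<epsilon>" using \<epsilon> by (intro order_tendstoD(2)) auto
      then show "\<forall>\<^sub>F n in sequentially. \<forall>x\<in>UNIV. \<forall>h. norm (h *\<^sub>R ((\<gamma>1 x + of_real (T n) * (\<i> * \<gamma>2 x)) * F (Suc k) x (T n)) - h *\<^sub>R (\<gamma>1 x * G (Suc k) x)) \<le> \<epsilon> * norm h"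
      proof eventually_elim
        case (elim n)
        show ?case
        proof (intro ballI allI)
          fix x h :: real
          let ?F = "F (Suc k) x (T n)"
          have "(\<gamma>1 x + of_real (T n) * (\<i> * \<gamma>2 x)) * ?F - \<gamma>1 x * G (Suc k) x = \<gamma>1 x * (?F - G (Suc k) x) + of_real (T n) * (\<i> * \<gamma>2 x) * ?F"
            by (simp add: algebra_simps)
          then have "norm ((\<gamma>1 x + of_real (T n) * (\<i> * \<gamma>2 x)) * ?F - \<gamma>1 x * G (Suc k) x) \<le> norm (?F - G (Suc k) x) + T n * norm (\<gamma>2 x) * norm ?F"
            using norm_triangle_ineq[of "\<gamma>1 x * (?F - G (Suc k) x)" "of_real (T n) * (\<i> * \<gamma>2 x) * ?F"] T[of n] by (simp add: norm_mult unit)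
          also have "norm (?F - G (Suc k) x) \<le> Ck (Suc (Suc k)) / e * T n powr e" using k by (intro rate T) auto
          also have "T n * norm (\<gamma>2 x) * norm ?F \<le> T n * B * (Ck (Suc k) * T n powr (e - 1))"
            using T[of n] B Ck[of "Suc k" "T n" x] k by (intro mult_mono) auto
          also have "\<dots> = B * Ck (Suc k) * T n powr e"
            using T(1)[of n] powr_add[of "T n" 1 "e - 1"] by simp
          finally have "norm ((\<gamma>1 x + of_real (T n) * (\<i> * \<gamma>2 x)) * ?F - \<gamma>1 x * G (Suc k) x) \<le> Cb * T n powr e"
            by (simp add: Cb_def distrib_right)
          then have "norm ((\<gamma>1 x + of_real (T n) * (\<i> * \<gamma>2 x)) * ?F - \<gamma>1 x * G (Suc k) x) \<le> \<epsilon>" using elim by simp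
          from mult_left_mono[OF this abs_ge_zero[of h]]
          show "norm (h *\<^sub>R ((\<gamma>1 x + of_real (T n) * (\<i> * \<gamma>2 x)) * ?F) - h *\<^sub>R (\<gamma>1 x * G (Suc k) x)) \<le> \<epsilon> * norm h"
            by (simp only: scaleR_diff_right[symmetric] norm_scaleR real_norm_def mult.commute)
        qed
      qed
    qed auto
    then obtain h where h: "\<And>x. (\<lambda>n. F k x (T n)) \<longlonglongrightarrow> h x" "\<And>x. (h has_derivative (\<lambda>y. y *\<^sub>R (\<gamma>1 x * G (Suc k) x))) (at x)" by auto
    have "h = G k" using h(1) Glim[of k] k LIMSEQ_unique by fastforce
    then show "(G k has_vector_derivative \<gamma>1 s * G (Suc k) s) (at s)" using h(2)[of s] by (simp add: has_vector_derivative_def)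
  next
    show "continuous_on UNIV (G 3)"
    proof (rule uniform_limit_theorem)
      show "\<forall>\<^sub>F n in sequentially. continuous_on UNIV (\<lambda>s. F 3 s (T n))"
      proof (rule always_eventually, rule allI)
        fix n
        show "continuous_on UNIV (\<lambda>s. F 3 s (T n))"
          unfolding F_def
          by (intro continuous_at_imp_continuous_on ballI has_vector_derivative_continuous[OF deriv_along_curve[OF nin[OF T]]])
      qed
      show "uniform_limit UNIV (\<lambda>n s. F 3 s (T n)) (G 3) sequentially"
        unfolding uniform_limit_iff
      proof safe
        fix \<epsilon> :: real assume \<epsilon>: "\<epsilon> > 0"
        have "(\<lambda>n. Ck (Suc 3) / e * T n powr e) \<longlonglongrightarrow> Ck (Suc 3) / e * 0" by (intro tendsto_intros Te)
        then have "\<forall>\<^sub>F n in sequentially. Ck (Suc 3) / e * T n powr e < \<epsilon>" using \<epsilon> by (intro order_tendstoD(2)) auto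
        then show "\<forall>\<^sub>F n in sequentially. \<forall>x\<in>UNIV. dist (F 3 x (T n)) (G 3 x) < \<epsilon>"
        proof eventually_elim
          case (elim n)
          then show ?case using rate[of 3 "T n"] T[of n] by (auto simp: dist_norm intro: le_less_trans)
        qed
      qed
    qed simp
  next
    show "G k (s + L) = G k s" for k s by (simp add: G_def F_def nrm_periodic)
  qed
qed

end

section \<open>Expansion along the normal\<close>

text \<open>f = 1 + a t + b t^2 + o(t^2) as t tends to 0 from the right. The leading coefficient is
  normalised to 1 so that products and reciprocal roots are computed on two coefficients.\<close>

definition expands :: "(real \<Rightarrow> real) \<Rightarrow> real \<Rightarrow> real \<Rightarrow> bool" where
  "expands f a b \<longleftrightarrow> ((\<lambda>t. (f t - (1 + a * t + b * t\<^sup>2)) / t\<^sup>2) \<longlongrightarrow> 0) (at_right 0)"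

lemma tendsto_right_ident: "((\<lambda>t::real. t) \<longlongrightarrow> 0) (at_right 0)"
  by (rule tendsto_ident_at)

lemma eventually_right_pos: "\<forall>\<^sub>F t in at_right (0::real). t > 0"
  by (simp add: eventually_at_right_less)

lemma expands_linear:
  assumes "expands f a b"
  shows "((\<lambda>t. (f t - 1) / t) \<longlongrightarrow> a) (at_right 0)"
proof -
  let ?r = "\<lambda>t. (f t - (1 + a * t + b * t\<^sup>2)) / t\<^sup>2"
  have "((\<lambda>t. ?r t * t + a + b * t) \<longlongrightarrow> 0 * 0 + a + b * 0) (at_right 0)"
    by (intro tendsto_intros assms[unfolded expands_def])
  then have "((\<lambda>t. ?r t * t + a + b * t) \<longlongrightarrow> a) (at_right 0)" by simp
  moreover have "\<forall>\<^sub>F t in at_right 0. ?r t * t + a + b * t = (f t - 1) / t"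
    using eventually_right_pos by eventually_elim (simp add: field_simps power2_eq_square)
  ultimately show ?thesis by (rule Lim_transform_eventually)
qed

lemma expands_limit:
  assumes "expands f a b"
  shows "(f \<longlongrightarrow> 1) (at_right 0)"
proof -
  have "((\<lambda>t. (f t - 1) / t * t + 1) \<longlongrightarrow> a * 0 + 1) (at_right 0)"
    by (intro tendsto_intros expands_linear[OF assms])
  moreover have "\<forall>\<^sub>F t in at_right 0. (f t - 1) / t * t + 1 = f t"
    using eventually_right_pos by eventually_elim simp
  ultimately show ?thesis using Lim_transform_eventually by fastforce
qed

lemma expands_mult:
  assumes f: "expands f a b" and g: "expands g c d"
  shows "expands (\<lambda>t. f t * g t) (a + c) (b + a * c + d)"
proof -
  let ?r = "\<lambda>t. (f t - (1 + a * t + b * t\<^sup>2)) / t\<^sup>2"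
  let ?s = "\<lambda>t. (g t - (1 + c * t + d * t\<^sup>2)) / t\<^sup>2"
  have "((\<lambda>t. ?r t * g t + (1 + a * t + b * t\<^sup>2) * ?s t + (a * d + b * c) * t + b * d * t\<^sup>2)
     \<longlongrightarrow> 0 * 1 + (1 + a * 0 + b * 0\<^sup>2) * 0 + (a * d + b * c) * 0 + b * d * 0\<^sup>2) (at_right 0)"
    by (intro tendsto_intros f[unfolded expands_def] g[unfolded expands_def] expands_limit[OF g])
  then have 1: "((\<lambda>t. ?r t * g t + (1 + a * t + b * t\<^sup>2) * ?s t + (a * d + b * c) * t + b * d * t\<^sup>2) \<longlongrightarrow> 0) (at_right 0)" by simp
  have "\<forall>\<^sub>F t in at_right 0. ?r t * g t + (1 + a * t + b * t\<^sup>2) * ?s t + (a * d + b * c) * t + b * d * t\<^sup>2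
     = (f t * g t - (1 + (a + c) * t + (b + a * c + d) * t\<^sup>2)) / t\<^sup>2"
    using eventually_right_pos
  proof eventually_elim
    case (elim t)
    have "?r t * g t + (1 + a * t + b * t\<^sup>2) * ?s t
      = ((f t - (1 + a * t + b * t\<^sup>2)) * g t + (1 + a * t + b * t\<^sup>2) * (g t - (1 + c * t + d * t\<^sup>2))) / t\<^sup>2"
      by (simp add: add_divide_distrib)
    moreover have "(a * d + b * c) * t + b * d * t\<^sup>2 = ((a * d + b * c) * t + b * d * t\<^sup>2) * t\<^sup>2 / t\<^sup>2" using elim by simp
    ultimately have "?r t * g t + (1 + a * t + b * t\<^sup>2) * ?s t + ((a * d + b * c) * t + b * d * t\<^sup>2) =
      ((f t - (1 + a * t + b * t\<^sup>2)) * g t + (1 + a * t + b * t\<^sup>2) * (g t - (1 + c * t + d * t\<^sup>2)) + ((a * d + b * c) * t + b * d * t\<^sup>2) * t\<^sup>2) / t\<^sup>2"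
      by (simp add: add_divide_distrib)
    also have "(f t - (1 + a * t + b * t\<^sup>2)) * g t + (1 + a * t + b * t\<^sup>2) * (g t - (1 + c * t + d * t\<^sup>2)) + ((a * d + b * c) * t + b * d * t\<^sup>2) * t\<^sup>2
      = f t * g t - (1 + (a + c) * t + (b + a * c + d) * t\<^sup>2)"
      by (simp add: algebra_simps power2_eq_square)
    finally show ?case by (simp add: add.assoc)
  qed
  then show ?thesis unfolding expands_def using 1 by (rule Lim_transform_eventually[rotated])
qed

text \<open>The remainder of the outer function has the form y^2 w(y) with w continuous at 0.
  Substituting u = O(t) therefore leaves o(t^2), including at points where u vanishes.\<close>

lemma expands_comp:
  fixes \<phi> :: "real \<Rightarrow> real" and u :: "real \<Rightarrow> real"
  assumes \<phi>: "((\<lambda>y. (\<phi> y - (1 + p * y + k * y\<^sup>2)) / y\<^sup>2) \<longlongrightarrow> 0) (at 0)" and \<phi>0: "\<phi> 0 = 1"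
    and u: "((\<lambda>t. (u t - (m1 * t + m2 * t\<^sup>2)) / t\<^sup>2) \<longlongrightarrow> 0) (at_right 0)"
  shows "expands (\<lambda>t. \<phi> (u t)) (p * m1) (p * m2 + k * m1\<^sup>2)"
proof -
  define w where "w = (\<lambda>y. (\<phi> y - (1 + p * y + k * y\<^sup>2)) / y\<^sup>2)"
  have w0: "w 0 = 0" by (simp add: w_def)
  have wc: "isCont w 0" using \<phi> w0 by (simp add: isCont_def w_def[symmetric])
  let ?r = "\<lambda>t. (u t - (m1 * t + m2 * t\<^sup>2)) / t\<^sup>2"
  have ut: "((\<lambda>t. u t / t) \<longlongrightarrow> m1) (at_right 0)"
  proof -
    have "((\<lambda>t. ?r t * t + m1 + m2 * t) \<longlongrightarrow> 0 * 0 + m1 + m2 * 0) (at_right 0)" by (intro tendsto_intros u)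
    then have "((\<lambda>t. ?r t * t + m1 + m2 * t) \<longlongrightarrow> m1) (at_right 0)" by simp
    moreover have "\<forall>\<^sub>F t in at_right 0. ?r t * t + m1 + m2 * t = u t / t"
      using eventually_right_pos by eventually_elim (simp add: field_simps power2_eq_square)
    ultimately show ?thesis by (rule Lim_transform_eventually)
  qed
  have u0: "(u \<longlongrightarrow> 0) (at_right 0)"
  proof -
    have "((\<lambda>t. u t / t * t) \<longlongrightarrow> m1 * 0) (at_right 0)" by (intro tendsto_intros ut)
    moreover have "\<forall>\<^sub>F t in at_right 0. u t / t * t = u t" using eventually_right_pos by eventually_elim simp
    ultimately show ?thesis using Lim_transform_eventually by fastforce
  qed
  have wu: "((\<lambda>t. w (u t)) \<longlongrightarrow> 0) (at_right 0)" using isCont_tendsto_compose[OF wc u0] w0 by simp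
  have "((\<lambda>t. (u t / t)\<^sup>2 * w (u t) + p * ?r t + k * ((u t / t)\<^sup>2 - m1\<^sup>2)) \<longlongrightarrow> m1\<^sup>2 * 0 + p * 0 + k * (m1\<^sup>2 - m1\<^sup>2)) (at_right 0)"
    by (intro tendsto_intros ut wu u)
  then have 1: "((\<lambda>t. (u t / t)\<^sup>2 * w (u t) + p * ?r t + k * ((u t / t)\<^sup>2 - m1\<^sup>2)) \<longlongrightarrow> 0) (at_right 0)" by simp
  have "\<forall>\<^sub>F t in at_right 0. (u t / t)\<^sup>2 * w (u t) + p * ?r t + k * ((u t / t)\<^sup>2 - m1\<^sup>2)
     = (\<phi> (u t) - (1 + p * m1 * t + (p * m2 + k * m1\<^sup>2) * t\<^sup>2)) / t\<^sup>2"
    using eventually_right_pos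
  proof eventually_elim
    case (elim t)
    have "(u t)\<^sup>2 * w (u t) = \<phi> (u t) - (1 + p * u t + k * (u t)\<^sup>2)"
      by (cases "u t = 0") (simp_all add: w_def \<phi>0)
    then have "(u t / t)\<^sup>2 * w (u t) = (\<phi> (u t) - (1 + p * u t + k * (u t)\<^sup>2)) / t\<^sup>2"
      by (simp add: power_divide)
    moreover have "p * ?r t = (p * (u t - (m1 * t + m2 * t\<^sup>2))) / t\<^sup>2" by simp
    moreover have "k * ((u t / t)\<^sup>2 - m1\<^sup>2) = (k * ((u t)\<^sup>2 - m1\<^sup>2 * t\<^sup>2)) / t\<^sup>2" using elim by (simp add: power_divide field_simps)
    ultimately have "(u t / t)\<^sup>2 * w (u t) + p * ?r t + k * ((u t / t)\<^sup>2 - m1\<^sup>2)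
      = ((\<phi> (u t) - (1 + p * u t + k * (u t)\<^sup>2)) + p * (u t - (m1 * t + m2 * t\<^sup>2)) + k * ((u t)\<^sup>2 - m1\<^sup>2 * t\<^sup>2)) / t\<^sup>2"
      by (simp only: add_divide_distrib)
    also have "(\<phi> (u t) - (1 + p * u t + k * (u t)\<^sup>2)) + p * (u t - (m1 * t + m2 * t\<^sup>2)) + k * ((u t)\<^sup>2 - m1\<^sup>2 * t\<^sup>2)
      = \<phi> (u t) - (1 + p * m1 * t + (p * m2 + k * m1\<^sup>2) * t\<^sup>2)" by (simp add: algebra_simps)
    finally show ?case .
  qed
  then show ?thesis unfolding expands_def using 1 by (rule Lim_transform_eventually[rotated])
qed

lemma expands_rsqrt:
  assumes "expands M m1 m2"
  shows "expands (\<lambda>t. 1 / sqrt (M t)) (- m1 / 2) (3 * m1\<^sup>2 / 8 - m2 / 2)"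
proof -
  have 1: "((\<lambda>y::real. (1 / sqrt (1 + y) - (1 + (-1/2) * y + (3/8) * y\<^sup>2)) / y\<^sup>2) \<longlongrightarrow> 0) (at 0)"
    by real_asymp
  have "((\<lambda>t. ((M t - 1) - (m1 * t + m2 * t\<^sup>2)) / t\<^sup>2) \<longlongrightarrow> 0) (at_right 0)"
    using assms unfolding expands_def by (simp add: algebra_simps)
  from expands_comp[OF 1 _ this] show ?thesis by simp
qed

text \<open>sin y / y has no linear term, so at second order only the linear coefficient of
  \<open>u\<close> enters. The case distinction fills the removable singularity.\<close>

lemma expands_sinc:
  assumes "((\<lambda>t. (u t - (m1 * t + m2 * t\<^sup>2)) / t\<^sup>2) \<longlongrightarrow> 0) (at_right 0)"
  shows "expands (\<lambda>t. if u t = 0 then 1 else sin (u t) / u t) 0 (- m1\<^sup>2 / 6)"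
proof -
  have "((\<lambda>y::real. (sin y / y - (1 + 0 * y + (-1/6) * y\<^sup>2)) / y\<^sup>2) \<longlongrightarrow> 0) (at 0)"
    by real_asymp
  moreover have "\<forall>\<^sub>F y in at (0::real). (sin y / y - (1 + 0 * y + (-1/6) * y\<^sup>2)) / y\<^sup>2
      = ((if y = 0 then 1 else sin y / y) - (1 + 0 * y + (-1/6) * y\<^sup>2)) / y\<^sup>2"
    by (auto simp: eventually_at_filter)
  ultimately have "((\<lambda>y::real. ((if y = 0 then 1 else sin y / y) - (1 + 0 * y + (-1/6) * y\<^sup>2)) / y\<^sup>2) \<longlongrightarrow> 0) (at 0)"
    by (rule Lim_transform_eventually)
  from expands_comp[OF this _ assms] show ?thesis by simp
qed

text \<open>L'Hopital's rule takes the role of integration, since the functions are given for t > 0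
  only, with a limit at 0 instead of a value.\<close>

lemma integrate_little_o:
  fixes f f' :: "real \<Rightarrow> real"
  assumes \<delta>: "\<delta> > 0" and d: "\<And>t. 0 < t \<Longrightarrow> t < \<delta> \<Longrightarrow> (f has_real_derivative f' t) (at t)"
    and f0: "(f \<longlongrightarrow> 0) (at_right 0)" and f': "((\<lambda>t. f' t / t ^ k) \<longlongrightarrow> 0) (at_right 0)"
  shows "((\<lambda>t. f t / t ^ Suc k) \<longlongrightarrow> 0) (at_right 0)"
proof (rule lhopital_right[where f'=f' and g'="\<lambda>t. real (Suc k) * t ^ k"])
  show "((\<lambda>t. t ^ Suc k) \<longlongrightarrow> 0) (at_right (0::real))"
    by (rule tendsto_eq_intros tendsto_right_ident refl | simp)+
  show "\<forall>\<^sub>F t in at_right 0. (f has_real_derivative f' t) (at t)"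
    unfolding eventually_at_right_field using \<delta> d by blast
  show "\<forall>\<^sub>F t in at_right 0. ((\<lambda>t. t ^ Suc k) has_real_derivative real (Suc k) * t ^ k) (at t)"
    by (intro always_eventually allI) (auto intro!: derivative_eq_intros simp del: power_Suc)
  have "((\<lambda>t. f' t / t ^ k / real (Suc k)) \<longlongrightarrow> 0 / real (Suc k)) (at_right 0)"
    by (intro tendsto_intros f') auto
  then show "((\<lambda>t. f' t / (real (Suc k) * t ^ k)) \<longlongrightarrow> 0) (at_right 0)" by (simp add: mult.commute)
  show "\<forall>\<^sub>F t in at_right 0. t ^ Suc k \<noteq> (0::real)" "\<forall>\<^sub>F t in at_right 0. real (Suc k) * t ^ k \<noteq> 0"
    using eventually_right_pos by (eventually_elim, simp)+
qed (rule f0)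

text \<open>\<open>X\<close> stands for - ln |g| and \<open>Q\<close> for |g'/g|^2 along a normal,
  \<open>p1\<close> and \<open>p2\<close> for the derivatives of \<psi> along the curve. Divided by
  \<open>t\<close>, the expression is a product of three factors with constant term 1: sin (a X) /
  (a X), X / (\<psi> t) and the reciprocal root of Q / \<psi>^2. The linear coefficient is
  \<kappa>/2 - \<kappa> = - \<kappa>/2, which is the term subtracted in the definition of
  \<open>c3_coeff\<close>.\<close>

lemma normal_expansion:
  fixes X X1 X2 X3 Q Q1 Q2 :: "real \<Rightarrow> real"
  assumes \<delta>: "\<delta> > 0"
    and X: "\<And>t. 0 < t \<Longrightarrow> t < \<delta> \<Longrightarrow> (X has_real_derivative X1 t) (at t)"
      "\<And>t. 0 < t \<Longrightarrow> t < \<delta> \<Longrightarrow> (X1 has_real_derivative X2 t) (at t)"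
      "\<And>t. 0 < t \<Longrightarrow> t < \<delta> \<Longrightarrow> (X2 has_real_derivative X3 t) (at t)"
    and Q: "\<And>t. 0 < t \<Longrightarrow> t < \<delta> \<Longrightarrow> (Q has_real_derivative Q1 t) (at t)"
      "\<And>t. 0 < t \<Longrightarrow> t < \<delta> \<Longrightarrow> (Q1 has_real_derivative Q2 t) (at t)"
    and Xl: "(X \<longlongrightarrow> 0) (at_right 0)" "(X1 \<longlongrightarrow> \<psi>) (at_right 0)" "(X2 \<longlongrightarrow> \<kappa> * \<psi>) (at_right 0)" "(X3 \<longlongrightarrow> 2 * \<kappa>\<^sup>2 * \<psi> - p2) (at_right 0)"
    and Ql: "(Q \<longlongrightarrow> \<psi>\<^sup>2) (at_right 0)" "(Q1 \<longlongrightarrow> 2 * \<kappa> * \<psi>\<^sup>2) (at_right 0)"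
      "(Q2 \<longlongrightarrow> 6 * \<kappa>\<^sup>2 * \<psi>\<^sup>2 + 2 * p1\<^sup>2 - 2 * \<psi> * p2) (at_right 0)"
    and \<psi>: "\<psi> > 0" and a: "a > 0"
  shows "((\<lambda>t. (sin (a * X t) / a / sqrt (Q t) - t + \<kappa> * t\<^sup>2 / 2) / t ^ 3) \<longlongrightarrow>
     p2 / (3 * \<psi>) - \<kappa>\<^sup>2 / 6 - (p1 / \<psi>)\<^sup>2 / 2 - a\<^sup>2 * \<psi>\<^sup>2 / 6) (at_right 0)"
proof -
  define x3 where "x3 = 2 * \<kappa>\<^sup>2 * \<psi> - p2"
  define q2 where "q2 = 6 * \<kappa>\<^sup>2 * \<psi>\<^sup>2 + 2 * p1\<^sup>2 - 2 * \<psi> * p2"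
  have e3: "((\<lambda>t. (X2 t - (\<kappa> * \<psi> + x3 * t)) / t ^ Suc 0) \<longlongrightarrow> 0) (at_right 0)"
  proof (rule integrate_little_o[OF \<delta>, where f'="\<lambda>t. X3 t - x3"])
    show "((\<lambda>t. X2 t - (\<kappa> * \<psi> + x3 * t)) has_real_derivative X3 t - x3) (at t)" if "0 < t" "t < \<delta>" for t
      using X(3)[OF that] by (auto intro!: derivative_eq_intros)
    have "((\<lambda>t. X2 t - (\<kappa> * \<psi> + x3 * t)) \<longlongrightarrow> \<kappa> * \<psi> - (\<kappa> * \<psi> + x3 * 0)) (at_right 0)" by (intro tendsto_intros Xl)
    then show "((\<lambda>t. X2 t - (\<kappa> * \<psi> + x3 * t)) \<longlongrightarrow> 0) (at_right 0)" by simp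
    have "((\<lambda>t. X3 t - x3) \<longlongrightarrow> x3 - x3) (at_right 0)" using Xl(4) by (intro tendsto_intros) (simp add: x3_def)
    then show "((\<lambda>t. (X3 t - x3) / t ^ 0) \<longlongrightarrow> 0) (at_right 0)" by simp
  qed
  have e2: "((\<lambda>t. (X1 t - (\<psi> + \<kappa> * \<psi> * t + x3 * t\<^sup>2 / 2)) / t ^ Suc (Suc 0)) \<longlongrightarrow> 0) (at_right 0)"
  proof (rule integrate_little_o[OF \<delta> _ _ e3])
    show "((\<lambda>t. X1 t - (\<psi> + \<kappa> * \<psi> * t + x3 * t\<^sup>2 / 2)) has_real_derivative X2 t - (\<kappa> * \<psi> + x3 * t)) (at t)" if "0 < t" "t < \<delta>" for t
      using X(2)[OF that] by (auto intro!: derivative_eq_intros)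
    have "((\<lambda>t. X1 t - (\<psi> + \<kappa> * \<psi> * t + x3 * t\<^sup>2 / 2)) \<longlongrightarrow> \<psi> - (\<psi> + \<kappa> * \<psi> * 0 + x3 * 0\<^sup>2 / 2)) (at_right 0)" by (intro tendsto_intros Xl) simp
    then show "((\<lambda>t. X1 t - (\<psi> + \<kappa> * \<psi> * t + x3 * t\<^sup>2 / 2)) \<longlongrightarrow> 0) (at_right 0)" by simp
  qed
  have e1: "((\<lambda>t. (X t - (\<psi> * t + \<kappa> * \<psi> * t\<^sup>2 / 2 + x3 * t ^ 3 / 6)) / t ^ Suc (Suc (Suc 0))) \<longlongrightarrow> 0) (at_right 0)"
  proof (rule integrate_little_o[OF \<delta> _ _ e2])
    show "((\<lambda>t. X t - (\<psi> * t + \<kappa> * \<psi> * t\<^sup>2 / 2 + x3 * t ^ 3 / 6)) has_real_derivative X1 t - (\<psi> + \<kappa> * \<psi> * t + x3 * t\<^sup>2 / 2)) (at t)" if "0 < t" "t < \<delta>" for t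
      using X(1)[OF that] by (auto intro!: derivative_eq_intros simp: field_simps)
    have "((\<lambda>t. X t - (\<psi> * t + \<kappa> * \<psi> * t\<^sup>2 / 2 + x3 * t ^ 3 / 6)) \<longlongrightarrow> 0 - (\<psi> * 0 + \<kappa> * \<psi> * 0\<^sup>2 / 2 + x3 * 0 ^ 3 / 6)) (at_right 0)" by (intro tendsto_intros Xl) simp_all
    then show "((\<lambda>t. X t - (\<psi> * t + \<kappa> * \<psi> * t\<^sup>2 / 2 + x3 * t ^ 3 / 6)) \<longlongrightarrow> 0) (at_right 0)" by simp
  qed
  have m1: "((\<lambda>t. (Q1 t - (2 * \<kappa> * \<psi>\<^sup>2 + q2 * t)) / t ^ Suc 0) \<longlongrightarrow> 0) (at_right 0)"
  proof (rule integrate_little_o[OF \<delta>, where f'="\<lambda>t. Q2 t - q2"])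
    show "((\<lambda>t. Q1 t - (2 * \<kappa> * \<psi>\<^sup>2 + q2 * t)) has_real_derivative Q2 t - q2) (at t)" if "0 < t" "t < \<delta>" for t
      using Q(2)[OF that] by (auto intro!: derivative_eq_intros)
    have "((\<lambda>t. Q1 t - (2 * \<kappa> * \<psi>\<^sup>2 + q2 * t)) \<longlongrightarrow> 2 * \<kappa> * \<psi>\<^sup>2 - (2 * \<kappa> * \<psi>\<^sup>2 + q2 * 0)) (at_right 0)" by (intro tendsto_intros Ql)
    then show "((\<lambda>t. Q1 t - (2 * \<kappa> * \<psi>\<^sup>2 + q2 * t)) \<longlongrightarrow> 0) (at_right 0)" by simp
    have "((\<lambda>t. Q2 t - q2) \<longlongrightarrow> q2 - q2) (at_right 0)" using Ql(3) by (intro tendsto_intros) (simp add: q2_def)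
    then show "((\<lambda>t. (Q2 t - q2) / t ^ 0) \<longlongrightarrow> 0) (at_right 0)" by simp
  qed
  have m0: "((\<lambda>t. (Q t - (\<psi>\<^sup>2 + 2 * \<kappa> * \<psi>\<^sup>2 * t + q2 * t\<^sup>2 / 2)) / t ^ Suc (Suc 0)) \<longlongrightarrow> 0) (at_right 0)"
  proof (rule integrate_little_o[OF \<delta> _ _ m1])
    show "((\<lambda>t. Q t - (\<psi>\<^sup>2 + 2 * \<kappa> * \<psi>\<^sup>2 * t + q2 * t\<^sup>2 / 2)) has_real_derivative Q1 t - (2 * \<kappa> * \<psi>\<^sup>2 + q2 * t)) (at t)" if "0 < t" "t < \<delta>" for t
      using Q(1)[OF that] by (auto intro!: derivative_eq_intros)
    have "((\<lambda>t. Q t - (\<psi>\<^sup>2 + 2 * \<kappa> * \<psi>\<^sup>2 * t + q2 * t\<^sup>2 / 2)) \<longlongrightarrow> \<psi>\<^sup>2 - (\<psi>\<^sup>2 + 2 * \<kappa> * \<psi>\<^sup>2 * 0 + q2 * 0\<^sup>2 / 2)) (at_right 0)" by (intro tendsto_intros Ql) simp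
    then show "((\<lambda>t. Q t - (\<psi>\<^sup>2 + 2 * \<kappa> * \<psi>\<^sup>2 * t + q2 * t\<^sup>2 / 2)) \<longlongrightarrow> 0) (at_right 0)" by simp
  qed
  have EX: "expands (\<lambda>t. X t / (\<psi> * t)) (\<kappa> / 2) (x3 / (6 * \<psi>))"
  proof -
    have "((\<lambda>t. (X t - (\<psi> * t + \<kappa> * \<psi> * t\<^sup>2 / 2 + x3 * t ^ 3 / 6)) / t ^ Suc (Suc (Suc 0)) / \<psi>) \<longlongrightarrow> 0 / \<psi>) (at_right 0)"
      using \<psi> by (intro tendsto_intros e1) auto
    then have 1: "((\<lambda>t. (X t - (\<psi> * t + \<kappa> * \<psi> * t\<^sup>2 / 2 + x3 * t ^ 3 / 6)) / t ^ Suc (Suc (Suc 0)) / \<psi>) \<longlongrightarrow> 0) (at_right 0)" by simp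
    have "\<forall>\<^sub>F t in at_right 0. (X t - (\<psi> * t + \<kappa> * \<psi> * t\<^sup>2 / 2 + x3 * t ^ 3 / 6)) / t ^ Suc (Suc (Suc 0)) / \<psi>
        = (X t / (\<psi> * t) - (1 + \<kappa> / 2 * t + x3 / (6 * \<psi>) * t\<^sup>2)) / t\<^sup>2"
      using eventually_right_pos
    proof eventually_elim
      case (elim t)
      have "X t / (\<psi> * t) - (1 + \<kappa> / 2 * t + x3 / (6 * \<psi>) * t\<^sup>2) = (X t - (\<psi> * t + \<kappa> * \<psi> * t\<^sup>2 / 2 + x3 * t ^ 3 / 6)) / (\<psi> * t)"
        using elim \<psi> by (simp add: field_simps power2_eq_square power3_eq_cube)
      then show ?case by (simp add: power2_eq_square mult_ac)
    qed
    then show ?thesis unfolding expands_def using 1 by (rule Lim_transform_eventually[rotated])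
  qed
  have EQ: "expands (\<lambda>t. Q t / \<psi>\<^sup>2) (2 * \<kappa>) (q2 / (2 * \<psi>\<^sup>2))"
  proof -
    have "((\<lambda>t. (Q t - (\<psi>\<^sup>2 + 2 * \<kappa> * \<psi>\<^sup>2 * t + q2 * t\<^sup>2 / 2)) / t ^ Suc (Suc 0) / \<psi>\<^sup>2) \<longlongrightarrow> 0 / \<psi>\<^sup>2) (at_right 0)"
      using \<psi> by (intro tendsto_intros m0) auto
    then have 1: "((\<lambda>t. (Q t - (\<psi>\<^sup>2 + 2 * \<kappa> * \<psi>\<^sup>2 * t + q2 * t\<^sup>2 / 2)) / t ^ Suc (Suc 0) / \<psi>\<^sup>2) \<longlongrightarrow> 0) (at_right 0)" by simp
    have "(Q t - (\<psi>\<^sup>2 + 2 * \<kappa> * \<psi>\<^sup>2 * t + q2 * t\<^sup>2 / 2)) / t ^ Suc (Suc 0) / \<psi>\<^sup>2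
        = (Q t / \<psi>\<^sup>2 - (1 + 2 * \<kappa> * t + q2 / (2 * \<psi>\<^sup>2) * t\<^sup>2)) / t\<^sup>2" for t
    proof -
      have "Q t / \<psi>\<^sup>2 - (1 + 2 * \<kappa> * t + q2 / (2 * \<psi>\<^sup>2) * t\<^sup>2) = (Q t - (\<psi>\<^sup>2 + 2 * \<kappa> * \<psi>\<^sup>2 * t + q2 * t\<^sup>2 / 2)) / \<psi>\<^sup>2"
        using \<psi> by (simp add: field_simps)
      then show ?thesis by (simp add: power2_eq_square mult_ac)
    qed
    with 1 show ?thesis unfolding expands_def by simp
  qed
  have u: "((\<lambda>t. (a * X t - (a * \<psi> * t + a * \<kappa> * \<psi> / 2 * t\<^sup>2)) / t\<^sup>2) \<longlongrightarrow> 0) (at_right 0)"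
  proof -
    have "((\<lambda>t. a * ((X t - (\<psi> * t + \<kappa> * \<psi> * t\<^sup>2 / 2 + x3 * t ^ 3 / 6)) / t ^ Suc (Suc (Suc 0)) * t + x3 / 6 * t)) \<longlongrightarrow> a * (0 * 0 + x3 / 6 * 0)) (at_right 0)"
      by (intro tendsto_intros e1)
    then have 1: "((\<lambda>t. a * ((X t - (\<psi> * t + \<kappa> * \<psi> * t\<^sup>2 / 2 + x3 * t ^ 3 / 6)) / t ^ Suc (Suc (Suc 0)) * t + x3 / 6 * t)) \<longlongrightarrow> 0) (at_right 0)" by simp
    have "\<forall>\<^sub>F t in at_right 0. a * ((X t - (\<psi> * t + \<kappa> * \<psi> * t\<^sup>2 / 2 + x3 * t ^ 3 / 6)) / t ^ Suc (Suc (Suc 0)) * t + x3 / 6 * t)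
        = (a * X t - (a * \<psi> * t + a * \<kappa> * \<psi> / 2 * t\<^sup>2)) / t\<^sup>2"
      using eventually_right_pos
    proof eventually_elim
      case (elim t)
      have "(X t - (\<psi> * t + \<kappa> * \<psi> * t\<^sup>2 / 2 + x3 * t ^ 3 / 6)) / t ^ Suc (Suc (Suc 0)) * t
        = (X t - (\<psi> * t + \<kappa> * \<psi> * t\<^sup>2 / 2 + x3 * t ^ 3 / 6)) / t\<^sup>2" using elim by (simp add: power2_eq_square)
      moreover have "x3 / 6 * t = (x3 * t ^ 3 / 6) / t\<^sup>2" using elim by (simp add: power2_eq_square power3_eq_cube)
      ultimately have "a * ((X t - (\<psi> * t + \<kappa> * \<psi> * t\<^sup>2 / 2 + x3 * t ^ 3 / 6)) / t ^ Suc (Suc (Suc 0)) * t + x3 / 6 * t)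
         = a * (((X t - (\<psi> * t + \<kappa> * \<psi> * t\<^sup>2 / 2 + x3 * t ^ 3 / 6)) + x3 * t ^ 3 / 6) / t\<^sup>2)"
        by (simp only: add_divide_distrib)
      then show ?case by (simp add: algebra_simps)
    qed
    then show ?thesis using 1 by (rule Lim_transform_eventually[rotated])
  qed
  have "expands (\<lambda>t. (if a * X t = 0 then 1 else sin (a * X t) / (a * X t)) * (X t / (\<psi> * t) * (1 / sqrt (Q t / \<psi>\<^sup>2))))
     (0 + (\<kappa> / 2 + - (2 * \<kappa>) / 2)) (- (a * \<psi>)\<^sup>2 / 6 + 0 * (\<kappa> / 2 + - (2 * \<kappa>) / 2) +
     (x3 / (6 * \<psi>) + \<kappa> / 2 * (- (2 * \<kappa>) / 2) + (3 * (2 * \<kappa>)\<^sup>2 / 8 - q2 / (2 * \<psi>\<^sup>2) / 2)))"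
    by (intro expands_mult expands_sinc[OF u] EX expands_rsqrt[OF EQ])
  moreover have "0 + (\<kappa> / 2 + - (2 * \<kappa>) / 2) = - \<kappa> / 2" by simp
  moreover define c where "c = p2 / (3 * \<psi>) - \<kappa>\<^sup>2 / 6 - (p1 / \<psi>)\<^sup>2 / 2 - a\<^sup>2 * \<psi>\<^sup>2 / 6"
  have "- (a * \<psi>)\<^sup>2 / 6 + 0 * (\<kappa> / 2 + - (2 * \<kappa>) / 2) +
     (x3 / (6 * \<psi>) + \<kappa> / 2 * (- (2 * \<kappa>) / 2) + (3 * (2 * \<kappa>)\<^sup>2 / 8 - q2 / (2 * \<psi>\<^sup>2) / 2)) = c"
    using \<psi> unfolding c_def x3_def q2_def by (simp add: field_simps power2_eq_square)
  ultimately have E: "expands (\<lambda>t. (if a * X t = 0 then 1 else sin (a * X t) / (a * X t)) * (X t / (\<psi> * t) * (1 / sqrt (Q t / \<psi>\<^sup>2)))) (- \<kappa> / 2) c"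
    by simp
  then have 1: "((\<lambda>t. (((if a * X t = 0 then 1 else sin (a * X t) / (a * X t)) * (X t / (\<psi> * t) * (1 / sqrt (Q t / \<psi>\<^sup>2)))) - (1 + (- \<kappa> / 2) * t + c * t\<^sup>2)) / t\<^sup>2 + c) \<longlongrightarrow> 0 + c) (at_right 0)"
    unfolding expands_def by (intro tendsto_intros)
  have "\<forall>\<^sub>F t in at_right 0. (((if a * X t = 0 then 1 else sin (a * X t) / (a * X t)) * (X t / (\<psi> * t) * (1 / sqrt (Q t / \<psi>\<^sup>2)))) - (1 + (- \<kappa> / 2) * t + c * t\<^sup>2)) / t\<^sup>2 + c
     = (sin (a * X t) / a / sqrt (Q t) - t + \<kappa> * t\<^sup>2 / 2) / t ^ 3"
    using eventually_right_pos
  proof eventually_elim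
    case (elim t)
    have sq: "sqrt (Q t / \<psi>\<^sup>2) = sqrt (Q t) / \<psi>" using \<psi> by (simp add: real_sqrt_divide)
    have A: "(if a * X t = 0 then 1 else sin (a * X t) / (a * X t)) * (X t / (\<psi> * t) * (1 / sqrt (Q t / \<psi>\<^sup>2))) = sin (a * X t) / a / sqrt (Q t) / t"
      unfolding sq using \<psi> a by (auto simp: field_simps)
    have B: "(V / t - (1 + (- \<kappa> / 2) * t + c * t\<^sup>2)) / t\<^sup>2 + c = (V - t + \<kappa> * t\<^sup>2 / 2) / t ^ 3" for V
    proof -
      have "V / t - (1 + (- \<kappa> / 2) * t + c * t\<^sup>2) = (V - t + \<kappa> * t\<^sup>2 / 2) / t - c * t\<^sup>2"
        using elim by (simp add: field_simps power2_eq_square)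
      then have "(V / t - (1 + (- \<kappa> / 2) * t + c * t\<^sup>2)) / t\<^sup>2 = ((V - t + \<kappa> * t\<^sup>2 / 2) / t - c * t\<^sup>2) / t\<^sup>2"
        by (simp only:)
      also have "\<dots> = (V - t + \<kappa> * t\<^sup>2 / 2) / t / t\<^sup>2 - c * t\<^sup>2 / t\<^sup>2" by (rule diff_divide_distrib)
      also have "c * t\<^sup>2 / t\<^sup>2 = c" using elim by simp
      finally show ?thesis using elim by (simp add: power2_eq_square power3_eq_cube mult.assoc)
    qed
    show ?case unfolding A by (rule B)
  qed
  from Lim_transform_eventually[OF 1 this] show ?thesis by (simp add: c_def)
qed

section \<open>Logarithmic derivatives and Frenet relations on the boundary\<close>

lemma has_vector_derivative_quotient:
  fixes f g :: "real \<Rightarrow> complex"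
  assumes f: "(f has_vector_derivative f') (at x)" and g: "(g has_vector_derivative g') (at x)" and nz: "g x \<noteq> 0"
  shows "((\<lambda>x. f x / g x) has_vector_derivative f' / g x - f x * g' / (g x)\<^sup>2) (at x)"
proof -
  have "((\<lambda>x. f x / g x) has_derivative (\<lambda>h. - f x * (inverse (g x) * (h *\<^sub>R g') * inverse (g x)) + (h *\<^sub>R f') / g x)) (at x)"
    using has_derivative_divide[OF f[unfolded has_vector_derivative_def] g[unfolded has_vector_derivative_def] nz] by simp
  moreover have "(\<lambda>h. - f x * (inverse (g x) * (h *\<^sub>R g') * inverse (g x)) + (h *\<^sub>R f') / g x) = (\<lambda>h. h *\<^sub>R (f' / g x - f x * g' / (g x)\<^sup>2))"
    using nz by (auto simp: fun_eq_iff scaleR_conv_of_real field_simps power2_eq_square)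
  ultimately show ?thesis by (simp add: has_vector_derivative_def)
qed

text \<open>\<open>F0\<close>, \<open>F1\<close>, \<open>F2\<close> stand for g, g', g'' along a
  path with velocity \<open>n\<close>, and the results are the next two derivatives of ln g. The
  same form serves the normals, with n = i \<gamma>1, and the boundary values along the curve, with
  n = \<gamma>1.\<close>

lemma log_derivatives:
  fixes F0 F1 F2 :: "real \<Rightarrow> complex" and n F3 :: complex
  assumes d: "(F0 has_vector_derivative n * F1 x) (at x)" "(F1 has_vector_derivative n * F2 x) (at x)"
      "(F2 has_vector_derivative n * F3) (at x)" and nz: "F0 x \<noteq> 0"
  shows "((\<lambda>t. F1 t / F0 t) has_vector_derivative n * (F2 x / F0 x - (F1 x / F0 x)\<^sup>2)) (at x)"
    and "((\<lambda>t. F2 t / F0 t - (F1 t / F0 t)\<^sup>2) has_vector_derivative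
      n * (F3 / F0 x - 3 * F1 x * F2 x / (F0 x)\<^sup>2 + 2 * (F1 x / F0 x) ^ 3)) (at x)"
proof -
  have 1: "((\<lambda>t. F1 t / F0 t) has_vector_derivative n * F2 x / F0 x - F1 x * (n * F1 x) / (F0 x)\<^sup>2) (at x)"
    by (rule has_vector_derivative_quotient[OF d(2,1) nz])
  moreover have e1: "n * F2 x / F0 x - F1 x * (n * F1 x) / (F0 x)\<^sup>2 = n * (F2 x / F0 x - (F1 x / F0 x)\<^sup>2)"
    by (simp add: power_divide power2_eq_square algebra_simps)
  ultimately show 2: "((\<lambda>t. F1 t / F0 t) has_vector_derivative n * (F2 x / F0 x - (F1 x / F0 x)\<^sup>2)) (at x)" by simp
  have 3: "((\<lambda>t. F2 t / F0 t) has_vector_derivative n * F3 / F0 x - F2 x * (n * F1 x) / (F0 x)\<^sup>2) (at x)"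
    by (rule has_vector_derivative_quotient[OF d(3,1) nz])
  have 4: "((\<lambda>t. (F1 t / F0 t) * (F1 t / F0 t)) has_vector_derivative
      (F1 x / F0 x) * (n * (F2 x / F0 x - (F1 x / F0 x)\<^sup>2)) + (n * (F2 x / F0 x - (F1 x / F0 x)\<^sup>2)) * (F1 x / F0 x)) (at x)"
    by (rule has_vector_derivative_mult[OF 2 2])
  have "((\<lambda>t. F2 t / F0 t - (F1 t / F0 t) * (F1 t / F0 t)) has_vector_derivative
     (n * F3 / F0 x - F2 x * (n * F1 x) / (F0 x)\<^sup>2) - ((F1 x / F0 x) * (n * (F2 x / F0 x - (F1 x / F0 x)\<^sup>2)) + (n * (F2 x / F0 x - (F1 x / F0 x)\<^sup>2)) * (F1 x / F0 x))) (at x)"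
    by (rule has_vector_derivative_diff[OF 3 4])
  moreover have "(n * F3 / F0 x - F2 x * (n * F1 x) / (F0 x)\<^sup>2) - ((F1 x / F0 x) * (n * (F2 x / F0 x - (F1 x / F0 x)\<^sup>2)) + (n * (F2 x / F0 x - (F1 x / F0 x)\<^sup>2)) * (F1 x / F0 x))
     = n * (F3 / F0 x - 3 * F1 x * F2 x / (F0 x)\<^sup>2 + 2 * (F1 x / F0 x) ^ 3)"
    using nz by (simp add: field_simps power2_eq_square power3_eq_cube)
  ultimately show "((\<lambda>t. F2 t / F0 t - (F1 t / F0 t)\<^sup>2) has_vector_derivative
      n * (F3 / F0 x - 3 * F1 x * F2 x / (F0 x)\<^sup>2 + 2 * (F1 x / F0 x) ^ 3)) (at x)"
    by (simp add: power2_eq_square)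
qed

lemma Re_has_derivative: "(f has_vector_derivative f') (at x) \<Longrightarrow> ((\<lambda>t. Re (f t)) has_real_derivative Re f') (at x)"
  and Im_has_derivative: "(f has_vector_derivative f') (at x) \<Longrightarrow> ((\<lambda>t. Im (f t)) has_real_derivative Im f') (at x)"
  using bounded_linear.has_vector_derivative[OF bounded_linear_Re] bounded_linear.has_vector_derivative[OF bounded_linear_Im]
  by (auto simp: has_real_derivative_iff_has_vector_derivative)

lemma inner_has_derivative:
  fixes f g :: "real \<Rightarrow> complex"
  assumes "(f has_vector_derivative f') (at x)" "(g has_vector_derivative g') (at x)"
  shows "((\<lambda>t. f t \<bullet> g t) has_real_derivative f x \<bullet> g' + f' \<bullet> g x) (at x)"
proof -
  have "((\<lambda>t. f t \<bullet> g t) has_derivative (\<lambda>h. f x \<bullet> (h *\<^sub>R g') + (h *\<^sub>R f') \<bullet> g x)) (at x)"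
    using assms unfolding has_vector_derivative_def by (rule has_derivative_inner)
  moreover have "(\<lambda>h. f x \<bullet> (h *\<^sub>R g') + (h *\<^sub>R f') \<bullet> g x) = (*) (f x \<bullet> g' + f' \<bullet> g x)"
    by (auto simp: fun_eq_iff algebra_simps)
  ultimately show ?thesis by (simp add: has_field_derivative_def)
qed

lemma inner_mult_unit:
  fixes n a b :: complex
  assumes "norm n = 1"
  shows "(n * a) \<bullet> (n * b) = a \<bullet> b"
proof -
  have "(n * a) \<bullet> (n * b) = Re (n * cnj n * (a * cnj b))" by (simp add: inner_complex_def algebra_simps)
  also have "n * cnj n = 1" using assms complex_norm_square[of n] by simp
  finally show ?thesis by (simp add: inner_complex_def)
qed

context C3a_curve begin

text \<open>The signed curvature with respect to the left normal i \<gamma>1.\<close>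

definition kappa :: "real \<Rightarrow> real" where
  "kappa s = Im (\<gamma>2 s * cnj (\<gamma>1 s))"

lemma gamma1_cnj: "\<gamma>1 s * cnj (\<gamma>1 s) = 1"
  using unit[of s] complex_norm_square[of "\<gamma>1 s"] by simp

lemma gamma2_eq: "\<gamma>2 s = \<i> * of_real (kappa s) * \<gamma>1 s"
proof -
  have "((\<lambda>t. \<gamma>1 t \<bullet> \<gamma>1 t) has_real_derivative \<gamma>1 s \<bullet> \<gamma>2 s + \<gamma>2 s \<bullet> \<gamma>1 s) (at s)"
    by (rule inner_has_derivative[OF d2 d2])
  moreover have "(\<lambda>t. \<gamma>1 t \<bullet> \<gamma>1 t) = (\<lambda>t. 1)" using unit by (simp add: power2_norm_eq_inner[symmetric])
  ultimately have "\<gamma>1 s \<bullet> \<gamma>2 s + \<gamma>2 s \<bullet> \<gamma>1 s = 0" by (metis DERIV_const DERIV_unique)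
  then have "Re (\<gamma>2 s * cnj (\<gamma>1 s)) = 0" by (simp add: inner_complex_def algebra_simps)
  then have "\<gamma>2 s * cnj (\<gamma>1 s) = \<i> * of_real (kappa s)" by (simp add: complex_eq_iff kappa_def)
  then have "\<gamma>2 s * (cnj (\<gamma>1 s) * \<gamma>1 s) = \<i> * of_real (kappa s) * \<gamma>1 s" by (simp add: mult.assoc[symmetric])
  then show ?thesis using gamma1_cnj[of s] by (simp add: mult.commute)
qed

text \<open>Obtained by differentiating the orthogonality of \<gamma>2 and \<gamma>1. This
  tangential component of \<gamma>3 is the one that enters \<psi>''.\<close>

lemma gamma3_cnj: "Re (\<gamma>3 s * cnj (\<gamma>1 s)) = - (kappa s)\<^sup>2"
proof -
  have z: "\<gamma>2 t \<bullet> \<gamma>1 t = 0" for t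
  proof -
    have "\<gamma>2 t \<bullet> \<gamma>1 t = Re (\<i> * of_real (kappa t) * (\<gamma>1 t * cnj (\<gamma>1 t)))"
      by (subst gamma2_eq) (simp add: inner_complex_def algebra_simps)
    then show ?thesis by (simp only: gamma1_cnj) simp
  qed
  have "((\<lambda>t. \<gamma>2 t \<bullet> \<gamma>1 t) has_real_derivative \<gamma>2 s \<bullet> \<gamma>2 s + \<gamma>3 s \<bullet> \<gamma>1 s) (at s)"
    by (rule inner_has_derivative[OF d3 d2])
  then have "\<gamma>2 s \<bullet> \<gamma>2 s + \<gamma>3 s \<bullet> \<gamma>1 s = 0" unfolding z by (metis DERIV_const DERIV_unique)
  moreover have "\<gamma>2 s \<bullet> \<gamma>2 s = (kappa s)\<^sup>2"
    by (subst (1 2) gamma2_eq) (simp add: power2_norm_eq_inner[symmetric] norm_mult unit)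
  ultimately show ?thesis by (simp add: inner_complex_def)
qed

lemma kappa_continuous: "continuous_on A kappa"
  unfolding kappa_def by (intro continuous_intros cont1 cont2)

end

context annular_domain begin

text \<open>Everything follows from |G 0| = 1: for the boundary values h1 of g'/g it gives \<gamma>1
  h1 = i \<psi>. Two differentiations along the curve, with the Frenet equations, express
  \<gamma>1^2 h2 and the imaginary part of \<gamma>1^3 h3 by \<kappa>, \<psi> and the derivatives of
  \<psi>. Since the normal is i \<gamma>1, powers of i turn these into the normal derivatives that
  \<open>normal_expansion\<close> requires.\<close>

lemma c3_expansion:
  obtains G0 :: "real \<Rightarrow> complex" and \<psi> \<psi>1 \<psi>2 :: "real \<Rightarrow> real" where
    "\<And>s. \<psi> s > 0" "\<And>s. (\<psi> has_real_derivative \<psi>1 s) (at s)" "\<And>s. (\<psi>1 has_real_derivative \<psi>2 s) (at s)"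
    "continuous_on UNIV \<psi>2" "\<And>s. \<psi> (s + L) = \<psi> s" "\<And>s. \<psi>1 (s + L) = \<psi>1 s"
    "\<And>s. (G0 has_vector_derivative \<i> * of_real (\<psi> s) * G0 s) (at s)" "\<And>s. norm (G0 s) = 1" "\<And>s. G0 (s + L) = G0 s"
    "\<And>s a. a > 0 \<Longrightarrow> ((\<lambda>t. (sin (a * (- ln (norm (g (nrm s t))))) / a / norm (deriv g (nrm s t) / g (nrm s t)) - t + kappa s * t\<^sup>2 / 2) / t ^ 3)
       \<longlongrightarrow> \<psi>2 s / (3 * \<psi> s) - (kappa s)\<^sup>2 / 6 - (\<psi>1 s / \<psi> s)\<^sup>2 / 2 - a\<^sup>2 * (\<psi> s)\<^sup>2 / 6) (at_right 0)"
proof -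
  obtain G :: "nat \<Rightarrow> real \<Rightarrow> complex" where
    Gl: "\<And>k s. k \<le> 3 \<Longrightarrow> ((\<lambda>t. (deriv ^^ k) g (nrm s t)) \<longlongrightarrow> G k s) (at_right 0)"
    and Gd: "\<And>k s. k \<le> 2 \<Longrightarrow> (G k has_vector_derivative \<gamma>1 s * G (Suc k) s) (at s)"
    and G3c: "continuous_on UNIV (G 3)" and Gp: "\<And>k s. G k (s + L) = G k s"
    by (rule boundary_values) (rule that)
  have Gd0: "(G 0 has_vector_derivative \<gamma>1 s * G 1 s) (at s)" for s using Gd[of 0 s] by simp
  have Gd1: "(G 1 has_vector_derivative \<gamma>1 s * G 2 s) (at s)" for s using Gd[of 1 s] by (simp add: eval_nat_numeral)
  have Gd2: "(G 2 has_vector_derivative \<gamma>1 s * G 3 s) (at s)" for s using Gd[of 2 s] by (simp add: eval_nat_numeral)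
  define t1 where "t1 = min \<rho> (\<delta>0 / 2)"
  have t1: "t1 > 0" using \<rho>pos \<delta>0 by (simp add: t1_def)
  have nin: "nrm s t \<in> \<Omega>" if "0 < t" "t < t1" for s t
    unfolding nrm_def using normal_in[of t s] that \<delta>0 by (auto simp: t1_def)
  have gnz: "g (nrm s t) \<noteq> 0" if "0 < t" "t < t1" for s t using gA[OF nin[OF that, of s]] \<beta> by auto
  \<comment> \<open>The upper bound comes from the annulus, the lower one from the uniform limit of
    |g| at the curve.\<close>
  have G0n: "norm (G 0 s) = 1" for s
  proof -
    have l: "((\<lambda>t. norm (g (nrm s t))) \<longlongrightarrow> norm (G 0 s)) (at_right 0)" using tendsto_norm[OF Gl[of 0 s]] by simp
    have ev: "\<forall>\<^sub>F t in at_right 0. 0 < t \<and> t < t1" using t1 by (auto simp: eventually_at_right_field)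
    have "\<forall>\<^sub>F t in at_right 0. norm (g (nrm s t)) \<le> 1"
      using ev by eventually_elim (use gA nin in \<open>auto intro: less_imp_le\<close>)
    then have "norm (G 0 s) \<le> 1" by (intro tendsto_upperbound[OF l]) auto
    moreover have "m \<le> norm (G 0 s)" if m: "m < 1" for m
    proof (rule tendsto_lowerbound[OF l])
      obtain \<delta> where \<delta>: "\<delta> > 0" "\<And>z. z \<in> \<Omega> \<Longrightarrow> infdist z (range \<gamma>) < \<delta> \<Longrightarrow> m < norm (g z)" using glim[OF m] by blast
      have "m \<le> norm (g (nrm s t))" if "0 < t" "t < min t1 \<delta>" for t
      proof -
        have "infdist (nrm s t) (range \<gamma>) \<le> \<bar>t\<bar>" unfolding nrm_def by (rule infdist_normal)
        then show ?thesis using \<delta>(2)[OF nin[of t s]] that by simp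
      qed
      then show "\<forall>\<^sub>F t in at_right 0. m \<le> norm (g (nrm s t))"
        unfolding eventually_at_right_field using t1 \<delta>(1) by (intro exI[of _ "min t1 \<delta>"]) auto
    qed simp
    then have "1 \<le> norm (G 0 s)" by (meson dense_le)
    ultimately show ?thesis by simp
  qed
  have G0nz: "G 0 s \<noteq> 0" for s using G0n[of s] by auto
  define h1 where "h1 = (\<lambda>s. G 1 s / G 0 s)"
  define h2 where "h2 = (\<lambda>s. G 2 s / G 0 s - (G 1 s / G 0 s)\<^sup>2)"
  define h3 where "h3 = (\<lambda>s. G 3 s / G 0 s - 3 * G 1 s * G 2 s / (G 0 s)\<^sup>2 + 2 * (G 1 s / G 0 s) ^ 3)"
  have h1d: "(h1 has_vector_derivative \<gamma>1 s * h2 s) (at s)" for s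
    unfolding h1_def h2_def by (rule log_derivatives(1)[OF Gd0 Gd1 Gd2 G0nz])
  have h2d: "(h2 has_vector_derivative \<gamma>1 s * h3 s) (at s)" for s
    unfolding h2_def h3_def by (rule log_derivatives(2)[OF Gd0 Gd1 Gd2 G0nz])
  define \<psi> where "\<psi> = (\<lambda>s. Im (\<gamma>1 s * h1 s))"
  define \<psi>1 where "\<psi>1 = (\<lambda>s. Im (\<gamma>1 s * (\<gamma>1 s * h2 s) + \<gamma>2 s * h1 s))"
  define D2 where "D2 = (\<lambda>s. (\<gamma>1 s * (\<gamma>1 s * (\<gamma>1 s * h3 s) + \<gamma>2 s * h2 s) + \<gamma>2 s * (\<gamma>1 s * h2 s)) + (\<gamma>2 s * (\<gamma>1 s * h2 s) + \<gamma>3 s * h1 s))"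
  define \<psi>2 where "\<psi>2 = (\<lambda>s. Im (D2 s))"
  have d_1: "((\<lambda>s. \<gamma>1 s * h1 s) has_vector_derivative \<gamma>1 s * (\<gamma>1 s * h2 s) + \<gamma>2 s * h1 s) (at s)" for s
    by (rule has_vector_derivative_mult[OF d2 h1d])
  have d_2: "((\<lambda>s. \<gamma>1 s * (\<gamma>1 s * h2 s) + \<gamma>2 s * h1 s) has_vector_derivative D2 s) (at s)" for s
    unfolding D2_def by (intro has_vector_derivative_add has_vector_derivative_mult d2 d3 h1d h2d)
  have re0: "Re (\<gamma>1 s * h1 s) = 0" for s
  proof -
    have "((\<lambda>t. G 0 t \<bullet> G 0 t) has_real_derivative G 0 s \<bullet> (\<gamma>1 s * G 1 s) + (\<gamma>1 s * G 1 s) \<bullet> G 0 s) (at s)"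
      by (rule inner_has_derivative[OF Gd0 Gd0])
    moreover have "(\<lambda>t. G 0 t \<bullet> G 0 t) = (\<lambda>t. 1)" using G0n by (simp add: power2_norm_eq_inner[symmetric])
    ultimately have "G 0 s \<bullet> (\<gamma>1 s * G 1 s) + (\<gamma>1 s * G 1 s) \<bullet> G 0 s = 0" by (metis DERIV_const DERIV_unique)
    then have "(\<gamma>1 s * G 1 s) \<bullet> G 0 s = 0" by (simp add: inner_commute)
    moreover have "(\<gamma>1 s * G 1 s) \<bullet> G 0 s = Re (\<gamma>1 s * h1 s)"
    proof -
      have "G 0 s * cnj (G 0 s) = 1" using G0n[of s] complex_norm_square[of "G 0 s"] by simp
      then have "cnj (G 0 s) = 1 / G 0 s" using G0nz[of s] by (simp add: field_simps)
      moreover have "(\<gamma>1 s * G 1 s) \<bullet> G 0 s = Re (\<gamma>1 s * G 1 s * cnj (G 0 s))" by (simp add: inner_complex_def)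
      ultimately show ?thesis by (simp add: h1_def)
    qed
    ultimately show ?thesis by simp
  qed
  have e1: "\<gamma>1 s * h1 s = \<i> * of_real (\<psi> s)" for s using re0[of s] by (simp add: complex_eq_iff \<psi>_def)
  have re1: "Re (\<gamma>1 s * (\<gamma>1 s * h2 s) + \<gamma>2 s * h1 s) = 0" for s
    using Re_has_derivative[OF d_1[of s]] unfolding re0 by (metis DERIV_const DERIV_unique)
  have "\<gamma>1 s * (\<gamma>1 s * h2 s) + \<gamma>2 s * h1 s = \<i> * of_real (\<psi>1 s)" for s using re1[of s] by (simp add: complex_eq_iff \<psi>1_def)
  moreover have g2h1: "\<gamma>2 s * h1 s = - of_real (kappa s * \<psi> s)" for s
  proof -
    have "\<gamma>2 s * h1 s = \<i> * of_real (kappa s) * (\<gamma>1 s * h1 s)" by (subst gamma2_eq) simp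
    then show ?thesis unfolding e1 by (simp only:) (simp add: complex_eq_iff)
  qed
  ultimately have e2: "\<gamma>1 s * (\<gamma>1 s * h2 s) = of_real (kappa s * \<psi> s) + \<i> * of_real (\<psi>1 s)" for s
    by (metis add.commute add_diff_cancel_right' diff_minus_eq_add)
  \<comment> \<open>The curvature terms are 3 \<kappa>^2 \<psi> from the three equal products of
    \<gamma>2 with \<open>h2\<close> and - \<kappa>^2 \<psi> from \<gamma>3, together 2 \<kappa>^2
    \<psi>.\<close>
  have e3: "Im (\<gamma>1 s * (\<gamma>1 s * (\<gamma>1 s * h3 s))) = \<psi>2 s - 2 * (kappa s)\<^sup>2 * \<psi> s" for s
  proof -
    define w where "w = \<gamma>3 s * cnj (\<gamma>1 s)"
    have "\<gamma>3 s = w * \<gamma>1 s" using gamma1_cnj[of s] by (simp add: w_def mult.assoc mult.commute[of "cnj _"])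
    then have g3: "\<gamma>3 s * h1 s = w * (\<i> * of_real (\<psi> s))" using e1[of s] by (simp add: mult.assoc)
    have gh: "\<gamma>1 s * (\<gamma>2 s * h2 s) = \<i> * of_real (kappa s) * (\<gamma>1 s * (\<gamma>1 s * h2 s))"
      "\<gamma>2 s * (\<gamma>1 s * h2 s) = \<i> * of_real (kappa s) * (\<gamma>1 s * (\<gamma>1 s * h2 s))"
      by (subst gamma2_eq, simp)+
    have "D2 s = \<gamma>1 s * (\<gamma>1 s * (\<gamma>1 s * h3 s)) + 3 * (\<i> * of_real (kappa s) * (\<gamma>1 s * (\<gamma>1 s * h2 s))) + w * (\<i> * of_real (\<psi> s))"
      unfolding D2_def distrib_left gh g3 by simp
    then have "\<psi>2 s = Im (\<gamma>1 s * (\<gamma>1 s * (\<gamma>1 s * h3 s))) + Im (3 * (\<i> * of_real (kappa s) * (of_real (kappa s * \<psi> s) + \<i> * of_real (\<psi>1 s)))) + Im (w * (\<i> * of_real (\<psi> s)))"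
      unfolding \<psi>2_def e2 by simp
    also have "Im (3 * (\<i> * of_real (kappa s) * (of_real (kappa s * \<psi> s) + \<i> * of_real (\<psi>1 s)))) = 3 * (kappa s)\<^sup>2 * \<psi> s"
      by (simp add: power2_eq_square)
    also have "Im (w * (\<i> * of_real (\<psi> s))) = Re w * \<psi> s" by simp
    also have "Re w = - (kappa s)\<^sup>2" unfolding w_def by (rule gamma3_cnj)
    finally show ?thesis by simp
  qed
  define n where "n = (\<lambda>s. \<i> * \<gamma>1 s)"
  have nn: "norm (n s) = 1" for s by (simp add: n_def norm_mult unit)
  have l1: "n s * h1 s = - of_real (\<psi> s)" for s using e1[of s] by (simp add: n_def mult.assoc)
  have l2: "n s * (n s * h2 s) = - (of_real (kappa s * \<psi> s) + \<i> * of_real (\<psi>1 s))" for s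
    using e2[of s] by (simp add: n_def algebra_simps)
  have l3: "Re (n s * (n s * (n s * h3 s))) = \<psi>2 s - 2 * (kappa s)\<^sup>2 * \<psi> s" for s
  proof -
    have "n s * (n s * (n s * h3 s)) = - \<i> * (\<gamma>1 s * (\<gamma>1 s * (\<gamma>1 s * h3 s)))" by (simp add: n_def algebra_simps)
    then have "Re (n s * (n s * (n s * h3 s))) = Im (\<gamma>1 s * (\<gamma>1 s * (\<gamma>1 s * h3 s)))" by (simp only:) simp
    then show ?thesis using e3[of s] by simp
  qed
  have gd0: "((\<lambda>t. g (nrm s t)) has_vector_derivative n s * deriv g (nrm s t)) (at t)"
    and gd1: "((\<lambda>t. deriv g (nrm s t)) has_vector_derivative n s * (deriv ^^ 2) g (nrm s t)) (at t)"
    and gd2: "((\<lambda>t. (deriv ^^ 2) g (nrm s t)) has_vector_derivative n s * (deriv ^^ 3) g (nrm s t)) (at t)"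
    if "0 < t" "t < t1" for s t
    using deriv_along_normal[OF nin[OF that], of 0 s] deriv_along_normal[OF nin[OF that], of 1 s] deriv_along_normal[OF nin[OF that], of 2 s]
    by (simp_all add: n_def eval_nat_numeral)
  define q0 where "q0 = (\<lambda>s t. deriv g (nrm s t) / g (nrm s t))"
  define q1 where "q1 = (\<lambda>s t. (deriv ^^ 2) g (nrm s t) / g (nrm s t) - (deriv g (nrm s t) / g (nrm s t))\<^sup>2)"
  define q2 where "q2 = (\<lambda>s t. (deriv ^^ 3) g (nrm s t) / g (nrm s t) - 3 * deriv g (nrm s t) * (deriv ^^ 2) g (nrm s t) / (g (nrm s t))\<^sup>2 + 2 * (deriv g (nrm s t) / g (nrm s t)) ^ 3)"
  have q0d: "(q0 s has_vector_derivative n s * q1 s t) (at t)" if "0 < t" "t < t1" for s t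
    unfolding q0_def q1_def by (rule log_derivatives(1)[OF gd0[OF that] gd1[OF that] gd2[OF that] gnz[OF that]])
  have q1d: "(q1 s has_vector_derivative n s * q2 s t) (at t)" if "0 < t" "t < t1" for s t
    unfolding q1_def q2_def by (rule log_derivatives(2)[OF gd0[OF that] gd1[OF that] gd2[OF that] gnz[OF that]])
  have Gl0: "((\<lambda>t. g (nrm s t)) \<longlongrightarrow> G 0 s) (at_right 0)" and Gl1: "((\<lambda>t. deriv g (nrm s t)) \<longlongrightarrow> G 1 s) (at_right 0)"
    and Gl2: "((\<lambda>t. (deriv ^^ 2) g (nrm s t)) \<longlongrightarrow> G 2 s) (at_right 0)" and Gl3: "((\<lambda>t. (deriv ^^ 3) g (nrm s t)) \<longlongrightarrow> G 3 s) (at_right 0)" for s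
    using Gl[of 0 s] Gl[of 1 s] Gl[of 2 s] Gl[of 3 s] by simp_all
  have q0l: "(q0 s \<longlongrightarrow> h1 s) (at_right 0)" for s unfolding q0_def h1_def by (intro tendsto_intros Gl0 Gl1 G0nz)
  have q1l: "(q1 s \<longlongrightarrow> h2 s) (at_right 0)" for s unfolding q1_def h2_def by (intro tendsto_intros Gl0 Gl1 Gl2 G0nz)
  have q2l: "(q2 s \<longlongrightarrow> h3 s) (at_right 0)" for s unfolding q2_def h3_def by (intro tendsto_intros Gl0 Gl1 Gl2 Gl3) (simp_all add: G0nz)
  have Xd: "((\<lambda>t. - ln (norm (g (nrm s t)))) has_real_derivative - Re (n s * q0 s t)) (at t)" if "0 < t" "t < t1" for s t
    using DERIV_minus[OF ln_norm_has_derivative[OF gd0[OF that] gnz[OF that]]] by (simp add: q0_def)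
  have Xl: "((\<lambda>t. - ln (norm (g (nrm s t)))) \<longlongrightarrow> 0) (at_right 0)" for s
  proof -
    have "((\<lambda>t. - ln (norm (g (nrm s t)))) \<longlongrightarrow> - ln (norm (G 0 s))) (at_right 0)"
      by (intro tendsto_intros Gl0) (simp add: G0nz)
    then show ?thesis by (simp add: G0n)
  qed
  have X1l: "((\<lambda>t. - Re (n s * q0 s t)) \<longlongrightarrow> \<psi> s) (at_right 0)" for s
  proof -
    have "((\<lambda>t. - Re (n s * q0 s t)) \<longlongrightarrow> - Re (n s * h1 s)) (at_right 0)" by (intro tendsto_intros q0l)
    then show ?thesis unfolding l1 by simp
  qed
  \<comment> \<open>\<psi> is the normal derivative of - ln |g|, and - ln |g| \<ge> 1 - |g| carries
    the Hopf bound over to it.\<close>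
  have \<psi>pos: "\<psi> s > 0" for s
  proof -
    obtain c r1 where c: "c > 0" "r1 > 0" "\<And>t. 0 < t \<Longrightarrow> t < r1 \<Longrightarrow> 1 - norm (g (nrm s t)) \<ge> c * t"
      using hopf[of s] unfolding nrm_def by metis
    have "((\<lambda>t. - ln (norm (g (nrm s t))) / t) \<longlongrightarrow> \<psi> s) (at_right 0)"
    proof (rule lhopital_right[where f'="\<lambda>t. - Re (n s * q0 s t)" and g'="\<lambda>t. 1"])
      show "\<forall>\<^sub>F t in at_right 0. ((\<lambda>t. - ln (norm (g (nrm s t)))) has_real_derivative - Re (n s * q0 s t)) (at t)"
        unfolding eventually_at_right_field using t1 Xd by blast
      show "((\<lambda>t. - Re (n s * q0 s t) / 1) \<longlongrightarrow> \<psi> s) (at_right 0)" using X1l by simp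
      show "\<forall>\<^sub>F t in at_right (0::real). t \<noteq> 0" using eventually_right_pos by eventually_elim simp
    qed (auto intro!: Xl tendsto_right_ident)
    moreover have "c \<le> - ln (norm (g (nrm s t))) / t" if t: "0 < t" "t < min r1 t1" for t
    proof -
      have "norm (g (nrm s t)) > 0" using gnz[of t s] t by auto
      then have "ln (norm (g (nrm s t))) \<le> norm (g (nrm s t)) - 1" by (rule ln_le_minus_one)
      then have "c * t \<le> - ln (norm (g (nrm s t)))" using c(3)[of t] t by linarith
      then show ?thesis using t by (subst pos_le_divide_eq) auto
    qed
    then have "\<forall>\<^sub>F t in at_right 0. c \<le> - ln (norm (g (nrm s t))) / t"
      unfolding eventually_at_right_field using c(2) t1 by (intro exI[of _ "min r1 t1"]) auto
    ultimately have "c \<le> \<psi> s" by (rule tendsto_lowerbound) simp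
    then show ?thesis using c by simp
  qed
  show thesis
  proof (rule that[of \<psi> \<psi>1 \<psi>2 "G 0"])
    show "\<psi> s > 0" for s by (rule \<psi>pos)
    show "(\<psi> has_real_derivative \<psi>1 s) (at s)" for s unfolding \<psi>_def \<psi>1_def by (rule Im_has_derivative[OF d_1])
    show "(\<psi>1 has_real_derivative \<psi>2 s) (at s)" for s unfolding \<psi>1_def \<psi>2_def by (rule Im_has_derivative[OF d_2])
    have hc: "continuous_on UNIV h1" "continuous_on UNIV h2"
      using h1d h2d by (auto intro!: continuous_at_imp_continuous_on has_vector_derivative_continuous)
    have Gc: "continuous_on UNIV (G 0)" "continuous_on UNIV (G 1)" "continuous_on UNIV (G 2)"
      using Gd0 Gd1 Gd2 by (auto intro!: continuous_at_imp_continuous_on has_vector_derivative_continuous)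
    have "continuous_on UNIV h3" unfolding h3_def using G0nz by (intro continuous_intros Gc G3c) auto
    then show "continuous_on UNIV \<psi>2" unfolding \<psi>2_def D2_def by (intro continuous_intros hc cont1 cont2 cont3)
    show "\<psi> (s + L) = \<psi> s" "\<psi>1 (s + L) = \<psi>1 s" for s
      by (simp_all add: \<psi>_def \<psi>1_def h1_def h2_def Gp per1 per2)
    show "(G 0 has_vector_derivative \<i> * of_real (\<psi> s) * G 0 s) (at s)" for s
    proof -
      have "\<gamma>1 s * G 1 s = \<gamma>1 s * h1 s * G 0 s" using G0nz[of s] by (simp add: h1_def)
      then show ?thesis using Gd0[of s] by (simp add: e1)
    qed
    show "norm (G 0 s) = 1" "G 0 (s + L) = G 0 s" for s by (rule G0n, rule Gp)
    fix s a :: real assume a: "a > 0"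
    let ?X = "\<lambda>t. - ln (norm (g (nrm s t)))"
    let ?N = "n s"
    have "((\<lambda>t. (sin (a * ?X t) / a / sqrt (q0 s t \<bullet> q0 s t) - t + kappa s * t\<^sup>2 / 2) / t ^ 3)
       \<longlongrightarrow> \<psi>2 s / (3 * \<psi> s) - (kappa s)\<^sup>2 / 6 - (\<psi>1 s / \<psi> s)\<^sup>2 / 2 - a\<^sup>2 * (\<psi> s)\<^sup>2 / 6) (at_right 0)"
    proof (rule normal_expansion[OF t1])
      show "(?X has_real_derivative - Re (?N * q0 s t)) (at t)" if "0 < t" "t < t1" for t by (rule Xd[OF that])
      show "((\<lambda>t. - Re (?N * q0 s t)) has_real_derivative - Re (?N * (?N * q1 s t))) (at t)" if "0 < t" "t < t1" for t
        by (intro DERIV_minus Re_has_derivative has_vector_derivative_mult_right q0d[OF that])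
      show "((\<lambda>t. - Re (?N * (?N * q1 s t))) has_real_derivative - Re (?N * (?N * (?N * q2 s t)))) (at t)" if "0 < t" "t < t1" for t
        by (intro DERIV_minus Re_has_derivative has_vector_derivative_mult_right q1d[OF that])
      show "((\<lambda>t. q0 s t \<bullet> q0 s t) has_real_derivative 2 * (q0 s t \<bullet> (?N * q1 s t))) (at t)" if "0 < t" "t < t1" for t
        using inner_has_derivative[OF q0d[OF that, of s] q0d[OF that, of s]] by (simp add: inner_commute)
      show "((\<lambda>t. 2 * (q0 s t \<bullet> (?N * q1 s t))) has_real_derivative 2 * (q0 s t \<bullet> (?N * (?N * q2 s t)) + (?N * q1 s t) \<bullet> (?N * q1 s t))) (at t)" if "0 < t" "t < t1" for t
        by (intro DERIV_cmult inner_has_derivative q0d[OF that] has_vector_derivative_mult_right q1d[OF that])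
      show "(?X \<longlongrightarrow> 0) (at_right 0)" by (rule Xl)
      show "((\<lambda>t. - Re (?N * q0 s t)) \<longlongrightarrow> \<psi> s) (at_right 0)" by (rule X1l)
      have "((\<lambda>t. - Re (?N * (?N * q1 s t))) \<longlongrightarrow> - Re (?N * (?N * h2 s))) (at_right 0)" by (intro tendsto_intros q1l)
      then show "((\<lambda>t. - Re (?N * (?N * q1 s t))) \<longlongrightarrow> kappa s * \<psi> s) (at_right 0)" unfolding l2 by simp
      have "((\<lambda>t. - Re (?N * (?N * (?N * q2 s t)))) \<longlongrightarrow> - Re (?N * (?N * (?N * h3 s)))) (at_right 0)" by (intro tendsto_intros q2l)
      then show "((\<lambda>t. - Re (?N * (?N * (?N * q2 s t)))) \<longlongrightarrow> 2 * (kappa s)\<^sup>2 * \<psi> s - \<psi>2 s) (at_right 0)" unfolding l3 by simp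
      have hn: "norm (h1 s) = \<psi> s" using arg_cong[OF l1[of s], of norm] \<psi>pos[of s] by (simp add: norm_mult nn)
      have "((\<lambda>t. q0 s t \<bullet> q0 s t) \<longlongrightarrow> h1 s \<bullet> h1 s) (at_right 0)" by (intro tendsto_intros q0l)
      then show "((\<lambda>t. q0 s t \<bullet> q0 s t) \<longlongrightarrow> (\<psi> s)\<^sup>2) (at_right 0)" using hn by (simp add: power2_norm_eq_inner[symmetric])
      \<comment> \<open>Multiplying both vectors by the unit \<open>n s\<close> preserves the inner
        product and brings them to the forms computed in \<open>l1\<close>, \<open>l2\<close> and
        \<open>l3\<close>.\<close>
      have i2: "h1 s \<bullet> (?N * h2 s) = kappa s * (\<psi> s)\<^sup>2"
      proof -
        have "h1 s \<bullet> (?N * h2 s) = (?N * h1 s) \<bullet> (?N * (?N * h2 s))" by (rule inner_mult_unit[OF nn, symmetric])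
        then show ?thesis unfolding l1 l2 by (simp add: inner_complex_def power2_eq_square)
      qed
      have "((\<lambda>t. 2 * (q0 s t \<bullet> (?N * q1 s t))) \<longlongrightarrow> 2 * (h1 s \<bullet> (?N * h2 s))) (at_right 0)" by (intro tendsto_intros q0l q1l)
      then show "((\<lambda>t. 2 * (q0 s t \<bullet> (?N * q1 s t))) \<longlongrightarrow> 2 * kappa s * (\<psi> s)\<^sup>2) (at_right 0)" unfolding i2 by (simp only: mult.assoc)
      have i3: "h1 s \<bullet> (?N * (?N * h3 s)) = - \<psi> s * (\<psi>2 s - 2 * (kappa s)\<^sup>2 * \<psi> s)"
      proof -
        have "h1 s \<bullet> (?N * (?N * h3 s)) = (?N * h1 s) \<bullet> (?N * (?N * (?N * h3 s)))" by (rule inner_mult_unit[OF nn, symmetric])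
        also have "\<dots> = - \<psi> s * Re (?N * (?N * (?N * h3 s)))" unfolding l1 by (simp only: inner_complex_def) simp
        finally show ?thesis unfolding l3 .
      qed
      have i4: "(?N * h2 s) \<bullet> (?N * h2 s) = (kappa s * \<psi> s)\<^sup>2 + (\<psi>1 s)\<^sup>2"
      proof -
        have "(?N * h2 s) \<bullet> (?N * h2 s) = (?N * (?N * h2 s)) \<bullet> (?N * (?N * h2 s))" by (rule inner_mult_unit[OF nn, symmetric])
        then show ?thesis unfolding l2 by (simp add: inner_complex_def power2_eq_square)
      qed
      have i5: "2 * (h1 s \<bullet> (?N * (?N * h3 s)) + (?N * h2 s) \<bullet> (?N * h2 s)) = 6 * (kappa s)\<^sup>2 * (\<psi> s)\<^sup>2 + 2 * (\<psi>1 s)\<^sup>2 - 2 * \<psi> s * \<psi>2 s"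
        unfolding i3 i4 by (simp add: algebra_simps power2_eq_square)
      have "((\<lambda>t. 2 * (q0 s t \<bullet> (?N * (?N * q2 s t)) + (?N * q1 s t) \<bullet> (?N * q1 s t))) \<longlongrightarrow> 2 * (h1 s \<bullet> (?N * (?N * h3 s)) + (?N * h2 s) \<bullet> (?N * h2 s))) (at_right 0)"
        by (intro tendsto_intros q0l q1l q2l)
      then show "((\<lambda>t. 2 * (q0 s t \<bullet> (?N * (?N * q2 s t)) + (?N * q1 s t) \<bullet> (?N * q1 s t))) \<longlongrightarrow>
          6 * (kappa s)\<^sup>2 * (\<psi> s)\<^sup>2 + 2 * (\<psi>1 s)\<^sup>2 - 2 * \<psi> s * \<psi>2 s) (at_right 0)"
        unfolding i5 .
    qed (use \<psi>pos a in auto)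
    then show "((\<lambda>t. (sin (a * ?X t) / a / norm (deriv g (nrm s t) / g (nrm s t)) - t + kappa s * t\<^sup>2 / 2) / t ^ 3)
       \<longlongrightarrow> \<psi>2 s / (3 * \<psi> s) - (kappa s)\<^sup>2 / 6 - (\<psi>1 s / \<psi> s)\<^sup>2 / 2 - a\<^sup>2 * (\<psi> s)\<^sup>2 / 6) (at_right 0)"
      by (simp add: norm_eq_sqrt_inner q0_def)
  qed
qed

end

section \<open>Integral estimates\<close>

text \<open>Cauchy-Schwarz as a variance: the integral of (|f| - c)^2 is nonnegative for the mean
  \<open>c\<close> of |f|.\<close>

lemma integral_square_ge:
  fixes f :: "real \<Rightarrow> real"
  assumes L: "L > 0" and f: "continuous_on {0..L} f" and A: "0 \<le> A" "A \<le> integral {0..L} (\<lambda>s. \<bar>f s\<bar>)"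
  shows "A\<^sup>2 \<le> L * integral {0..L} (\<lambda>s. (f s)\<^sup>2)"
proof -
  define I where "I = integral {0..L} (\<lambda>s. \<bar>f s\<bar>)"
  define c where "c = I / L"
  have i1: "(\<lambda>s. (f s)\<^sup>2) integrable_on {0..L}" "(\<lambda>s. \<bar>f s\<bar>) integrable_on {0..L}"
    by (intro integrable_continuous_real continuous_intros f)+
  have "0 \<le> integral {0..L} (\<lambda>s. (\<bar>f s\<bar> - c)\<^sup>2)" by (rule integral_nonneg) (auto intro!: integrable_continuous_real continuous_intros f)
  also have "integral {0..L} (\<lambda>s. (\<bar>f s\<bar> - c)\<^sup>2) = integral {0..L} (\<lambda>s. (f s)\<^sup>2 - 2 * c * \<bar>f s\<bar> + c\<^sup>2)"
    by (rule integral_cong) (simp add: power2_diff)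
  also have "\<dots> = integral {0..L} (\<lambda>s. (f s)\<^sup>2 - 2 * c * \<bar>f s\<bar>) + integral {0..L} (\<lambda>s. c\<^sup>2)"
    by (rule Henstock_Kurzweil_Integration.integral_add) (auto intro!: integrable_continuous_real continuous_intros f)
  also have "integral {0..L} (\<lambda>s. (f s)\<^sup>2 - 2 * c * \<bar>f s\<bar>) = integral {0..L} (\<lambda>s. (f s)\<^sup>2) - integral {0..L} (\<lambda>s. 2 * c * \<bar>f s\<bar>)"
    by (rule Henstock_Kurzweil_Integration.integral_diff) (auto intro!: integrable_continuous_real continuous_intros f)
  also have "integral {0..L} (\<lambda>s. 2 * c * \<bar>f s\<bar>) = 2 * c * I" unfolding I_def by (rule integral_mult_right)
  also have "integral {0..L} (\<lambda>s. c\<^sup>2) = L * c\<^sup>2" using L by simp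
  finally have "2 * c * I - L * c\<^sup>2 \<le> integral {0..L} (\<lambda>s. (f s)\<^sup>2)" by simp
  moreover have "2 * c * I - L * c\<^sup>2 = I\<^sup>2 / L" using L by (simp add: c_def power2_eq_square field_simps)
  ultimately have "I\<^sup>2 / L \<le> integral {0..L} (\<lambda>s. (f s)\<^sup>2)" by (simp only:)
  then have "I\<^sup>2 \<le> L * integral {0..L} (\<lambda>s. (f s)\<^sup>2)" using L by (simp only: pos_divide_le_eq mult.commute)
  moreover have "A\<^sup>2 \<le> I\<^sup>2" using A by (intro power_mono) (auto simp: I_def)
  ultimately show ?thesis by linarith
qed

text \<open>The product of \<open>f\<close> with cis of minus the integral of \<phi> has derivative
  0. It is used for the unit tangent, where \<phi> is the curvature, and for the boundary values of
  the annulus map, where \<phi> is \<psi>.\<close>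

lemma angle_lift:
  fixes f :: "real \<Rightarrow> complex" and \<phi> :: "real \<Rightarrow> real"
  assumes L: "L > 0" and f: "\<And>s. (f has_vector_derivative \<i> * of_real (\<phi> s) * f s) (at s)" and c: "continuous_on UNIV \<phi>"
    and s: "s \<in> {0..L}"
  shows "f s = f 0 * cis (integral {0..s} \<phi>)"
proof -
  define \<tau> where "\<tau> = (\<lambda>s. integral {0..s} \<phi>)"
  define F where "F = (\<lambda>s. f s * cis (- \<tau> s))"
  have \<tau>d: "(\<tau> has_vector_derivative \<phi> x) (at x within {0..L})" if "x \<in> {0..L}" for x
    unfolding \<tau>_def by (rule integral_has_vector_derivative) (use that c in \<open>auto intro: continuous_on_subset\<close>)
  have "(F has_derivative (\<lambda>h. 0)) (at x within {0..L})" if x: "x \<in> {0..L}" for x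
  proof -
    have "((\<lambda>s. - \<tau> s) has_vector_derivative - \<phi> x) (at x within {0..L})" by (intro derivative_intros \<tau>d x)
    then have "((\<lambda>s. exp (\<i> * of_real (- \<tau> s))) has_vector_derivative (\<i> * of_real (- \<phi> x)) * exp (\<i> * of_real (- \<tau> x))) (at x within {0..L})"
    proof -
      assume d: "((\<lambda>s. - \<tau> s) has_vector_derivative - \<phi> x) (at x within {0..L})"
      have "((\<lambda>s. complex_of_real (- \<tau> s)) has_vector_derivative of_real (- \<phi> x)) (at x within {0..L})"
        by (rule has_vector_derivative_of_real[OF d[unfolded has_real_derivative_iff_has_vector_derivative[symmetric]]])
      then have "((\<lambda>s. \<i> * complex_of_real (- \<tau> s)) has_vector_derivative \<i> * of_real (- \<phi> x)) (at x within {0..L})"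
        by (intro has_vector_derivative_mult_right) auto
      from field_vector_diff_chain_within[OF this, of exp "exp (\<i> * of_real (- \<tau> x))"]
      show ?thesis by (simp add: o_def DERIV_exp has_field_derivative_at_within)
    qed
    then have c: "((\<lambda>s. cis (- \<tau> s)) has_vector_derivative (\<i> * of_real (- \<phi> x)) * cis (- \<tau> x)) (at x within {0..L})"
      by (simp add: cis_conv_exp)
    have "(F has_vector_derivative f x * ((\<i> * of_real (- \<phi> x)) * cis (- \<tau> x)) + (\<i> * of_real (\<phi> x) * f x) * cis (- \<tau> x)) (at x within {0..L})"
      unfolding F_def by (rule has_vector_derivative_mult[OF has_vector_derivative_at_within[OF f] c])
    moreover have "f x * ((\<i> * of_real (- \<phi> x)) * cis (- \<tau> x)) + (\<i> * of_real (\<phi> x) * f x) * cis (- \<tau> x) = 0" by simp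
    ultimately show ?thesis by (simp add: has_vector_derivative_def)
  qed
  then obtain k where k: "\<And>x. x \<in> {0..L} \<Longrightarrow> F x = k"
    using has_derivative_zero_constant[of "{0..L}" F] by auto
  have "F s = F 0" using k[OF s] k[of 0] L by simp
  then have "f s * cis (- \<tau> s) * cis (\<tau> s) = f 0 * cis (\<tau> s)" by (simp add: F_def \<tau>_def)
  then show ?thesis by (simp add: \<tau>_def mult.assoc cis_mult)
qed

lemma cis_eq_1:
  assumes "cis x = 1"
  obtains k :: int where "x = 2 * pi * of_int k"
proof -
  have "cos x = 1" using assms by (metis cis.simps(1) one_complex.simps(1))
  then show thesis using that cos_one_2pi_int[of x] by (auto simp: mult_ac)
qed

section \<open>Total absolute curvature of a closed curve\<close>

context C3a_curve begin

text \<open>Over one period the tangent angle \<tau> changes by 2 \<pi> k. For nonzero k the bound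
  is immediate. For k = 0 the range of \<tau> has length at least \<pi>: otherwise all tangents
  would lie in an open half plane, yet they integrate to 0 around a closed curve. The angle crosses
  this range and returns, so its variation is at least 2 \<pi>.\<close>

lemma total_curvature: "integral {0..L} (\<lambda>s. \<bar>kappa s\<bar>) \<ge> 2 * pi"
proof -
  define \<tau> where "\<tau> = (\<lambda>s. integral {0..s} kappa)"
  have kc: "continuous_on A kappa" for A by (rule kappa_continuous)
  have ki: "kappa integrable_on {a..b}" for a b by (rule integrable_continuous_real[OF kc])
  have ai: "(\<lambda>s. \<bar>kappa s\<bar>) integrable_on {a..b}" for a b by (intro integrable_continuous_real continuous_intros kc)
  have lift: "\<gamma>1 s = \<gamma>1 0 * cis (\<tau> s)" if "s \<in> {0..L}" for s
    unfolding \<tau>_def by (rule angle_lift[OF L _ kc that]) (use d2 gamma2_eq in simp)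
  have g10: "\<gamma>1 0 \<noteq> 0" using unit[of 0] by auto
  have dif: "\<bar>\<tau> b - \<tau> a\<bar> \<le> integral {a..b} (\<lambda>s. \<bar>kappa s\<bar>)" if "0 \<le> a" "a \<le> b" for a b
  proof -
    have "\<tau> a + integral {a..b} kappa = \<tau> b" unfolding \<tau>_def by (rule Henstock_Kurzweil_Integration.integral_combine[OF that ki])
    then have "\<tau> b - \<tau> a = integral {a..b} kappa" by simp
    also have "\<bar>\<dots>\<bar> \<le> integral {a..b} (\<lambda>s. \<bar>kappa s\<bar>)"
      using integral_norm_bound_integral[OF ki ai, of a b] by simp
    finally show ?thesis .
  qed
  have \<tau>0: "\<tau> 0 = 0" by (simp add: \<tau>_def)
  have "\<gamma>1 0 = \<gamma>1 0 * cis (\<tau> L)" using lift[of L] per1[of 0] L by simp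
  then have "cis (\<tau> L) = 1" using g10 by simp
  then obtain k :: int where k: "\<tau> L = 2 * pi * of_int k" by (rule cis_eq_1)
  show ?thesis
  proof (cases "k = 0")
    case False
    then have "\<bar>of_int k :: real\<bar> \<ge> 1" by linarith
    then have "\<bar>\<tau> L\<bar> \<ge> 2 * pi" unfolding k by (simp add: abs_mult)
    then show ?thesis using dif[of 0 L] L \<tau>0 by simp
  next
    case True
    then have \<tau>L: "\<tau> L = 0" using k by simp
    have \<tau>c: "continuous_on {0..L} \<tau>" unfolding \<tau>_def by (rule indefinite_integral_continuous_1[OF ki])
    have ne: "{0..L} \<noteq> {}" using L by simp
    obtain a where a: "a \<in> {0..L}" "\<And>s. s \<in> {0..L} \<Longrightarrow> \<tau> s \<le> \<tau> a"
      using continuous_attains_sup[OF compact_Icc ne \<tau>c] by auto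
    obtain b where b: "b \<in> {0..L}" "\<And>s. s \<in> {0..L} \<Longrightarrow> \<tau> b \<le> \<tau> s"
      using continuous_attains_inf[OF compact_Icc ne \<tau>c] by auto
    have big: "\<tau> a - \<tau> b \<ge> pi"
    proof (rule ccontr)
      assume "\<not> \<tau> a - \<tau> b \<ge> pi"
      then have lt: "\<tau> a - \<tau> b < pi" by simp
      \<comment> \<open>The midpoint of the range: all angles are within \<pi>/2 of it, so the
        tangent has a positive component in this direction.\<close>
      define m where "m = (\<tau> a + \<tau> b) / 2"
      have pos: "cos (\<tau> s - m) > 0" if "s \<in> {0..L}" for s
        using a(2)[OF that] b(2)[OF that] lt by (intro cos_gt_zero_pi) (auto simp: m_def field_simps)
      have cc: "continuous_on {0..L} (\<lambda>s. cos (\<tau> s - m))" by (intro continuous_intros \<tau>c)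
      have "(\<gamma>1 has_integral \<gamma> L - \<gamma> 0) {0..L}"
        by (rule fundamental_theorem_of_calculus) (use L d1 in \<open>auto intro: has_vector_derivative_at_within\<close>)
      then have "(\<gamma>1 has_integral 0) {0..L}" using per[of 0] by simp
      then have "((\<lambda>s. cis (- m) / \<gamma>1 0 * \<gamma>1 s) has_integral cis (- m) / \<gamma>1 0 * 0) {0..L}" by (rule has_integral_mult_right)
      then have "((\<lambda>s. Re (cis (- m) / \<gamma>1 0 * \<gamma>1 s)) has_integral Re 0) {0..L}"
        using has_integral_linear[OF _ bounded_linear_Re, of "\<lambda>s. cis (- m) / \<gamma>1 0 * \<gamma>1 s"] by (simp only: o_def mult_zero_right)
      moreover have "Re (cis (- m) / \<gamma>1 0 * \<gamma>1 s) = cos (\<tau> s - m)" if s: "s \<in> {0..L}" for s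
      proof -
        have "cis (- m) / \<gamma>1 0 * \<gamma>1 s = cis (- m) * cis (\<tau> s)"
          unfolding lift[OF s] using g10 by simp
        also have "\<dots> = cis (\<tau> s - m)" by (simp only: cis_mult) (simp add: algebra_simps)
        finally show ?thesis by simp
      qed
      ultimately have "((\<lambda>s. cos (\<tau> s - m)) has_integral Re 0) {0..L}" by (rule has_integral_eq[rotated])
      then have "((\<lambda>s. cos (\<tau> s - m)) has_integral 0) {0..L}" by simp
      then have i0: "integral {0..L} (\<lambda>s. cos (\<tau> s - m)) = 0" by (rule integral_unique)
      obtain s0 where s0: "s0 \<in> {0..L}" "\<And>s. s \<in> {0..L} \<Longrightarrow> cos (\<tau> s0 - m) \<le> cos (\<tau> s - m)"
        using continuous_attains_inf[OF compact_Icc ne cc] by auto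
      have "integral {0..L} (\<lambda>s. cos (\<tau> s0 - m)) \<le> integral {0..L} (\<lambda>s. cos (\<tau> s - m))"
        by (rule integral_le) (use s0 cc in \<open>auto intro: integrable_continuous_real\<close>)
      then have "L * cos (\<tau> s0 - m) \<le> 0" using i0 L by simp
      moreover have "L * cos (\<tau> s0 - m) > 0" using pos[OF s0(1)] L by simp
      ultimately show False by simp
    qed
    \<comment> \<open>From 0 to one extremum, to the other, and back to the value 0 at
      \<open>L\<close>: the first and last piece together vary at least as much as the middle
      one.\<close>
    define p where "p = min a b"
    define q where "q = max a b"
    have pq: "0 \<le> p" "p \<le> q" "q \<le> L" using a b by (auto simp: p_def q_def)
    have apq: "\<bar>\<tau> q - \<tau> p\<bar> \<ge> pi" using big pi_gt_zero by (cases "a \<le> b") (auto simp: p_def q_def min_def max_def)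
    have "integral {0..L} (\<lambda>s. \<bar>kappa s\<bar>) = integral {0..p} (\<lambda>s. \<bar>kappa s\<bar>) + integral {p..L} (\<lambda>s. \<bar>kappa s\<bar>)"
      by (rule Henstock_Kurzweil_Integration.integral_combine[OF _ _ ai, symmetric]) (use pq in auto)
    also have "integral {p..L} (\<lambda>s. \<bar>kappa s\<bar>) = integral {p..q} (\<lambda>s. \<bar>kappa s\<bar>) + integral {q..L} (\<lambda>s. \<bar>kappa s\<bar>)"
      by (rule Henstock_Kurzweil_Integration.integral_combine[OF _ _ ai, symmetric]) (use pq in auto)
    finally show ?thesis using dif[of 0 p] dif[of p q] dif[of q L] pq apq \<tau>0 \<tau>L by linarith
  qed
qed

end

context annular_domain begin

text \<open>The derivative of \<psi>1/\<psi> integrates to 0 over a period, so the integral of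
  \<psi>2 / (3 \<psi>) is one third of that of (\<psi>1/\<psi>)^2. Against the term with 1/2 there
  remains - 1/6 of a square, which is discarded in the favourable direction. The integrals of
  \<kappa>^2 and \<psi>^2 are each at least (2 \<pi>)^2 / L.\<close>

lemma integral_c3_bound:
  obtains c3 :: "real \<Rightarrow> real" where
    "\<And>s. ((\<lambda>t. (sin (pi / (- ln \<beta>) * (- ln (norm (g (nrm s t))))) / (pi / (- ln \<beta>)) / norm (deriv g (nrm s t) / g (nrm s t)) - t + kappa s * t\<^sup>2 / 2) / t ^ 3) \<longlongrightarrow> c3 s) (at_right 0)"
    "\<And>s. c3 (s + L) = c3 s" "continuous_on UNIV c3"
    "- L * integral {0..L} c3 \<ge> 2 * pi\<^sup>2 / 3 * ((pi / ln \<beta>)\<^sup>2 + 1)"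
proof -
  obtain G0 :: "real \<Rightarrow> complex" and \<psi> \<psi>1 \<psi>2 :: "real \<Rightarrow> real" where
    \<psi>pos: "\<And>s. \<psi> s > 0" and \<psi>d: "\<And>s. (\<psi> has_real_derivative \<psi>1 s) (at s)" and \<psi>1d: "\<And>s. (\<psi>1 has_real_derivative \<psi>2 s) (at s)"
    and \<psi>2c: "continuous_on UNIV \<psi>2" and \<psi>p: "\<And>s. \<psi> (s + L) = \<psi> s" and \<psi>1p: "\<And>s. \<psi>1 (s + L) = \<psi>1 s"
    and G0d: "\<And>s. (G0 has_vector_derivative \<i> * of_real (\<psi> s) * G0 s) (at s)" and G0n: "\<And>s. norm (G0 s) = 1" and G0p: "\<And>s. G0 (s + L) = G0 s"
    and lim: "\<And>s a. a > 0 \<Longrightarrow> ((\<lambda>t. (sin (a * (- ln (norm (g (nrm s t))))) / a / norm (deriv g (nrm s t) / g (nrm s t)) - t + kappa s * t\<^sup>2 / 2) / t ^ 3)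
       \<longlongrightarrow> \<psi>2 s / (3 * \<psi> s) - (kappa s)\<^sup>2 / 6 - (\<psi>1 s / \<psi> s)\<^sup>2 / 2 - a\<^sup>2 * (\<psi> s)\<^sup>2 / 6) (at_right 0)"
    by (rule c3_expansion) (rule that)
  define a where "a = pi / (- ln \<beta>)"
  have "ln \<beta> < 0" using \<beta> by simp
  then have a: "a > 0" unfolding a_def by (intro divide_pos_pos) auto
  define c3 where "c3 = (\<lambda>s. \<psi>2 s / (3 * \<psi> s) - (kappa s)\<^sup>2 / 6 - (\<psi>1 s / \<psi> s)\<^sup>2 / 2 - a\<^sup>2 * (\<psi> s)\<^sup>2 / 6)"
  have \<psi>c: "continuous_on A \<psi>" and \<psi>1c: "continuous_on A \<psi>1" for A
    by (rule continuous_at_imp_continuous_on; use DERIV_isCont[OF \<psi>d] DERIV_isCont[OF \<psi>1d] in blast)+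
  have \<psi>2c': "continuous_on A \<psi>2" for A using \<psi>2c continuous_on_subset by blast
  have \<psi>nz: "\<psi> s \<noteq> 0" for s using \<psi>pos[of s] by simp
  have c3c: "continuous_on A c3" for A
    unfolding c3_def using \<psi>nz by (intro continuous_intros \<psi>c \<psi>1c \<psi>2c' kappa_continuous) auto
  have \<psi>2p: "\<psi>2 (s + L) = \<psi>2 s" for s
  proof -
    have "((\<lambda>s. \<psi>1 (s + L)) has_real_derivative \<psi>2 (s + L)) (at s)" using \<psi>1d[of "s + L"] by (simp add: DERIV_shift)
    then show ?thesis unfolding \<psi>1p using DERIV_unique[OF _ \<psi>1d[of s]] by blast
  qed
  have kp: "kappa (s + L) = kappa s" for s by (simp add: kappa_def per1 per2)
  have i0: "integral {0..L} (\<lambda>s. \<psi>2 s / \<psi> s - (\<psi>1 s / \<psi> s)\<^sup>2) = 0"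
  proof (rule integral_unique)
    have "((\<lambda>s. \<psi>2 s / \<psi> s - (\<psi>1 s / \<psi> s)\<^sup>2) has_integral \<psi>1 L / \<psi> L - \<psi>1 0 / \<psi> 0) {0..L}"
    proof (rule fundamental_theorem_of_calculus)
      fix s assume "s \<in> {0..L}"
      have "((\<lambda>s. \<psi>1 s / \<psi> s) has_real_derivative (\<psi>2 s * \<psi> s - \<psi>1 s * \<psi>1 s) / (\<psi> s * \<psi> s)) (at s)"
        by (rule DERIV_divide[OF \<psi>1d \<psi>d \<psi>nz])
      moreover have "(\<psi>2 s * \<psi> s - \<psi>1 s * \<psi>1 s) / (\<psi> s * \<psi> s) = \<psi>2 s / \<psi> s - (\<psi>1 s / \<psi> s)\<^sup>2"
        using \<psi>nz[of s] by (simp add: field_simps power2_eq_square)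
      ultimately show "((\<lambda>s. \<psi>1 s / \<psi> s) has_vector_derivative \<psi>2 s / \<psi> s - (\<psi>1 s / \<psi> s)\<^sup>2) (at s within {0..L})"
        by (simp add: has_real_derivative_iff_has_vector_derivative has_vector_derivative_at_within)
    qed (use L in auto)
    then show "((\<lambda>s. \<psi>2 s / \<psi> s - (\<psi>1 s / \<psi> s)\<^sup>2) has_integral 0) {0..L}" using \<psi>p[of 0] \<psi>1p[of 0] by simp
  qed
  have int: "f integrable_on {0..L}" if "continuous_on {0..L} f" for f :: "real \<Rightarrow> real" using that by (rule integrable_continuous_real)
  define A where "A = integral {0..L} (\<lambda>s. (kappa s)\<^sup>2)"
  define P where "P = integral {0..L} (\<lambda>s. (\<psi> s)\<^sup>2)"
  \<comment> \<open>The closed curve \<open>G0\<close> on the unit circle makes this a multiple of 2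
    \<pi>, and positivity of \<psi> makes the multiple at least 1.\<close>
  have \<psi>int: "integral {0..L} \<psi> \<ge> 2 * pi"
  proof -
    have "G0 L = G0 0 * cis (integral {0..L} \<psi>)" by (rule angle_lift[OF L G0d \<psi>c]) (use L in auto)
    moreover have "G0 L = G0 0" using G0p[of 0] by simp
    moreover have "G0 0 \<noteq> 0" using G0n[of 0] by auto
    ultimately have "cis (integral {0..L} \<psi>) = 1" by simp
    then obtain k :: int where k: "integral {0..L} \<psi> = 2 * pi * of_int k" by (rule cis_eq_1)
    obtain s0 where s0: "s0 \<in> {0..L}" "\<And>s. s \<in> {0..L} \<Longrightarrow> \<psi> s0 \<le> \<psi> s"
      using continuous_attains_inf[OF compact_Icc _ \<psi>c, of 0 L] L by auto
    have "integral {0..L} (\<lambda>s. \<psi> s0) \<le> integral {0..L} \<psi>" by (rule integral_le) (use s0 \<psi>c int in auto)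
    then have "L * \<psi> s0 \<le> integral {0..L} \<psi>" using L by simp
    moreover have "L * \<psi> s0 > 0" using L \<psi>pos by simp
    ultimately have "2 * pi * of_int k > 0" using k by simp
    then have "of_int k > (0::real)" by (simp add: zero_less_mult_iff)
    then have "k \<ge> 1" by simp
    then have "of_int k \<ge> (1::real)" by simp
    then show ?thesis unfolding k by simp
  qed
  have bA: "(2 * pi)\<^sup>2 \<le> L * A" unfolding A_def
    by (rule integral_square_ge[OF L kappa_continuous _ total_curvature]) simp
  have bP: "(2 * pi)\<^sup>2 \<le> L * P" unfolding P_def
  proof (rule integral_square_ge[OF L \<psi>c])
    have "(\<lambda>s. \<bar>\<psi> s\<bar>) = \<psi>" using \<psi>pos by (auto simp: fun_eq_iff less_imp_le)
    then show "2 * pi \<le> integral {0..L} (\<lambda>s. \<bar>\<psi> s\<bar>)" using \<psi>int by simp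
  qed simp
  define f where "f = (\<lambda>s. (1/3) * (\<psi>2 s / \<psi> s - (\<psi>1 s / \<psi> s)\<^sup>2))"
  define h where "h = (\<lambda>s. (1/6) * (kappa s)\<^sup>2 + a\<^sup>2 / 6 * (\<psi> s)\<^sup>2)"
  have fc: "continuous_on {0..L} f" "continuous_on {0..L} h" unfolding f_def h_def
    using \<psi>nz by (intro continuous_intros \<psi>c \<psi>1c \<psi>2c' kappa_continuous; auto)+
  have "integral {0..L} c3 \<le> integral {0..L} (\<lambda>s. f s - h s)"
  proof (rule integral_le)
    show "c3 integrable_on {0..L}" by (rule int[OF c3c])
    show "(\<lambda>s. f s - h s) integrable_on {0..L}" by (intro int continuous_intros fc)
    show "c3 s \<le> f s - h s" for s
    proof -
      have "c3 s = (f s - h s) - (1/6) * (\<psi>1 s / \<psi> s)\<^sup>2" by (simp add: c3_def f_def h_def algebra_simps)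
      then show ?thesis by simp
    qed
  qed
  also have "\<dots> = integral {0..L} f - integral {0..L} h" by (rule Henstock_Kurzweil_Integration.integral_diff) (intro int fc)+
  also have "integral {0..L} f = 0" unfolding f_def by (simp only: integral_mult_right i0)
  also have "integral {0..L} h = integral {0..L} (\<lambda>s. (1/6) * (kappa s)\<^sup>2) + integral {0..L} (\<lambda>s. a\<^sup>2 / 6 * (\<psi> s)\<^sup>2)"
    unfolding h_def by (rule Henstock_Kurzweil_Integration.integral_add) (intro int continuous_intros \<psi>c kappa_continuous)+
  also have "integral {0..L} (\<lambda>s. (1/6) * (kappa s)\<^sup>2) = (1/6) * A" unfolding A_def by (rule integral_mult_right)
  also have "integral {0..L} (\<lambda>s. a\<^sup>2 / 6 * (\<psi> s)\<^sup>2) = a\<^sup>2 / 6 * P" unfolding P_def by (rule integral_mult_right)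
  finally have "(1/6) * A + a\<^sup>2 / 6 * P \<le> - integral {0..L} c3" by simp
  then have "L * ((1/6) * A + a\<^sup>2 / 6 * P) \<le> L * (- integral {0..L} c3)" using L by (intro mult_left_mono) auto
  moreover have "a\<^sup>2 * (2 * pi)\<^sup>2 \<le> a\<^sup>2 * (L * P)" using bP by (intro mult_left_mono) auto
  moreover have "L * ((1/6) * A + a\<^sup>2 / 6 * P) = (1/6) * (L * A) + (1/6) * (a\<^sup>2 * (L * P))" by (simp add: algebra_simps)
  moreover have "a\<^sup>2 = (pi / ln \<beta>)\<^sup>2" by (simp add: a_def)
  ultimately have fin: "- L * integral {0..L} c3 \<ge> 2 * pi\<^sup>2 / 3 * ((pi / ln \<beta>)\<^sup>2 + 1)"
    using bA by (simp add: power_mult_distrib algebra_simps)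
  show thesis
  proof (rule that[of c3])
    show "((\<lambda>t. (sin (pi / (- ln \<beta>) * (- ln (norm (g (nrm s t))))) / (pi / (- ln \<beta>)) / norm (deriv g (nrm s t) / g (nrm s t)) - t + kappa s * t\<^sup>2 / 2) / t ^ 3) \<longlongrightarrow> c3 s) (at_right 0)" for s
      using lim[OF a, of s] unfolding a_def c3_def .
    show "c3 (s + L) = c3 s" for s by (simp add: c3_def \<psi>p \<psi>1p \<psi>2p kp)
  qed (rule c3c, rule fin)
qed

end

section \<open>The hyperbolic metric\<close>

text \<open>Locally - ln |g| is the real part of a holomorphic coordinate, namely - Ln g, with
  values in a strip of width l - 2 x0; the function is the logarithm of the pulled back strip
  density a / sin (a x). Its first part has second derivative a^2 / sin^2 in that coordinate, and ln
  |g'/g| is harmonic. A positive margin \<open>x0\<close> yields a smaller ring whose metric blows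
  up on level sets within \<Omega>.\<close>

lemma annulus_metric_liouville:
  fixes g :: "complex \<Rightarrow> complex"
  assumes \<Omega>: "open \<Omega>" and g: "g holomorphic_on \<Omega>" "\<And>z. z \<in> \<Omega> \<Longrightarrow> g z \<noteq> 0" "\<And>z. z \<in> \<Omega> \<Longrightarrow> deriv g z \<noteq> 0"
    and x: "2 * x0 < l" and U: "U = {z \<in> \<Omega>. x0 < - ln (norm (g z)) \<and> - ln (norm (g z)) < l - x0}"
  shows "liouville U (\<lambda>z. ln (pi / (l - 2 * x0)) - ln (sin (pi / (l - 2 * x0) * (- ln (norm (g z)) - x0))) + ln (norm (deriv g z / g z)))"
    and "\<And>z. z \<in> U \<Longrightarrow> sin (pi / (l - 2 * x0) * (- ln (norm (g z)) - x0)) > 0"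
proof -
  define a where "a = pi / (l - 2 * x0)"
  have a: "a > 0" using x by (simp add: a_def)
  show pos: "sin (pi / (l - 2 * x0) * (- ln (norm (g z)) - x0)) > 0" if "z \<in> U" for z
  proof (rule sin_gt_zero)
    show "0 < pi / (l - 2 * x0) * (- ln (cmod (g z)) - x0)" using that x by (intro mult_pos_pos) (auto simp: U)
    have "a * (- ln (cmod (g z)) - x0) < a * (l - 2 * x0)" using that a by (intro mult_strict_left_mono) (auto simp: U)
    also have "\<dots> = pi" using x by (simp add: a_def)
    finally show "pi / (l - 2 * x0) * (- ln (cmod (g z)) - x0) < pi" by (simp add: a_def)
  qed
  have US: "U \<subseteq> \<Omega>" by (auto simp: U)
  define q where "q = (\<lambda>z. deriv g z / g z)"
  have qe: "deriv g z / g z = q z" for z by (simp add: q_def)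
  have qh: "q holomorphic_on \<Omega>" unfolding q_def by (intro holomorphic_intros holomorphic_deriv g \<Omega>)
  have qn: "q z \<noteq> 0" if "z \<in> \<Omega>" for z using g that by (simp add: q_def)
  have gc: "continuous_on U g" "continuous_on U q"
    using continuous_on_subset[OF holomorphic_on_imp_continuous_on[OF g(1)] US] continuous_on_subset[OF holomorphic_on_imp_continuous_on[OF qh] US] by auto
  show "liouville U (\<lambda>z. ln (pi / (l - 2 * x0)) - ln (sin (pi / (l - 2 * x0) * (- ln (norm (g z)) - x0))) + ln (norm (deriv g z / g z)))"
    unfolding liouville_def qe a_def[symmetric]
  proof (intro conjI ballI)
    have "continuous_on U (\<lambda>z. ln a - ln (sin (a * (- ln (cmod (g z)) - x0))) + ln (cmod (q z)))"
      using pos g qn US by (intro continuous_intros gc) (fastforce simp: a_def)+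
    then show "continuous_on U (\<lambda>z. ln a - ln (sin (a * (- ln (cmod (g z)) - x0))) + ln (cmod (q z)))" .
    fix z assume z: "z \<in> U"
    then have z': "z \<in> \<Omega>" by (simp add: U)
    define F where "F = (\<lambda>x. ln a - ln (sin (a * (- x - x0))))"
    define F' where "F' = (\<lambda>x. a * (cos (a * (- x - x0)) / sin (a * (- x - x0))))"
    have sp: "sin (a * (- ln (norm (g z)) - x0)) > 0" using pos[OF z] by (simp add: a_def)
    have "((\<lambda>x. sin (a * (- x - x0))) \<longlongrightarrow> sin (a * (- ln (norm (g z)) - x0))) (nhds (ln (norm (g z))))"
      by (intro tendsto_intros filterlim_ident)
    from order_tendstoD(1)[OF this sp] have ev: "\<forall>\<^sub>F x in nhds (ln (norm (g z))). 0 < sin (a * (- x - x0))" .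
    have F1: "\<forall>\<^sub>F x in nhds (ln (norm (g z))). (F has_real_derivative F' x) (at x)"
      using ev
    proof eventually_elim
      case (elim x)
      show ?case unfolding F_def F'_def using elim by (auto intro!: derivative_eq_intros)
    qed
    have "((\<lambda>x. a * (cos (a * (- x - x0)) / sin (a * (- x - x0)))) has_real_derivative
        a * ((- sin (a * (- ln (norm (g z)) - x0)) * - a * sin (a * (- ln (norm (g z)) - x0)) - cos (a * (- ln (norm (g z)) - x0)) * (cos (a * (- ln (norm (g z)) - x0)) * - a)) / (sin (a * (- ln (norm (g z)) - x0)) * sin (a * (- ln (norm (g z)) - x0))))) (at (ln (norm (g z))))"
      using sp by (auto intro!: derivative_eq_intros simp: algebra_simps)
    moreover have "a * ((- s * - a * s - c * (c * - a)) / (s * s)) = a\<^sup>2 / s\<^sup>2" if "s = sin y" "c = cos y" for s c y :: real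
    proof -
      have "- s * - a * s - c * (c * - a) = a * (s\<^sup>2 + c\<^sup>2)" by (simp add: algebra_simps power2_eq_square)
      also have "\<dots> = a" using that by simp
      finally show ?thesis by (simp add: power2_eq_square)
    qed
    ultimately have F2: "(F' has_real_derivative a\<^sup>2 / (sin (a * (- ln (norm (g z)) - x0)))\<^sup>2) (at (ln (norm (g z))))"
      unfolding F'_def by metis
    have "has_lap (\<lambda>z. F (ln (norm (g z))) + ln (norm (q z))) z (a\<^sup>2 / (sin (a * (- ln (norm (g z)) - x0)))\<^sup>2 * (norm (deriv g z / g z))\<^sup>2 + 0)"
      by (intro has_lap_add has_lap_comp_ln_norm[OF \<Omega> z' g(1,2) F1 F2] has_lap_ln_norm[OF \<Omega> z' qh qn])
    moreover have "exp (2 * (ln a - ln (sin (a * (- ln (cmod (g z)) - x0))) + ln (cmod (q z)))) = a\<^sup>2 / (sin (a * (- ln (norm (g z)) - x0)))\<^sup>2 * (norm (deriv g z / g z))\<^sup>2 + 0"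
    proof -
      have "exp (2 * y) = (exp y)\<^sup>2" for y :: real by (simp add: exp_double)
      then show ?thesis using a sp qn[OF z'] unfolding qe
        by (simp add: exp_add exp_diff power_mult_distrib power_divide)
    qed
    ultimately show "has_lap (\<lambda>z. ln a - ln (sin (a * (- ln (cmod (g z)) - x0))) + ln (cmod (q z))) z
         (exp (2 * (ln a - ln (sin (a * (- ln (cmod (g z)) - x0))) + ln (cmod (q z)))))"
      by (simp only: F_def)
  qed
qed

text \<open>The explicit solution \<open>w 0\<close> is approached from above. On the ring with
  margin x0 > 0, whose closure is compact in \<Omega>, \<open>u\<close> is bounded while
  \<open>w x0\<close> blows up at the frontier, so u \<le> w x0. Letting x0 tend to 0 gives u \<le>
  w 0, and \<open>liouville_unique\<close> turns this into equality.\<close>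

lemma hyperbolic_metric_eq:
  fixes g :: "complex \<Rightarrow> complex"
  assumes \<Omega>: "open \<Omega>" "bounded \<Omega>" and \<beta>: "0 < \<beta>" "\<beta> < 1"
    and gh: "g holomorphic_on \<Omega>" and gA: "\<And>z. z \<in> \<Omega> \<Longrightarrow> \<beta> < norm (g z) \<and> norm (g z) < 1"
    and dg: "\<And>z. z \<in> \<Omega> \<Longrightarrow> deriv g z \<noteq> 0"
    and proper: "\<And>m1 m2. \<beta> < m1 \<Longrightarrow> m2 < 1 \<Longrightarrow> compact {z \<in> \<Omega>. m1 \<le> norm (g z) \<and> norm (g z) \<le> m2}"
    and u: "liouville \<Omega> u" and blow: "\<And>\<xi>. \<xi> \<in> frontier \<Omega> \<Longrightarrow> filterlim u at_top (at \<xi> within \<Omega>)"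
    and r0: "r0 > 0" and nd: "\<And>p t. p \<in> frontier \<Omega> \<Longrightarrow> 0 \<le> t \<Longrightarrow> t \<le> r0 \<Longrightarrow> \<exists>x. x \<notin> \<Omega> \<and> dist p x = t"
    and z: "z \<in> \<Omega>"
  shows "exp (- u z) = sin (pi / (- ln \<beta>) * (- ln (norm (g z)))) / (pi / (- ln \<beta>)) / norm (deriv g z / g z)"
proof -
  define l where "l = - ln \<beta>"
  have l: "l > 0" using \<beta> by (simp add: l_def)
  define X where "X = (\<lambda>z. - ln (norm (g z)))"
  define U where "U = (\<lambda>x0. {z \<in> \<Omega>. x0 < - ln (norm (g z)) \<and> - ln (norm (g z)) < l - x0})"
  define w where "w = (\<lambda>x0 z. ln (pi / (l - 2 * x0)) - ln (sin (pi / (l - 2 * x0) * (- ln (norm (g z)) - x0))) + ln (norm (deriv g z / g z)))"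
  have gn: "g z \<noteq> 0" if "z \<in> \<Omega>" for z using gA[OF that] \<beta> by auto
  have lio: "liouville (U x0) (w x0)" if "2 * x0 < l" for x0
    unfolding w_def by (rule annulus_metric_liouville(1)[OF \<Omega>(1) gh gn dg that U_def[THEN fun_cong]])
  have pos: "sin (pi / (l - 2 * x0) * (X z - x0)) > 0" if "2 * x0 < l" "z \<in> U x0" for x0 z
    unfolding X_def by (rule annulus_metric_liouville(2)[OF \<Omega>(1) gh gn dg that(1) U_def[THEN fun_cong] that(2)])
  have Xr: "0 < X z \<and> X z < l" if "z \<in> \<Omega>" for z
  proof -
    have "0 < norm (g z)" using gA[OF that] \<beta> by linarith
    then show ?thesis using gA[OF that] \<beta> by (simp add: X_def l_def)
  qed
  have U0: "U 0 = \<Omega>" using Xr by (auto simp: U_def X_def)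
  have gc: "continuous_on \<Omega> g" by (rule holomorphic_on_imp_continuous_on[OF gh])
  have qc: "continuous_on \<Omega> (\<lambda>z. deriv g z / g z)"
    by (rule holomorphic_on_imp_continuous_on) (intro holomorphic_intros holomorphic_deriv gh \<Omega> gn)
  have Xc: "continuous_on \<Omega> X" unfolding X_def by (intro continuous_intros gc) (use gn in auto)
  have uc: "continuous_on \<Omega> u" using u by (simp add: liouville_def)
  have le: "u z \<le> w x0 z" if x0: "0 < x0" "2 * x0 < l" and zU: "z \<in> U x0" for x0 z
  proof (rule liouville_compare[OF _ _ _ lio[OF x0(2)] _ zU])
    have "U x0 = \<Omega> \<inter> X -` {x0<..<l - x0}" by (auto simp: U_def X_def)
    then show Uo: "open (U x0)" using continuous_open_preimage[OF Xc \<Omega>(1), of "{x0<..<l - x0}"] by simp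
    have US: "U x0 \<subseteq> \<Omega>" by (auto simp: U_def)
    then show "bounded (U x0)" using \<Omega>(2) bounded_subset by blast
    show "liouville (U x0) u" by (rule liouville_subset[OF u US])
    fix \<xi> \<epsilon> assume \<xi>: "\<xi> \<in> frontier (U x0)" and \<epsilon>: "(\<epsilon>::real) > 0"
    \<comment> \<open>Properness of \<open>g\<close> makes this set compact, so the closure of the
      ring stays within \<Omega>.\<close>
    let ?C = "{z \<in> \<Omega>. exp (- (l - x0)) \<le> norm (g z) \<and> norm (g z) \<le> exp (- x0)}"
    have Ceq: "z \<in> ?C \<longleftrightarrow> z \<in> \<Omega> \<and> x0 \<le> X z \<and> X z \<le> l - x0" for z
    proof -
      have "exp (- (l - x0)) \<le> norm (g z) \<longleftrightarrow> X z \<le> l - x0" if "z \<in> \<Omega>"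
        using ln_ge_iff[of "norm (g z)" "- (l - x0)"] gn[OF that] by (auto simp: X_def)
      moreover have "norm (g z) \<le> exp (- x0) \<longleftrightarrow> x0 \<le> X z" if "z \<in> \<Omega>"
        using ln_le_cancel_iff[of "norm (g z)" "exp (- x0)"] gn[OF that] by (auto simp: X_def)
      ultimately show ?thesis by auto
    qed
    have b: "\<beta> = exp (- l)" using \<beta> by (simp add: l_def)
    have "compact ?C" by (rule proper) (use x0 in \<open>auto simp: b\<close>)
    then have "closed ?C" by (rule compact_imp_closed)
    moreover have "U x0 \<subseteq> ?C"
      by (rule subsetI, rule Ceq[THEN iffD2]) (auto simp: U_def X_def)
    ultimately have "closure (U x0) \<subseteq> ?C" by (intro closure_minimal)
    then have "\<xi> \<in> ?C" using \<xi> unfolding frontier_def by blast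
    then have \<xi>C: "\<xi> \<in> \<Omega>" "x0 \<le> X \<xi>" "X \<xi> \<le> l - x0" using Ceq[of \<xi>, THEN iffD1] by blast+
    have "\<xi> \<notin> U x0" using \<xi> Uo by (simp add: frontier_def interior_open)
    then have "X \<xi> = x0 \<or> X \<xi> = l - x0" using \<xi>C by (auto simp: U_def X_def)
    then have s0: "sin (pi / (l - 2 * x0) * (X \<xi> - x0)) = 0"
    proof
      assume "X \<xi> = l - x0"
      then have e: "X \<xi> - x0 = l - 2 * x0" by simp
      have "pi / (l - 2 * x0) * (X \<xi> - x0) = pi" unfolding e using x0 by simp
      then show ?thesis by simp
    qed simp
    have tl: "(f \<longlongrightarrow> f \<xi>) (at \<xi> within U x0)" if "continuous_on \<Omega> f" for f :: "complex \<Rightarrow> real"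
      by (rule tendsto_mono[OF at_le[OF US]]) (use that \<xi>C(1) in \<open>auto simp: continuous_on_def\<close>)
    \<comment> \<open>u - w x0 is \<open>f\<close> plus the logarithm of the sine; \<open>f\<close>
      is bounded near \<xi> while the sine tends to 0.\<close>
    define f where "f = (\<lambda>z. u z - ln (pi / (l - 2 * x0)) - ln (norm (deriv g z / g z)))"
    have "continuous_on \<Omega> f" unfolding f_def by (intro continuous_intros uc qc) (use gn dg in auto)
    from order_tendstoD(2)[OF tl[OF this], of "f \<xi> + 1"]
    have e1: "\<forall>\<^sub>F z in at \<xi> within U x0. f z < f \<xi> + 1" by simp
    have "continuous_on \<Omega> (\<lambda>z. sin (pi / (l - 2 * x0) * (X z - x0)))" by (intro continuous_intros Xc)
    from order_tendstoD(2)[OF tl[OF this], of "exp (\<epsilon> - (f \<xi> + 1))"] s0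
    have e2: "\<forall>\<^sub>F z in at \<xi> within U x0. sin (pi / (l - 2 * x0) * (X z - x0)) < exp (\<epsilon> - (f \<xi> + 1))" by simp
    have "\<forall>\<^sub>F z in at \<xi> within U x0. z \<in> U x0" by (simp add: eventually_at_filter)
    with e1 e2 show "\<forall>\<^sub>F z in at \<xi> within U x0. u z - w x0 z < \<epsilon>"
    proof eventually_elim
      case (elim z)
      define s where "s = sin (pi / (l - 2 * x0) * (X z - x0))"
      have "s > 0" unfolding s_def by (rule pos[OF x0(2) elim(3)])
      then have "ln s < \<epsilon> - (f \<xi> + 1)" using elim(2) ln_less_cancel_iff[of s "exp (\<epsilon> - (f \<xi> + 1))"] by (simp add: s_def)
      moreover have "u z - w x0 z = f z + ln s" by (simp add: f_def w_def s_def X_def)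
      ultimately show ?case using elim(1) by simp
    qed
  qed
  have le0: "u z \<le> w 0 z" if z: "z \<in> \<Omega>" for z
  proof (rule tendsto_lowerbound)
    have "sin (pi / l * (- ln (norm (g z)))) \<noteq> 0" using pos[of 0 z] l z U0 by (simp add: X_def)
    then have "isCont (\<lambda>x0. w x0 z) 0" unfolding w_def using l by (intro continuous_intros) auto
    then have "((\<lambda>x0. w x0 z) \<longlongrightarrow> w 0 z) (at 0)" by (simp only: isCont_def)
    then show "((\<lambda>x0. w x0 z) \<longlongrightarrow> w 0 z) (at_right 0)" by (rule tendsto_mono[OF at_le[OF subset_UNIV]])
    define e where "e = min (X z) (min (l - X z) (l / 2))"
    have "e > 0" using Xr[OF z] l by (simp add: e_def)
    then have "\<forall>\<^sub>F x0 in at_right 0. x0 < e" "\<forall>\<^sub>F x0 in at_right (0::real). x0 > 0"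
      by (auto simp: eventually_at_right_less eventually_at_right_field)
    then show "\<forall>\<^sub>F x0 in at_right 0. u z \<le> w x0 z"
    proof eventually_elim
      case (elim x0)
      then show ?case using z by (intro le) (auto simp: U_def X_def e_def)
    qed
  qed simp
  have weq: "w 0 z = u z"
    by (rule liouville_unique[OF \<Omega> u _ blow r0 nd le0 z]) (use lio[of 0] l U0 in simp_all)
  define s where "s = sin (pi / l * (- ln (norm (g z))))"
  have "s > 0" using pos[of 0 z] l z U0 by (simp add: X_def s_def)
  have "- u z = ln s - ln (pi / l) - ln (norm (deriv g z / g z))" unfolding weq[symmetric] by (simp add: w_def s_def)
  then have "exp (- u z) = s / (pi / l) / norm (deriv g z / g z)"
    using \<open>s > 0\<close> l gn[OF z] dg[OF z] by (simp add: exp_diff del: divide_divide_eq_left divide_divide_eq_right)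
  then show ?thesis by (simp only: s_def l_def)
qed

section \<open>Topology of the domain\<close>

lemma compact_infdist_bound:
  fixes A C :: "'a::metric_space set"
  assumes C: "compact C" and A: "closed A" "A \<noteq> {}" "A \<inter> C = {}"
  obtains \<delta> where "\<delta> > 0" "\<And>z. z \<in> C \<Longrightarrow> \<delta> \<le> infdist z A"
proof (cases "C = {}")
  case False
  have "continuous_on C (\<lambda>z. infdist z A)" by (intro continuous_intros)
  then obtain z0 where z0: "z0 \<in> C" "\<And>z. z \<in> C \<Longrightarrow> infdist z0 A \<le> infdist z A"
    using continuous_attains_inf[OF C False] by blast
  have "z0 \<notin> A" using z0(1) A(3) by blast
  from that[OF infdist_pos_not_in_closed[OF A(1,2) this] z0(2)] show thesis .
qed (use that[of 1] in auto)

text \<open>As \<open>g\<close> is bounded, it would extend holomorphically over \<open>p\<close>.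
  If the new value lay in the annulus, k (h z) = z would pass to the limit and make \<open>p\<close>
  a value of \<open>k\<close>. Otherwise the image is the annulus together with one further point,
  which is not open, against the open mapping theorem.\<close>

lemma annulus_not_punctured:
  fixes g k :: "complex \<Rightarrow> complex"
  assumes S: "open S" "connected S" "p \<in> S" and \<beta>: "0 < \<beta>" "\<beta> < 1"
    and gh: "g holomorphic_on (S - {p})" and kc: "continuous_on (annulus \<beta>) k"
    and gA: "g ` (S - {p}) = annulus \<beta>" and kA: "k ` annulus \<beta> = S - {p}" and kg: "\<And>z. z \<in> S - {p} \<Longrightarrow> k (g z) = z"
  shows False
proof -
  have ev: "\<forall>\<^sub>F z in at p. z \<in> S - {p}"
    using S by (auto simp: eventually_at_filter eventually_nhds_in_open intro: eventually_mono[OF eventually_nhds_in_open[OF S(1,3)]])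
  have gn: "\<beta> < norm (g z) \<and> norm (g z) < 1" if "z \<in> S - {p}" for z
    using gA that unfolding annulus_def by blast
  have "\<forall>\<^sub>F z in at p. norm (g z) \<le> 1" using ev
  proof eventually_elim
    case (elim z) then show ?case using gn[of z] by simp
  qed
  then obtain h where h: "h holomorphic_on S" "\<And>z. z \<in> S - {p} \<Longrightarrow> h z = g z"
    using holomorphic_on_extend_bounded[of g S p] gh S by (auto simp: interior_open)
  have "isCont h p" using holomorphic_on_imp_continuous_on[OF h(1)] S continuous_on_eq_continuous_at by blast
  then have hl: "(h \<longlongrightarrow> h p) (at p)" by (simp add: isCont_def)
  have he: "\<forall>\<^sub>F z in at p. h z = g z" using ev by eventually_elim (rule h(2))
  have hS: "h ` S = insert (h p) (annulus \<beta>)"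
  proof -
    have "S = insert p (S - {p})" using S(3) by blast
    then have "h ` S = insert (h p) (h ` (S - {p}))" by (metis image_insert)
    also have "h ` (S - {p}) = g ` (S - {p})" using h(2) by simp
    finally show ?thesis using gA by simp
  qed
  show False
  proof (cases "h p \<in> annulus \<beta>")
    case True
    have ao: "open (annulus \<beta>)"
    proof -
      have "annulus \<beta> = norm -` {\<beta><..<1}" by (auto simp: annulus_def)
      then show ?thesis using open_vimage[OF open_greaterThanLessThan continuous_on_norm_id] by simp
    qed
    have "isCont k (h p)" using kc ao True continuous_on_eq_continuous_at by blast
    then have "((\<lambda>z. k (h z)) \<longlongrightarrow> k (h p)) (at p)" by (rule isCont_tendsto_compose[OF _ hl])
    moreover have "\<forall>\<^sub>F z in at p. k (h z) = z" using ev
    proof eventually_elim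
      case (elim z) then show ?case using h(2)[OF elim] kg[OF elim] by simp
    qed
    ultimately have "((\<lambda>z. z) \<longlongrightarrow> k (h p)) (at p)" by (simp add: tendsto_cong)
    then have "k (h p) = p" using tendsto_unique[OF _ _ tendsto_ident_at] by (metis at_neq_bot)
    then show False using kA True by blast
  next
    case False
    have "\<not> h constant_on S"
    proof
      assume "h constant_on S"
      then obtain c where c: "\<And>z. z \<in> S \<Longrightarrow> h z = c" by (auto simp: constant_on_def)
      define m where "m = (\<beta> + 1) / 2"
      define m' where "m' = (\<beta> + 2) / 3"
      have "of_real m \<in> annulus \<beta>" "of_real m' \<in> annulus \<beta>" using \<beta> by (auto simp: annulus_def m_def m'_def)
      then have "of_real m \<in> h ` S" "of_real m' \<in> h ` S" using hS by auto
      then have "of_real m = c" "of_real m' = c" using c by auto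
      then have "m = m'" by (metis of_real_eq_iff)
      then show False using \<beta> by (simp add: m_def m'_def field_simps)
    qed
    then have op: "open (h ` S)" by (intro open_mapping_thm[OF h(1) S(1,2) S(1)]) auto
    have nl: "((\<lambda>z. norm (h z)) \<longlongrightarrow> norm (h p)) (at p)" by (intro tendsto_intros hl)
    have "\<beta> \<le> norm (h p)"
    proof (rule tendsto_lowerbound[OF nl])
      show "\<forall>\<^sub>F z in at p. \<beta> \<le> norm (h z)" using ev
      proof eventually_elim
        case (elim z) then show ?case using gn[OF elim] h(2)[OF elim] by simp
      qed
    qed simp
    then have hp: "norm (h p) = \<beta> \<or> norm (h p) \<ge> 1" using False by (auto simp: annulus_def)
    obtain e where e: "e > 0" "ball (h p) e \<subseteq> insert (h p) (annulus \<beta>)"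
      using op hS openE[of "h ` S" "h p"] S(3) by (metis imageI)
    \<comment> \<open>A small radial push of h p away from the annulus, inwards if |h p| = \<beta>
      and outwards otherwise: \<open>e\<close> limits the step, and 1/2 keeps the factor 1 + c
      positive.\<close>
    define c where "c = (if norm (h p) = \<beta> then -1 else 1) * min (1/2) (e / (2 * norm (h p)))"
    have n0: "norm (h p) > 0" using hp \<beta> by auto
    have c0: "\<bar>c\<bar> = min (1/2) (e / (2 * norm (h p)))" "c \<noteq> 0" using e n0 by (auto simp: c_def abs_mult min_def)
    have "\<bar>c\<bar> * norm (h p) \<le> e / (2 * norm (h p)) * norm (h p)" using c0 by (intro mult_right_mono) auto
    also have "\<dots> < e" using e n0 by (simp add: field_simps)
    finally have "norm (of_real c * h p) < e" by (simp add: norm_mult)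
    then have "h p + of_real c * h p \<in> ball (h p) e" by (simp add: dist_norm)
    moreover have "h p + of_real c * h p \<noteq> h p" using c0 n0 by auto
    ultimately have "h p + of_real c * h p \<in> annulus \<beta>" using e by blast
    moreover have "norm (h p + of_real c * h p) = (1 + c) * norm (h p)"
    proof -
      have "h p + of_real c * h p = of_real (1 + c) * h p" by (simp add: algebra_simps)
      moreover have "1 + c \<ge> 0" using c0 by linarith
      ultimately show ?thesis by (simp add: norm_mult del: of_real_add)
    qed
    ultimately have r: "\<beta> < (1 + c) * norm (h p)" "(1 + c) * norm (h p) < 1" by (auto simp: annulus_def)
    show False
    proof (cases "norm (h p) = \<beta>")
      case True
      then have "c < 0" using c0 e n0 by (auto simp: c_def)
      then have "(1 + c) * norm (h p) < 1 * norm (h p)" using n0 by (intro mult_strict_right_mono) auto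
      then show False using r True by simp
    next
      case f: False
      then have "c > 0" using c0 e n0 by (auto simp: c_def)
      then have "(1 + c) * norm (h p) > 1 * norm (h p)" using n0 by (intro mult_strict_right_mono) auto
      then show False using r f hp by simp
    qed
  qed
qed

lemma connected_dist_attained:
  fixes K :: "'a::metric_space set"
  assumes "connected K" "p \<in> K" "q \<in> K" "0 \<le> t" "t \<le> dist p q"
  obtains x where "x \<in> K" "dist p x = t"
proof -
  have "connected ((\<lambda>x. dist p x) ` K)" by (intro connected_continuous_image continuous_intros assms)
  then have "t \<in> (\<lambda>x. dist p x) ` K"
    using connectedD_interval[of "(\<lambda>x. dist p x) ` K" 0 "dist p q" t] assms by (force simp: image_iff)
  then show thesis using that by auto
qed

lemma annulus_preimage_compact:
  fixes g k :: "complex \<Rightarrow> complex"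
  assumes kc: "continuous_on (annulus \<beta>) k" and gA: "g ` \<Omega> = annulus \<beta>" and kA: "k ` annulus \<beta> = \<Omega>"
    and kg: "\<And>z. z \<in> \<Omega> \<Longrightarrow> k (g z) = z" and gk: "\<And>w. w \<in> annulus \<beta> \<Longrightarrow> g (k w) = w" and m: "\<beta> < m1" "m2 < 1"
  shows "compact {z \<in> \<Omega>. m1 \<le> norm (g z) \<and> norm (g z) \<le> m2}"
proof -
  define A where "A = {w::complex. m1 \<le> norm w \<and> norm w \<le> m2}"
  have "A = cball 0 m2 - ball 0 m1" by (auto simp: A_def)
  then have "compact A" by (simp add: compact_diff)
  moreover have As: "A \<subseteq> annulus \<beta>" using m by (auto simp: A_def annulus_def)
  ultimately have "compact (k ` A)" using continuous_on_subset[OF kc] by (intro compact_continuous_image) auto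
  moreover have "k ` A = {z \<in> \<Omega>. m1 \<le> norm (g z) \<and> norm (g z) \<le> m2}"
  proof
    show "k ` A \<subseteq> {z \<in> \<Omega>. m1 \<le> norm (g z) \<and> norm (g z) \<le> m2}"
      using As gk kA by (auto simp: A_def subset_iff)
    show "{z \<in> \<Omega>. m1 \<le> norm (g z) \<and> norm (g z) \<le> m2} \<subseteq> k ` A"
    proof
      fix z assume z: "z \<in> {z \<in> \<Omega>. m1 \<le> norm (g z) \<and> norm (g z) \<le> m2}"
      then have "z = k (g z)" "g z \<in> A" using kg[of z] by (auto simp: A_def)
      then show "z \<in> k ` A" by blast
    qed
  qed
  ultimately show ?thesis by simp
qed

section \<open>The outer curve and the complementary components\<close>

context C3a_curve begin

text \<open>Both Jordan components miss the frontier of the unbounded component \<open>W\<close>, so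
  each is contained in \<open>W\<close> or disjoint from it. The outside is contained, since
  otherwise \<open>W\<close> would be bounded; the inside is disjoint, since otherwise
  \<open>W\<close> would be the whole plane.\<close>

lemma outer_boundary_structure:
  assumes D: "doubly_connected_domain \<Omega>" "bounded \<Omega>" and ob: "range \<gamma> = outer_boundary \<Omega>"
  obtains K W where "inside (range \<gamma>) = \<Omega> \<union> K" "\<Omega> \<inter> K = {}" "compact K" "connected K" "K \<noteq> {}" "K \<inter> range \<gamma> = {}"
    "- \<Omega> = W \<union> K" "connected W" "\<not> bounded W"
proof -
  have \<Omega>: "open \<Omega>" "\<Omega> \<noteq> {}" and c2: "card (components (- \<Omega>)) = 2" using D(1) by (auto simp: doubly_connected_domain_def)
  have b: "bounded (- (- \<Omega>))" using D(2) by simp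
  obtain W where W: "W \<in> components (- \<Omega>)" "\<not> bounded W" using cobounded_unbounded_components[OF b] by blast
  have uq: "W' = W" if "W' \<in> components (- \<Omega>)" "\<not> bounded W'" for W'
    by (rule cobounded_unique_unbounded_components[OF b W that]) simp
  have "(THE W. W \<in> components (- \<Omega>) \<and> \<not> bounded W) = W"
  proof (rule the_equality)
    show "W \<in> components (- \<Omega>) \<and> \<not> bounded W" using W by (intro conjI)
    show "W' = W" if "W' \<in> components (- \<Omega>) \<and> \<not> bounded W'" for W' by (rule uq) (use that in simp_all)
  qed
  then have fW: "frontier W = range \<gamma>" using ob by (simp add: outer_boundary_def)
  obtain K where K: "components (- \<Omega>) = {W, K}" "K \<noteq> W"
  proof -
    obtain x y where xy: "components (- \<Omega>) = {x, y}" "x \<noteq> y" using c2 by (auto simp: card_2_iff)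
    then consider "W = x" | "W = y" using W(1) by blast
    then show thesis
    proof cases
      case 1 then show ?thesis using that[of y] xy by simp
    next
      case 2 then show ?thesis using that[of x] xy by (simp add: insert_commute)
    qed
  qed
  have Kc: "K \<in> components (- \<Omega>)" using K by blast
  have "bounded K" using uq[OF Kc] K(2) by blast
  have clo: "closed (- \<Omega>)" using \<Omega>(1) by (simp only: open_closed)
  have "closed K" "closed W" using closed_components[OF clo Kc] closed_components[OF clo W(1)] by auto
  have un: "- \<Omega> = W \<union> K" using Union_components[of "- \<Omega>"] K(1) by auto
  have dis: "W \<inter> K = {}" using components_nonoverlap[OF W(1) Kc] K(2) by blast
  have con: "connected W" "connected K" using in_components_connected W(1) Kc by blast+
  have rW: "range \<gamma> \<subseteq> W" using fW \<open>closed W\<close> frontier_subset_closed by blast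
  have oW: "outside (range \<gamma>) \<subseteq> W"
  proof (rule ccontr)
    assume "\<not> outside (range \<gamma>) \<subseteq> W"
    moreover have "outside (range \<gamma>) \<inter> frontier W = {}" using fW jordan(8) by blast
    ultimately have "outside (range \<gamma>) \<inter> W = {}" using connected_Int_frontier[OF jordan(4), of W] by blast
    then have "W \<subseteq> range \<gamma> \<union> inside (range \<gamma>)" using jordan(8) by blast
    then show False using W(2) jordan(5) compact_imp_bounded[OF compact_range] bounded_subset[of "range \<gamma> \<union> inside (range \<gamma>)" W] by simp
  qed
  have iW: "inside (range \<gamma>) \<inter> W = {}"
  proof (rule ccontr)
    assume "inside (range \<gamma>) \<inter> W \<noteq> {}"
    moreover have "inside (range \<gamma>) \<inter> frontier W = {}" using fW jordan(8) by blast
    ultimately have "inside (range \<gamma>) \<subseteq> W" using connected_Int_frontier[OF jordan(2), of W] by blast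
    then have "W = UNIV" using oW rW jordan(8) by blast
    then show False using un \<Omega>(2) by blast
  qed
  have We: "W = range \<gamma> \<union> outside (range \<gamma>)" using oW rW iW jordan(8) by blast
  have ins: "inside (range \<gamma>) = - W" unfolding We using jordan(7,8) by blast
  show thesis
  proof (rule that[of K W])
    show "inside (range \<gamma>) = \<Omega> \<union> K" unfolding ins using un dis by blast
    show "\<Omega> \<inter> K = {}" using un by blast
    show "compact K" using \<open>closed K\<close> \<open>bounded K\<close> compact_eq_bounded_closed by blast
    show "connected K" by (rule con)
    show "K \<noteq> {}" using Kc in_components_nonempty by blast
    show "K \<inter> range \<gamma> = {}" using rW dis by blast
  qed (rule un, rule con, rule W)
qed

end

context collar_domain begin

text \<open>By properness |g| leaves every compact part of the interval from \<beta> to 1 near the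
  curve. A thin collar is connected and avoids the middle modulus \<open>m0\<close>, so |g| stays on
  one side of \<open>m0\<close> and tends to the end on that side.\<close>

lemma annulus_map_end:
  fixes g :: "complex \<Rightarrow> complex"
  assumes \<beta>: "0 < \<beta>" "\<beta> < 1" and gc: "continuous_on \<Omega> g" and gA: "\<And>z. z \<in> \<Omega> \<Longrightarrow> \<beta> < norm (g z) \<and> norm (g z) < 1"
    and proper: "\<And>m1 m2. \<beta> < m1 \<Longrightarrow> m2 < 1 \<Longrightarrow> compact {z \<in> \<Omega>. m1 \<le> norm (g z) \<and> norm (g z) \<le> m2}"
  shows "(\<forall>m<1. \<exists>\<delta>>0. \<forall>z\<in>\<Omega>. infdist z (range \<gamma>) < \<delta> \<longrightarrow> m < norm (g z)) \<or>
    (\<forall>m>\<beta>. \<exists>\<delta>>0. \<forall>z\<in>\<Omega>. infdist z (range \<gamma>) < \<delta> \<longrightarrow> norm (g z) < m)"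
proof -
  have avoid: "\<exists>\<delta>>0. \<forall>z\<in>\<Omega>. infdist z (range \<gamma>) < \<delta> \<longrightarrow> norm (g z) < m1 \<or> m2 < norm (g z)" if m: "\<beta> < m1" "m2 < 1" for m1 m2
  proof -
    have ne: "range \<gamma> \<noteq> {}" by blast
    have dj: "range \<gamma> \<inter> {z \<in> \<Omega>. m1 \<le> norm (g z) \<and> norm (g z) \<le> m2} = {}" using \<Omega>in jordan(8) by blast
    obtain \<delta> where "\<delta> > 0" and d: "\<And>z. z \<in> {z \<in> \<Omega>. m1 \<le> norm (g z) \<and> norm (g z) \<le> m2} \<Longrightarrow> \<delta> \<le> infdist z (range \<gamma>)"
      by (rule compact_infdist_bound[OF proper[OF m] closed_range ne dj]) (rule that)
    have "norm (g z) < m1 \<or> m2 < norm (g z)" if "z \<in> \<Omega>" "infdist z (range \<gamma>) < \<delta>" for z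
    proof (rule ccontr)
      assume "\<not> (norm (g z) < m1 \<or> m2 < norm (g z))"
      then have "z \<in> {z \<in> \<Omega>. m1 \<le> norm (g z) \<and> norm (g z) \<le> m2}" using that(1) by simp
      from d[OF this] that(2) show False by simp
    qed
    then show ?thesis using \<open>\<delta> > 0\<close> by blast
  qed
  define m0 where "m0 = (\<beta> + 1) / 2"
  have m0: "\<beta> < m0" "m0 < 1" using \<beta> by (auto simp: m0_def)
  obtain \<delta>1 where \<delta>1: "\<delta>1 > 0" "\<And>z. z \<in> \<Omega> \<Longrightarrow> infdist z (range \<gamma>) < \<delta>1 \<Longrightarrow> norm (g z) < m0 \<or> m0 < norm (g z)"
    using avoid[OF m0] by blast
  define \<delta>2 where "\<delta>2 = min \<delta>1 (min \<rho> \<delta>0)"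
  have \<delta>2: "\<delta>2 > 0" "\<delta>2 \<le> \<delta>1" "\<delta>2 \<le> \<rho>" "\<delta>2 \<le> \<delta>0" using \<delta>1 \<rho>pos \<delta>0 by (auto simp: \<delta>2_def)
  define T where "T = (\<lambda>p::real\<times>real. \<gamma> (fst p) + of_real (snd p) * (\<i> * \<gamma>1 (fst p))) ` (UNIV \<times> {0<..<\<delta>2})"
  have Tcon: "connected T" unfolding T_def
    by (intro connected_continuous_image connected_Times continuous_intros
        continuous_on_compose2[OF cont0[of UNIV]] continuous_on_compose2[OF cont1[of UNIV]]) auto
  have T\<Omega>: "T \<subseteq> \<Omega>" unfolding T_def using \<delta>2 by (auto intro!: normal_in)
  have Tin: "z \<in> T" if "z \<in> \<Omega>" "infdist z (range \<gamma>) < \<delta>2" for z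
  proof -
    have "infdist z (range \<gamma>) \<le> \<rho>" using that \<delta>2 by simp
    from collar_normal[OF that(1) this] obtain s where
      "z = \<gamma> s + of_real (infdist z (range \<gamma>)) * (\<i> * \<gamma>1 s)" "infdist z (range \<gamma>) > 0" by blast
    then show ?thesis using that(2) unfolding T_def by (intro image_eqI[of _ _ "(s, infdist z (range \<gamma>))"]) auto
  qed
  have Tn: "norm (g z) \<noteq> m0" if "z \<in> T" for z
  proof -
    have "infdist z (range \<gamma>) < \<delta>1" using that infdist_normal \<delta>2 unfolding T_def by (fastforce intro: le_less_trans)
    then show ?thesis using \<delta>1(2)[of z] that T\<Omega> by auto
  qed
  have ngc: "connected ((\<lambda>z. norm (g z)) ` T)"
    by (intro connected_continuous_image continuous_intros continuous_on_subset[OF gc T\<Omega>] Tcon)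
  have "m0 \<notin> (\<lambda>z. norm (g z)) ` T" using Tn by auto
  then have alt: "(\<forall>z\<in>T. norm (g z) > m0) \<or> (\<forall>z\<in>T. norm (g z) < m0)"
    using connectedD_interval[OF ngc, of _ _ m0] by (meson imageI linorder_not_less less_imp_le)
  then show ?thesis
  proof
    assume gt: "\<forall>z\<in>T. norm (g z) > m0"
    have "\<exists>\<delta>>0. \<forall>z\<in>\<Omega>. infdist z (range \<gamma>) < \<delta> \<longrightarrow> m < norm (g z)" if m: "m < 1" for m
    proof -
      obtain \<delta> where \<delta>: "\<delta> > 0" "\<And>z. z \<in> \<Omega> \<Longrightarrow> infdist z (range \<gamma>) < \<delta> \<Longrightarrow> norm (g z) < m0 \<or> m < norm (g z)"
        using avoid[OF m0(1) m] by blast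
      have "m < norm (g z)" if "z \<in> \<Omega>" "infdist z (range \<gamma>) < min \<delta> \<delta>2" for z
        using \<delta>(2)[of z] gt Tin[of z] that by force
      then show ?thesis using \<delta>(1) \<delta>2(1) by (intro exI[of _ "min \<delta> \<delta>2"]) auto
    qed
    then show ?thesis by blast
  next
    assume lt: "\<forall>z\<in>T. norm (g z) < m0"
    have "\<exists>\<delta>>0. \<forall>z\<in>\<Omega>. infdist z (range \<gamma>) < \<delta> \<longrightarrow> norm (g z) < m" if m: "m > \<beta>" for m
    proof -
      obtain \<delta> where \<delta>: "\<delta> > 0" "\<And>z. z \<in> \<Omega> \<Longrightarrow> infdist z (range \<gamma>) < \<delta> \<Longrightarrow> norm (g z) < m \<or> m0 < norm (g z)"
        using avoid[OF m m0(2)] by blast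
      have "norm (g z) < m" if "z \<in> \<Omega>" "infdist z (range \<gamma>) < min \<delta> \<delta>2" for z
        using \<delta>(2)[of z] lt Tin[of z] that by force
      then show ?thesis using \<delta>(1) \<delta>2(1) by (intro exI[of _ "min \<delta> \<delta>2"]) auto
    qed
    then show ?thesis by blast
  qed
qed

text \<open>The inversion w -> \<beta>/w exchanges the two ends of the annulus and preserves
  properness and the nonvanishing of the derivative.\<close>

lemma oriented_annulus_map:
  fixes g :: "complex \<Rightarrow> complex"
  assumes \<beta>: "0 < \<beta>" "\<beta> < 1" and gh: "g holomorphic_on \<Omega>" and gA: "\<And>z. z \<in> \<Omega> \<Longrightarrow> \<beta> < norm (g z) \<and> norm (g z) < 1"
    and dg: "\<And>z. z \<in> \<Omega> \<Longrightarrow> deriv g z \<noteq> 0"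
    and proper: "\<And>m1 m2. \<beta> < m1 \<Longrightarrow> m2 < 1 \<Longrightarrow> compact {z \<in> \<Omega>. m1 \<le> norm (g z) \<and> norm (g z) \<le> m2}"
  obtains f where "annular_domain \<gamma> \<gamma>1 \<gamma>2 \<gamma>3 L \<alpha> M \<Omega> \<rho> \<delta>0 f \<beta>" "\<And>z. z \<in> \<Omega> \<Longrightarrow> deriv f z \<noteq> 0"
    "\<And>m1 m2. \<beta> < m1 \<Longrightarrow> m2 < 1 \<Longrightarrow> compact {z \<in> \<Omega>. m1 \<le> norm (f z) \<and> norm (f z) \<le> m2}"
proof -
  have "(\<forall>m<1. \<exists>\<delta>>0. \<forall>z\<in>\<Omega>. infdist z (range \<gamma>) < \<delta> \<longrightarrow> m < norm (g z)) \<or>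
    (\<forall>m>\<beta>. \<exists>\<delta>>0. \<forall>z\<in>\<Omega>. infdist z (range \<gamma>) < \<delta> \<longrightarrow> norm (g z) < m)"
    by (rule annulus_map_end[OF \<beta> holomorphic_on_imp_continuous_on[OF gh] gA proper])
  then show thesis
  proof
    assume g1: "\<forall>m<1. \<exists>\<delta>>0. \<forall>z\<in>\<Omega>. infdist z (range \<gamma>) < \<delta> \<longrightarrow> m < norm (g z)"
    show thesis
    proof (rule that[of g])
      show "annular_domain \<gamma> \<gamma>1 \<gamma>2 \<gamma>3 L \<alpha> M \<Omega> \<rho> \<delta>0 g \<beta>"
        by unfold_locales (use \<beta> gh gA g1 in auto)
    qed (rule dg, assumption, rule proper)
  next
    assume g2: "\<forall>m>\<beta>. \<exists>\<delta>>0. \<forall>z\<in>\<Omega>. infdist z (range \<gamma>) < \<delta> \<longrightarrow> norm (g z) < m"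
    define f where "f = (\<lambda>z. of_real \<beta> / g z)"
    have gp: "norm (g z) > 0" if "z \<in> \<Omega>" for z using gA[OF that] \<beta> by linarith
    have fn: "norm (f z) = \<beta> / norm (g z)" for z using \<beta> by (simp add: f_def norm_divide)
    have fh: "f holomorphic_on \<Omega>" unfolding f_def by (intro holomorphic_intros gh) (use gp in auto)
    have fA: "\<beta> < norm (f z) \<and> norm (f z) < 1" if "z \<in> \<Omega>" for z
      using gA[OF that] gp[OF that] \<beta> by (simp add: fn field_simps)
    have fle: "m1 \<le> norm (f z) \<longleftrightarrow> norm (g z) \<le> \<beta> / m1" "norm (f z) \<le> m1 \<longleftrightarrow> \<beta> / m1 \<le> norm (g z)"
      if "z \<in> \<Omega>" "m1 > 0" for z m1 using gp[OF that(1)] that(2) by (simp_all add: fn field_simps)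
    show thesis
    proof (rule that[of f])
      have fl: "\<exists>\<delta>>0. \<forall>z\<in>\<Omega>. infdist z (range \<gamma>) < \<delta> \<longrightarrow> m < norm (f z)" if m: "m < 1" for m
      proof -
        define m' where "m' = max m \<beta>"
        have m': "0 < m'" "m' < 1" "m \<le> m'" using m \<beta> by (auto simp: m'_def)
        then have "\<beta> < \<beta> / m'" using \<beta> by (simp add: field_simps)
        then obtain \<delta> where \<delta>: "\<delta> > 0" "\<And>z. z \<in> \<Omega> \<Longrightarrow> infdist z (range \<gamma>) < \<delta> \<Longrightarrow> norm (g z) < \<beta> / m'" using g2 by blast
        have "m < norm (f z)" if "z \<in> \<Omega>" "infdist z (range \<gamma>) < \<delta>" for z
          using \<delta>(2)[OF that] fle(2)[OF that(1) m'(1)] m'(3) by linarith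
        then show ?thesis using \<delta>(1) by blast
      qed
      show "annular_domain \<gamma> \<gamma>1 \<gamma>2 \<gamma>3 L \<alpha> M \<Omega> \<rho> \<delta>0 f \<beta>"
        by unfold_locales (use \<beta> fh fA fl in auto)
      show "deriv f z \<noteq> 0" if z: "z \<in> \<Omega>" for z
      proof -
        have "(g has_field_derivative deriv g z) (at z)" by (rule holomorphic_derivI[OF gh \<Omega>o z])
        then have "(f has_field_derivative (0 * g z - of_real \<beta> * deriv g z) / (g z * g z)) (at z)"
          unfolding f_def using gp[OF z] by (intro DERIV_divide DERIV_const) auto
        then have "deriv f z = (0 * g z - of_real \<beta> * deriv g z) / (g z * g z)" by (rule DERIV_imp_deriv)
        then show ?thesis using dg[OF z] gp[OF z] \<beta> by auto
      qed
      show "compact {z \<in> \<Omega>. m1 \<le> norm (f z) \<and> norm (f z) \<le> m2}" if m: "\<beta> < m1" "m2 < 1" for m1 m2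
      proof (cases "m2 > 0")
        case True
        have "{z \<in> \<Omega>. m1 \<le> norm (f z) \<and> norm (f z) \<le> m2} = {z \<in> \<Omega>. \<beta> / m2 \<le> norm (g z) \<and> norm (g z) \<le> \<beta> / m1}"
          using fle True m \<beta> by auto
        moreover have "\<beta> < \<beta> / m2" "\<beta> / m1 < 1" using True m \<beta> by (auto simp: field_simps)
        ultimately show ?thesis using proper by simp
      next
        case False
        then have "norm (f z) > m2" if "z \<in> \<Omega>" for z using fA[OF that] \<beta> by linarith
        then have "{z \<in> \<Omega>. m1 \<le> norm (f z) \<and> norm (f z) \<le> m2} = {}" by force
        then show ?thesis by (simp only: compact_empty)
      qed
    qed
  qed
qed

end

lemma hyperbolic_conformal_factor_liouville:
  assumes "open \<Omega>" "hyperbolic_conformal_factor \<Omega> u"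
  shows "liouville \<Omega> u"
  using C2_on_has_lap[OF assms(1)] C2_on_continuous assms(2)
  by (fastforce simp: liouville_def hyperbolic_conformal_factor_def)

section \<open>Counterclockwise curves, reversal and the conclusion\<close>

context C3a_curve begin

text \<open>The last two conclusions serve to evaluate the case distinction in
  \<open>inward_normal\<close>, for the curve and for its reversal. Periodicity and continuity of
  \<open>c3\<close> are exported for the change of variables under reversal.\<close>

lemma c3_integral_bound_left:
  assumes left: "left_inside \<rho>" and \<beta>: "0 < \<beta>" "\<beta> < 1"
    and D: "doubly_connected_domain \<Omega>" "bounded \<Omega>" and ob: "range \<gamma> = outer_boundary \<Omega>"
    and bih: "biholomorphic \<Omega> (annulus \<beta>)" and hyp: "hyperbolic_conformal_factor \<Omega> u"
  obtains c3 :: "real \<Rightarrow> real" where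
    "\<And>s. ((\<lambda>t. (exp (- u (\<gamma> s + of_real t * (\<i> * \<gamma>1 s))) - t + kappa s * t\<^sup>2 / 2) / t ^ 3) \<longlongrightarrow> c3 s) (at_right 0)"
    "\<And>s. c3 (s + L) = c3 s" "continuous_on UNIV c3"
    "- L * integral {0..L} c3 \<ge> 2 * pi\<^sup>2 / 3 * ((pi / ln \<beta>)\<^sup>2 + 1)"
    "\<And>s. \<forall>\<^sub>F t in at_right 0. \<gamma> s + of_real t * (\<i> * \<gamma>1 s) \<in> \<Omega>"
    "\<And>s. \<forall>\<^sub>F t in at_right 0. \<gamma> s - of_real t * (\<i> * \<gamma>1 s) \<notin> \<Omega>"
proof -
  have \<Omega>: "open \<Omega>" using D by (simp add: doubly_connected_domain_def)
  obtain K W where K: "inside (range \<gamma>) = \<Omega> \<union> K" "\<Omega> \<inter> K = {}" "compact K" "connected K" "K \<noteq> {}" "K \<inter> range \<gamma> = {}"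
    and W: "- \<Omega> = W \<union> K" "connected W" "\<not> bounded W"
    by (rule outer_boundary_structure[OF D ob]) (rule that)
  have ne: "range \<gamma> \<noteq> {}" and dj: "range \<gamma> \<inter> K = {}" using K(6) by blast+
  obtain \<delta>0 where \<delta>0: "\<delta>0 > 0" "\<And>z. z \<in> K \<Longrightarrow> \<delta>0 \<le> infdist z (range \<gamma>)"
    by (rule compact_infdist_bound[OF K(3) closed_range ne dj]) (rule that)
  interpret collar_domain \<gamma> \<gamma>1 \<gamma>2 \<gamma>3 L \<alpha> M \<Omega> \<rho> \<delta>0
  proof
    show "left_inside \<rho>" by (rule left)
    show "open \<Omega>" by (rule \<Omega>)
    show "\<Omega> \<subseteq> inside (range \<gamma>)" using K(1) by blast
    show "\<delta>0 > 0" by (rule \<delta>0)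
    show "z \<in> \<Omega>" if "z \<in> inside (range \<gamma>)" "infdist z (range \<gamma>) < \<delta>0" for z
    proof -
      have "z \<notin> K" using \<delta>0(2)[of z] that(2) by linarith
      then show ?thesis using that(1) K(1) by blast
    qed
  qed
  obtain g k where gh: "g holomorphic_on \<Omega>" and kh: "k holomorphic_on annulus \<beta>" and gA: "g ` \<Omega> = annulus \<beta>" and kA: "k ` annulus \<beta> = \<Omega>"
    and kg: "\<And>z. z \<in> \<Omega> \<Longrightarrow> k (g z) = z" and gk: "\<And>w. w \<in> annulus \<beta> \<Longrightarrow> g (k w) = w"
    using bih unfolding biholomorphic_def by metis
  have kc: "continuous_on (annulus \<beta>) k" by (rule holomorphic_on_imp_continuous_on[OF kh])
  have gn: "\<beta> < norm (g z) \<and> norm (g z) < 1" if "z \<in> \<Omega>" for z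
    using gA that unfolding annulus_def by blast
  have "inj_on g \<Omega>" using kg by (metis inj_on_def)
  then have dg: "deriv g z \<noteq> 0" if "z \<in> \<Omega>" for z
    using holomorphic_injective_imp_regular[OF gh \<Omega> _ that] by blast
  obtain f where f: "annular_domain \<gamma> \<gamma>1 \<gamma>2 \<gamma>3 L \<alpha> M \<Omega> \<rho> \<delta>0 f \<beta>" and df: "\<And>z. z \<in> \<Omega> \<Longrightarrow> deriv f z \<noteq> 0"
    and fproper: "\<And>m1 m2. \<beta> < m1 \<Longrightarrow> m2 < 1 \<Longrightarrow> compact {z \<in> \<Omega>. m1 \<le> norm (f z) \<and> norm (f z) \<le> m2}"
    by (rule oriented_annulus_map[OF \<beta> gh gn dg annulus_preimage_compact[OF kc gA kA kg gk]]) (assumption | rule that)+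
  interpret A: annular_domain \<gamma> \<gamma>1 \<gamma>2 \<gamma>3 L \<alpha> M \<Omega> \<rho> \<delta>0 f \<beta> by (rule f)
  \<comment> \<open>For any point of \<open>K\<close>, one of two distinct points of
    \<open>K\<close> is at least half their distance away; this gives the radius
    \<open>r0\<close>.\<close>
  obtain k1 k2 where k12: "k1 \<in> K" "k2 \<in> K" "k1 \<noteq> k2"
  proof (rule ccontr)
    assume n: "\<not> thesis"
    obtain p where p: "p \<in> K" using K(5) by blast
    have Kp: "K = {p}" using n that[of p] p by blast
    have S: "inside (range \<gamma>) - {p} = \<Omega>" using K(1,2) Kp by blast
    have pS: "p \<in> inside (range \<gamma>)" using K(1) Kp by blast
    show False
      by (rule annulus_not_punctured[OF jordan(1,2) pS \<beta>, unfolded S, OF gh kc gA kA kg])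
  qed
  define r0 where "r0 = dist k1 k2 / 2"
  have r0: "r0 > 0" using k12(3) by (simp add: r0_def)
  \<comment> \<open>A connected set meets every circle about one of its points up to the distance of
    another. \<open>W\<close> is unbounded and meets all of them, \<open>K\<close> those of radius
    at most \<open>r0\<close>.\<close>
  have nd: "\<exists>x. x \<notin> \<Omega> \<and> dist p x = t" if p: "p \<in> frontier \<Omega>" and t: "0 \<le> t" "t \<le> r0" for p t
  proof -
    have "p \<notin> \<Omega>" using p \<Omega> by (simp add: frontier_def interior_open)
    then consider "p \<in> W" | "p \<in> K" using W(1) by blast
    then show ?thesis
    proof cases
      case 1
      obtain q where q: "q \<in> W" "\<not> dist p q \<le> t" using W(3) bounded_any_center[of W p] by blast
      obtain x where "x \<in> W" "dist p x = t"
        by (rule connected_dist_attained[OF W(2) 1 q(1) t(1)]) (use q that in auto)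
      then show ?thesis using W(1) by blast
    next
      case 2
      obtain q where q: "q \<in> K" "t \<le> dist p q"
      proof (cases "t \<le> dist p k1")
        case True then show ?thesis using that k12 by blast
      next
        case False
        have "t \<le> dist p k2" using False t dist_triangle3[of k1 k2 p] by (simp add: r0_def)
        then show ?thesis using that k12 by blast
      qed
      obtain x where "x \<in> K" "dist p x = t"
        by (rule connected_dist_attained[OF K(4) 2 q(1) t(1) q(2)]) (rule that)
      then show ?thesis using W(1) by blast
    qed
  qed
  have lio: "liouville \<Omega> u" by (rule hyperbolic_conformal_factor_liouville[OF \<Omega> hyp])
  have blow: "filterlim u at_top (at \<xi> within \<Omega>)" if "\<xi> \<in> frontier \<Omega>" for \<xi>
    using hyp that unfolding hyperbolic_conformal_factor_def by blast
  have eq: "exp (- u z) = sin (pi / (- ln \<beta>) * (- ln (norm (f z)))) / (pi / (- ln \<beta>)) / norm (deriv f z / f z)" if "z \<in> \<Omega>" for z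
    by (rule hyperbolic_metric_eq[OF \<Omega> D(2) \<beta> A.gh A.gA df fproper lio blow r0 nd that])
  obtain c3 :: "real \<Rightarrow> real" where
    lim: "\<And>s. ((\<lambda>t. (sin (pi / (- ln \<beta>) * (- ln (norm (f (A.nrm s t))))) / (pi / (- ln \<beta>)) / norm (deriv f (A.nrm s t) / f (A.nrm s t)) - t + kappa s * t\<^sup>2 / 2) / t ^ 3) \<longlongrightarrow> c3 s) (at_right 0)"
    and c3: "\<And>s. c3 (s + L) = c3 s" "continuous_on UNIV c3"
    "- L * integral {0..L} c3 \<ge> 2 * pi\<^sup>2 / 3 * ((pi / ln \<beta>)\<^sup>2 + 1)"
    by (rule A.integral_c3_bound) (rule that)
  define e where "e = min \<rho> (\<delta>0 / 2)"
  have e: "e > 0" "e \<le> \<rho>" "e < \<delta>0" using \<rho>pos \<delta>0 by (auto simp: e_def)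
  have ev: "\<forall>\<^sub>F t in at_right 0. t < e \<and> (0::real) < t"
    using e(1) by (auto simp: eventually_at_right_field)
  have in\<Omega>: "\<forall>\<^sub>F t in at_right 0. A.nrm s t \<in> \<Omega>" for s
    using ev by eventually_elim (use e in \<open>auto simp: A.nrm_def intro!: normal_in\<close>)
  show thesis
  proof (rule that[of c3])
    fix s
    show "((\<lambda>t. (exp (- u (\<gamma> s + of_real t * (\<i> * \<gamma>1 s))) - t + kappa s * t\<^sup>2 / 2) / t ^ 3) \<longlongrightarrow> c3 s) (at_right 0)"
      unfolding A.nrm_def[symmetric]
    proof (rule Lim_transform_eventually[OF lim[of s]])
      show "\<forall>\<^sub>F t in at_right 0. (sin (pi / (- ln \<beta>) * (- ln (norm (f (A.nrm s t))))) / (pi / (- ln \<beta>)) / norm (deriv f (A.nrm s t) / f (A.nrm s t)) - t + kappa s * t\<^sup>2 / 2) / t ^ 3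
          = (exp (- u (A.nrm s t)) - t + kappa s * t\<^sup>2 / 2) / t ^ 3"
        using in\<Omega>[of s] by eventually_elim (simp only: eq)
    qed
    show "\<forall>\<^sub>F t in at_right 0. \<gamma> s + of_real t * (\<i> * \<gamma>1 s) \<in> \<Omega>" using in\<Omega>[of s] by (simp only: A.nrm_def)
    show "\<forall>\<^sub>F t in at_right 0. \<gamma> s - of_real t * (\<i> * \<gamma>1 s) \<notin> \<Omega>" using ev
    proof eventually_elim
      case (elim t)
      then have "\<gamma> s - of_real t * (\<i> * \<gamma>1 s) \<in> outside (range \<gamma>)" using right_ball[of t s] e by auto
      then show ?case using \<Omega>in jordan(7) by blast
    qed
  qed (rule c3)+
qed

lemma tangent_eq: "tangent \<gamma> s = \<gamma>1 s"
  unfolding tangent_def by (rule vector_derivative_at[OF d1])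

lemma curvature_vector_eq: "vector_derivative (tangent \<gamma>) (at s) = \<gamma>2 s"
proof -
  have "tangent \<gamma> = \<gamma>1" by (rule ext) (rule tangent_eq)
  then show ?thesis using vector_derivative_at[OF d2] by simp
qed

text \<open>Clockwise curves are run backwards: the left normal of the reversed curve at parameter -
  s is the right normal of the given one at s.\<close>

lemma reversed: "C3a_curve (\<lambda>s. \<gamma> (- s)) (\<lambda>s. - \<gamma>1 (- s)) (\<lambda>s. \<gamma>2 (- s)) (\<lambda>s. - \<gamma>3 (- s)) L \<alpha> M"
proof
  have rev: "((\<lambda>s. f (- s)) has_vector_derivative - f' (- s)) (at s)" if "\<And>s. (f has_vector_derivative f' s) (at s)" for f f' :: "real \<Rightarrow> complex" and s
  proof -
    have "((\<lambda>s::real. - s) has_real_derivative -1) (at s)" by (auto intro!: derivative_eq_intros)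
    from vector_diff_chain_at[OF this[unfolded has_real_derivative_iff_has_vector_derivative] that[of "- s"]]
    show ?thesis by (simp add: o_def)
  qed
  show "L > 0" "0 < \<alpha>" "\<alpha> < 1" by (rule L \<alpha>)+
  show "\<gamma> (- (s + L)) = \<gamma> (- s)" for s using per[of "- s - L"] by simp
  \<comment> \<open>Negation sends [0, L) to (- L, 0]. A period is added to the nonzero parameters
    to return to [0, L), and 0 is treated apart.\<close>
  show "inj_on (\<lambda>s. \<gamma> (- s)) {0..<L}"
  proof (rule inj_onI)
    fix s t assume st: "s \<in> {0..<L}" "t \<in> {0..<L}" "\<gamma> (- s) = \<gamma> (- t)"
    have eq: "\<gamma> (L - s) = \<gamma> (- s)" for s using per[of "- s"] by (simp add: add.commute)
    consider "s = 0" "t = 0" | "s = 0" "t > 0" | "s > 0" "t = 0" | "s > 0" "t > 0" using st by force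
    then show "s = t"
    proof cases
      case 2
      then have "\<gamma> 0 = \<gamma> (L - t)" using st eq[of t] by simp
      then show ?thesis using inj_onD[OF inj, of 0 "L - t"] st 2 by auto
    next
      case 3
      then have "\<gamma> (L - s) = \<gamma> 0" using st eq[of s] by simp
      then show ?thesis using inj_onD[OF inj, of "L - s" 0] st 3 by auto
    next
      case 4
      then have "\<gamma> (L - s) = \<gamma> (L - t)" using st eq[of s] eq[of t] by simp
      then show ?thesis using inj_onD[OF inj, of "L - s" "L - t"] st 4 by auto
    qed simp
  qed
  show "((\<lambda>s. \<gamma> (- s)) has_vector_derivative - \<gamma>1 (- s)) (at s)" for s by (rule rev[OF d1])
  show "((\<lambda>s. - \<gamma>1 (- s)) has_vector_derivative \<gamma>2 (- s)) (at s)" for s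
    using has_vector_derivative_minus[OF rev[OF d2, of s]] by simp
  show "((\<lambda>s. \<gamma>2 (- s)) has_vector_derivative - \<gamma>3 (- s)) (at s)" for s by (rule rev[OF d3])
  show "norm (- \<gamma>3 (- s) - - \<gamma>3 (- t)) \<le> M * \<bar>s - t\<bar> powr \<alpha>" for s t
    using hoelder[of "- t" "- s"] by simp
  show "norm (- \<gamma>1 (- s)) = 1" for s by (simp add: unit)
qed

end

theorem theorem3p3:
  fixes \<Omega> :: "complex set" and \<beta> :: real and u :: "complex \<Rightarrow> real"
    and \<gamma> :: "real \<Rightarrow> complex" and L \<alpha> :: real
  assumes "0 < \<beta>" and "\<beta> < 1"
    and "doubly_connected_domain \<Omega>" and "bounded \<Omega>"
    and "C3a_arclength_param \<gamma> L \<alpha>" and "\<gamma> ` {0..L} = outer_boundary \<Omega>"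
    and "biholomorphic \<Omega> (annulus \<beta>)"
    and "hyperbolic_conformal_factor \<Omega> u"
  shows "lambda_inv \<Omega> (\<lambda>z. exp (- u z)) \<gamma> L \<ge> 2 * pi^2 / 3 * ((pi / ln \<beta>)^2 + 1)"
proof -
  obtain \<gamma>1 \<gamma>2 \<gamma>3 M where "C3a_curve \<gamma> \<gamma>1 \<gamma>2 \<gamma>3 L \<alpha> M"
    using assms(5) unfolding C3a_arclength_param_def C3a_curve_def by blast
  then interpret C3a_curve \<gamma> \<gamma>1 \<gamma>2 \<gamma>3 L \<alpha> M .
  have ob: "range \<gamma> = outer_boundary \<Omega>" using assms(6) range_eq by simp
  obtain \<rho> where "left_inside \<rho> \<or> right_inside \<rho>" by (rule sides)
  then show ?thesis
  proof
    assume left: "left_inside \<rho>"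
    obtain c3 :: "real \<Rightarrow> real" where
      lim: "\<And>s. ((\<lambda>t. (exp (- u (\<gamma> s + of_real t * (\<i> * \<gamma>1 s))) - t + kappa s * t\<^sup>2 / 2) / t ^ 3) \<longlongrightarrow> c3 s) (at_right 0)"
      and bound: "- L * integral {0..L} c3 \<ge> 2 * pi\<^sup>2 / 3 * ((pi / ln \<beta>)\<^sup>2 + 1)"
      and ev: "\<And>s. \<forall>\<^sub>F t in at_right 0. \<gamma> s + of_real t * (\<i> * \<gamma>1 s) \<in> \<Omega>"
      by (rule c3_integral_bound_left[OF left assms(1-4) ob assms(7,8)]) (rule that)
    have "c3_coeff \<Omega> (\<lambda>z. exp (- u z)) \<gamma> s = c3 s" for s
    proof -
      have N: "inward_normal \<Omega> \<gamma> s = \<i> * \<gamma>1 s" using ev[of s] by (simp add: inward_normal_def tangent_eq)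
      have "bdry_curvature \<Omega> \<gamma> s = kappa s"
        unfolding bdry_curvature_def N curvature_vector_eq kappa_def by (simp add: algebra_simps)
      then show ?thesis unfolding c3_coeff_def N using tendsto_Lim[OF _ lim[of s]] by simp
    qed
    then show ?thesis using bound by (simp only: lambda_inv_def)
  next
    assume right: "right_inside \<rho>"
    interpret R: C3a_curve "\<lambda>s. \<gamma> (- s)" "\<lambda>s. - \<gamma>1 (- s)" "\<lambda>s. \<gamma>2 (- s)" "\<lambda>s. - \<gamma>3 (- s)" L \<alpha> M by (rule reversed)
    have rg: "range (\<lambda>s. \<gamma> (- s)) = range \<gamma>"
    proof
      show "range \<gamma> \<subseteq> range (\<lambda>s. \<gamma> (- s))" by (rule image_subsetI) (rule range_eqI[of _ _ "- x" for x], simp)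
    qed blast
    have left: "R.left_inside \<rho>"
      using right unfolding R.left_inside_def right_inside_def rg by simp
    have ob': "range (\<lambda>s. \<gamma> (- s)) = outer_boundary \<Omega>" using ob rg by simp
    obtain c3 :: "real \<Rightarrow> real" where
      lim: "\<And>s. ((\<lambda>t. (exp (- u (\<gamma> (- s) + of_real t * (\<i> * - \<gamma>1 (- s)))) - t + R.kappa s * t\<^sup>2 / 2) / t ^ 3) \<longlongrightarrow> c3 s) (at_right 0)"
      and per3: "\<And>s. c3 (s + L) = c3 s" and cont3: "continuous_on UNIV c3"
      and bound: "- L * integral {0..L} c3 \<ge> 2 * pi\<^sup>2 / 3 * ((pi / ln \<beta>)\<^sup>2 + 1)"
      and ev: "\<And>s. \<forall>\<^sub>F t in at_right 0. \<gamma> (- s) - of_real t * (\<i> * - \<gamma>1 (- s)) \<notin> \<Omega>"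
      by (rule R.c3_integral_bound_left[OF left assms(1-4) ob' assms(7,8)]) (rule that)
    have c3: "c3_coeff \<Omega> (\<lambda>z. exp (- u z)) \<gamma> s = c3 (- s)" for s
    proof -
      have out: "\<forall>\<^sub>F t in at_right 0. \<gamma> s + of_real t * (\<i> * \<gamma>1 s) \<notin> \<Omega>" using ev[of "- s"] by simp
      \<comment> \<open>\<open>inward_normal\<close> tests the left normal first; here that one
        points out of \<Omega>.\<close>
      have "\<not> (\<forall>\<^sub>F t in at_right 0. \<gamma> s + of_real t * (\<i> * \<gamma>1 s) \<in> \<Omega>)"
      proof
        assume "\<forall>\<^sub>F t in at_right 0. \<gamma> s + of_real t * (\<i> * \<gamma>1 s) \<in> \<Omega>"
        with out have "\<forall>\<^sub>F t in at_right (0::real). False" by eventually_elim blast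
        then show False by simp
      qed
      then have N: "inward_normal \<Omega> \<gamma> s = \<i> * - \<gamma>1 s" by (simp add: inward_normal_def tangent_eq)
      have "bdry_curvature \<Omega> \<gamma> s = R.kappa (- s)"
        unfolding bdry_curvature_def N curvature_vector_eq R.kappa_def by (simp add: algebra_simps)
      then show ?thesis unfolding c3_coeff_def N using tendsto_Lim[OF _ lim[of "- s"]] by simp
    qed
    \<comment> \<open>The coefficient at s is that of the reversed curve at - s; a reflection and a
      shift by one period bring the integral back to [0, L].\<close>
    have "integral {0..L} (\<lambda>s. c3 (- s)) = integral {- L..0} c3"
      using Henstock_Kurzweil_Integration.integral_reflect_real[of 0 "- L" c3] by (simp only: minus_minus minus_zero)
    also have "\<dots> = integral {- L..0} (c3 \<circ> (\<lambda>s. s + L))" using per3 by (simp add: o_def)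
    also have "\<dots> = integral {- L + L..0 + L} c3"
      by (rule integral_shift) (rule continuous_on_subset[OF cont3 subset_UNIV])
    finally have "integral {0..L} (\<lambda>s. c3 (- s)) = integral {0..L} c3" by simp
    then show ?thesis using bound by (simp only: lambda_inv_def c3)
  qed
qed

end
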